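(* Let $n\geq 2$ and $h\geq 1$. There exists a commutative local ring $T$ such that every $n$-presented cyclic $T$-module is projective and $\operatorname{fPD}(T)=h$. Moreover, $T$ has a finitely generated proper ideal $I$ satisfying \[ \operatorname{Ext}_T^i(T/I,T)=0\quad(0\leq i<h), \qquad \operatorname{Ext}_T^h(T/I,T)\neq 0. \] By contrast, every cyclic weak $(1,d)$-ring has small finitistic dimension at most $d$.
   Context: All rings are commutative with identity and all modules are unital; $n$, $h$ and $d$ denote integers, with $d\geq 0$. Local means having a unique maximal ideal (not necessarily Noetherian). For $n\geq 0$, a module $E$ over a ring $A$ is $n$-presented if there is an exact sequence $F_n\to F_{n-1}\to\cdots\to F_0\to E\to 0$ in which every $F_i$ is a finitely generated free $A$-module. A ring $A$ is a cyclic weak $(n,d)$-ring if $\operatorname{pd}_A E\leq d$ (projective dimension) for every $n$-presented cyclic $A$-module $E$; in particular, $A$ is a cyclic weak $(1,d)$-ring if every finitely presented cyclic $A$-module has projective dimension at most $d$. The small finitistic dimension of a ring $A$ is $\operatorname{fPD}(A)=\sup\{\operatorname{pd}_A M\mid M\in\mathcal{FPR}(A)\}$, where $\mathcal{FPR}(A)$ is the class of $A$-modules $M$ admitting a finite projective resolution by finitely generated projective modules, i.e. an exact sequence $0\to P_s\to\cdots\to P_0\to M\to 0$ with every $P_i$ finitely generated projective. *)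

theory Defs
  imports "HOL-Algebra.Algebra" "HOL-Library.Extended_Nat"
begin

section \<open>Modules over a commutative ring\<close>

text \<open>The ring structure (fields \<open>mult\<close> and \<open>one\<close>) contained in the record type of modules plays no
  role in the locale \<^locale>\<open>module\<close>; below it is left undefined wherever a module is constructed.\<close>

definition mod_hom :: "'a ring \<Rightarrow> ('a, 'b) module \<Rightarrow> ('a, 'c) module \<Rightarrow> ('b \<Rightarrow> 'c) set" where
  "mod_hom R M N =
    {f \<in> hom (add_monoid M) (add_monoid N).
      \<forall>r\<in>carrier R. \<forall>x\<in>carrier M. f (r \<odot>\<^bsub>M\<^esub> x) = r \<odot>\<^bsub>N\<^esub> f x}"

definition self_module :: "'a ring \<Rightarrow> ('a, 'a) module" where
  "self_module R =
    \<lparr>carrier = carrier R, monoid.mult = undefined, one = undefined,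
     ring.zero = \<zero>\<^bsub>R\<^esub>, ring.add = ring.add R, smult = monoid.mult R\<rparr>"

definition quot_module :: "'a ring \<Rightarrow> 'a set \<Rightarrow> ('a, 'a set) module" where
  "quot_module R I =
    \<lparr>carrier = carrier (R Quot I), monoid.mult = undefined, one = undefined,
     ring.zero = \<zero>\<^bsub>R Quot I\<^esub>, ring.add = ring.add (R Quot I),
     smult = (\<lambda>r C. \<Union>x\<in>C. I +>\<^bsub>R\<^esub> (r \<otimes>\<^bsub>R\<^esub> x))\<rparr>"

definition fg_module :: "'a ring \<Rightarrow> ('a, 'b) module \<Rightarrow> bool" where
  "fg_module R M \<longleftrightarrow> module R M \<and>
    (\<exists>S. finite S \<and> S \<subseteq> carrier M \<and> (\<forall>N. submodule N R M \<and> S \<subseteq> N \<longrightarrow> N = carrier M))"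

definition cyclic_module :: "'a ring \<Rightarrow> ('a, 'b) module \<Rightarrow> bool" where
  "cyclic_module R M \<longleftrightarrow> module R M \<and>
    (\<exists>x\<in>carrier M. carrier M = {r \<odot>\<^bsub>M\<^esub> x | r. r \<in> carrier R})"

definition fg_free_module :: "'a ring \<Rightarrow> ('a, 'b) module \<Rightarrow> bool" where
  "fg_free_module R M \<longleftrightarrow> module R M \<and>
    (\<exists>B. finite B \<and> B \<subseteq> carrier M \<and>
      bij_betw (\<lambda>c. \<Oplus>\<^bsub>M\<^esub>b\<in>B. c b \<odot>\<^bsub>M\<^esub> b) (B \<rightarrow>\<^sub>E carrier R) (carrier M))"

text \<open>Projectivity by the lifting property. HOL cannot quantify over the carrier types of the test
  modules \<open>N \<rightarrow> L\<close>, but the chosen types lose nothing: the canonical surjection \<open>R\<^bsup>(P)\<^esup> \<rightarrow> P\<close> from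
  the free module of finitely supported functions \<open>P \<rightarrow> R\<close> is among the tests. It therefore
  splits, and lifting along arbitrary surjections follows.\<close>

definition projective_module :: "'a ring \<Rightarrow> ('a, 'p) module \<Rightarrow> bool" where
  "projective_module R P \<longleftrightarrow> module R P \<and>
    (\<forall>(N :: ('a, 'p \<Rightarrow> 'a) module) (L :: ('a, 'p) module) g f.
      module R N \<and> module R L \<and> g \<in> mod_hom R N L \<and> g ` carrier N = carrier L \<and>
      f \<in> mod_hom R P L \<longrightarrow>
      (\<exists>k\<in>mod_hom R P N. \<forall>x\<in>carrier P. g (k x) = f x))"


section \<open>Resolutions\<close>

text \<open>Exactness of \<open>F n \<rightarrow> \<dots> \<rightarrow> F 1 \<rightarrow> F 0 \<rightarrow> M \<rightarrow> 0\<close>, with \<open>d i : F (i+1) \<rightarrow> F i\<close> and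
  \<open>e : F 0 \<rightarrow> M\<close>; nothing is required at \<open>F n\<close>.\<close>

definition exact_upto ::
  "'a ring \<Rightarrow> nat \<Rightarrow> (nat \<Rightarrow> ('a, 'p) module) \<Rightarrow> (nat \<Rightarrow> 'p \<Rightarrow> 'p) \<Rightarrow> ('p \<Rightarrow> 'b) \<Rightarrow>
   ('a, 'b) module \<Rightarrow> bool" where
  "exact_upto R n F d e M \<longleftrightarrow>
    module R M \<and> (\<forall>i\<le>n. module R (F i)) \<and>
    e \<in> mod_hom R (F 0) M \<and> e ` carrier (F 0) = carrier M \<and>
    (\<forall>i<n. d i \<in> mod_hom R (F (Suc i)) (F i)) \<and>
    (\<forall>i<n. d i ` carrier (F (Suc i)) =
      (case i of 0 \<Rightarrow> a_kernel (F 0) M e | Suc j \<Rightarrow> a_kernel (F i) (F j) (d j)))"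

text \<open>Every finitely generated free module is isomorphic to some \<open>R\<^sup>m\<close> and hence has a copy on the
  carrier type \<^typ>\<open>nat \<Rightarrow> 'a\<close>.\<close>

definition n_presented :: "'a ring \<Rightarrow> nat \<Rightarrow> ('a, 'b) module \<Rightarrow> bool" where
  "n_presented R n E \<longleftrightarrow>
    (\<exists>(F :: nat \<Rightarrow> ('a, nat \<Rightarrow> 'a) module) d e.
      (\<forall>i\<le>n. fg_free_module R (F i)) \<and> exact_upto R n F d e E)"

definition projective_resolution ::
  "'a ring \<Rightarrow> (nat \<Rightarrow> ('a, 'p) module) \<Rightarrow> (nat \<Rightarrow> 'p \<Rightarrow> 'p) \<Rightarrow> ('p \<Rightarrow> 'b) \<Rightarrow>
   ('a, 'b) module \<Rightarrow> bool" where
  "projective_resolution R P d e M \<longleftrightarrow>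
    (\<forall>i. projective_module R (P i)) \<and> (\<forall>n. exact_upto R n P d e M)"

text \<open>A finite resolution \<open>0 \<rightarrow> P s \<rightarrow> \<dots> \<rightarrow> P 0 \<rightarrow> M \<rightarrow> 0\<close> is encoded as one continued by zero
  modules.\<close>

definition vanishes_above :: "(nat \<Rightarrow> ('a, 'p) module) \<Rightarrow> nat \<Rightarrow> bool" where
  "vanishes_above P s \<longleftrightarrow> (\<forall>i>s. carrier (P i) = {\<zero>\<^bsub>P i\<^esub>})"

text \<open>A carrier type that is large enough for projective resolutions of modules on the type \<open>'b\<close>
  over rings on the type \<open>'a\<close>: \<open>'b\<close> and the finitely supported functions of type
  \<open>('a, 'b) res\<close> both inject into \<^typ>\<open>(nat \<times> 'a \<times> 'b) list\<close>, so free modules and their syzygies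
  can be covered by free modules on subsets of that list type. See \<open>projective_resolution_exists\<close>
  below.\<close>

type_synonym ('a, 'b) res = "(nat \<times> 'a \<times> 'b) list \<Rightarrow> 'a"

text \<open>The projective dimension; it is \<open>\<infinity>\<close> if there is no finite projective resolution, and \<open>0\<close> for
  the zero module.\<close>

definition pd :: "'a ring \<Rightarrow> ('a, 'b) module \<Rightarrow> enat" where
  "pd R M = Inf {enat s | s. \<exists>(P :: nat \<Rightarrow> ('a, ('a, 'b) res) module) d e.
    projective_resolution R P d e M \<and> vanishes_above P s}"

text \<open>Quotients of \<open>R\<close> have copies on the type \<^typ>\<open>'a set\<close> (as sets of cosets), so this covers all
  cyclic modules.\<close>

definition cyclic_weak_ring :: "'a ring \<Rightarrow> nat \<Rightarrow> nat \<Rightarrow> bool" where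
  "cyclic_weak_ring R n d \<longleftrightarrow> cring R \<and>
    (\<forall>E :: ('a, 'a set) module. cyclic_module R E \<and> n_presented R n E \<longrightarrow> pd R E \<le> enat d)"


section \<open>The small finitistic dimension\<close>

text \<open>All modules involved are quotients of some \<open>R\<^sup>m\<close>; choosing representatives of the cosets gives
  copies on the type \<^typ>\<open>nat \<Rightarrow> 'a\<close>.\<close>

definition FPR :: "'a ring \<Rightarrow> ('a, 'b) module set" where
  "FPR R = {M. \<exists>s (P :: nat \<Rightarrow> ('a, nat \<Rightarrow> 'a) module) d e.
    projective_resolution R P d e M \<and> (\<forall>i. fg_module R (P i)) \<and> vanishes_above P s}"

definition fPD :: "'a ring \<Rightarrow> enat" where
  "fPD R = (SUP M \<in> (FPR R :: ('a, nat \<Rightarrow> 'a) module set). pd R M)"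


section \<open>Ext\<close>

definition Hom_module :: "'a ring \<Rightarrow> ('a, 'b) module \<Rightarrow> ('a, 'c) module \<Rightarrow> ('a, 'b \<Rightarrow> 'c) module"
  where
  "Hom_module R M N =
    \<lparr>carrier = mod_hom R M N \<inter> extensional (carrier M), monoid.mult = undefined, one = undefined,
     ring.zero = (\<lambda>x\<in>carrier M. \<zero>\<^bsub>N\<^esub>),
     ring.add = (\<lambda>f g. \<lambda>x\<in>carrier M. f x \<oplus>\<^bsub>N\<^esub> g x),
     smult = (\<lambda>r f. \<lambda>x\<in>carrier M. r \<odot>\<^bsub>N\<^esub> f x)\<rparr>"

definition cocycles ::
  "'a ring \<Rightarrow> (nat \<Rightarrow> ('a, 'p) module) \<Rightarrow> (nat \<Rightarrow> 'p \<Rightarrow> 'p) \<Rightarrow> ('a, 'c) module \<Rightarrow> nat \<Rightarrow>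
   ('p \<Rightarrow> 'c) set" where
  "cocycles R P d N i =
    {f \<in> carrier (Hom_module R (P i) N). \<forall>x\<in>carrier (P (Suc i)). f (d i x) = \<zero>\<^bsub>N\<^esub>}"

definition coboundaries ::
  "'a ring \<Rightarrow> (nat \<Rightarrow> ('a, 'p) module) \<Rightarrow> (nat \<Rightarrow> 'p \<Rightarrow> 'p) \<Rightarrow> ('a, 'c) module \<Rightarrow> nat \<Rightarrow>
   ('p \<Rightarrow> 'c) set" where
  "coboundaries R P d N i =
    (case i of 0 \<Rightarrow> {\<zero>\<^bsub>Hom_module R (P 0) N\<^esub>}
     | Suc j \<Rightarrow> (\<lambda>g. \<lambda>x\<in>carrier (P i). g (d j x)) ` carrier (Hom_module R (P j) N))"

definition cohomology ::
  "'a ring \<Rightarrow> (nat \<Rightarrow> ('a, 'p) module) \<Rightarrow> (nat \<Rightarrow> 'p \<Rightarrow> 'p) \<Rightarrow> ('a, 'c) module \<Rightarrow> nat \<Rightarrow>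
   ('p \<Rightarrow> 'c) set monoid" where
  "cohomology R P d N i =
    (Hom_module R (P i) N)\<lparr>carrier := cocycles R P d N i\<rparr> A_Mod coboundaries R P d N i"

text \<open>\<open>Ext\<^bsup>i\<^esup>(M, N)\<close> as an abelian group (written multiplicatively, as are all quotients formed with
  \<^const>\<open>A_FactGroup\<close>): the cohomology of \<open>Hom(P, N)\<close> for a chosen projective resolution \<open>P\<close> of
  \<open>M\<close>. Up to isomorphism the choice is irrelevant.\<close>

definition Ext :: "'a ring \<Rightarrow> nat \<Rightarrow> ('a, 'b) module \<Rightarrow> ('a, 'c) module \<Rightarrow>
    (('a, 'b) res \<Rightarrow> 'c) set monoid" where
  "Ext R i M N =
    (case (SOME (P, d). \<exists>e. projective_resolution R P d e M) of (P, d) \<Rightarrow> cohomology R P d N i)"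


section \<open>Local rings and finitely generated ideals\<close>

definition local_ring :: "'a ring \<Rightarrow> bool" where
  "local_ring R \<longleftrightarrow> cring R \<and> (\<exists>!m. maximalideal m R)"

definition fg_ideal :: "'a set \<Rightarrow> 'a ring \<Rightarrow> bool" where
  "fg_ideal I R \<longleftrightarrow> (\<exists>S. finite S \<and> S \<subseteq> carrier R \<and> I = Idl\<^bsub>R\<^esub> S)"


section \<open>Existence of projective resolutions on the type \<open>('a, 'b) res\<close>\<close>

text \<open>The free module on a set \<open>B\<close>, realised as the finitely supported functions on \<open>B\<close>.\<close>


definition fsupp_module :: "'a ring \<Rightarrow> 'c set \<Rightarrow> ('a, 'c \<Rightarrow> 'a) module" where
  "fsupp_module R B =
    \<lparr>carrier = {f. (\<forall>b. f b \<in> carrier R) \<and> finite {b. f b \<noteq> \<zero>\<^bsub>R\<^esub>} \<and> (\<forall>b. b \<notin> B \<longrightarrow> f b = \<zero>\<^bsub>R\<^esub>)},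
     monoid.mult = undefined, one = undefined,
     ring.zero = (\<lambda>b. \<zero>\<^bsub>R\<^esub>), ring.add = (\<lambda>f g b. f b \<oplus>\<^bsub>R\<^esub> g b),
     smult = (\<lambda>r f b. r \<otimes>\<^bsub>R\<^esub> f b)\<rparr>"

lemma module_fsupp_module:
  assumes "cring R"
  shows "module R (fsupp_module R B)"
proof -
  interpret R: cring R by fact
  have fin: "finite {b. f b \<oplus>\<^bsub>R\<^esub> g b \<noteq> \<zero>\<^bsub>R\<^esub>}"
    if "finite {b. f b \<noteq> \<zero>\<^bsub>R\<^esub>}" "finite {b. g b \<noteq> \<zero>\<^bsub>R\<^esub>}" for f g :: "'b \<Rightarrow> 'a"
    by (rule finite_subset[of _ "{b. f b \<noteq> \<zero>\<^bsub>R\<^esub>} \<union> {b. g b \<noteq> \<zero>\<^bsub>R\<^esub>}"]) (use that in auto)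
  have fin2: "finite {b. h (f b) \<noteq> \<zero>\<^bsub>R\<^esub>}"
    if "finite {b. f b \<noteq> \<zero>\<^bsub>R\<^esub>}" "h \<zero>\<^bsub>R\<^esub> = \<zero>\<^bsub>R\<^esub>" for f :: "'b \<Rightarrow> 'a" and h
    by (rule finite_subset[of _ "{b. f b \<noteq> \<zero>\<^bsub>R\<^esub>}"]) (use that in auto)
  show ?thesis
  proof (rule moduleI[OF assms abelian_groupI])
    fix f assume "f \<in> carrier (fsupp_module R B)"
    then show "\<exists>y\<in>carrier (fsupp_module R B). y \<oplus>\<^bsub>fsupp_module R B\<^esub> f = \<zero>\<^bsub>fsupp_module R B\<^esub>"
      using fin2[of f "\<lambda>x. \<ominus>\<^bsub>R\<^esub> x"]
      by (intro bexI[of _ "\<lambda>b. \<ominus>\<^bsub>R\<^esub> f b"]) (auto simp: fsupp_module_def R.l_neg)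
  next
    fix a f assume "a \<in> carrier R" "f \<in> carrier (fsupp_module R B)"
    then show "a \<odot>\<^bsub>fsupp_module R B\<^esub> f \<in> carrier (fsupp_module R B)"
      using fin2[of f "\<lambda>x. a \<otimes>\<^bsub>R\<^esub> x"] by (auto simp: fsupp_module_def)
  qed (auto simp: fsupp_module_def fin R.a_ac R.m_ac R.l_distr R.r_distr intro!: ext)
qed

lemma mod_homD:
  assumes "f \<in> mod_hom R M N"
  shows "x \<in> carrier M \<Longrightarrow> f x \<in> carrier N"
    and "x \<in> carrier M \<Longrightarrow> y \<in> carrier M \<Longrightarrow> f (x \<oplus>\<^bsub>M\<^esub> y) = f x \<oplus>\<^bsub>N\<^esub> f y"
    and "r \<in> carrier R \<Longrightarrow> x \<in> carrier M \<Longrightarrow> f (r \<odot>\<^bsub>M\<^esub> x) = r \<odot>\<^bsub>N\<^esub> f x"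
  using assms by (auto simp: mod_hom_def hom_def)

lemma mod_homI:
  assumes "\<And>x. x \<in> carrier M \<Longrightarrow> f x \<in> carrier N"
    and "\<And>x y. x \<in> carrier M \<Longrightarrow> y \<in> carrier M \<Longrightarrow> f (x \<oplus>\<^bsub>M\<^esub> y) = f x \<oplus>\<^bsub>N\<^esub> f y"
    and "\<And>r x. r \<in> carrier R \<Longrightarrow> x \<in> carrier M \<Longrightarrow> f (r \<odot>\<^bsub>M\<^esub> x) = r \<odot>\<^bsub>N\<^esub> f x"
  shows "f \<in> mod_hom R M N"
  using assms by (auto simp: mod_hom_def hom_def)

lemma mod_hom_zero:
  assumes "module R M" "module R N" "f \<in> mod_hom R M N"
  shows "f \<zero>\<^bsub>M\<^esub> = \<zero>\<^bsub>N\<^esub>"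
proof -
  interpret M: module R M by fact
  interpret N: module R N by fact
  have "f (\<zero>\<^bsub>R\<^esub> \<odot>\<^bsub>M\<^esub> \<zero>\<^bsub>M\<^esub>) = \<zero>\<^bsub>R\<^esub> \<odot>\<^bsub>N\<^esub> f \<zero>\<^bsub>M\<^esub>"
    by (rule mod_homD(3)[OF assms(3) M.R.zero_closed M.zero_closed])
  then show ?thesis using mod_homD(1)[OF assms(3)] by simp
qed

definition lin_ext :: "'a ring \<Rightarrow> ('a, 'b) module \<Rightarrow> ('c \<Rightarrow> 'b) \<Rightarrow> ('c \<Rightarrow> 'a) \<Rightarrow> 'b" where
  "lin_ext R M \<phi> f = (\<Oplus>\<^bsub>M\<^esub>b\<in>{b. f b \<noteq> \<zero>\<^bsub>R\<^esub>}. f b \<odot>\<^bsub>M\<^esub> \<phi> b)"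

lemma lin_ext_eq:
  assumes "module R M" "f \<in> carrier (fsupp_module R B)" "\<phi> ` B \<subseteq> carrier M"
    and "finite S" "{b. f b \<noteq> \<zero>\<^bsub>R\<^esub>} \<subseteq> S" "S \<subseteq> B"
  shows "lin_ext R M \<phi> f = (\<Oplus>\<^bsub>M\<^esub>b\<in>S. f b \<odot>\<^bsub>M\<^esub> \<phi> b)"
proof -
  interpret M: module R M by fact
  have \<phi>: "\<phi> b \<in> carrier M" if "b \<in> S" for b using that assms(3,6) by auto
  show ?thesis unfolding lin_ext_def
    by (rule M.add.finprod_mono_neutral_cong_left)
       (use assms(2,4,5) \<phi> in \<open>auto simp: fsupp_module_def\<close>)
qed

lemma lin_ext_hom:
  assumes "module R M" "\<phi> ` B \<subseteq> carrier M"
  shows "lin_ext R M \<phi> \<in> mod_hom R (fsupp_module R B) M"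
proof -
  interpret M: module R M by fact
  interpret F: module R "fsupp_module R B" by (rule module_fsupp_module[OF M.R.cring_axioms])
  note eq = lin_ext_eq[OF assms(1) _ assms(2)]
  have supp: "finite {b. f b \<noteq> \<zero>\<^bsub>R\<^esub>}" "{b. f b \<noteq> \<zero>\<^bsub>R\<^esub>} \<subseteq> B" "f b \<in> carrier R"
    if "f \<in> carrier (fsupp_module R B)" for f b
    using that by (auto simp: fsupp_module_def)
  show ?thesis
  proof (rule mod_homI)
    fix f assume f: "f \<in> carrier (fsupp_module R B)"
    show "lin_ext R M \<phi> f \<in> carrier M" unfolding lin_ext_def
      using supp[OF f] assms(2) by (intro M.finsum_closed) (auto simp: subset_iff image_subset_iff)
  next
    fix f g assume f: "f \<in> carrier (fsupp_module R B)" and g: "g \<in> carrier (fsupp_module R B)"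
    let ?S = "{b. f b \<noteq> \<zero>\<^bsub>R\<^esub>} \<union> {b. g b \<noteq> \<zero>\<^bsub>R\<^esub>}"
    let ?h = "f \<oplus>\<^bsub>fsupp_module R B\<^esub> g"
    have h: "?h \<in> carrier (fsupp_module R B)" using f g by simp
    have hb: "?h b = f b \<oplus>\<^bsub>R\<^esub> g b" for b by (simp add: fsupp_module_def)
    have S: "finite ?S" "?S \<subseteq> B" using supp[OF f] supp[OF g] by auto
    have "lin_ext R M \<phi> ?h = (\<Oplus>\<^bsub>M\<^esub>b\<in>?S. ?h b \<odot>\<^bsub>M\<^esub> \<phi> b)"
      by (rule eq[OF h S(1) _ S(2)]) (auto simp: hb)
    also have "\<dots> = (\<Oplus>\<^bsub>M\<^esub>b\<in>?S. f b \<odot>\<^bsub>M\<^esub> \<phi> b \<oplus>\<^bsub>M\<^esub> g b \<odot>\<^bsub>M\<^esub> \<phi> b)"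
      using supp(3)[OF f] supp(3)[OF g] S(2) assms(2)
      by (intro M.finsum_cong') (auto simp: hb M.smult_l_distr subset_iff image_subset_iff)
    also have "\<dots> = (\<Oplus>\<^bsub>M\<^esub>b\<in>?S. f b \<odot>\<^bsub>M\<^esub> \<phi> b) \<oplus>\<^bsub>M\<^esub> (\<Oplus>\<^bsub>M\<^esub>b\<in>?S. g b \<odot>\<^bsub>M\<^esub> \<phi> b)"
      using supp(3)[OF f] supp(3)[OF g] S(2) assms(2)
      by (intro M.finsum_addf) (auto simp: subset_iff image_subset_iff)
    also have "\<dots> = lin_ext R M \<phi> f \<oplus>\<^bsub>M\<^esub> lin_ext R M \<phi> g"
      using eq[OF f S(1) _ S(2)] eq[OF g S(1) _ S(2)] by auto
    finally show "lin_ext R M \<phi> ?h = lin_ext R M \<phi> f \<oplus>\<^bsub>M\<^esub> lin_ext R M \<phi> g" .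
  next
    fix r f assume r: "r \<in> carrier R" and f: "f \<in> carrier (fsupp_module R B)"
    let ?S = "{b. f b \<noteq> \<zero>\<^bsub>R\<^esub>}"
    let ?h = "r \<odot>\<^bsub>fsupp_module R B\<^esub> f"
    have h: "?h \<in> carrier (fsupp_module R B)" using f r by simp
    have hb: "?h b = r \<otimes>\<^bsub>R\<^esub> f b" for b by (simp add: fsupp_module_def)
    have "lin_ext R M \<phi> ?h = (\<Oplus>\<^bsub>M\<^esub>b\<in>?S. ?h b \<odot>\<^bsub>M\<^esub> \<phi> b)"
      by (rule eq[OF h supp(1)[OF f] _ supp(2)[OF f]]) (use r in \<open>auto simp: hb\<close>)
    also have "\<dots> = (\<Oplus>\<^bsub>M\<^esub>b\<in>?S. r \<odot>\<^bsub>M\<^esub> (f b \<odot>\<^bsub>M\<^esub> \<phi> b))"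
      using supp(2,3)[OF f] assms(2) r
      by (intro M.finsum_cong') (auto simp: hb M.smult_assoc1 subset_iff image_subset_iff)
    also have "\<dots> = r \<odot>\<^bsub>M\<^esub> (\<Oplus>\<^bsub>M\<^esub>b\<in>?S. f b \<odot>\<^bsub>M\<^esub> \<phi> b)"
      using supp[OF f] assms(2) r
      by (intro M.finsum_smult_ldistr[symmetric]) (auto simp: subset_iff image_subset_iff)
    finally show "lin_ext R M \<phi> ?h = r \<odot>\<^bsub>M\<^esub> lin_ext R M \<phi> f" by (simp add: lin_ext_def)
  qed
qed

lemma lin_ext_unit:
  assumes "module R M" "\<phi> ` B \<subseteq> carrier M" "b \<in> B"
  defines "u \<equiv> (\<lambda>c. if c = b then \<one>\<^bsub>R\<^esub> else \<zero>\<^bsub>R\<^esub>)"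
  shows "u \<in> carrier (fsupp_module R B)" "lin_ext R M \<phi> u = \<phi> b"
proof -
  interpret M: module R M by fact
  show u: "u \<in> carrier (fsupp_module R B)"
    using assms(3) by (auto simp: fsupp_module_def u_def)
  have "lin_ext R M \<phi> u = (\<Oplus>\<^bsub>M\<^esub>c\<in>{b}. u c \<odot>\<^bsub>M\<^esub> \<phi> c)"
    by (rule lin_ext_eq[OF assms(1) u assms(2)]) (use assms(3) in \<open>auto simp: u_def\<close>)
  also have "\<dots> = \<phi> b"
    using assms(2,3) by (auto simp: u_def image_subset_iff)
  finally show "lin_ext R M \<phi> u = \<phi> b" .
qed

lemma submodule_smult_closed_finsum:
  assumes "module R M" "submodule K R M" "finite S" "\<And>b. b \<in> S \<Longrightarrow> x b \<in> K"
  shows "(\<Oplus>\<^bsub>M\<^esub>b\<in>S. x b) \<in> K"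
proof -
  interpret M: module R M by fact
  note E = M.submoduleE[OF assms(2)]
  have z: "\<zero>\<^bsub>M\<^esub> \<in> K" using E(2,4) E(1) M.smult_l_null[OF subsetD[OF E(1)]] by fastforce
  show ?thesis using assms(3,4)
  proof (induction S)
    case (insert b S)
    then have "(\<Oplus>\<^bsub>M\<^esub>b\<in>insert b S. x b) = x b \<oplus>\<^bsub>M\<^esub> (\<Oplus>\<^bsub>M\<^esub>b\<in>S. x b)"
      using E(1) by (intro M.finsum_insert) auto
    then show ?case using insert E(5) by auto
  qed (use z in auto)
qed

lemma lin_ext_image:
  assumes "module R M" "submodule K R M" "\<phi> ` B = K"
  shows "lin_ext R M \<phi> ` carrier (fsupp_module R B) = K"
proof -
  interpret M: module R M by fact
  note E = M.submoduleE[OF assms(2)]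
  have sub: "\<phi> ` B \<subseteq> carrier M" using assms(3) E(1) by simp
  show ?thesis
  proof (intro equalityI subsetI)
    fix y assume "y \<in> lin_ext R M \<phi> ` carrier (fsupp_module R B)"
    then obtain f where f: "f \<in> carrier (fsupp_module R B)" and y: "y = lin_ext R M \<phi> f" by auto
    show "y \<in> K" unfolding y lin_ext_def
      by (rule submodule_smult_closed_finsum[OF assms(1,2)])
         (use f in \<open>auto simp: fsupp_module_def assms(3)[symmetric] intro!: E(4)[unfolded assms(3)[symmetric]]\<close>)
  next
    fix y assume "y \<in> K"
    then obtain b where "b \<in> B" "y = \<phi> b" using assms(3) by auto
    then show "y \<in> lin_ext R M \<phi> ` carrier (fsupp_module R B)"
      using lin_ext_unit[OF assms(1) sub] by (metis imageI)
  qed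
qed

lemma lin_ext_unique:
  fixes R :: "'a ring" and B :: "'c set"
  assumes "module R M" "h \<in> mod_hom R (fsupp_module R B) M" "f \<in> carrier (fsupp_module R B)"
  shows "h f = lin_ext R M (\<lambda>b. h (\<lambda>c. if c = b then \<one>\<^bsub>R\<^esub> else \<zero>\<^bsub>R\<^esub>)) f"
proof -
  interpret M: module R M by fact
  interpret F: module R "fsupp_module R B" by (rule module_fsupp_module[OF M.R.cring_axioms])
  define u where "u b = (\<lambda>c. if c = b then \<one>\<^bsub>R\<^esub> else \<zero>\<^bsub>R\<^esub>)" for b :: 'c
  define \<phi> where "\<phi> b = h (u b)" for b
  have u: "u b \<in> carrier (fsupp_module R B)" if "b \<in> B" for b
    using that by (auto simp: fsupp_module_def u_def)
  have sub: "\<phi> ` B \<subseteq> carrier M" using mod_homD(1)[OF assms(2)] u by (auto simp: \<phi>_def)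
  note lh = lin_ext_hom[OF assms(1) sub]
  have "h g = lin_ext R M \<phi> g" if "finite S" "{b. g b \<noteq> \<zero>\<^bsub>R\<^esub>} \<subseteq> S"
    "g \<in> carrier (fsupp_module R B)" for S g
    using that
  proof (induction S arbitrary: g)
    case empty
    then have "g = \<zero>\<^bsub>fsupp_module R B\<^esub>" by (auto simp: fsupp_module_def)
    then show ?case
      using mod_hom_zero[OF F.module_axioms assms(1,2)] mod_hom_zero[OF F.module_axioms assms(1) lh]
      by simp
  next
    case (insert b S)
    show ?case
    proof (cases "g b = \<zero>\<^bsub>R\<^esub>")
      case True
      then show ?thesis using insert by (intro insert.IH) auto
    next
      case False
      define g' where "g' = g(b := \<zero>\<^bsub>R\<^esub>)"
      have bB: "b \<in> B" using False insert.prems(2) by (auto simp: fsupp_module_def)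
      have gb: "g b \<in> carrier R" using insert.prems(2) by (auto simp: fsupp_module_def)
      have "finite {x. g' x \<noteq> \<zero>\<^bsub>R\<^esub>}"
        by (rule finite_subset[of _ "{b. g b \<noteq> \<zero>\<^bsub>R\<^esub>}"])
           (use insert.prems(2) in \<open>auto simp: fsupp_module_def g'_def\<close>)
      then have g': "g' \<in> carrier (fsupp_module R B)"
        using insert.prems(2) by (simp add: fsupp_module_def) (auto simp: g'_def)
      have eq: "g = g b \<odot>\<^bsub>fsupp_module R B\<^esub> u b \<oplus>\<^bsub>fsupp_module R B\<^esub> g'"
        using insert.prems(2) gb by (auto simp: fsupp_module_def g'_def u_def fun_eq_iff)
      have c: "g b \<odot>\<^bsub>fsupp_module R B\<^esub> u b \<in> carrier (fsupp_module R B)"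
        using u[OF bB] gb by simp
      have "{c. g' c \<noteq> \<zero>\<^bsub>R\<^esub>} \<subseteq> S" using insert.prems(1) by (auto simp: g'_def)
      then have "h g' = lin_ext R M \<phi> g'" using g' by (rule insert.IH)
      moreover have "h (u b) = lin_ext R M \<phi> (u b)"
        using lin_ext_unit(2)[OF assms(1) sub bB] by (simp add: u_def \<phi>_def)
      ultimately have "h (g b \<odot>\<^bsub>fsupp_module R B\<^esub> u b \<oplus>\<^bsub>fsupp_module R B\<^esub> g') =
          lin_ext R M \<phi> (g b \<odot>\<^bsub>fsupp_module R B\<^esub> u b \<oplus>\<^bsub>fsupp_module R B\<^esub> g')"
        using mod_homD(2)[OF assms(2) c g'] mod_homD(2)[OF lh c g']
          mod_homD(3)[OF assms(2) gb u[OF bB]] mod_homD(3)[OF lh gb u[OF bB]] by simp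
      then show ?thesis using eq by simp
    qed
  qed
  from this[OF _ subset_refl assms(3)] assms(3) have "h f = lin_ext R M \<phi> f"
    by (auto simp: fsupp_module_def)
  then show ?thesis by (simp add: \<phi>_def[abs_def] u_def)
qed

lemma projective_fsupp_module:
  assumes "cring R"
  shows "projective_module R (fsupp_module R B :: ('a, 'c \<Rightarrow> 'a) module)"
  unfolding projective_module_def
proof (intro conjI allI impI; (elim conjE)?)
  let ?P = "fsupp_module R B :: ('a, 'c \<Rightarrow> 'a) module"
  show "module R ?P" by (rule module_fsupp_module[OF assms])
  fix N :: "('a, ('c \<Rightarrow> 'a) \<Rightarrow> 'a) module" and L :: "('a, 'c \<Rightarrow> 'a) module" and g f
  assume N: "module R N" and L: "module R L" and g: "g \<in> mod_hom R N L"
    and onto: "g ` carrier N = carrier L" and f: "f \<in> mod_hom R ?P L"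
  interpret P: module R ?P by (rule module_fsupp_module[OF assms])
  define u :: "'c \<Rightarrow> 'c \<Rightarrow> 'a" where "u b = (\<lambda>c. if c = b then \<one>\<^bsub>R\<^esub> else \<zero>\<^bsub>R\<^esub>)" for b
  have u: "u b \<in> carrier ?P" if "b \<in> B" for b
    using lin_ext_unit(1)[OF P.module_axioms, of "\<lambda>_. \<zero>\<^bsub>?P\<^esub>" B b] that by (auto simp: u_def)
  have "\<exists>y\<in>carrier N. g y = f (u b)" if "b \<in> B" for b
    using onto mod_homD(1)[OF f u[OF that]] by (metis imageE)
  then obtain \<phi> where \<phi>: "\<And>b. b \<in> B \<Longrightarrow> \<phi> b \<in> carrier N \<and> g (\<phi> b) = f (u b)" by metis
  have sub: "\<phi> ` B \<subseteq> carrier N" using \<phi> by auto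
  note k = lin_ext_hom[OF N sub]
  have gk: "g \<circ> lin_ext R N \<phi> \<in> mod_hom R ?P L"
    by (rule mod_homI) (auto simp: mod_homD[OF g] mod_homD[OF k])
  show "\<exists>k\<in>mod_hom R ?P N. \<forall>x\<in>carrier ?P. g (k x) = f x"
  proof (intro bexI[OF _ k] ballI)
    fix x assume x: "x \<in> carrier ?P"
    have S: "finite {b. x b \<noteq> \<zero>\<^bsub>R\<^esub>}" "{b. x b \<noteq> \<zero>\<^bsub>R\<^esub>} \<subseteq> B"
      using x by (auto simp: fsupp_module_def)
    have xb: "x b \<in> carrier R" for b using x by (auto simp: fsupp_module_def)
    interpret L: module R L by fact
    have "g (lin_ext R N \<phi> x) = lin_ext R L (\<lambda>b. g (lin_ext R N \<phi> (u b))) x"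
      using lin_ext_unique[OF L gk x] by (simp add: u_def)
    also have "\<dots> = lin_ext R L (\<lambda>b. f (u b)) x"
      unfolding lin_ext_def[of R L]
      using S(2) \<phi> xb lin_ext_unit(2)[OF N sub] mod_homD(1)[OF f u]
      by (intro L.finsum_cong') (auto simp: u_def subset_iff intro!: L.smult_closed)
    also have "\<dots> = f x" using lin_ext_unique[OF L f x] by (simp add: u_def)
    finally show "g (lin_ext R N \<phi> x) = f x" .
  qed
qed

fun enc :: "((nat \<times> 'a \<times> 'b) list \<times> 'a) list \<Rightarrow> (nat \<times> 'a \<times> 'b) list" where
  "enc [] = []"
| "enc ((l, a) # ps) = map (\<lambda>(k, z). (Suc k, z)) l @ (0, a, undefined) # enc ps"

lemma tagged_append_inj:
  "map (\<lambda>(k, z). (Suc k, z)) l @ (0, z) # xs = map (\<lambda>(k, z). (Suc k, z)) l' @ (0, z') # xs'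
    \<Longrightarrow> l = l' \<and> z = z' \<and> xs = xs'"
proof (induction l arbitrary: l')
  case Nil
  then show ?case by (cases l') auto
next
  case (Cons x l)
  then show ?case by (cases l'; cases x) auto
qed

lemma inj_enc: "inj enc"
proof (rule injI)
  fix x y :: "((nat \<times> 'a \<times> 'b) list \<times> 'a) list"
  assume "enc x = enc y"
  then show "x = y"
  proof (induction x arbitrary: y rule: enc.induct)
    case 1
    then show ?case by (cases y rule: enc.cases) auto
  next
    case (2 l a ps)
    then show ?case by (cases y rule: enc.cases) (auto dest!: tagged_append_inj)
  qed
qed

lemma finite_support_inject:
  "\<exists>\<psi> :: ('a, 'b) res \<Rightarrow> (nat \<times> 'a \<times> 'b) list. inj_on \<psi> {f. finite {b. f b \<noteq> z}}"
proof -
  have ex: "\<exists>l. set l = {(b, f b) | b. f b \<noteq> z}" if "finite {b. f b \<noteq> z}"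
    for f :: "('a, 'b) res"
  proof -
    have "{(b, f b) | b. f b \<noteq> z} = (\<lambda>b. (b, f b)) ` {b. f b \<noteq> z}" by auto
    then show ?thesis using finite_list[of "{(b, f b) | b. f b \<noteq> z}"] that by auto
  qed
  define l :: "('a, 'b) res \<Rightarrow> ((nat \<times> 'a \<times> 'b) list \<times> 'a) list"
    where "l f = (SOME l. set l = {(b, f b) | b. f b \<noteq> z})" for f
  have l: "set (l f) = {(b, f b) | b. f b \<noteq> z}" if "finite {b. f b \<noteq> z}" for f
    unfolding l_def by (rule someI_ex[OF ex[OF that]])
  have "inj_on (\<lambda>f. enc (l f)) {f. finite {b. f b \<noteq> z}}"
  proof (rule inj_onI)
    fix f g assume f: "f \<in> {f. finite {b. f b \<noteq> z}}" and g: "g \<in> {f. finite {b. f b \<noteq> z}}"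
      and "enc (l f) = enc (l g)"
    then have "l f = l g" using inj_enc by (auto dest: injD)
    then have eq: "{(b, f b) | b. f b \<noteq> z} = {(b, g b) | b. g b \<noteq> z}"
      using l[of f] l[of g] f g by simp
    show "f = g"
    proof
      fix b
      have *: "f b \<noteq> z \<and> c = f b \<longleftrightarrow> g b \<noteq> z \<and> c = g b" for c
        using arg_cong[OF eq, of "\<lambda>S. (b, c) \<in> S"] by (simp add: conj_commute)
      from *[of "f b"] *[of "g b"] show "f b = g b" by (cases "f b = z"; cases "g b = z") simp_all
    qed
  qed
  then show ?thesis by blast
qed

lemma kernel_submodule:
  assumes "module R M" "module R N" "f \<in> mod_hom R M N"
  shows "submodule (a_kernel M N f) R M"
proof -
  interpret M: module R M by fact
  interpret N: module R N by fact
  have ker: "a_kernel M N f = {x \<in> carrier M. f x = \<zero>\<^bsub>N\<^esub>}"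
    by (auto simp: a_kernel_def kernel_def)
  note z = mod_hom_zero[OF assms]
  have neg: "f (\<ominus>\<^bsub>M\<^esub> a) = \<zero>\<^bsub>N\<^esub>" if "a \<in> carrier M" "f a = \<zero>\<^bsub>N\<^esub>" for a
    using mod_homD(2)[OF assms(3), of "\<ominus>\<^bsub>M\<^esub> a" a] that z mod_homD(1)[OF assms(3), of "\<ominus>\<^bsub>M\<^esub> a"]
    by (simp add: M.l_neg)
  show ?thesis unfolding ker
    by (rule M.submoduleI) (auto simp: z neg mod_homD[OF assms(3)])
qed

lemma free_cover:
  fixes \<psi> :: "'b \<Rightarrow> 'c"
  assumes "module R M" "submodule K R M" "inj_on \<psi> K"
  shows "\<exists>(B :: 'c set) d. d \<in> mod_hom R (fsupp_module R B) M \<and> d ` carrier (fsupp_module R B) = K"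
proof -
  have "inv_into K \<psi> ` (\<psi> ` K) = K" using assms(3) by (simp add: image_image cong: image_cong)
  note im = this
  show ?thesis
  proof (intro exI conjI)
    show "lin_ext R M (inv_into K \<psi>) \<in> mod_hom R (fsupp_module R (\<psi> ` K)) M"
      by (rule lin_ext_hom[OF assms(1)]) (simp only: im module.submoduleE(1)[OF assms(1,2)])
    show "lin_ext R M (inv_into K \<psi>) ` carrier (fsupp_module R (\<psi> ` K)) = K"
      by (rule lin_ext_image[OF assms(1,2) im])
  qed
qed

lemma projective_resolution_exists:
  fixes M :: "('a, 'b) module"
  assumes "module R M"
  shows "\<exists>(P :: nat \<Rightarrow> ('a, ('a, 'b) res) module) d e. projective_resolution R P d e M"
proof -
  interpret M: module R M by fact
  let ?F = "\<lambda>B. fsupp_module R B :: ('a, ('a, 'b) res) module"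
  have F: "module R (?F B)" for B by (rule module_fsupp_module[OF M.R.cring_axioms])
  have "inj_on (\<lambda>m. [(0 :: nat, undefined :: 'a, m)]) (carrier M)" by (auto simp: inj_on_def)
  from free_cover[OF assms M.carrier_is_submodule this] obtain B0 e
    where e: "e \<in> mod_hom R (?F B0) M" "e ` carrier (?F B0) = carrier M" by blast
  obtain \<psi> :: "('a, 'b) res \<Rightarrow> (nat \<times> 'a \<times> 'b) list"
    where \<psi>: "inj_on \<psi> {f. finite {b. f b \<noteq> \<zero>\<^bsub>R\<^esub>}}"
    using finite_support_inject[of "\<zero>\<^bsub>R\<^esub>"] by (elim exE)
  have step: "\<exists>B' d. d \<in> mod_hom R (?F B') (?F B) \<and> d ` carrier (?F B') = K"
    if "submodule K R (?F B)" for B K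
  proof -
    have "K \<subseteq> {f. finite {b. f b \<noteq> \<zero>\<^bsub>R\<^esub>}}"
      using module.submoduleE(1)[OF F that] by (auto simp: fsupp_module_def)
    then show ?thesis using free_cover[OF F that] inj_on_subset[OF \<psi>] by blast
  qed
  define Q where "Q = (\<lambda>(B, K). submodule K R (?F B))"
  have "\<forall>s. \<exists>t. Q s \<longrightarrow> snd t \<in> mod_hom R (?F (fst t)) (?F (fst s)) \<and>
     snd t ` carrier (?F (fst t)) = snd s" 
  proof
    fix s :: "(nat \<times> 'a \<times> 'b) list set \<times> ('a, 'b) res set"
    obtain B K where s: "s = (B, K)" by fastforce
    show "\<exists>t. Q s \<longrightarrow> snd t \<in> mod_hom R (?F (fst t)) (?F (fst s)) \<and>
        snd t ` carrier (?F (fst t)) = snd s"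
    proof (cases "Q s")
      case True
      then obtain B' d where "d \<in> mod_hom R (?F B') (?F B)" "d ` carrier (?F B') = K"
        using step[of K B] by (auto simp: Q_def s)
      then show ?thesis by (intro exI[of _ "(B', d)"]) (simp add: s)
    qed simp
  qed
  then obtain nx where nx: "\<And>s. Q s \<Longrightarrow> snd (nx s) \<in> mod_hom R (?F (fst (nx s))) (?F (fst s)) \<and>
     snd (nx s) ` carrier (?F (fst (nx s))) = snd s" by metis
  define st where "st = rec_nat (B0, a_kernel (?F B0) M e)
    (\<lambda>_ s. (fst (nx s), a_kernel (?F (fst (nx s))) (?F (fst s)) (snd (nx s))))"
  have st0: "st 0 = (B0, a_kernel (?F B0) M e)" by (simp add: st_def)
  have stS: "st (Suc i) = (fst (nx (st i)),
      a_kernel (?F (fst (nx (st i)))) (?F (fst (st i))) (snd (nx (st i))))" for i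
    by (simp add: st_def)
  have Q: "Q (st i)" for i
  proof (induction i)
    case 0
    show ?case using kernel_submodule[OF F assms e(1)] by (simp add: st0 Q_def)
  next
    case (Suc i)
    show ?case using kernel_submodule[OF F F conjunct1[OF nx[OF Suc]]] by (simp add: stS Q_def)
  qed
  define P where "P i = ?F (fst (st i))" for i
  define d where "d i = snd (nx (st i))" for i
  have PS: "P (Suc i) = ?F (fst (nx (st i)))" for i by (simp add: P_def stS)
  have "d i \<in> mod_hom R (P (Suc i)) (P i)" "d i ` carrier (P (Suc i)) = snd (st i)" for i
    using nx[OF Q[of i]] by (simp_all add: PS d_def) (simp_all add: P_def)
  moreover have "snd (st i) =
      (case i of 0 \<Rightarrow> a_kernel (P 0) M e | Suc j \<Rightarrow> a_kernel (P i) (P j) (d j))" for i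
    by (cases i) (simp_all add: st0 stS P_def d_def)
  ultimately have ex: "exact_upto R n P d e M" for n
    using e assms F by (simp add: exact_upto_def P_def[of 0] st0) (simp add: P_def)
  have "projective_module R (P i)" for i
    unfolding P_def by (rule projective_fsupp_module[OF M.R.cring_axioms])
  then have "projective_resolution R P d e M"
    unfolding projective_resolution_def by (intro conjI allI ex)
  then show ?thesis by (intro exI)
qed

end

theory Submission
  imports Defs "HOL-Library.Poly_Mapping" "HOL-Computational_Algebra.Fraction_Field"
begin

text \<open>\<^bold>\<open>The bound for cyclic weak rings.\<close> A finite resolution \<open>0 \<rightarrow> P\<^sub>s \<rightarrow> \<dots> \<rightarrow> P\<^sub>0 \<rightarrow> M \<rightarrow> 0\<close> by finitely generated
  projectives can be shortened whenever its first map \<open>P\<^sub>s \<rightarrow> P\<^sub>s\<^sub>-\<^sub>1\<close> splits (\<open>fPD_le_if_split\<close>). Let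
  \<open>A\<close> be a cyclic weak \<open>(1, d)\<close>-ring and \<open>s > d\<close>. For \<open>x \<in> P\<^sub>s\<close> let \<open>J\<close> be the finitely generated ideal of
  the coordinates of the image of \<open>x\<close>. Since \<open>A/J\<close> has projective dimension at most \<open>d\<close>, the complex
  \<open>P \<otimes> A/J\<close> is exact at \<open>P\<^sub>s\<close>, where \<open>x\<close> is a cycle; so the coordinates of \<open>x\<close> lie in \<open>J\<close>
  (\<open>coordinates_in_ideal\<close>). This makes it possible to recover \<open>x\<close> from its image by a homomorphism
  (\<open>recover_element\<close>), and Villamayor's argument (\<open>recover_finite_family\<close>) extends this from single
  elements to a generating set of \<open>P\<^sub>s\<close>.

  \<^bold>\<open>The example.\<close> Let \<open>R\<close> be a regular local ring with regular parameters \<open>x\<^sub>0, \<dots>, x\<^sub>h\<close>, and let \<open>T\<close> be its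
  trivial extension by the direct sum \<open>E\<close> of infinitely many copies of each \<open>R/f\<close>, where \<open>f\<close> runs
  through the nonzero elements of the maximal ideal. Every element of the maximal ideal of \<open>T\<close>
  kills the generators \<open>\<epsilon>\<close> of infinitely many summands, and finitely many elements of \<open>T\<close> leave almost
  all summands of each kind alone (\<open>fresh_summand\<close>). This has the following consequences.

  \<^item> The relations between minimal generators of a nonzero proper ideal are never finitely generated:
    an \<open>\<epsilon>\<close> that kills one of the generators occurs in a relation, but it is not a combination of finitely
    many coefficients from the maximal ideal (\<open>relations_not_fg\<close>). Hence only the ideals \<open>0\<close> and \<open>T\<close>
    are finitely presented, and every \<open>2\<close>-presented cyclic module is \<open>T\<close> or \<open>0\<close>.

  \<^item> The Koszul complex of \<open>x\<^sub>0, \<dots>, x\<^sub>h\<close> is exact in degrees up to \<open>h\<close> over \<open>R\<close>, hence in degrees below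
    \<open>h\<close> over every \<open>R/f\<close> and over \<open>T\<close> (\<open>koszul_exact_extension\<close>). Read backwards, its beginning is a
    minimal free resolution of length \<open>h\<close>, so \<open>fPD T \<ge> h\<close> (\<open>fPD_lower\<close>).

  \<^item> A resolution over \<open>T\<close> remains exact in positive degrees when it is tensored with
    \<open>R/x\<^sub>0 \<cong> T \<epsilon>\<close>, because \<open>T \<epsilon>\<close> splits off compatibly with the finitely many matrix entries.
    Dividing by \<open>x\<^sub>1, \<dots>, x\<^sub>h\<close> costs one degree each. So beyond degree \<open>h\<close> the differentials stay
    injective modulo the maximal ideal, and a finite resolution that is longer than \<open>h\<close> begins with
    a split map (\<open>fPD_upper\<close>).

  \<^item> With \<open>I = (x\<^sub>0, \<dots>, x\<^sub>h)\<close>, the exactness of the Koszul complex below degree \<open>h\<close> forces the modules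
    \<open>Ext\<^bsup>i\<^esup>(T/I, T)\<close> with \<open>i < h\<close> to vanish (\<open>ext_vanishing\<close>), and its cohomology in degree \<open>h\<close> contains
    a nonzero class that is killed by \<open>I\<close> (\<open>koszul_class\<close>), which produces a nonzero element of
    \<open>Ext\<^bsup>h\<^esup>(T/I, T)\<close> (\<open>ext_nonvanishing\<close>).

  For \<open>R\<close> one can take the localisation of \<open>\<int>[x\<^sub>0, x\<^sub>1, \<dots>]\<close> at the prime ideal \<open>(x\<^sub>0, \<dots>, x\<^sub>h)\<close>. It is
  countable, so that \<open>T\<close> has a copy whose elements are sets of natural numbers.\<close>

section \<open>Homomorphisms, kernels and images\<close>

lemma a_kernel_eq: "a_kernel M N f = {x \<in> carrier M. f x = \<zero>\<^bsub>N\<^esub>}"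
  by (auto simp: a_kernel_def kernel_def)

lemma mod_hom_comp:
  "f \<in> mod_hom R M N \<Longrightarrow> g \<in> mod_hom R N L \<Longrightarrow> (\<lambda>x. g (f x)) \<in> mod_hom R M L"
  by (rule mod_homI) (auto simp: mod_homD)

lemma mod_hom_id: "(\<lambda>x. x) \<in> mod_hom R M M"
  by (rule mod_homI) auto

lemma mod_hom_add:
  assumes "module R M" "module R N" "f \<in> mod_hom R M N" "g \<in> mod_hom R M N"
  shows "(\<lambda>x. f x \<oplus>\<^bsub>N\<^esub> g x) \<in> mod_hom R M N"
proof -
  interpret M: module R M by fact
  interpret N: module R N by fact
  show ?thesis using mod_homD[OF assms(3)] mod_homD[OF assms(4)]
    by (intro mod_homI) (auto simp: N.smult_r_distr N.a_ac)
qed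

lemma mod_hom_neg:
  assumes "module R M" "module R N" "f \<in> mod_hom R M N" "x \<in> carrier M"
  shows "f (\<ominus>\<^bsub>M\<^esub> x) = \<ominus>\<^bsub>N\<^esub> f x"
proof -
  interpret M: module R M by fact
  interpret N: module R N by fact
  have "f (\<ominus>\<^bsub>M\<^esub> x) \<oplus>\<^bsub>N\<^esub> f x = \<zero>\<^bsub>N\<^esub>"
    using mod_homD(2)[OF assms(3), of "\<ominus>\<^bsub>M\<^esub> x" x] mod_hom_zero[OF assms(1-3)] assms(4)
    by (simp add: M.l_neg)
  then show ?thesis using mod_homD(1)[OF assms(3)] assms(4) by (simp add: N.minus_equality)
qed

lemma mod_hom_minus_apply:
  assumes "module R M" "module R N" "f \<in> mod_hom R M N" "x \<in> carrier M" "y \<in> carrier M"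
  shows "f (x \<ominus>\<^bsub>M\<^esub> y) = f x \<ominus>\<^bsub>N\<^esub> f y"
proof -
  interpret M: module R M by fact
  show ?thesis using mod_homD(2)[OF assms(3,4), of "\<ominus>\<^bsub>M\<^esub> y"] mod_hom_neg[OF assms(1-3,5)] assms(5)
    by (simp add: a_minus_def)
qed

lemma mod_hom_minus:
  assumes "module R M" "module R N" "f \<in> mod_hom R M N" "g \<in> mod_hom R M N"
  shows "(\<lambda>x. f x \<ominus>\<^bsub>N\<^esub> g x) \<in> mod_hom R M N"
proof -
  interpret M: module R M by fact
  interpret N: module R N by fact
  show ?thesis using mod_homD[OF assms(3)] mod_homD[OF assms(4)]
    by (intro mod_homI) (auto simp: a_minus_def N.smult_r_distr N.smult_r_minus N.a_ac N.minus_add)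
qed

lemma mod_hom_zero_map:
  assumes "module R M" "module R N"
  shows "(\<lambda>x. \<zero>\<^bsub>N\<^esub>) \<in> mod_hom R M N"
proof -
  interpret N: module R N by fact
  show ?thesis by (rule mod_homI) auto
qed

lemma mod_hom_smult:
  assumes "module R M" "module R N" "f \<in> mod_hom R M N" "r \<in> carrier R"
  shows "(\<lambda>x. r \<odot>\<^bsub>N\<^esub> f x) \<in> mod_hom R M N"
proof -
  interpret N: module R N by fact
  show ?thesis using mod_homD[OF assms(3)] assms(4)
    by (intro mod_homI) (auto simp: N.smult_r_distr N.smult_assoc1[symmetric] N.R.m_comm)
qed

lemma mod_hom_finsum:
  assumes "module R M" "module R N" "f \<in> mod_hom R M N" "finite A" "\<And>i. i \<in> A \<Longrightarrow> x i \<in> carrier M"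
  shows "f (\<Oplus>\<^bsub>M\<^esub>i\<in>A. x i) = (\<Oplus>\<^bsub>N\<^esub>i\<in>A. f (x i))"
proof -
  interpret M: module R M by fact
  interpret N: module R N by fact
  show ?thesis using assms(4,5)
  proof (induction A)
    case empty
    then show ?case using mod_hom_zero[OF assms(1-3)] by simp
  next
    case (insert a A)
    have 1: "(\<Oplus>\<^bsub>M\<^esub>i\<in>insert a A. x i) = x a \<oplus>\<^bsub>M\<^esub> (\<Oplus>\<^bsub>M\<^esub>i\<in>A. x i)"
      using insert by (intro M.finsum_insert) auto
    have 2: "(\<Oplus>\<^bsub>N\<^esub>i\<in>insert a A. f (x i)) = f (x a) \<oplus>\<^bsub>N\<^esub> (\<Oplus>\<^bsub>N\<^esub>i\<in>A. f (x i))"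
      using insert mod_homD(1)[OF assms(3)] by (intro N.finsum_insert) auto
    have "(\<Oplus>\<^bsub>M\<^esub>i\<in>A. x i) \<in> carrier M" using insert by (intro M.finsum_closed) auto
    then show ?case using insert mod_homD(2)[OF assms(3)] by (simp add: 1 2)
  qed
qed

lemma image_submodule:
  assumes "module R M" "module R N" "f \<in> mod_hom R M N"
  shows "submodule (f ` carrier M) R N"
proof -
  interpret M: module R M by fact
  interpret N: module R N by fact
  show ?thesis
  proof (rule N.submoduleI)
    show "\<zero>\<^bsub>N\<^esub> \<in> f ` carrier M" using mod_hom_zero[OF assms] by (metis M.zero_closed imageI)
    show "f ` carrier M \<subseteq> carrier N" using mod_homD(1)[OF assms(3)] by auto
    show "\<ominus>\<^bsub>N\<^esub> a \<in> f ` carrier M" if "a \<in> f ` carrier M" for a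
    proof -
      obtain x where "x \<in> carrier M" "a = f x" using \<open>a \<in> f ` carrier M\<close> by auto
      then show ?thesis using mod_hom_neg[OF assms, of x] by (metis M.a_inv_closed imageI)
    qed
    show "a \<oplus>\<^bsub>N\<^esub> b \<in> f ` carrier M" if ab: "a \<in> f ` carrier M" "b \<in> f ` carrier M" for a b
    proof -
      obtain x y where "x \<in> carrier M" "a = f x" "y \<in> carrier M" "b = f y" using ab by auto
      then show ?thesis using mod_homD(2)[OF assms(3), of x y] by (metis M.a_closed imageI)
    qed
    show "r \<odot>\<^bsub>N\<^esub> a \<in> f ` carrier M" if ra: "r \<in> carrier R" "a \<in> f ` carrier M" for r a
    proof -
      obtain x where "x \<in> carrier M" "a = f x" using ra by auto
      then show ?thesis using mod_homD(3)[OF assms(3), of r x] ra(1) by (metis M.smult_closed imageI)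
    qed
  qed
qed

lemma submodule_zero_mem:
  assumes "module R M" "submodule K R M"
  shows "\<zero>\<^bsub>M\<^esub> \<in> K"
  using submodule_smult_closed_finsum[OF assms, of "{}"] module.axioms(2)[OF assms(1)]
  by (simp add: abelian_group_def abelian_monoid.finsum_empty)

lemma module_submodule: "module R M \<Longrightarrow> submodule K R M \<Longrightarrow> module R (M\<lparr>carrier := K\<rparr>)"
  by (rule submodule.submodule_is_module)

lemma mod_hom_into_submodule:
  "f \<in> mod_hom R P M \<Longrightarrow> f ` carrier P \<subseteq> K \<Longrightarrow> f \<in> mod_hom R P (M\<lparr>carrier := K\<rparr>)"
  by (rule mod_homI) (auto simp: mod_homD)

lemma mod_hom_on_submodule:
  "f \<in> mod_hom R M P \<Longrightarrow> K \<subseteq> carrier M \<Longrightarrow> f \<in> mod_hom R (M\<lparr>carrier := K\<rparr>) P"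
  by (rule mod_homI) (auto simp: mod_homD subset_iff)

section \<open>Free modules of finitely supported functions\<close>

lemma fsupp_carrier_iff:
  "f \<in> carrier (fsupp_module R B) \<longleftrightarrow>
    (\<forall>b. f b \<in> carrier R) \<and> finite {b. f b \<noteq> \<zero>\<^bsub>R\<^esub>} \<and> (\<forall>b. b \<notin> B \<longrightarrow> f b = \<zero>\<^bsub>R\<^esub>)"
  by (simp add: fsupp_module_def)

lemma fsupp_carrier_finite:
  "finite B \<Longrightarrow> f \<in> carrier (fsupp_module R B) \<longleftrightarrow>
    (\<forall>b. f b \<in> carrier R) \<and> (\<forall>b. b \<notin> B \<longrightarrow> f b = \<zero>\<^bsub>R\<^esub>)"
  unfolding fsupp_carrier_iff by (auto intro: finite_subset[of _ B])

lemma fsupp_simps [simp]: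
  "\<zero>\<^bsub>fsupp_module R B\<^esub> = (\<lambda>b. \<zero>\<^bsub>R\<^esub>)"
  "f \<oplus>\<^bsub>fsupp_module R B\<^esub> g = (\<lambda>b. f b \<oplus>\<^bsub>R\<^esub> g b)"
  "r \<odot>\<^bsub>fsupp_module R B\<^esub> f = (\<lambda>b. r \<otimes>\<^bsub>R\<^esub> f b)"
  by (auto simp: fsupp_module_def)

lemma fsupp_neg:
  assumes "cring R" "f \<in> carrier (fsupp_module R B)"
  shows "\<ominus>\<^bsub>fsupp_module R B\<^esub> f = (\<lambda>b. \<ominus>\<^bsub>R\<^esub> f b)"
proof -
  interpret R: cring R by fact
  interpret F: module R "fsupp_module R B" by (rule module_fsupp_module[OF assms(1)])
  have f: "f b \<in> carrier R" for b using assms(2) by (auto simp: fsupp_carrier_iff)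
  have "{b. \<ominus>\<^bsub>R\<^esub> f b \<noteq> \<zero>\<^bsub>R\<^esub>} \<subseteq> {b. f b \<noteq> \<zero>\<^bsub>R\<^esub>}" by auto
  then have "(\<lambda>b. \<ominus>\<^bsub>R\<^esub> f b) \<in> carrier (fsupp_module R B)"
    using assms(2) f by (auto simp: fsupp_carrier_iff intro: finite_subset)
  then show ?thesis using assms(2) f
    by (intro F.minus_equality) (auto simp: R.l_neg)
qed

lemma fsupp_minus:
  assumes "cring R" "g \<in> carrier (fsupp_module R B)"
  shows "f \<ominus>\<^bsub>fsupp_module R B\<^esub> g = (\<lambda>b. f b \<ominus>\<^bsub>R\<^esub> g b)"
  by (simp add: a_minus_def fsupp_neg[OF assms])

lemma self_module_simps [simp]:
  "carrier (self_module R) = carrier R" "\<zero>\<^bsub>self_module R\<^esub> = \<zero>\<^bsub>R\<^esub>"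
  "x \<oplus>\<^bsub>self_module R\<^esub> y = x \<oplus>\<^bsub>R\<^esub> y" "r \<odot>\<^bsub>self_module R\<^esub> x = r \<otimes>\<^bsub>R\<^esub> x"
  by (simp_all add: self_module_def)

lemma module_self_module:
  assumes "cring R"
  shows "module R (self_module R)"
proof -
  interpret R: cring R by fact
  show ?thesis
  proof (rule moduleI[OF assms abelian_groupI])
    fix x assume "x \<in> carrier (self_module R)"
    then show "\<exists>y\<in>carrier (self_module R). y \<oplus>\<^bsub>self_module R\<^esub> x = \<zero>\<^bsub>self_module R\<^esub>"
      by (intro bexI[of _ "\<ominus>\<^bsub>R\<^esub> x"]) (auto simp: R.l_neg)
  qed (auto simp: R.a_ac R.m_ac R.l_distr R.r_distr)
qed

lemma self_module_neg:
  assumes "cring R" "x \<in> carrier R"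
  shows "\<ominus>\<^bsub>self_module R\<^esub> x = \<ominus>\<^bsub>R\<^esub> x"
proof -
  interpret R: cring R by fact
  interpret S: module R "self_module R" by (rule module_self_module[OF assms(1)])
  show ?thesis using assms(2) by (intro S.minus_equality) (auto simp: R.l_neg)
qed

lemma self_module_minus:
  "cring R \<Longrightarrow> y \<in> carrier R \<Longrightarrow> x \<ominus>\<^bsub>self_module R\<^esub> y = x \<ominus>\<^bsub>R\<^esub> y"
  by (simp add: a_minus_def self_module_neg)

lemma self_module_finsum:
  "(\<Oplus>\<^bsub>self_module R\<^esub>i\<in>A. x i) = (\<Oplus>\<^bsub>R\<^esub>i\<in>A. x i)"
  by (simp add: self_module_def finsum_def finprod_def)

lemma mod_hom_coord: "(\<lambda>f. f b) \<in> mod_hom R (fsupp_module R B) (self_module R)"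
  by (rule mod_homI) (auto simp: fsupp_carrier_iff)

lemma fsupp_finsum_apply:
  assumes "cring R" "finite A" "\<And>i. i \<in> A \<Longrightarrow> x i \<in> carrier (fsupp_module R B)"
  shows "(\<Oplus>\<^bsub>fsupp_module R B\<^esub>i\<in>A. x i) b = (\<Oplus>\<^bsub>R\<^esub>i\<in>A. x i b)"
  using mod_hom_finsum[OF module_fsupp_module module_self_module mod_hom_coord, of R A x B b] assms
  by (simp add: self_module_finsum)

text \<open>A homomorphism into a free module of finite rank is the same as a family of functionals.\<close>

lemma mod_hom_into_fsupp:
  assumes "cring R" "finite B" "\<And>b. b \<in> B \<Longrightarrow> g b \<in> mod_hom R P (self_module R)"
  shows "(\<lambda>x b. if b \<in> B then g b x else \<zero>\<^bsub>R\<^esub>) \<in> mod_hom R P (fsupp_module R B)"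
proof -
  interpret R: cring R by fact
  show ?thesis using mod_homD[OF assms(3)]
    by (intro mod_homI) (auto simp: fsupp_carrier_finite[OF assms(2)])
qed

lemma lin_ext_cong:
  assumes "module R M" "\<phi> ` B \<subseteq> carrier M" "\<And>b. b \<in> B \<Longrightarrow> \<phi> b = \<psi> b" "f \<in> carrier (fsupp_module R B)"
  shows "lin_ext R M \<phi> f = lin_ext R M \<psi> f"
proof -
  interpret M: module R M by fact
  have sub: "{b. f b \<noteq> \<zero>\<^bsub>R\<^esub>} \<subseteq> B" using assms(4) by (auto simp: fsupp_carrier_iff)
  have "lin_ext R M \<phi> f = (\<Oplus>\<^bsub>M\<^esub>b\<in>{b. f b \<noteq> \<zero>\<^bsub>R\<^esub>}. f b \<odot>\<^bsub>M\<^esub> \<phi> b)" by (simp add: lin_ext_def)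
  also have "\<dots> = (\<Oplus>\<^bsub>M\<^esub>b\<in>{b. f b \<noteq> \<zero>\<^bsub>R\<^esub>}. f b \<odot>\<^bsub>M\<^esub> \<psi> b)"
    using assms(2-4) sub by (intro M.finsum_cong') (auto simp: fsupp_carrier_iff subset_iff image_subset_iff
        intro!: M.smult_closed)
  finally show ?thesis by (simp add: lin_ext_def)
qed

lemma lin_ext_natural:
  assumes "module R N" "module R L" "g \<in> mod_hom R N L" "\<phi> ` B \<subseteq> carrier N"
    "f \<in> carrier (fsupp_module R B)"
  shows "g (lin_ext R N \<phi> f) = lin_ext R L (\<lambda>b. g (\<phi> b)) f"
proof -
  interpret N: module R N by fact
  interpret L: module R L by fact
  have sub: "{b. f b \<noteq> \<zero>\<^bsub>R\<^esub>} \<subseteq> B" and f: "f b \<in> carrier R" "finite {b. f b \<noteq> \<zero>\<^bsub>R\<^esub>}" for b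
    using assms(5) by (auto simp: fsupp_carrier_iff)
  have "g (lin_ext R N \<phi> f) = (\<Oplus>\<^bsub>L\<^esub>b\<in>{b. f b \<noteq> \<zero>\<^bsub>R\<^esub>}. g (f b \<odot>\<^bsub>N\<^esub> \<phi> b))"
    unfolding lin_ext_def using sub f assms(4)
    by (intro mod_hom_finsum[OF assms(1-3)]) (auto simp: subset_iff image_subset_iff)
  also have "\<dots> = (\<Oplus>\<^bsub>L\<^esub>b\<in>{b. f b \<noteq> \<zero>\<^bsub>R\<^esub>}. f b \<odot>\<^bsub>L\<^esub> g (\<phi> b))"
    using sub f assms(4) mod_homD[OF assms(3)]
    by (intro L.finsum_cong') (auto simp: subset_iff image_subset_iff)
  finally show ?thesis by (simp add: lin_ext_def)
qed

lemma lin_ext_fsupp_id: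
  assumes "cring R" "f \<in> carrier (fsupp_module R B)"
  shows "lin_ext R (fsupp_module R B) (\<lambda>b c. if c = b then \<one>\<^bsub>R\<^esub> else \<zero>\<^bsub>R\<^esub>) f = f"
  using lin_ext_unique[OF module_fsupp_module mod_hom_id, of R f B] assms by simp

section \<open>Projective modules\<close>

text \<open>The dual basis description of projectivity mentions only the carrier type of the module itself,
  so that the lifting property follows for test modules on every type.\<close>

definition proj :: "'a ring \<Rightarrow> ('a, 'p) module \<Rightarrow> bool" where
  "proj R P \<longleftrightarrow> module R P \<and> (\<exists>s\<in>mod_hom R P (fsupp_module R (carrier P)).
     \<forall>x\<in>carrier P. lin_ext R P (\<lambda>p. p) (s x) = x)"

lemma proj_lift:
  assumes "proj R P" "module R N" "module R L" "g \<in> mod_hom R N L" "f \<in> mod_hom R P L"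
    "f ` carrier P \<subseteq> g ` carrier N"
  shows "\<exists>k\<in>mod_hom R P N. \<forall>x\<in>carrier P. g (k x) = f x"
proof -
  obtain s where P: "module R P" and s: "s \<in> mod_hom R P (fsupp_module R (carrier P))"
    "\<And>x. x \<in> carrier P \<Longrightarrow> lin_ext R P (\<lambda>p. p) (s x) = x" using assms(1) by (auto simp: proj_def)
  have "\<forall>p\<in>carrier P. \<exists>y\<in>carrier N. g y = f p" using assms(6) by force
  then obtain n where n: "\<And>p. p \<in> carrier P \<Longrightarrow> n p \<in> carrier N" "\<And>p. p \<in> carrier P \<Longrightarrow> g (n p) = f p"
    by metis
  have sub: "n ` carrier P \<subseteq> carrier N" using n by auto
  show ?thesis
  proof (intro bexI ballI)
    show "(\<lambda>x. lin_ext R N n (s x)) \<in> mod_hom R P N"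
      by (rule mod_hom_comp[OF s(1) lin_ext_hom[OF assms(2) sub]])
    fix x assume x: "x \<in> carrier P"
    note sx = mod_homD(1)[OF s(1) x]
    have "g (lin_ext R N n (s x)) = lin_ext R L (\<lambda>b. g (n b)) (s x)"
      by (rule lin_ext_natural[OF assms(2-4) sub sx])
    also have "\<dots> = lin_ext R L f (s x)"
      by (rule lin_ext_cong[OF assms(3) _ _ sx]) (use n mod_homD(1)[OF assms(5)] in auto)
    also have "\<dots> = f (lin_ext R P (\<lambda>p. p) (s x))"
      by (rule lin_ext_natural[OF P assms(3,5) _ sx, symmetric]) auto
    finally show "g (lin_ext R N n (s x)) = f x" using s(2)[OF x] by simp
  qed
qed

text \<open>A section of the canonical surjection from the finitely supported functions on the module is a
  family of coordinates, and coordinates allow lifting along every surjection.\<close>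

lemma projective_module_iff_proj: "projective_module R P \<longleftrightarrow> proj R P"
proof
  assume P: "projective_module R P"
  then have M: "module R P" by (simp add: projective_module_def)
  then have R: "cring R" by (simp add: module_def)
  have id: "(\<lambda>p. p) ` carrier P = carrier P" by simp
  have sub: "(\<lambda>p. p) ` carrier P \<subseteq> carrier P" by simp
  have "\<exists>k\<in>mod_hom R P (fsupp_module R (carrier P)).
      \<forall>x\<in>carrier P. lin_ext R P (\<lambda>p. p) (k x) = (\<lambda>x. x) x"
    using P[unfolded projective_module_def] module_fsupp_module[OF R] M
      lin_ext_hom[OF M sub] lin_ext_image[OF M module.carrier_is_submodule[OF M] id]
      mod_hom_id[of R P] by blast
  then show "proj R P" using M by (simp add: proj_def)
next
  assume P: "proj R P"
  show "projective_module R P" unfolding projective_module_def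
  proof (intro conjI allI impI; (elim conjE)?)
    show "module R P" using P by (simp add: proj_def)
    fix N :: "('a, 'b \<Rightarrow> 'a) module" and L :: "('a, 'b) module" and g f
    assume N: "module R N" "module R L" "g \<in> mod_hom R N L" "g ` carrier N = carrier L" "f \<in> mod_hom R P L"
    then have "f ` carrier P \<subseteq> g ` carrier N" using mod_homD(1)[OF N(5)] by auto
    with N show "\<exists>k\<in>mod_hom R P N. \<forall>x\<in>carrier P. g (k x) = f x" by (intro proj_lift[OF P])
  qed
qed

lemma proj_module: "proj R P \<Longrightarrow> module R P" by (simp add: proj_def)

lemma proj_fsupp: "cring R \<Longrightarrow> proj R (fsupp_module R B)"
  using projective_fsupp_module projective_module_iff_proj by blast

lemma proj_retract:
  assumes "proj R P" "module R K" "i \<in> mod_hom R K P" "p \<in> mod_hom R P K"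
    "\<And>x. x \<in> carrier K \<Longrightarrow> p (i x) = x"
  shows "proj R K"
proof -
  have R: "cring R" using assms(2) by (simp add: module_def)
  let ?l = "lin_ext R K (\<lambda>x. x)" and ?F = "fsupp_module R (carrier K)"
  have l: "?l \<in> mod_hom R ?F K" by (rule lin_ext_hom[OF assms(2)]) simp
  have onto: "?l ` carrier ?F = carrier K"
    by (rule lin_ext_image[OF assms(2) module.carrier_is_submodule[OF assms(2)]]) simp
  obtain k where k: "k \<in> mod_hom R P ?F" "\<And>x. x \<in> carrier P \<Longrightarrow> ?l (k x) = p x"
    using proj_lift[OF assms(1) module_fsupp_module[OF R] assms(2) l assms(4)] onto
      mod_homD(1)[OF assms(4)] by blast
  show ?thesis unfolding proj_def
    using assms(2,5) k(2) mod_homD(1)[OF assms(3)]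
    by (intro conjI bexI[OF _ mod_hom_comp[OF assms(3) k(1)]]) auto
qed

lemma proj_self_module:
  assumes "cring R"
  shows "proj R (self_module R)"
proof -
  interpret R: cring R by fact
  let ?B = "{0 :: nat}"
  show ?thesis
  proof (rule proj_retract[OF proj_fsupp[OF assms, of ?B] module_self_module[OF assms]])
    show "(\<lambda>r b. if b \<in> ?B then r else \<zero>\<^bsub>R\<^esub>) \<in> mod_hom R (self_module R) (fsupp_module R ?B)"
      by (rule mod_hom_into_fsupp[OF assms]) (auto intro: mod_hom_id)
    show "(\<lambda>f. f 0) \<in> mod_hom R (fsupp_module R ?B) (self_module R)" by (rule mod_hom_coord)
  qed simp
qed

lemma submodule_zero:
  assumes "module R M"
  shows "submodule {\<zero>\<^bsub>M\<^esub>} R M"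
proof -
  interpret M: module R M by fact
  show ?thesis by (rule M.submoduleI) auto
qed

lemma proj_zero_module:
  assumes "proj R P"
  shows "proj R (P\<lparr>carrier := {\<zero>\<^bsub>P\<^esub>}\<rparr>)"
proof -
  interpret P: module R P using assms by (rule proj_module)
  note Z = module_submodule[OF P.module_axioms submodule_zero[OF P.module_axioms]]
  show ?thesis
    by (rule proj_retract[OF assms Z mod_hom_on_submodule[OF mod_hom_id] mod_hom_zero_map[OF P.module_axioms Z]])
      auto
qed

section \<open>Finitely generated modules\<close>

lemma fg_moduleI:
  assumes "module R M" "finite S" "S \<subseteq> carrier M"
    "\<And>N. submodule N R M \<Longrightarrow> S \<subseteq> N \<Longrightarrow> N = carrier M"
  shows "fg_module R M"
  unfolding fg_module_def using assms by (intro conjI exI[of _ S]) simp_all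

lemma fg_module_iff:
  "fg_module R M \<longleftrightarrow> module R M \<and> (\<exists>S. finite S \<and> S \<subseteq> carrier M \<and>
     lin_ext R M (\<lambda>x. x) ` carrier (fsupp_module R S) = carrier M)"
proof (cases "module R M")
  case True
  interpret M: module R M by fact
  have F: "module R (fsupp_module R S)" for S :: "'b set" by (rule module_fsupp_module[OF M.R.cring_axioms])
  have key: "(\<forall>N. submodule N R M \<and> S \<subseteq> N \<longrightarrow> N = carrier M) \<longleftrightarrow>
      lin_ext R M (\<lambda>x. x) ` carrier (fsupp_module R S) = carrier M" if S: "S \<subseteq> carrier M" for S
  proof
    have sub: "(\<lambda>x. x) ` S \<subseteq> carrier M" using S by simp
    let ?I = "lin_ext R M (\<lambda>x. x) ` carrier (fsupp_module R S)"
    assume "\<forall>N. submodule N R M \<and> S \<subseteq> N \<longrightarrow> N = carrier M"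
    moreover have "submodule ?I R M" by (rule image_submodule[OF F True lin_ext_hom[OF True sub]])
    moreover have "S \<subseteq> ?I"
    proof
      fix b assume "b \<in> S"
      from lin_ext_unit[OF True sub this] show "b \<in> ?I" by (metis imageI)
    qed
    ultimately show "?I = carrier M" by blast
  next
    assume I: "lin_ext R M (\<lambda>x. x) ` carrier (fsupp_module R S) = carrier M"
    show "\<forall>N. submodule N R M \<and> S \<subseteq> N \<longrightarrow> N = carrier M"
    proof (intro allI impI; elim conjE)
      fix N assume N: "submodule N R M" "S \<subseteq> N"
      note E = M.submoduleE[OF N(1)]
      have "lin_ext R M (\<lambda>x. x) f \<in> N" if "f \<in> carrier (fsupp_module R S)" for f
        unfolding lin_ext_def using that N(2)
        by (intro submodule_smult_closed_finsum[OF True N(1)]) (auto simp: fsupp_carrier_iff intro!: E(4))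
      then have "carrier M \<subseteq> N" unfolding I[symmetric] by auto
      with E(1) show "N = carrier M" by (rule subset_antisym)
    qed
  qed
  show ?thesis unfolding fg_module_def by (intro conj_cong ex_cong1 refl key)
qed (simp add: fg_module_def)

lemma fg_module_image:
  assumes "fg_module R M" "module R N" "f \<in> mod_hom R M N" "f ` carrier M = carrier N"
  shows "fg_module R N"
proof -
  obtain S where M: "module R M" and S: "finite S" "S \<subseteq> carrier M"
    "lin_ext R M (\<lambda>x. x) ` carrier (fsupp_module R S) = carrier M" using assms(1) by (auto simp: fg_module_iff)
  have "N' = carrier N" if N': "submodule N' R N" "f ` S \<subseteq> N'" for N'
  proof -
    note E = module.submoduleE[OF assms(2) N'(1)]
    have "f y \<in> N'" if y: "y \<in> carrier M" for y
    proof -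
      obtain c where c: "c \<in> carrier (fsupp_module R S)" "y = lin_ext R M (\<lambda>x. x) c" using S(3) y by blast
      have "f y = lin_ext R N f c" unfolding c(2) using lin_ext_natural[OF M assms(2,3) _ c(1)] S(2) by simp
      moreover have "lin_ext R N f c \<in> N'" unfolding lin_ext_def using c(1) N'(2)
        by (intro submodule_smult_closed_finsum[OF assms(2) N'(1)]) (auto simp: fsupp_carrier_iff intro!: E(4))
      ultimately show ?thesis by simp
    qed
    then have "carrier N \<subseteq> N'" unfolding assms(4)[symmetric] by auto
    with E(1) show ?thesis by (rule subset_antisym)
  qed
  note gen = this
  have "finite (f ` S)" "f ` S \<subseteq> carrier N" using S(1,2) mod_homD(1)[OF assms(3)] by auto
  from fg_moduleI[OF assms(2) this gen] show ?thesis .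
qed

lemma fg_fsupp:
  assumes "cring R" "finite B"
  shows "fg_module R (fsupp_module R B)"
proof -
  interpret R: cring R by fact
  interpret F: module R "fsupp_module R B" by (rule module_fsupp_module[OF assms(1)])
  let ?u = "\<lambda>b c. if c = b then \<one>\<^bsub>R\<^esub> else \<zero>\<^bsub>R\<^esub>"
  have "N = carrier (fsupp_module R B)" if N: "submodule N R (fsupp_module R B)" "?u ` B \<subseteq> N" for N
  proof -
    note E = F.submoduleE[OF N(1)]
    have "f \<in> N" if f: "f \<in> carrier (fsupp_module R B)" for f
    proof -
      have "lin_ext R (fsupp_module R B) ?u f \<in> N" unfolding lin_ext_def
      proof (rule submodule_smult_closed_finsum[OF F.module_axioms N(1)])
        show "finite {b. f b \<noteq> \<zero>\<^bsub>R\<^esub>}" using f by (auto simp: fsupp_carrier_iff)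
        fix b assume "b \<in> {b. f b \<noteq> \<zero>\<^bsub>R\<^esub>}"
        then have "b \<in> B" using f by (auto simp: fsupp_carrier_iff)
        then have "?u b \<in> N" using N(2) by blast
        then show "f b \<odot>\<^bsub>fsupp_module R B\<^esub> ?u b \<in> N" using E(4) f by (auto simp: fsupp_carrier_iff)
      qed
      then show ?thesis using lin_ext_fsupp_id[OF assms(1) f] by simp
    qed
    then show ?thesis using E(1) by blast
  qed
  note gen = this
  have "finite (?u ` B)" "?u ` B \<subseteq> carrier (fsupp_module R B)"
    using assms(2) by (auto simp: fsupp_carrier_finite)
  from fg_moduleI[OF F.module_axioms this gen] show ?thesis .
qed

text \<open>The coordinates come from a section of the surjection from the free module on the generators.\<close>

lemma fg_proj_dual_basis:
  assumes "proj R P" "finite S" "S \<subseteq> carrier P"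
    "lin_ext R P (\<lambda>x. x) ` carrier (fsupp_module R S) = carrier P"
  shows "\<exists>s\<in>mod_hom R P (fsupp_module R S). \<forall>x\<in>carrier P. lin_ext R P (\<lambda>x. x) (s x) = x"
proof -
  have P: "module R P" by (rule proj_module[OF assms(1)])
  have sub: "(\<lambda>x. x) ` S \<subseteq> carrier P" using assms(3) by simp
  have R: "cring R" using P by (simp add: module_def)
  show ?thesis
    using proj_lift[OF assms(1) module_fsupp_module[OF R] P lin_ext_hom[OF P sub] mod_hom_id] assms(4)
    by auto
qed

text \<open>A free basis in the sense of unique linear combinations provides an isomorphism with the finitely
  supported functions on it.\<close>

lemma fg_free_module_iso:
  assumes "fg_free_module R M"
  shows "\<exists>B. finite B \<and> B \<subseteq> carrier M \<and> bij_betw (lin_ext R M (\<lambda>x. x)) (carrier (fsupp_module R B)) (carrier M)"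
proof -
  obtain B where M: "module R M" and B: "finite B" "B \<subseteq> carrier M"
    "bij_betw (\<lambda>c. \<Oplus>\<^bsub>M\<^esub>b\<in>B. c b \<odot>\<^bsub>M\<^esub> b) (B \<rightarrow>\<^sub>E carrier R) (carrier M)"
    using assms by (auto simp: fg_free_module_def)
  interpret M: module R M by fact
  have bij: "bij_betw (\<lambda>f. restrict f B) (carrier (fsupp_module R B)) (B \<rightarrow>\<^sub>E carrier R)"
  proof (rule bij_betw_byWitness[where f' = "\<lambda>c b. if b \<in> B then c b else \<zero>\<^bsub>R\<^esub>"])
    show "(\<lambda>c b. if b \<in> B then c b else \<zero>\<^bsub>R\<^esub>) ` (B \<rightarrow>\<^sub>E carrier R) \<subseteq> carrier (fsupp_module R B)"
      by (auto simp: fsupp_carrier_finite[OF B(1)] PiE_def Pi_def)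
    show "\<forall>a'\<in>B \<rightarrow>\<^sub>E carrier R. restrict (\<lambda>b. if b \<in> B then a' b else \<zero>\<^bsub>R\<^esub>) B = a'"
      by (auto simp: PiE_def extensional_def fun_eq_iff)
  qed (auto simp: fsupp_carrier_finite[OF B(1)] fun_eq_iff)
  have "bij_betw (\<lambda>f. \<Oplus>\<^bsub>M\<^esub>b\<in>B. restrict f B b \<odot>\<^bsub>M\<^esub> b) (carrier (fsupp_module R B)) (carrier M)"
    using bij_betw_trans[OF bij B(3)] by (simp add: comp_def)
  moreover have "lin_ext R M (\<lambda>x. x) f = (\<Oplus>\<^bsub>M\<^esub>b\<in>B. restrict f B b \<odot>\<^bsub>M\<^esub> b)"
    if "f \<in> carrier (fsupp_module R B)" for f
  proof -
    have "lin_ext R M (\<lambda>x. x) f = (\<Oplus>\<^bsub>M\<^esub>b\<in>B. f b \<odot>\<^bsub>M\<^esub> b)"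
      by (rule lin_ext_eq[OF M that]) (use B that in \<open>auto simp: fsupp_carrier_iff\<close>)
    also have "\<dots> = (\<Oplus>\<^bsub>M\<^esub>b\<in>B. restrict f B b \<odot>\<^bsub>M\<^esub> b)"
      using that B by (intro M.finsum_cong') (auto simp: fsupp_carrier_iff)
    finally show ?thesis .
  qed
  ultimately show ?thesis using B(1,2) by (intro exI[of _ B] conjI) (auto cong: bij_betw_cong)
qed

lemma fg_free_proj_fg:
  assumes "fg_free_module R M"
  shows "proj R M" "fg_module R M"
proof -
  have M: "module R M" using assms by (simp add: fg_free_module_def)
  interpret M: module R M by fact
  obtain B where B: "finite B" "B \<subseteq> carrier M"
    "bij_betw (lin_ext R M (\<lambda>x. x)) (carrier (fsupp_module R B)) (carrier M)"
    using fg_free_module_iso[OF assms] by auto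
  let ?F = "fsupp_module R B" and ?l = "lin_ext R M (\<lambda>x. x)"
  interpret F: module R ?F by (rule module_fsupp_module[OF M.R.cring_axioms])
  have l: "?l \<in> mod_hom R ?F M" by (rule lin_ext_hom[OF M]) (use B in auto)
  have onto: "?l ` carrier ?F = carrier M" using B(3) by (simp add: bij_betw_def)
  show "fg_module R M" using M B onto by (auto simp: fg_module_iff)
  define k where "k = inv_into (carrier ?F) ?l"
  have k: "k x \<in> carrier ?F" "?l (k x) = x" if "x \<in> carrier M" for x
    using that onto unfolding k_def by (simp_all add: inv_into_into f_inv_into_f)
  have inj: "a = b" if "a \<in> carrier ?F" "b \<in> carrier ?F" "?l a = ?l b" for a b
    using B(3) that by (auto simp: bij_betw_def inj_on_def)
  have kh: "k \<in> mod_hom R M ?F"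
  proof (rule mod_homI)
    show "k (x \<oplus>\<^bsub>M\<^esub> y) = k x \<oplus>\<^bsub>?F\<^esub> k y" if "x \<in> carrier M" "y \<in> carrier M" for x y
      by (rule inj[OF k(1) F.a_closed]) (use that k mod_homD(2)[OF l] in auto)
    show "k (r \<odot>\<^bsub>M\<^esub> x) = r \<odot>\<^bsub>?F\<^esub> k x" if "r \<in> carrier R" "x \<in> carrier M" for r x
      by (rule inj[OF k(1) F.smult_closed]) (use that k mod_homD(3)[OF l] in auto)
  qed (rule k(1))
  show "proj R M"
    by (rule proj_retract[OF proj_fsupp[OF M.R.cring_axioms] M kh l]) (rule k(2))
qed

lemma fg_free_fsupp:
  assumes "cring R" "finite B"
  shows "fg_free_module R (fsupp_module R B)"
proof -
  interpret R: cring R by fact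
  let ?F = "fsupp_module R B"
  interpret F: module R ?F by (rule module_fsupp_module[OF assms(1)])
  define u :: "'b \<Rightarrow> 'b \<Rightarrow> 'a" where "u = (\<lambda>b c. if c = b then \<one>\<^bsub>R\<^esub> else \<zero>\<^bsub>R\<^esub>)"
  note mem = fsupp_carrier_finite[OF assms(2)]
  show ?thesis
  proof (cases "\<one>\<^bsub>R\<^esub> = \<zero>\<^bsub>R\<^esub>")
    case True
    then have "carrier R = {\<zero>\<^bsub>R\<^esub>}" by (simp add: R.carrier_one_zero)
    then have "carrier ?F = {\<zero>\<^bsub>?F\<^esub>}" by (auto simp: mem)
    then show ?thesis unfolding fg_free_module_def
      by (intro conjI F.module_axioms exI[of _ "{}"]) (auto simp: bij_betw_def)
  next
    case False
    have inj: "inj u" using False by (auto simp: inj_def u_def fun_eq_iff)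
    have ub: "u b c \<in> carrier R" for b c by (simp add: u_def)
    have uF: "u ` B \<subseteq> carrier ?F" by (auto simp: mem u_def)
    have ev: "(\<Oplus>\<^bsub>?F\<^esub>v\<in>u ` B. c v \<odot>\<^bsub>?F\<^esub> v) = (\<lambda>b. if b \<in> B then c (u b) else \<zero>\<^bsub>R\<^esub>)"
      if c: "c \<in> u ` B \<rightarrow>\<^sub>E carrier R" for c
    proof
      fix b
      have cb: "c (u b) \<in> carrier R" if "b \<in> B" for b using c that by auto
      have "(\<Oplus>\<^bsub>?F\<^esub>v\<in>u ` B. c v \<odot>\<^bsub>?F\<^esub> v) b = (\<Oplus>\<^bsub>R\<^esub>v\<in>u ` B. (c v \<odot>\<^bsub>?F\<^esub> v) b)"
      proof (rule fsupp_finsum_apply[OF assms(1)])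
        show "finite (u ` B)" using assms(2) by simp
        show "c v \<odot>\<^bsub>?F\<^esub> v \<in> carrier ?F" if "v \<in> u ` B" for v
          by (rule F.smult_closed) (use that c uF in auto)
      qed
      also have "\<dots> = (\<Oplus>\<^bsub>R\<^esub>b'\<in>B. c (u b') \<otimes>\<^bsub>R\<^esub> u b' b)"
        using cb ub inj_on_subset[OF inj subset_UNIV] by (subst R.finsum_reindex) auto
      also have "\<dots> = (\<Oplus>\<^bsub>R\<^esub>b'\<in>B. if b = b' then c (u b') else \<zero>\<^bsub>R\<^esub>)"
        using cb by (intro R.finsum_cong') (auto simp: u_def)
      also have "\<dots> = (if b \<in> B then c (u b) else \<zero>\<^bsub>R\<^esub>)"
      proof (cases "b \<in> B")
        case True
        then show ?thesis using R.finsum_singleton[OF True assms(2), of "\<lambda>b. c (u b)"] cb by simp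
      next
        case False
        then have "(\<Oplus>\<^bsub>R\<^esub>b'\<in>B. if b = b' then c (u b') else \<zero>\<^bsub>R\<^esub>) = (\<Oplus>\<^bsub>R\<^esub>b'\<in>B. \<zero>\<^bsub>R\<^esub>)"
          by (intro R.finsum_cong') auto
        then show ?thesis using False by simp
      qed
      finally show "(\<Oplus>\<^bsub>?F\<^esub>v\<in>u ` B. c v \<odot>\<^bsub>?F\<^esub> v) b = (if b \<in> B then c (u b) else \<zero>\<^bsub>R\<^esub>)" .
    qed
    have "bij_betw (\<lambda>c. \<Oplus>\<^bsub>?F\<^esub>v\<in>u ` B. c v \<odot>\<^bsub>?F\<^esub> v) (u ` B \<rightarrow>\<^sub>E carrier R) (carrier ?F)"
    proof (rule bij_betw_byWitness[where f' = "\<lambda>f. \<lambda>v\<in>u ` B. f (inv_into UNIV u v)"])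
      show "\<forall>c\<in>u ` B \<rightarrow>\<^sub>E carrier R. (\<lambda>v\<in>u ` B. (\<Oplus>\<^bsub>?F\<^esub>v\<in>u ` B. c v \<odot>\<^bsub>?F\<^esub> v) (inv_into UNIV u v)) = c"
      proof
        fix c assume c: "c \<in> u ` B \<rightarrow>\<^sub>E carrier R"
        show "(\<lambda>v\<in>u ` B. (\<Oplus>\<^bsub>?F\<^esub>v\<in>u ` B. c v \<odot>\<^bsub>?F\<^esub> v) (inv_into UNIV u v)) = c"
          unfolding ev[OF c] using c by (intro ext) (auto simp: inv_f_f[OF inj] PiE_def extensional_def)
      qed
      have r: "(\<lambda>v\<in>u ` B. f (inv_into UNIV u v)) \<in> u ` B \<rightarrow>\<^sub>E carrier R" if "f \<in> carrier ?F" for f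
        using that by (auto simp: mem)
      then show "(\<lambda>f. \<lambda>v\<in>u ` B. f (inv_into UNIV u v)) ` carrier ?F \<subseteq> u ` B \<rightarrow>\<^sub>E carrier R" by blast
      show "\<forall>f\<in>carrier ?F. (\<Oplus>\<^bsub>?F\<^esub>v\<in>u ` B. (\<lambda>v\<in>u ` B. f (inv_into UNIV u v)) v \<odot>\<^bsub>?F\<^esub> v) = f"
      proof
        fix f assume f: "f \<in> carrier ?F"
        show "(\<Oplus>\<^bsub>?F\<^esub>v\<in>u ` B. (\<lambda>v\<in>u ` B. f (inv_into UNIV u v)) v \<odot>\<^bsub>?F\<^esub> v) = f"
          unfolding ev[OF r[OF f]] using f by (intro ext) (auto simp: mem inv_f_f[OF inj])
      qed
      show "(\<lambda>c. \<Oplus>\<^bsub>?F\<^esub>v\<in>u ` B. c v \<odot>\<^bsub>?F\<^esub> v) ` (u ` B \<rightarrow>\<^sub>E carrier R) \<subseteq> carrier ?F"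
      proof (rule image_subsetI)
        fix c assume c: "c \<in> u ` B \<rightarrow>\<^sub>E carrier R"
        show "(\<Oplus>\<^bsub>?F\<^esub>v\<in>u ` B. c v \<odot>\<^bsub>?F\<^esub> v) \<in> carrier ?F"
          using c uF by (intro F.finsum_closed) (auto intro!: F.smult_closed simp del: fsupp_simps)
      qed
    qed
    then show ?thesis unfolding fg_free_module_def using uF assms(2)
      by (intro conjI F.module_axioms exI[of _ "u ` B"]) auto
  qed
qed

section \<open>Quotients on the same carrier type\<close>

text \<open>Choosing one representative in every coset gives a copy of the quotient on the carrier type of
  the module itself.\<close>

lemma quotient_module_exists:
  fixes F :: "('a, 'b) module"
  assumes "module R F" "submodule K R F"
  shows "\<exists>(Q :: ('a, 'b) module) \<pi>. module R Q \<and> \<pi> \<in> mod_hom R F Q \<and> \<pi> ` carrier F = carrier Q \<and>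
    (\<forall>x\<in>carrier F. \<pi> x = \<zero>\<^bsub>Q\<^esub> \<longleftrightarrow> x \<in> K)"
proof -
  interpret F: module R F by fact
  note E = F.submoduleE[OF assms(2)]
  note zK = submodule_zero_mem[OF assms]
  define \<pi> where "\<pi> x = (SOME y. y \<in> carrier F \<and> y \<ominus>\<^bsub>F\<^esub> x \<in> K)" for x
  have \<pi>: "\<pi> x \<in> carrier F" "\<pi> x \<ominus>\<^bsub>F\<^esub> x \<in> K" if "x \<in> carrier F" for x
    using someI[of "\<lambda>y. y \<in> carrier F \<and> y \<ominus>\<^bsub>F\<^esub> x \<in> K" x] that zK
    by (auto simp: \<pi>_def F.r_neg a_minus_def)
  have sub: "a \<ominus>\<^bsub>F\<^esub> c \<in> K" if "a \<ominus>\<^bsub>F\<^esub> b \<in> K" "b \<ominus>\<^bsub>F\<^esub> c \<in> K" "a \<in> carrier F" "b \<in> carrier F" "c \<in> carrier F" for a b c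
  proof -
    have "a \<ominus>\<^bsub>F\<^esub> c = (a \<ominus>\<^bsub>F\<^esub> b) \<oplus>\<^bsub>F\<^esub> (b \<ominus>\<^bsub>F\<^esub> c)"
      using that(3-5) by (simp add: a_minus_def F.a_assoc F.r_neg1)
    then show ?thesis using E(5) that by simp
  qed
  have swap: "b \<ominus>\<^bsub>F\<^esub> a \<in> K" if "a \<ominus>\<^bsub>F\<^esub> b \<in> K" "a \<in> carrier F" "b \<in> carrier F" for a b
  proof -
    have "b \<ominus>\<^bsub>F\<^esub> a = \<ominus>\<^bsub>F\<^esub> (a \<ominus>\<^bsub>F\<^esub> b)" using that by (simp add: a_minus_def F.minus_add F.a_comm)
    then show ?thesis using E(3)[OF that(1)] by simp
  qed
  have eq: "\<pi> x = \<pi> y \<longleftrightarrow> x \<ominus>\<^bsub>F\<^esub> y \<in> K" if x: "x \<in> carrier F" and y: "y \<in> carrier F" for x y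
  proof
    assume "\<pi> x = \<pi> y"
    then show "x \<ominus>\<^bsub>F\<^esub> y \<in> K" using sub[of x "\<pi> x" y] swap[OF \<pi>(2)[OF x]] \<pi>[OF x] \<pi>[OF y] x y by metis
  next
    assume d: "x \<ominus>\<^bsub>F\<^esub> y \<in> K"
    have "z \<ominus>\<^bsub>F\<^esub> x \<in> K \<longleftrightarrow> z \<ominus>\<^bsub>F\<^esub> y \<in> K" if "z \<in> carrier F" for z
      using sub[of z x y] sub[of z y x] d swap[OF d] x y that by blast
    then have "(\<lambda>z. z \<in> carrier F \<and> z \<ominus>\<^bsub>F\<^esub> x \<in> K) = (\<lambda>z. z \<in> carrier F \<and> z \<ominus>\<^bsub>F\<^esub> y \<in> K)" by auto
    then show "\<pi> x = \<pi> y" by (simp add: \<pi>_def)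
  qed
  define Q :: "('a, 'b) module" where
    "Q = \<lparr>carrier = \<pi> ` carrier F, monoid.mult = undefined, one = undefined, ring.zero = \<pi> \<zero>\<^bsub>F\<^esub>,
      ring.add = (\<lambda>x y. \<pi> (x \<oplus>\<^bsub>F\<^esub> y)), smult = (\<lambda>r x. \<pi> (r \<odot>\<^bsub>F\<^esub> x))\<rparr>"
  have add: "\<pi> (\<pi> x \<oplus>\<^bsub>F\<^esub> \<pi> y) = \<pi> (x \<oplus>\<^bsub>F\<^esub> y)" if x: "x \<in> carrier F" and y: "y \<in> carrier F" for x y
  proof -
    have "(\<pi> x \<oplus>\<^bsub>F\<^esub> \<pi> y) \<ominus>\<^bsub>F\<^esub> (x \<oplus>\<^bsub>F\<^esub> y) = (\<pi> x \<ominus>\<^bsub>F\<^esub> x) \<oplus>\<^bsub>F\<^esub> (\<pi> y \<ominus>\<^bsub>F\<^esub> y)"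
      using \<pi>[OF x] \<pi>[OF y] x y by (simp add: a_minus_def F.minus_add F.a_ac)
    then show ?thesis using \<pi>[OF x] \<pi>[OF y] x y E(5) by (subst eq) auto
  qed
  have addl: "\<pi> (\<pi> x \<oplus>\<^bsub>F\<^esub> y) = \<pi> (x \<oplus>\<^bsub>F\<^esub> y)" if x: "x \<in> carrier F" and y: "y \<in> carrier F" for x y
  proof -
    have "(\<pi> x \<oplus>\<^bsub>F\<^esub> y) \<ominus>\<^bsub>F\<^esub> (x \<oplus>\<^bsub>F\<^esub> y) = (\<pi> x \<ominus>\<^bsub>F\<^esub> x) \<oplus>\<^bsub>F\<^esub> (y \<oplus>\<^bsub>F\<^esub> \<ominus>\<^bsub>F\<^esub> y)"
      using \<pi>[OF x] x y by (simp add: a_minus_def F.minus_add F.a_ac)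
    then have "(\<pi> x \<oplus>\<^bsub>F\<^esub> y) \<ominus>\<^bsub>F\<^esub> (x \<oplus>\<^bsub>F\<^esub> y) = \<pi> x \<ominus>\<^bsub>F\<^esub> x"
      using \<pi>[OF x] x y by (simp add: F.r_neg)
    then show ?thesis using \<pi>[OF x] x y by (subst eq) auto
  qed
  have addr: "\<pi> (x \<oplus>\<^bsub>F\<^esub> \<pi> y) = \<pi> (x \<oplus>\<^bsub>F\<^esub> y)" if x: "x \<in> carrier F" and y: "y \<in> carrier F" for x y
    using addl[OF y x] \<pi>(1)[OF y] x y by (simp add: F.a_comm)
  have sm: "\<pi> (r \<odot>\<^bsub>F\<^esub> \<pi> x) = \<pi> (r \<odot>\<^bsub>F\<^esub> x)" if r: "r \<in> carrier R" and x: "x \<in> carrier F" for r x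
  proof -
    have "(r \<odot>\<^bsub>F\<^esub> \<pi> x) \<ominus>\<^bsub>F\<^esub> (r \<odot>\<^bsub>F\<^esub> x) = r \<odot>\<^bsub>F\<^esub> (\<pi> x \<ominus>\<^bsub>F\<^esub> x)"
      using \<pi>[OF x] r x by (simp add: a_minus_def F.smult_r_distr F.smult_r_minus)
    then show ?thesis using \<pi>[OF x] r x E(4) by (subst eq) auto
  qed
  have idem: "\<pi> (\<pi> x) = \<pi> x" if "x \<in> carrier F" for x
    using \<pi>[OF that] that by (subst eq) auto
  have "module R Q"
  proof (rule moduleI[OF F.R.cring_axioms abelian_groupI])
    fix q assume "q \<in> carrier Q"
    then obtain x where x: "x \<in> carrier F" "q = \<pi> x" by (auto simp: Q_def)
    then show "\<exists>y\<in>carrier Q. y \<oplus>\<^bsub>Q\<^esub> q = \<zero>\<^bsub>Q\<^esub>"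
      by (intro bexI[of _ "\<pi> (\<ominus>\<^bsub>F\<^esub> x)"]) (auto simp: Q_def add F.l_neg)
  next
    show "x \<oplus>\<^bsub>Q\<^esub> y = y \<oplus>\<^bsub>Q\<^esub> x" if "x \<in> carrier Q" "y \<in> carrier Q" for x y
      using that by (auto simp: Q_def add F.a_comm)
    show "(a \<oplus>\<^bsub>R\<^esub> b) \<odot>\<^bsub>Q\<^esub> x = a \<odot>\<^bsub>Q\<^esub> x \<oplus>\<^bsub>Q\<^esub> b \<odot>\<^bsub>Q\<^esub> x"
      if "a \<in> carrier R" "b \<in> carrier R" "x \<in> carrier Q" for a b x
    proof -
      obtain y where y: "y \<in> carrier F" "x = \<pi> y" using \<open>x \<in> carrier Q\<close> by (auto simp: Q_def)
      have "(a \<oplus>\<^bsub>R\<^esub> b) \<odot>\<^bsub>Q\<^esub> x = \<pi> ((a \<oplus>\<^bsub>R\<^esub> b) \<odot>\<^bsub>F\<^esub> \<pi> y)" by (simp add: Q_def y(2))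
      also have "\<dots> = \<pi> (a \<odot>\<^bsub>F\<^esub> y \<oplus>\<^bsub>F\<^esub> b \<odot>\<^bsub>F\<^esub> y)"
        using that y(1) sm[of "a \<oplus>\<^bsub>R\<^esub> b" y] by (simp add: F.smult_l_distr)
      also have "\<dots> = a \<odot>\<^bsub>Q\<^esub> x \<oplus>\<^bsub>Q\<^esub> b \<odot>\<^bsub>Q\<^esub> x" using that y by (simp add: Q_def sm add)
      finally show ?thesis .
    qed
    show "a \<odot>\<^bsub>Q\<^esub> (x \<oplus>\<^bsub>Q\<^esub> z) = a \<odot>\<^bsub>Q\<^esub> x \<oplus>\<^bsub>Q\<^esub> a \<odot>\<^bsub>Q\<^esub> z"
      if "a \<in> carrier R" "x \<in> carrier Q" "z \<in> carrier Q" for a x z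
      using that by (auto simp: Q_def add sm F.smult_r_distr)
    show "(a \<otimes>\<^bsub>R\<^esub> b) \<odot>\<^bsub>Q\<^esub> x = a \<odot>\<^bsub>Q\<^esub> (b \<odot>\<^bsub>Q\<^esub> x)"
      if "a \<in> carrier R" "b \<in> carrier R" "x \<in> carrier Q" for a b x
    proof -
      obtain y where y: "y \<in> carrier F" "x = \<pi> y" using \<open>x \<in> carrier Q\<close> by (auto simp: Q_def)
      have "(a \<otimes>\<^bsub>R\<^esub> b) \<odot>\<^bsub>Q\<^esub> x = \<pi> ((a \<otimes>\<^bsub>R\<^esub> b) \<odot>\<^bsub>F\<^esub> \<pi> y)" by (simp add: Q_def y(2))
      also have "\<dots> = \<pi> (a \<odot>\<^bsub>F\<^esub> (b \<odot>\<^bsub>F\<^esub> y))"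
        using that y(1) sm[of "a \<otimes>\<^bsub>R\<^esub> b" y] by (simp add: F.smult_assoc1)
      also have "\<dots> = a \<odot>\<^bsub>Q\<^esub> (b \<odot>\<^bsub>Q\<^esub> x)" using that y by (simp add: Q_def sm)
      finally show ?thesis .
    qed
  qed (auto simp: Q_def add idem \<pi>(1) addl addr F.a_assoc)
  moreover have "\<pi> \<in> mod_hom R F Q" by (rule mod_homI) (auto simp: Q_def add sm)
  moreover have "\<forall>x\<in>carrier F. \<pi> x = \<zero>\<^bsub>Q\<^esub> \<longleftrightarrow> x \<in> K" using F.add.inv_one by (auto simp: Q_def eq a_minus_def a_inv_def)
  ultimately show ?thesis by (intro exI[of _ Q] exI[of _ \<pi>]) (auto simp: Q_def)
qed

section \<open>Comparison of resolutions\<close>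

lemma module_minus_eq_zero:
  assumes "module R M" "x \<ominus>\<^bsub>M\<^esub> y = \<zero>\<^bsub>M\<^esub>" "x \<in> carrier M" "y \<in> carrier M"
  shows "x = y"
proof -
  interpret M: module R M by fact
  have "(x \<ominus>\<^bsub>M\<^esub> y) \<oplus>\<^bsub>M\<^esub> y = x" using assms(3,4) by (simp add: a_minus_def M.a_assoc M.l_neg)
  then show ?thesis using assms(2,4) by simp
qed

definition cycles_at ::
  "(nat \<Rightarrow> ('a, 'p) module) \<Rightarrow> (nat \<Rightarrow> 'p \<Rightarrow> 'p) \<Rightarrow> ('p \<Rightarrow> 'b) \<Rightarrow> ('a, 'b) module \<Rightarrow> nat \<Rightarrow> 'p set" where
  "cycles_at F d e M i = (case i of 0 \<Rightarrow> {x \<in> carrier (F 0). e x = \<zero>\<^bsub>M\<^esub>}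
     | Suc j \<Rightarrow> {x \<in> carrier (F (Suc j)). d j x = \<zero>\<^bsub>F j\<^esub>})"

lemma cycles_at_simps [simp]:
  "cycles_at F d e M 0 = {x \<in> carrier (F 0). e x = \<zero>\<^bsub>M\<^esub>}"
  "cycles_at F d e M (Suc j) = {x \<in> carrier (F (Suc j)). d j x = \<zero>\<^bsub>F j\<^esub>}"
  by (simp_all add: cycles_at_def)

lemma exact_upto_iff:
  "exact_upto R n F d e M \<longleftrightarrow>
    module R M \<and> (\<forall>i\<le>n. module R (F i)) \<and> e \<in> mod_hom R (F 0) M \<and> e ` carrier (F 0) = carrier M \<and>
    (\<forall>i<n. d i \<in> mod_hom R (F (Suc i)) (F i)) \<and>
    (\<forall>i<n. d i ` carrier (F (Suc i)) = cycles_at F d e M i)"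
proof -
  have "(case i of 0 \<Rightarrow> a_kernel (F 0) M e | Suc j \<Rightarrow> a_kernel (F i) (F j) (d j)) = cycles_at F d e M i" for i
    by (cases i) (auto simp: a_kernel_eq)
  then show ?thesis unfolding exact_upto_def by presburger
qed

lemma exact_uptoD:
  assumes "exact_upto R n F d e M"
  shows "module R M" "i \<le> n \<Longrightarrow> module R (F i)" "e \<in> mod_hom R (F 0) M" "e ` carrier (F 0) = carrier M"
    "i < n \<Longrightarrow> d i \<in> mod_hom R (F (Suc i)) (F i)"
    "i < n \<Longrightarrow> d i ` carrier (F (Suc i)) = cycles_at F d e M i"
  using assms by (auto simp: exact_upto_iff)

lemma exact_upto_mono: "exact_upto R n F d e M \<Longrightarrow> m \<le> n \<Longrightarrow> exact_upto R m F d e M"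
  by (auto simp: exact_upto_iff)

lemma exact_upto_aug_diff:
  assumes "exact_upto R n F d e M" "0 < n" "x \<in> carrier (F (Suc 0))"
  shows "e (d 0 x) = \<zero>\<^bsub>M\<^esub>"
  using exact_uptoD(6)[OF assms(1,2)] assms(3) by auto

lemma exact_upto_diff_diff:
  assumes "exact_upto R n F d e M" "Suc i < n" "x \<in> carrier (F (Suc (Suc i)))"
  shows "d i (d (Suc i) x) = \<zero>\<^bsub>F i\<^esub>"
  using exact_uptoD(6)[OF assms(1,2)] assms(3) by auto

lemma lift_cycles:
  assumes "exact_upto R n W d e M" "i < n" "proj R P" "f \<in> mod_hom R P (W i)"
    "\<And>x. x \<in> carrier P \<Longrightarrow> f x \<in> cycles_at W d e M i"
  shows "\<exists>k\<in>mod_hom R P (W (Suc i)). \<forall>x\<in>carrier P. d i (k x) = f x"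
  by (rule proj_lift[OF assms(3) _ _ exact_uptoD(5)[OF assms(1,2)] assms(4)])
    (use exact_uptoD(2)[OF assms(1)] exact_uptoD(6)[OF assms(1,2)] assms(2,5) in auto)

lemma chain_map_exists:
  assumes "exact_upto R n P d e M" "exact_upto R n W d' e' M" "\<And>i. i \<le> n \<Longrightarrow> proj R (P i)"
  shows "\<exists>\<phi>. (\<forall>i\<le>n. \<phi> i \<in> mod_hom R (P i) (W i)) \<and> (\<forall>x\<in>carrier (P 0). e' (\<phi> 0 x) = e x) \<and>
    (\<forall>i<n. \<forall>x\<in>carrier (P (Suc i)). d' i (\<phi> (Suc i) x) = \<phi> i (d i x))"
  using assms
proof (induction n)
  case 0
  have "\<exists>k\<in>mod_hom R (P 0) (W 0). \<forall>x\<in>carrier (P 0). e' (k x) = e x"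
    by (rule proj_lift[OF 0(3) _ _ exact_uptoD(3)[OF 0(2)] exact_uptoD(3)[OF 0(1)]])
      (use exact_uptoD[OF 0(2)] mod_homD(1)[OF exact_uptoD(3)[OF 0(1)]] in auto)
  then obtain k where "k \<in> mod_hom R (P 0) (W 0)" "\<forall>x\<in>carrier (P 0). e' (k x) = e x" by blast
  then show ?case by (intro exI[of _ "\<lambda>_. k"]) auto
next
  case (Suc n)
  have "\<exists>\<phi>. (\<forall>i\<le>n. \<phi> i \<in> mod_hom R (P i) (W i)) \<and> (\<forall>x\<in>carrier (P 0). e' (\<phi> 0 x) = e x) \<and>
    (\<forall>i<n. \<forall>x\<in>carrier (P (Suc i)). d' i (\<phi> (Suc i) x) = \<phi> i (d i x))"
    using Suc.prems exact_upto_mono[OF Suc.prems(1), of n] exact_upto_mono[OF Suc.prems(2), of n]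
    by (intro Suc.IH) auto
  then obtain \<phi> where \<phi>: "\<And>i. i \<le> n \<Longrightarrow> \<phi> i \<in> mod_hom R (P i) (W i)"
    "\<And>x. x \<in> carrier (P 0) \<Longrightarrow> e' (\<phi> 0 x) = e x"
    "\<And>i x. i < n \<Longrightarrow> x \<in> carrier (P (Suc i)) \<Longrightarrow> d' i (\<phi> (Suc i) x) = \<phi> i (d i x)" by blast
  note dP = exact_uptoD(5)[OF Suc.prems(1), of n]
  have f: "(\<lambda>x. \<phi> n (d n x)) \<in> mod_hom R (P (Suc n)) (W n)" using mod_hom_comp[OF dP \<phi>(1)] by simp
  have "\<phi> n (d n x) \<in> cycles_at W d' e' M n" if x: "x \<in> carrier (P (Suc n))" for x
  proof (cases n)
    case 0
    then show ?thesis using mod_homD(1)[OF f x] \<phi>(2) mod_homD(1)[OF dP] x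
        exact_upto_aug_diff[OF Suc.prems(1)] by simp
  next
    case (Suc j)
    have "d' j (\<phi> n (d n x)) = \<phi> j (d j (d n x))" using \<phi>(3)[of j "d n x"] mod_homD(1)[OF dP] x Suc by simp
    also have "\<dots> = \<phi> j \<zero>\<^bsub>P j\<^esub>" using exact_upto_diff_diff[OF Suc.prems(1), of j x] x Suc by simp
    also have "\<dots> = \<zero>\<^bsub>W j\<^esub>" using \<phi>(1)[of j] exact_uptoD(2)[OF Suc.prems(1), of j]
        exact_uptoD(2)[OF Suc.prems(2), of j] Suc by (intro mod_hom_zero) auto
    finally show ?thesis using mod_homD(1)[OF f x] Suc by simp
  qed
  from lift_cycles[OF Suc.prems(2) _ Suc.prems(3) f this]
  obtain k where k: "k \<in> mod_hom R (P (Suc n)) (W (Suc n))"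
    "\<forall>x\<in>carrier (P (Suc n)). d' n (k x) = \<phi> n (d n x)" by auto
  show ?case
  proof (intro exI[of _ "\<phi>(Suc n := k)"] conjI allI impI ballI)
    fix i x assume "i < Suc n" "x \<in> carrier (P (Suc i))"
    then show "d' i ((\<phi>(Suc n := k)) (Suc i) x) = (\<phi>(Suc n := k)) i (d i x)"
      using k(2) \<phi>(3)[of i x] by (cases "i = n") auto
  qed (use k(1) \<phi> in auto)
qed

text \<open>The second half of the comparison theorem, for complexes cut off at \<open>n\<close>; the two complexes may
  live on different carrier types.\<close>

lemma homotopy_exists:
  assumes "exact_upto R n P d e M" "exact_upto R (Suc n) W d' e' M'" "\<And>i. i \<le> n \<Longrightarrow> proj R (P i)"
    "\<And>i. i \<le> n \<Longrightarrow> \<phi> i \<in> mod_hom R (P i) (W i)"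
    "\<And>i x. i < n \<Longrightarrow> x \<in> carrier (P (Suc i)) \<Longrightarrow> d' i (\<phi> (Suc i) x) = \<phi> i (d i x)"
    "\<And>x. x \<in> carrier (P 0) \<Longrightarrow> e' (\<phi> 0 x) = \<zero>\<^bsub>M'\<^esub>"
  shows "\<exists>\<sigma>. (\<forall>i\<le>n. \<sigma> i \<in> mod_hom R (P i) (W (Suc i))) \<and> (\<forall>x\<in>carrier (P 0). d' 0 (\<sigma> 0 x) = \<phi> 0 x) \<and>
    (\<forall>i<n. \<forall>x\<in>carrier (P (Suc i)). d' (Suc i) (\<sigma> (Suc i) x) = \<phi> (Suc i) x \<ominus>\<^bsub>W (Suc i)\<^esub> \<sigma> i (d i x))"
  using assms
proof (induction n)
  case 0
  from lift_cycles[OF 0(2) _ 0(3) 0(4)[of 0]] 0(6) mod_homD(1)[OF 0(4)[of 0]]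
  obtain k where "k \<in> mod_hom R (P 0) (W (Suc 0))" "\<forall>x\<in>carrier (P 0). d' 0 (k x) = \<phi> 0 x" by auto
  then show ?case by (intro exI[of _ "\<lambda>_. k"]) auto
next
  case (Suc n)
  have "\<exists>\<sigma>. (\<forall>i\<le>n. \<sigma> i \<in> mod_hom R (P i) (W (Suc i))) \<and> (\<forall>x\<in>carrier (P 0). d' 0 (\<sigma> 0 x) = \<phi> 0 x) \<and>
    (\<forall>i<n. \<forall>x\<in>carrier (P (Suc i)). d' (Suc i) (\<sigma> (Suc i) x) = \<phi> (Suc i) x \<ominus>\<^bsub>W (Suc i)\<^esub> \<sigma> i (d i x))"
    using Suc.prems exact_upto_mono[OF Suc.prems(1), of n] exact_upto_mono[OF Suc.prems(2), of "Suc n"]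
    by (intro Suc.IH) auto
  then obtain \<sigma> where \<sigma>: "\<And>i. i \<le> n \<Longrightarrow> \<sigma> i \<in> mod_hom R (P i) (W (Suc i))"
    "\<And>x. x \<in> carrier (P 0) \<Longrightarrow> d' 0 (\<sigma> 0 x) = \<phi> 0 x"
    "\<And>i x. i < n \<Longrightarrow> x \<in> carrier (P (Suc i)) \<Longrightarrow>
      d' (Suc i) (\<sigma> (Suc i) x) = \<phi> (Suc i) x \<ominus>\<^bsub>W (Suc i)\<^esub> \<sigma> i (d i x)" by blast
  have mP: "module R (P i)" if "i \<le> Suc n" for i using exact_uptoD(2)[OF Suc.prems(1) that] .
  have mX: "module R (W i)" if "i \<le> Suc (Suc n)" for i using exact_uptoD(2)[OF Suc.prems(2) that] .
  have dP: "d i \<in> mod_hom R (P (Suc i)) (P i)" if "i \<le> n" for i using exact_uptoD(5)[OF Suc.prems(1), of i] that by simp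
  have dX: "d' i \<in> mod_hom R (W (Suc i)) (W i)" if "i \<le> Suc n" for i using exact_uptoD(5)[OF Suc.prems(2), of i] that by simp
  interpret W: module R "W n" using mX by simp
  let ?f = "\<lambda>x. \<phi> (Suc n) x \<ominus>\<^bsub>W (Suc n)\<^esub> \<sigma> n (d n x)"
  have sd: "(\<lambda>x. \<sigma> n (d n x)) \<in> mod_hom R (P (Suc n)) (W (Suc n))"
    by (rule mod_hom_comp[OF dP \<sigma>(1)]) auto
  have f: "?f \<in> mod_hom R (P (Suc n)) (W (Suc n))"
    by (rule mod_hom_minus[OF mP mX Suc.prems(4) sd]) auto
  have "?f x \<in> cycles_at W d' e' M' (Suc n)" if x: "x \<in> carrier (P (Suc n))" for x
  proof -
    have dx: "d n x \<in> carrier (P n)" using mod_homD(1)[OF dP x] by simp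
    have px: "\<phi> n (d n x) \<in> carrier (W n)" using mod_homD(1)[OF Suc.prems(4) dx] by simp
    have "d' n (\<sigma> n (d n x)) = \<phi> n (d n x)"
    proof (cases n)
      case 0
      then show ?thesis using \<sigma>(2) dx by simp
    next
      case (Suc j)
      have "d' n (\<sigma> n (d n x)) = \<phi> n (d n x) \<ominus>\<^bsub>W n\<^esub> \<sigma> j (d j (d n x))"
        using \<sigma>(3)[of j "d n x"] dx Suc by simp
      also have "d j (d n x) = \<zero>\<^bsub>P j\<^esub>" using exact_upto_diff_diff[OF Suc.prems(1), of j x] x Suc by simp
      also have "\<sigma> j \<zero>\<^bsub>P j\<^esub> = \<zero>\<^bsub>W n\<^esub>" using mod_hom_zero[OF mP mX \<sigma>(1), of j] Suc by simp
      finally show ?thesis using px by (simp add: a_minus_def)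
    qed
    then have "d' n (?f x) = \<zero>\<^bsub>W n\<^esub>"
      using mod_hom_minus_apply[OF mX mX dX mod_homD(1)[OF Suc.prems(4) x] mod_homD(1)[OF sd x]]
        Suc.prems(5)[OF _ x] px by (simp add: a_minus_def W.r_neg)
    then show ?thesis using mod_homD(1)[OF f x] by simp
  qed
  from lift_cycles[OF Suc.prems(2) _ Suc.prems(3) f this]
  obtain k where k: "k \<in> mod_hom R (P (Suc n)) (W (Suc (Suc n)))"
    "\<forall>x\<in>carrier (P (Suc n)). d' (Suc n) (k x) = ?f x" by auto
  show ?case
  proof (intro exI[of _ "\<sigma>(Suc n := k)"] conjI allI impI ballI)
    fix i x assume "i < Suc n" "x \<in> carrier (P (Suc i))"
    then show "d' (Suc i) ((\<sigma>(Suc n := k)) (Suc i) x) =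
        \<phi> (Suc i) x \<ominus>\<^bsub>W (Suc i)\<^esub> (\<sigma>(Suc n := k)) i (d i x)"
      using k(2) \<sigma>(3)[of i x] by (cases "i = n") auto
  qed (use k(1) \<sigma> in auto)
qed

section \<open>Projective dimension\<close>

lemma projective_resolution_iff:
  "projective_resolution R P d e M \<longleftrightarrow> (\<forall>i. proj R (P i)) \<and> (\<forall>n. exact_upto R n P d e M)"
  by (simp add: projective_resolution_def projective_module_iff_proj)

text \<open>If one projective resolution stops at \<open>s\<close>, then in every other one the boundaries in degree \<open>s\<close>
  form a direct summand: the composite of the two comparison maps is homotopic to the identity, and
  the homotopy provides the idempotent. The carrier types of the two resolutions
  may differ.\<close>

lemma boundaries_split:
  assumes "projective_resolution R P d e M" "vanishes_above P s" "projective_resolution R W d' e' M"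
  shows "\<exists>\<rho>\<in>mod_hom R (W s) (W s). \<rho> ` carrier (W s) \<subseteq> d' s ` carrier (W (Suc s)) \<and>
    (\<forall>x\<in>carrier (W (Suc s)). \<rho> (d' s x) = d' s x)"
proof -
  have pP: "proj R (P i)" and eP: "exact_upto R n P d e M" for i n
    using assms(1) by (auto simp: projective_resolution_iff)
  have pX: "proj R (W i)" and eX: "exact_upto R n W d' e' M" for i n
    using assms(3) by (auto simp: projective_resolution_iff)
  note mP = proj_module[OF pP] and mX = proj_module[OF pX]
  have dX: "d' i \<in> mod_hom R (W (Suc i)) (W i)" for i using exact_uptoD(5)[OF eX, of i "Suc i"] by simp
  have dP: "d i \<in> mod_hom R (P (Suc i)) (P i)" for i using exact_uptoD(5)[OF eP, of i "Suc i"] by simp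
  obtain \<phi> where \<phi>: "\<And>i. i \<le> Suc s \<Longrightarrow> \<phi> i \<in> mod_hom R (P i) (W i)"
    "\<And>x. x \<in> carrier (P 0) \<Longrightarrow> e' (\<phi> 0 x) = e x"
    "\<And>i x. i < Suc s \<Longrightarrow> x \<in> carrier (P (Suc i)) \<Longrightarrow> d' i (\<phi> (Suc i) x) = \<phi> i (d i x)"
    using chain_map_exists[OF eP[of "Suc s"] eX[of "Suc s"] pP] by blast
  obtain \<psi> where \<psi>: "\<And>i. i \<le> Suc s \<Longrightarrow> \<psi> i \<in> mod_hom R (W i) (P i)"
    "\<And>x. x \<in> carrier (W 0) \<Longrightarrow> e (\<psi> 0 x) = e' x"
    "\<And>i x. i < Suc s \<Longrightarrow> x \<in> carrier (W (Suc i)) \<Longrightarrow> d i (\<psi> (Suc i) x) = \<psi> i (d' i x)"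
    using chain_map_exists[OF eX[of "Suc s"] eP[of "Suc s"] pX] by blast
  define \<chi> where "\<chi> i x = x \<ominus>\<^bsub>W i\<^esub> \<phi> i (\<psi> i x)" for i x
  have pp: "(\<lambda>x. \<phi> i (\<psi> i x)) \<in> mod_hom R (W i) (W i)" if "i \<le> Suc s" for i
    by (rule mod_hom_comp[OF \<psi>(1)[OF that] \<phi>(1)[OF that]])
  have \<chi>: "\<chi> i \<in> mod_hom R (W i) (W i)" if "i \<le> Suc s" for i
    using mod_hom_minus[OF mX mX mod_hom_id pp[OF that]] by (simp add: \<chi>_def[abs_def])
  have comm: "d' i (\<chi> (Suc i) x) = \<chi> i (d' i x)" if i: "i < Suc s" and x: "x \<in> carrier (W (Suc i))" for i x
  proof -
    have "\<psi> (Suc i) x \<in> carrier (P (Suc i))" using mod_homD(1)[OF \<psi>(1)] i x by simp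
    then show ?thesis unfolding \<chi>_def using i x
      by (subst mod_hom_minus_apply[OF mX mX dX x]) (auto intro: mod_homD(1)[OF pp] simp: \<phi>(3) \<psi>(3))
  qed
  interpret M: module R M using exact_uptoD(1)[OF eX] .
  have aug: "e' (\<chi> 0 x) = \<zero>\<^bsub>M\<^esub>" if x: "x \<in> carrier (W 0)" for x
  proof -
    have "\<psi> 0 x \<in> carrier (P 0)" using mod_homD(1)[OF \<psi>(1)] x by simp
    moreover have "e' x \<in> carrier M" using mod_homD(1)[OF exact_uptoD(3)[OF eX]] x .
    ultimately show ?thesis unfolding \<chi>_def using x
      by (subst mod_hom_minus_apply[OF mX exact_uptoD(1,3)[OF eX] x])
        (auto intro: mod_homD(1)[OF pp] simp: \<phi>(2) \<psi>(2) a_minus_def M.r_neg)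
  qed
  obtain \<sigma> where \<sigma>: "\<And>i. i \<le> Suc s \<Longrightarrow> \<sigma> i \<in> mod_hom R (W i) (W (Suc i))"
    "\<And>i x. i < Suc s \<Longrightarrow> x \<in> carrier (W (Suc i)) \<Longrightarrow>
      d' (Suc i) (\<sigma> (Suc i) x) = \<chi> (Suc i) x \<ominus>\<^bsub>W (Suc i)\<^esub> \<sigma> i (d' i x)"
    using homotopy_exists[OF eX[of "Suc s"] eX[of "Suc (Suc s)"] pX \<chi> comm aug] by blast
  have s: "\<sigma> s \<in> mod_hom R (W s) (W (Suc s))" using \<sigma>(1) by simp
  show ?thesis
  proof (intro bexI[OF _ mod_hom_comp[OF s dX]] conjI ballI)
    show "(\<lambda>x. d' s (\<sigma> s x)) ` carrier (W s) \<subseteq> d' s ` carrier (W (Suc s))"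
      using mod_homD(1)[OF s] by auto
    fix x assume x: "x \<in> carrier (W (Suc s))"
    interpret W: module R "W s" by (rule mX)
    interpret W': module R "W (Suc s)" by (rule mX)
    note dx = mod_homD(1)[OF dX x]
    have "\<psi> (Suc s) x \<in> carrier (P (Suc s))" using mod_homD(1)[OF \<psi>(1)] x by simp
    then have "\<psi> (Suc s) x = \<zero>\<^bsub>P (Suc s)\<^esub>" using assms(2) by (simp add: vanishes_above_def)
    then have "\<chi> (Suc s) x = x"
      using mod_hom_zero[OF mP mX \<phi>(1)[of "Suc s"]] x by (simp add: \<chi>_def a_minus_def)
    then have "d' (Suc s) (\<sigma> (Suc s) x) = x \<ominus>\<^bsub>W (Suc s)\<^esub> \<sigma> s (d' s x)" using \<sigma>(2)[of s x] x by simp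
    moreover have "\<sigma> (Suc s) x \<in> carrier (W (Suc (Suc s)))" using mod_homD(1)[OF \<sigma>(1)] x by simp
    ultimately have "d' s (x \<ominus>\<^bsub>W (Suc s)\<^esub> \<sigma> s (d' s x)) = \<zero>\<^bsub>W s\<^esub>"
      using exact_upto_diff_diff[OF eX[of "Suc (Suc s)"], of s "\<sigma> (Suc s) x"] by simp
    then have "d' s x \<ominus>\<^bsub>W s\<^esub> d' s (\<sigma> s (d' s x)) = \<zero>\<^bsub>W s\<^esub>"
      using mod_hom_minus_apply[OF mX mX dX x mod_homD(1)[OF s dx]] by simp
    then show "d' s (\<sigma> s (d' s x)) = d' s x"
      using dx mod_homD(1)[OF dX mod_homD(1)[OF s dx]] module_minus_eq_zero[OF mX] by metis
  qed
qed

text \<open>Conversely, a resolution whose boundaries in degree \<open>s\<close> split off can be cut at \<open>s\<close>: the module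
  in degree \<open>s\<close> is replaced by a complement of the boundaries.\<close>

lemma resolution_truncate:
  fixes W :: "nat \<Rightarrow> ('a, 'p) module"
  assumes "projective_resolution R W d e M" "\<rho> \<in> mod_hom R (W s) (W s)"
    "\<rho> ` carrier (W s) \<subseteq> d s ` carrier (W (Suc s))" "\<And>x. x \<in> carrier (W (Suc s)) \<Longrightarrow> \<rho> (d s x) = d s x"
  shows "\<exists>(Y :: nat \<Rightarrow> ('a, 'p) module) d'. projective_resolution R Y d' e M \<and> vanishes_above Y s \<and>
    ((\<forall>i. fg_module R (W i)) \<longrightarrow> (\<forall>i. fg_module R (Y i)))"
proof -
  have pX: "proj R (W i)" and eX: "exact_upto R n W d e M" for i n
    using assms(1) by (auto simp: projective_resolution_iff)
  note mX = proj_module[OF pX]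
  have dX: "d i \<in> mod_hom R (W (Suc i)) (W i)" for i using exact_uptoD(5)[OF eX, of i "Suc i"] by simp
  interpret W: module R "W s" by (rule mX)
  define K where "K = {x \<in> carrier (W s). \<rho> x = \<zero>\<^bsub>W s\<^esub>}"
  have subK: "submodule K R (W s)" using kernel_submodule[OF mX mX assms(2)] by (simp add: a_kernel_eq K_def)
  note mK = module_submodule[OF mX subK]
  define Z where "Z i = (W i)\<lparr>carrier := {\<zero>\<^bsub>W i\<^esub>}\<rparr>" for i
  have pZ: "proj R (Z i)" for i unfolding Z_def by (rule proj_zero_module[OF pX])
  define Y where "Y i = (if i < s then W i else if i = s then (W s)\<lparr>carrier := K\<rparr> else Z i)" for i
  define d' where "d' i = (if i < s then d i else (\<lambda>x. \<zero>\<^bsub>W i\<^esub>))" for i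
  have zero: "\<zero>\<^bsub>Y i\<^esub> = \<zero>\<^bsub>W i\<^esub>" for i by (simp add: Y_def Z_def)
  have \<rho>\<rho>: "\<rho> (\<rho> x) = \<rho> x" if x: "x \<in> carrier (W s)" for x
  proof -
    obtain y where "y \<in> carrier (W (Suc s))" "\<rho> x = d s y" using assms(3) x by blast
    then show ?thesis using assms(4) by simp
  qed
  define c where "c x = x \<ominus>\<^bsub>W s\<^esub> \<rho> x" for x
  have c: "c \<in> mod_hom R (W s) (W s)" unfolding c_def[abs_def] by (rule mod_hom_minus[OF mX mX mod_hom_id assms(2)])
  have cK: "c x \<in> K" if "x \<in> carrier (W s)" for x
    using mod_homD(1)[OF c that] mod_hom_minus_apply[OF mX mX assms(2) that mod_homD(1)[OF assms(2) that]]
      \<rho>\<rho>[OF that] mod_homD(1)[OF assms(2) that] by (simp add: K_def c_def a_minus_def W.r_neg)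
  have c_id: "c x = x" if "x \<in> K" for x using that by (simp add: K_def c_def a_minus_def)
  have cY: "c \<in> mod_hom R (W s) ((W s)\<lparr>carrier := K\<rparr>)" by (rule mod_hom_into_submodule[OF c]) (use cK in auto)
  have KX: "K \<subseteq> carrier (W s)" by (auto simp: K_def)
  have pK: "proj R ((W s)\<lparr>carrier := K\<rparr>)"
    by (rule proj_retract[OF pX mK mod_hom_on_submodule[OF mod_hom_id KX] cY]) (simp add: c_id)
  have fgK: "fg_module R ((W s)\<lparr>carrier := K\<rparr>)" if "fg_module R (W s)"
  proof (rule fg_module_image[OF that mK cY])
    show "c ` carrier (W s) = carrier ((W s)\<lparr>carrier := K\<rparr>)" using cK c_id KX by (auto simp: image_iff) (metis subsetD)
  qed
  have pY: "proj R (Y i)" for i using pX pK pZ by (simp add: Y_def)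
  note mY = proj_module[OF pY]
  have YX: "carrier (Y i) \<subseteq> carrier (W i)" for i using KX module.axioms(2)[OF mX]
    by (auto simp: Y_def Z_def abelian_group_def abelian_monoid.zero_closed)
  have homY: "f \<in> mod_hom R (Y i) N" if "f \<in> mod_hom R (W i) N" for f i and N :: "('a, 'q) module"
    using that mod_homD[OF that] YX[of i] by (intro mod_homI) (auto simp: subset_iff Y_def Z_def)
  have dY: "d' i \<in> mod_hom R (Y (Suc i)) (Y i)" for i
  proof (cases "i < s")
    case True
    then have "Y i = W i" by (simp add: Y_def)
    then show ?thesis using homY[OF dX] True by (simp add: d'_def)
  next
    case False
    show ?thesis using mod_hom_zero_map[OF mY mY] False by (simp add: d'_def flip: zero)
  qed
  \<comment> \<open>Every element differs from its component in \<open>K\<close> by a boundary, so the images do not change.\<close>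
  have dc: "f (c x) = f x" if f: "f \<in> mod_hom R (W s) N" "module R N" "x \<in> carrier (W s)"
    "\<And>y. y \<in> carrier (W (Suc s)) \<Longrightarrow> f (d s y) = \<zero>\<^bsub>N\<^esub>" for f x and N :: "('a, 'q) module"
  proof -
    interpret N: module R N by fact
    obtain y where y: "y \<in> carrier (W (Suc s))" "\<rho> x = d s y" using assms(3) f(3) by blast
    show ?thesis unfolding c_def
      using mod_hom_minus_apply[OF mX f(2,1,3) mod_homD(1)[OF assms(2) f(3)]] y(2) f(4)[OF y(1)]
        mod_homD(1)[OF f(1,3)] by (simp add: a_minus_def)
  qed
  have bdry: "x \<in> d s ` carrier (W (Suc s)) \<Longrightarrow> x \<in> K \<Longrightarrow> x = \<zero>\<^bsub>W s\<^esub>" for x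
    using assms(4) by (auto simp: K_def)
  have mM: "module R M" by (rule exact_uptoD(1)[OF eX])
  have "e ` carrier (Y 0) = carrier M"
  proof (cases "s = 0")
    case True
    have eX': "e \<in> mod_hom R (W s) M" using exact_uptoD(3)[OF eX] True by simp
    have "e (c x) = e x" if "x \<in> carrier (W s)" for x
      by (rule dc[OF eX' mM that]) (use exact_upto_aug_diff[OF eX[of 1]] True in auto)
    then have "e ` carrier (W s) \<subseteq> e ` K" using cK by (metis image_eqI image_subsetI)
    then show ?thesis using exact_uptoD(4)[OF eX] KX True by (auto simp: Y_def)
  qed (use exact_uptoD(4)[OF eX] in \<open>simp add: Y_def\<close>)
  moreover have "d' i ` carrier (Y (Suc i)) = cycles_at Y d' e M i" for i
  proof -
    consider "Suc i < s" | "Suc i = s" | "i = s" | "i > s" by linarith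
    then show ?thesis
    proof cases
      case 1
      then have "cycles_at Y d' e M i = cycles_at W d e M i"
        by (cases i) (auto simp: Y_def d'_def)
      then show ?thesis using exact_uptoD(6)[OF eX, of i "Suc i"] 1 by (simp add: Y_def d'_def)
    next
      case 2
      have "d i (c x) = d i x" if "x \<in> carrier (W s)" for x
        by (rule dc[OF _ mX that]) (use dX[of i] 2 exact_upto_diff_diff[OF eX[of "Suc (Suc i)"]] in auto)
      then have "d i ` carrier (W s) \<subseteq> d i ` K" using cK by (metis image_eqI image_subsetI)
      then have "d i ` K = d i ` carrier (W s)" using KX by auto
      moreover have "cycles_at Y d' e M i = cycles_at W d e M i"
        using 2 by (cases i) (auto simp: Y_def d'_def)
      ultimately show ?thesis using exact_uptoD(6)[OF eX, of i "Suc i"] 2 by (simp add: Y_def d'_def)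
    next
      case 3
      have cyc: "cycles_at Y d' e M s = cycles_at W d e M s \<inter> K"
        using KX by (cases s) (auto simp: Y_def d'_def)
      have "cycles_at W d e M s = d s ` carrier (W (Suc s))" using exact_uptoD(6)[OF eX, of s "Suc s"] by simp
      then have "cycles_at Y d' e M s \<subseteq> {\<zero>\<^bsub>W s\<^esub>}" using bdry cyc by auto
      moreover have "\<zero>\<^bsub>W s\<^esub> \<in> cycles_at Y d' e M s"
        unfolding cyc using submodule_zero_mem[OF mX subK] mod_hom_zero[OF mX mX dX]
          mod_hom_zero[OF mX mM exact_uptoD(3)[OF eX]] W.zero_closed by (cases s) auto
      ultimately show ?thesis using 3 by (auto simp: Y_def d'_def Z_def)
    next
      case 4
      then obtain j where j: "i = Suc j" "s \<le> j" by (cases i) auto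
      then show ?thesis by (auto simp: Y_def d'_def Z_def)
    qed
  qed
  ultimately have "exact_upto R n Y d' e M" for n
    using mM mY homY[OF exact_uptoD(3)[OF eX]] dY by (simp add: exact_upto_iff)
  then have "projective_resolution R Y d' e M" using pY by (simp add: projective_resolution_iff)
  moreover have "vanishes_above Y s" by (simp add: vanishes_above_def Y_def Z_def)
  moreover have "fg_module R (Y i)" if "\<forall>i. fg_module R (W i)" for i
  proof -
    have "fg_module R (Z i)"
    proof (rule fg_moduleI[OF proj_module[OF pZ], of "{}"])
      fix N assume N: "submodule N R (Z i)"
      show "N = carrier (Z i)" using submodule_zero_mem[OF proj_module[OF pZ] N]
          module.submoduleE(1)[OF proj_module[OF pZ] N] by (auto simp: Z_def)
    qed auto
    then show ?thesis using that fgK by (simp add: Y_def)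
  qed
  ultimately show ?thesis by blast
qed

lemma vanishes_above_mono: "vanishes_above P s \<Longrightarrow> s \<le> t \<Longrightarrow> vanishes_above P t"
  by (auto simp: vanishes_above_def)

lemma pd_le_iff:
  fixes M :: "('a, 'b) module"
  shows "pd R M \<le> enat s \<longleftrightarrow> (\<exists>(P :: nat \<Rightarrow> ('a, ('a, 'b) res) module) d e.
    projective_resolution R P d e M \<and> vanishes_above P s)"
proof
  let ?A = "{enat s | s. \<exists>(P :: nat \<Rightarrow> ('a, ('a, 'b) res) module) d e.
    projective_resolution R P d e M \<and> vanishes_above P s}"
  assume le: "pd R M \<le> enat s"
  have "?A \<noteq> {}"
  proof
    assume "?A = {}"
    then have "pd R M = \<infinity>" unfolding pd_def by (simp only: Inf_empty top_enat_def)
    then show False using le by simp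
  qed
  then obtain a where "a \<in> ?A" unfolding ex_in_conv[symmetric] by (elim exE)
  then have "Inf ?A \<in> ?A" by (rule wellorder_InfI)
  then have "pd R M \<in> ?A" unfolding pd_def .
  then obtain t and P :: "nat \<Rightarrow> ('a, ('a, 'b) res) module" and d e where
    P: "pd R M = enat t" "projective_resolution R P d e M" "vanishes_above P t" by (elim CollectE exE conjE)
  have "vanishes_above P s" using le P(1) vanishes_above_mono[OF P(3)] by simp
  with P(2) show "\<exists>(P :: nat \<Rightarrow> ('a, ('a, 'b) res) module) d e.
    projective_resolution R P d e M \<and> vanishes_above P s" by (intro exI conjI)
next
  let ?A = "{enat s | s. \<exists>(P :: nat \<Rightarrow> ('a, ('a, 'b) res) module) d e.
    projective_resolution R P d e M \<and> vanishes_above P s}"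
  assume "\<exists>(P :: nat \<Rightarrow> ('a, ('a, 'b) res) module) d e. projective_resolution R P d e M \<and> vanishes_above P s"
  then have "enat s \<in> ?A" by (intro CollectI exI[of _ s] conjI refl)
  then show "pd R M \<le> enat s" unfolding pd_def by (rule Inf_lower)
qed

lemma pd_le_of_resolution:
  assumes "projective_resolution R P d e M" "vanishes_above P s"
  shows "pd R M \<le> enat s"
proof -
  have "exact_upto R 0 P d e M" using assms(1) by (simp add: projective_resolution_iff)
  then have "module R M" by (rule exact_uptoD(1))
  from projective_resolution_exists[OF this] obtain W d' e' where
    W: "projective_resolution R (W :: nat \<Rightarrow> ('a, ('a, 'c) res) module) d' e' M" by blast
  from boundaries_split[OF assms W] obtain \<rho> where "\<rho> \<in> mod_hom R (W s) (W s)"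
    "\<rho> ` carrier (W s) \<subseteq> d' s ` carrier (W (Suc s))" "\<And>x. x \<in> carrier (W (Suc s)) \<Longrightarrow> \<rho> (d' s x) = d' s x"
    by blast
  from resolution_truncate[OF W this] show ?thesis unfolding pd_le_iff by blast
qed

text \<open>A finite resolution of minimal length cannot be shortened, so its first map does not split, and by
  the hypothesis its length is at most \<open>b\<close>.\<close>

lemma fPD_le_if_split:
  fixes R :: "'a ring"
  assumes "\<And>s (P :: nat \<Rightarrow> ('a, nat \<Rightarrow> 'a) module) d e (M :: ('a, nat \<Rightarrow> 'a) module).
    projective_resolution R P d e M \<Longrightarrow> \<forall>i. fg_module R (P i) \<Longrightarrow> vanishes_above P (Suc s) \<Longrightarrow> b \<le> s \<Longrightarrow>
    \<exists>r\<in>mod_hom R (P s) (P (Suc s)). \<forall>x\<in>carrier (P (Suc s)). r (d s x) = x"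
  shows "fPD R \<le> enat b"
proof -
  have "pd R M \<le> enat b" if M: "M \<in> (FPR R :: ('a, nat \<Rightarrow> 'a) module set)" for M
  proof -
    let ?Q = "\<lambda>s. \<exists>(P :: nat \<Rightarrow> ('a, nat \<Rightarrow> 'a) module) d e.
      projective_resolution R P d e M \<and> (\<forall>i. fg_module R (P i)) \<and> vanishes_above P s"
    have "\<exists>s. ?Q s" using M by (auto simp: FPR_def)
    then have least: "?Q (LEAST s. ?Q s)" by (rule LeastI_ex)
    define t where "t = (LEAST s. ?Q s)"
    have min: "\<not> ?Q s" if "s < t" for s using not_less_Least that unfolding t_def by blast
    have "t \<le> b"
    proof (rule ccontr)
      assume "\<not> t \<le> b"
      then obtain s where t: "t = Suc s" "b \<le> s" by (cases t) auto
      from least[folded t_def] obtain P :: "nat \<Rightarrow> ('a, nat \<Rightarrow> 'a) module" and d e where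
        P: "projective_resolution R P d e M" "\<forall>i. fg_module R (P i)" "vanishes_above P (Suc s)"
        unfolding t(1) by blast
      from assms[OF P t(2)] obtain r where r: "r \<in> mod_hom R (P s) (P (Suc s))"
        "\<And>x. x \<in> carrier (P (Suc s)) \<Longrightarrow> r (d s x) = x" by blast
      have "exact_upto R (Suc s) P d e M" using P(1) by (simp add: projective_resolution_iff)
      then have d: "d s \<in> mod_hom R (P (Suc s)) (P s)" using exact_uptoD(5) by blast
      have "\<exists>(Y :: nat \<Rightarrow> ('a, nat \<Rightarrow> 'a) module) d'. projective_resolution R Y d' e M \<and>
        vanishes_above Y s \<and> ((\<forall>i. fg_module R (P i)) \<longrightarrow> (\<forall>i. fg_module R (Y i)))"
        by (rule resolution_truncate[OF P(1) mod_hom_comp[OF r(1) d]])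
          (use r(2) mod_homD(1)[OF r(1)] in auto)
      then have "?Q s" using P(2) by blast
      then show False using min[of s] t(1) by simp
    qed
    moreover have "pd R M \<le> enat t" using least[folded t_def] pd_le_of_resolution by blast
    ultimately show ?thesis by (meson enat_ord_simps(1) order_trans)
  qed
  then show ?thesis unfolding fPD_def by (rule SUP_least)
qed

section \<open>Tensoring a map of projective modules with a module\<close>

lemma (in abelian_monoid) finsum_swap:
  assumes "finite A" "finite B" "\<And>a b. a \<in> A \<Longrightarrow> b \<in> B \<Longrightarrow> f a b \<in> carrier G"
  shows "(\<Oplus>a\<in>A. \<Oplus>b\<in>B. f a b) = (\<Oplus>b\<in>B. \<Oplus>a\<in>A. f a b)"
  using assms(1,3)
proof (induction A)
  case (insert x A)
  have 1: "(\<Oplus>b\<in>B. f a b) \<in> carrier G" if "a \<in> insert x A" for a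
    using insert.prems that by (intro finsum_closed) auto
  have "(\<Oplus>b\<in>B. \<Oplus>a\<in>insert x A. f a b) = (\<Oplus>b\<in>B. f x b \<oplus> (\<Oplus>a\<in>A. f a b))"
    using insert.prems insert.hyps by (intro finsum_cong' refl finsum_insert) auto
  also have "\<dots> = (\<Oplus>b\<in>B. f x b) \<oplus> (\<Oplus>b\<in>B. \<Oplus>a\<in>A. f a b)"
    using insert.prems by (intro finsum_addf) auto
  finally show ?case using insert 1 by (subst finsum_insert) auto
qed simp

lemma (in abelian_group) finsum_minusf:
  assumes "finite A" "\<And>a. a \<in> A \<Longrightarrow> f a \<in> carrier G" "\<And>a. a \<in> A \<Longrightarrow> g a \<in> carrier G"
  shows "(\<Oplus>a\<in>A. f a \<ominus> g a) = (\<Oplus>a\<in>A. f a) \<ominus> (\<Oplus>a\<in>A. g a)"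
  using assms
proof (induction A)
  case (insert x A)
  have "f a \<ominus> g a \<in> carrier G" if "a \<in> insert x A" for a using insert.prems that by auto
  moreover have "(\<Oplus>a\<in>A. f a) \<in> carrier G" "(\<Oplus>a\<in>A. g a) \<in> carrier G"
    using insert.prems by (auto intro!: finsum_closed)
  ultimately show ?case using insert
    by (simp add: a_minus_def minus_add a_ac)
next
  case empty
  have z: "\<ominus> \<zero> = \<zero>" by (metis a_inv_closed l_zero r_neg zero_closed)
  show ?case by (simp add: a_minus_def z)
qed

text \<open>For a hom \<open>f\<close> between modules with dual bases \<open>(S, s)\<close> and \<open>(S', s')\<close> this is the matrix of
  \<open>f\<close> acting on vectors over \<open>L\<close>, that is, the map \<open>f \<otimes> L\<close> in coordinates. On the coordinates of
  \<open>P \<otimes> L\<close> inside \<open>L\<^bsup>S\<^esup>\<close> the matrix of the identity is idempotent, not the unit matrix.\<close>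

definition tens ::
  "('a, 'l) module \<Rightarrow> ('q \<Rightarrow> 'q \<Rightarrow> 'a) \<Rightarrow> 'p set \<Rightarrow> ('p \<Rightarrow> 'q) \<Rightarrow> ('p \<Rightarrow> 'l) \<Rightarrow> 'q \<Rightarrow> 'l" where
  "tens L s' S f u b = (\<Oplus>\<^bsub>L\<^esub>c\<in>S. s' (f c) b \<odot>\<^bsub>L\<^esub> u c)"

definition dual_basis :: "'a ring \<Rightarrow> ('a, 'p) module \<Rightarrow> 'p set \<Rightarrow> ('p \<Rightarrow> 'p \<Rightarrow> 'a) \<Rightarrow> bool" where
  "dual_basis R P S s \<longleftrightarrow> module R P \<and> finite S \<and> S \<subseteq> carrier P \<and> s \<in> mod_hom R P (fsupp_module R S) \<and>
    (\<forall>x\<in>carrier P. lin_ext R P (\<lambda>x. x) (s x) = x)"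

lemma dual_basisD:
  assumes "dual_basis R P S s"
  shows "module R P" "finite S" "S \<subseteq> carrier P" "s \<in> mod_hom R P (fsupp_module R S)"
    "x \<in> carrier P \<Longrightarrow> lin_ext R P (\<lambda>x. x) (s x) = x"
    "x \<in> carrier P \<Longrightarrow> s x b \<in> carrier R"
    "x \<in> carrier P \<Longrightarrow> b \<notin> S \<Longrightarrow> s x b = \<zero>\<^bsub>R\<^esub>"
proof -
  show s: "s \<in> mod_hom R P (fsupp_module R S)" using assms by (simp add: dual_basis_def)
  show "s x b \<in> carrier R" if "x \<in> carrier P" using mod_homD(1)[OF s that] by (simp add: fsupp_carrier_iff)
  show "s x b = \<zero>\<^bsub>R\<^esub>" if "x \<in> carrier P" "b \<notin> S" using mod_homD(1)[OF s that(1)] that(2)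
    by (simp add: fsupp_carrier_iff)
qed (use assms in \<open>auto simp: dual_basis_def\<close>)

lemma dual_basis_exists:
  assumes "proj R P" "fg_module R P"
  shows "\<exists>S s. dual_basis R P S s"
proof -
  obtain S where S: "finite S" "S \<subseteq> carrier P" "lin_ext R P (\<lambda>x. x) ` carrier (fsupp_module R S) = carrier P"
    using assms(2) by (auto simp: fg_module_iff)
  from fg_proj_dual_basis[OF assms(1) S] show ?thesis
    using S proj_module[OF assms(1)] by (auto simp: dual_basis_def)
qed

lemma mod_hom_dual_coord:
  "dual_basis R P S s \<Longrightarrow> (\<lambda>x. s x b) \<in> mod_hom R P (self_module R)"
  using mod_hom_comp[OF dual_basisD(4) mod_hom_coord] .

lemma dual_basis_sum:
  assumes "dual_basis R P S s" "module R N" "h \<in> mod_hom R P N" "x \<in> carrier P"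
  shows "h x = (\<Oplus>\<^bsub>N\<^esub>c\<in>S. s x c \<odot>\<^bsub>N\<^esub> h c)"
proof -
  note P = dual_basisD[OF assms(1)]
  have sx: "s x \<in> carrier (fsupp_module R S)" by (rule mod_homD(1)[OF P(4) assms(4)])
  have "h x = h (lin_ext R P (\<lambda>x. x) (s x))" using P(5)[OF assms(4)] by simp
  also have "\<dots> = lin_ext R N h (s x)"
    by (rule lin_ext_natural[OF P(1) assms(2,3) _ sx]) (use P(3) in auto)
  also have "\<dots> = (\<Oplus>\<^bsub>N\<^esub>c\<in>S. s x c \<odot>\<^bsub>N\<^esub> h c)"
    by (rule lin_ext_eq[OF assms(2) sx]) (use P(2,3,7) assms(4) mod_homD(1)[OF assms(3)] in auto)
  finally show ?thesis .
qed

lemma tens_closed: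
  assumes "dual_basis R P S s" "dual_basis R P' S' s'" "f \<in> mod_hom R P P'" "module R L"
    "\<And>c. c \<in> S \<Longrightarrow> u c \<in> carrier L"
  shows "tens L s' S f u b \<in> carrier L"
proof -
  interpret L: module R L by fact
  show ?thesis unfolding tens_def
    using dual_basisD(3)[OF assms(1)] dual_basisD(6)[OF assms(2)] mod_homD(1)[OF assms(3)] assms(5)
    by (intro L.finsum_closed) auto
qed

lemma tens_cong:
  assumes "dual_basis R P S s" "dual_basis R P' S' s'" "f \<in> mod_hom R P P'" "module R L"
    "\<And>c. c \<in> S \<Longrightarrow> v c \<in> carrier L" "\<And>c. c \<in> S \<Longrightarrow> u c = v c" "\<And>c. c \<in> S \<Longrightarrow> f c = g c"
  shows "tens L s' S f u b = tens L s' S g v b"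
proof -
  interpret L: module R L by fact
  have "f c \<in> carrier P'" "s' (f c) b \<in> carrier R" if "c \<in> S" for c
    using dual_basisD(3)[OF assms(1)] dual_basisD(6)[OF assms(2)] mod_homD(1)[OF assms(3)] that by auto
  then show ?thesis unfolding tens_def using assms(5-7) by (intro L.finsum_cong') auto
qed

lemma tens_comp:
  assumes "dual_basis R P S s" "dual_basis R P' S' s'" "dual_basis R P'' S'' s''"
    "f \<in> mod_hom R P P'" "g \<in> mod_hom R P' P''" "module R L" "\<And>c. c \<in> S \<Longrightarrow> u c \<in> carrier L"
  shows "tens L s'' S' g (tens L s' S f u) b = tens L s'' S (\<lambda>x. g (f x)) u b"
proof -
  interpret L: module R L by fact
  note P = dual_basisD[OF assms(1)] and P' = dual_basisD[OF assms(2)] and P'' = dual_basisD[OF assms(3)]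
  have c: "c \<in> S \<Longrightarrow> f c \<in> carrier P'" for c using P(3) mod_homD(1)[OF assms(4)] by auto
  have c': "c \<in> S' \<Longrightarrow> g c \<in> carrier P''" for c using P'(3) mod_homD(1)[OF assms(5)] by auto
  have a: "s' (f c) x \<in> carrier R" if "c \<in> S" for c x using P'(6) c that by simp
  have a': "s'' (g c) b \<in> carrier R" if "c \<in> S'" for c using P''(6) c' that by simp
  have h: "(\<lambda>y. s'' (g y) b) \<in> mod_hom R P' (self_module R)"
    by (rule mod_hom_comp[OF assms(5) mod_hom_dual_coord[OF assms(3)]])
  have "tens L s'' S' g (tens L s' S f u) b =
      (\<Oplus>\<^bsub>L\<^esub>c'\<in>S'. s'' (g c') b \<odot>\<^bsub>L\<^esub> (\<Oplus>\<^bsub>L\<^esub>c\<in>S. s' (f c) c' \<odot>\<^bsub>L\<^esub> u c))" by (simp add: tens_def)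
  also have "\<dots> = (\<Oplus>\<^bsub>L\<^esub>c'\<in>S'. \<Oplus>\<^bsub>L\<^esub>c\<in>S. s'' (g c') b \<odot>\<^bsub>L\<^esub> (s' (f c) c' \<odot>\<^bsub>L\<^esub> u c))"
    using a a' assms(7) P(2) by (intro L.finsum_cong' refl L.finsum_smult_ldistr) (auto intro!: L.finsum_closed)
  also have "\<dots> = (\<Oplus>\<^bsub>L\<^esub>c\<in>S. \<Oplus>\<^bsub>L\<^esub>c'\<in>S'. s'' (g c') b \<odot>\<^bsub>L\<^esub> (s' (f c) c' \<odot>\<^bsub>L\<^esub> u c))"
    using a a' assms(7) P(2) P'(2) by (intro L.finsum_swap) auto
  also have "\<dots> = (\<Oplus>\<^bsub>L\<^esub>c\<in>S. s'' (g (f c)) b \<odot>\<^bsub>L\<^esub> u c)"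
  proof (intro L.finsum_cong' refl)
    fix x assume x: "x \<in> S"
    have hx: "(\<lambda>r. r \<odot>\<^bsub>L\<^esub> u x) \<in> mod_hom R (self_module R) L"
      using assms(7)[OF x] by (intro mod_homI) (auto simp: L.smult_l_distr L.smult_assoc1)
    have "s'' (g (f x)) b = (\<Oplus>\<^bsub>self_module R\<^esub>c'\<in>S'. s' (f x) c' \<otimes>\<^bsub>R\<^esub> s'' (g c') b)"
      using dual_basis_sum[OF assms(2) module_self_module h c[OF x]] L.R.cring_axioms by simp
    also have "\<dots> \<odot>\<^bsub>L\<^esub> u x = (\<Oplus>\<^bsub>L\<^esub>c'\<in>S'. (s' (f x) c' \<otimes>\<^bsub>R\<^esub> s'' (g c') b) \<odot>\<^bsub>L\<^esub> u x)"
      by (rule mod_hom_finsum[OF module_self_module[OF L.R.cring_axioms] L.module_axioms hx P'(2)])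
        (use a a' x in auto)
    also have "\<dots> = (\<Oplus>\<^bsub>L\<^esub>c'\<in>S'. s'' (g c') b \<odot>\<^bsub>L\<^esub> (s' (f x) c' \<odot>\<^bsub>L\<^esub> u x))"
      using a a' assms(7) x by (intro L.finsum_cong') (auto simp: L.smult_assoc1[symmetric] L.R.m_comm)
    finally show "(\<Oplus>\<^bsub>L\<^esub>c'\<in>S'. s'' (g c') b \<odot>\<^bsub>L\<^esub> (s' (f x) c' \<odot>\<^bsub>L\<^esub> u x)) = s'' (g (f x)) b \<odot>\<^bsub>L\<^esub> u x" by simp
  qed (use P''(6) c assms(7) mod_homD(1)[OF assms(5)] in auto)
  finally show ?thesis by (simp add: tens_def)
qed

lemma tens_natural:
  assumes "dual_basis R P S s" "dual_basis R P' S' s'" "f \<in> mod_hom R P P'" "module R L" "module R L'"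
    "\<phi> \<in> mod_hom R L L'" "\<And>c. c \<in> S \<Longrightarrow> u c \<in> carrier L"
  shows "\<phi> (tens L s' S f u b) = tens L' s' S f (\<lambda>c. \<phi> (u c)) b"
proof -
  interpret L: module R L by fact
  interpret L': module R L' by fact
  have a: "s' (f c) b \<in> carrier R" if "c \<in> S" for c
    using dual_basisD(3)[OF assms(1)] dual_basisD(6)[OF assms(2)] mod_homD(1)[OF assms(3)] that by auto
  have "\<phi> (tens L s' S f u b) = (\<Oplus>\<^bsub>L'\<^esub>c\<in>S. \<phi> (s' (f c) b \<odot>\<^bsub>L\<^esub> u c))" unfolding tens_def
    by (rule mod_hom_finsum[OF assms(4-6) dual_basisD(2)[OF assms(1)]]) (use a assms(7) in auto)
  also have "\<dots> = tens L' s' S f (\<lambda>c. \<phi> (u c)) b" unfolding tens_def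
    using a assms(7) mod_homD[OF assms(6)] by (intro L'.finsum_cong') auto
  finally show ?thesis .
qed

lemma tens_minus:
  assumes "dual_basis R P S s" "dual_basis R P' S' s'" "f \<in> mod_hom R P P'" "module R L"
    "\<And>c. c \<in> S \<Longrightarrow> u c \<in> carrier L" "\<And>c. c \<in> S \<Longrightarrow> v c \<in> carrier L"
  shows "tens L s' S f (\<lambda>c. u c \<ominus>\<^bsub>L\<^esub> v c) b = tens L s' S f u b \<ominus>\<^bsub>L\<^esub> tens L s' S f v b"
proof -
  interpret L: module R L by fact
  have a: "s' (f c) b \<in> carrier R" if "c \<in> S" for c
    using dual_basisD(3)[OF assms(1)] dual_basisD(6)[OF assms(2)] mod_homD(1)[OF assms(3)] that by auto
  have "tens L s' S f (\<lambda>c. u c \<ominus>\<^bsub>L\<^esub> v c) b =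
      (\<Oplus>\<^bsub>L\<^esub>c\<in>S. s' (f c) b \<odot>\<^bsub>L\<^esub> u c \<ominus>\<^bsub>L\<^esub> s' (f c) b \<odot>\<^bsub>L\<^esub> v c)" unfolding tens_def
    using a assms(5,6) by (intro L.finsum_cong') (auto simp: a_minus_def L.smult_r_distr L.smult_r_minus)
  also have "\<dots> = tens L s' S f u b \<ominus>\<^bsub>L\<^esub> tens L s' S f v b" unfolding tens_def
    using a assms(5,6) dual_basisD(2)[OF assms(1)] by (intro L.finsum_minusf) auto
  finally show ?thesis .
qed

lemma tens_submodule:
  assumes "dual_basis R P S s" "dual_basis R P' S' s'" "f \<in> mod_hom R P P'" "module R L" "submodule U R L"
    "\<And>c. c \<in> S \<Longrightarrow> u c \<in> U"
  shows "tens L s' S f u b \<in> U"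
  unfolding tens_def
  using dual_basisD(2,3)[OF assms(1)] dual_basisD(6)[OF assms(2)] mod_homD(1)[OF assms(3)] assms(6)
    module.submoduleE(4)[OF assms(4,5)]
  by (intro submodule_smult_closed_finsum[OF assms(4,5)]) auto

lemma tens_zero:
  assumes "module R L" "dual_basis R P' S' s'" "\<And>c. c \<in> S \<Longrightarrow> u c \<in> carrier L"
    "\<And>c. c \<in> S \<Longrightarrow> f c = \<zero>\<^bsub>P'\<^esub>"
  shows "tens L s' S f u b = \<zero>\<^bsub>L\<^esub>"
proof -
  interpret L: module R L by fact
  have "s' \<zero>\<^bsub>P'\<^esub> = \<zero>\<^bsub>fsupp_module R S'\<^esub>"
    by (rule mod_hom_zero[OF dual_basisD(1)[OF assms(2)] module_fsupp_module dual_basisD(4)[OF assms(2)]])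
      (rule L.R.cring_axioms)
  then have "tens L s' S f u b = (\<Oplus>\<^bsub>L\<^esub>c\<in>S. \<zero>\<^bsub>L\<^esub>)" unfolding tens_def
    using assms(3,4) by (intro L.finsum_cong') auto
  then show ?thesis by simp
qed

text \<open>Vectors of the form \<open>a \<cdot> q\<close> with \<open>a\<close> the coordinates of an element \<open>x\<close>: here the matrix of \<open>f\<close>
  computes the coordinates of \<open>f x\<close>.\<close>

lemma tens_coord_smult:
  assumes "dual_basis R P S s" "dual_basis R P' S' s'" "f \<in> mod_hom R P P'" "module R L" "q \<in> carrier L"
    "x \<in> carrier P"
  shows "tens L s' S f (\<lambda>c. s x c \<odot>\<^bsub>L\<^esub> q) b = s' (f x) b \<odot>\<^bsub>L\<^esub> q"
proof -
  interpret L: module R L by fact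
  note P = dual_basisD[OF assms(1)] and P' = dual_basisD[OF assms(2)]
  have a: "s' (f c) b \<in> carrier R" if "c \<in> S" for c using P(3) P'(6) mod_homD(1)[OF assms(3)] that by auto
  have h: "(\<lambda>y. s' (f y) b \<odot>\<^bsub>L\<^esub> q) \<in> mod_hom R P L"
  proof (rule mod_hom_comp[OF mod_hom_comp[OF assms(3) mod_hom_dual_coord[OF assms(2)]]])
    show "(\<lambda>r. r \<odot>\<^bsub>L\<^esub> q) \<in> mod_hom R (self_module R) L"
      using assms(5) by (intro mod_homI) (auto simp: L.smult_l_distr L.smult_assoc1)
  qed
  have "s' (f x) b \<odot>\<^bsub>L\<^esub> q = (\<Oplus>\<^bsub>L\<^esub>c\<in>S. s x c \<odot>\<^bsub>L\<^esub> (s' (f c) b \<odot>\<^bsub>L\<^esub> q))"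
    by (rule dual_basis_sum[OF assms(1,4) h assms(6)])
  also have "\<dots> = tens L s' S f (\<lambda>c. s x c \<odot>\<^bsub>L\<^esub> q) b" unfolding tens_def
    using a assms(5,6) P(6) by (intro L.finsum_cong') (auto simp: L.smult_assoc1[symmetric] L.R.m_comm)
  finally show ?thesis by simp
qed

section \<open>Exactness of a tensored resolution\<close>

locale fg_resolution =
  fixes R :: "'a ring" and P :: "nat \<Rightarrow> ('a, 'p) module" and d e and M :: "('a, 'b) module" and S s
  assumes res: "projective_resolution R P d e M"
    and dual: "\<And>i. dual_basis R (P i) (S i) (s i)"
begin

lemma mP: "module R (P i)" by (rule dual_basisD(1)[OF dual])

lemma R: "cring R" using mP by (simp add: module_def)

lemma exactP: "exact_upto R n P d e M" using res by (simp add: projective_resolution_iff)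

lemma dP: "d i \<in> mod_hom R (P (Suc i)) (P i)" using exact_uptoD(5)[OF exactP, of i "Suc i"] by simp

lemma dd: "x \<in> carrier (P (Suc (Suc i))) \<Longrightarrow> d i (d (Suc i) x) = \<zero>\<^bsub>P i\<^esub>"
  using exact_upto_diff_diff[OF exactP[of "Suc (Suc i)"]] by simp

text \<open>Exactness of \<open>P \<otimes> L/U\<close> in degree \<open>Suc i\<close>.\<close>

definition exact_tensor :: "('a, 'l) module \<Rightarrow> 'l set \<Rightarrow> nat \<Rightarrow> bool" where
  "exact_tensor L U i \<longleftrightarrow> (\<forall>u. (\<forall>c\<in>S (Suc i). u c \<in> carrier L) \<and>
      (\<forall>b\<in>S i. tens L (s i) (S (Suc i)) (d i) u b \<in> U) \<longrightarrow>
    (\<exists>w. (\<forall>c\<in>S (Suc (Suc i)). w c \<in> carrier L) \<and>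
      (\<forall>b\<in>S (Suc i). tens L (s (Suc i)) (S (Suc i)) (\<lambda>x. x) u b \<ominus>\<^bsub>L\<^esub>
        tens L (s (Suc i)) (S (Suc (Suc i))) (d (Suc i)) w b \<in> U)))"

lemma exact_tensorI:
  assumes "\<And>u. (\<And>c. c \<in> S (Suc i) \<Longrightarrow> u c \<in> carrier L) \<Longrightarrow>
      (\<And>b. b \<in> S i \<Longrightarrow> tens L (s i) (S (Suc i)) (d i) u b \<in> U) \<Longrightarrow>
    \<exists>w. (\<forall>c\<in>S (Suc (Suc i)). w c \<in> carrier L) \<and>
      (\<forall>b\<in>S (Suc i). tens L (s (Suc i)) (S (Suc i)) (\<lambda>x. x) u b \<ominus>\<^bsub>L\<^esub>
        tens L (s (Suc i)) (S (Suc (Suc i))) (d (Suc i)) w b \<in> U)"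
  shows "exact_tensor L U i"
  using assms unfolding exact_tensor_def by simp

lemma exact_tensorD:
  assumes "exact_tensor L U i" "\<And>c. c \<in> S (Suc i) \<Longrightarrow> u c \<in> carrier L"
    "\<And>b. b \<in> S i \<Longrightarrow> tens L (s i) (S (Suc i)) (d i) u b \<in> U"
  obtains w where "\<And>c. c \<in> S (Suc (Suc i)) \<Longrightarrow> w c \<in> carrier L"
    "\<And>b. b \<in> S (Suc i) \<Longrightarrow> tens L (s (Suc i)) (S (Suc i)) (\<lambda>x. x) u b \<ominus>\<^bsub>L\<^esub>
        tens L (s (Suc i)) (S (Suc (Suc i))) (d (Suc i)) w b \<in> U"
  using assms(1)[unfolded exact_tensor_def, THEN spec, of u] assms(2,3) that by blast

text \<open>The long exact homology sequence of \<open>0 \<rightarrow> L'/U' \<rightarrow> L/U \<rightarrow> L/V \<rightarrow> 0\<close>: one degree of exactness is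
  lost in passing to the cokernel.\<close>

lemma exact_tensor_cokernel:
  assumes L: "module R L" and L': "module R L'" and \<phi>: "\<phi> \<in> mod_hom R L' L" and U: "submodule U R L"
    and U': "\<And>y. y \<in> carrier L' \<Longrightarrow> \<phi> y \<in> U \<Longrightarrow> y \<in> U'" and U'L: "\<And>y. y \<in> U' \<Longrightarrow> \<phi> y \<in> U"
    and V: "V = {\<phi> y \<oplus>\<^bsub>L\<^esub> z | y z. y \<in> carrier L' \<and> z \<in> U}"
    and ex: "exact_tensor L U (Suc j)" "exact_tensor L' U' j"
  shows "exact_tensor L V (Suc j)"
proof (rule exact_tensorI)
  let ?k = "Suc j" and ?l = "Suc (Suc j)" and ?m = "Suc (Suc (Suc j))"
  let ?e = "tens L (s ?k) (S ?k) (\<lambda>x. x)" and ?D = "tens L (s ?k) (S ?l) (d ?k)"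
  let ?d = "tens L (s j) (S ?k) (d j)"
  interpret L: module R L by fact
  interpret L': module R L' by fact
  note E = L.submoduleE[OF U]
  fix u assume u: "\<And>c. c \<in> S ?l \<Longrightarrow> u c \<in> carrier L" and Du: "\<And>b. b \<in> S ?k \<Longrightarrow> ?D u b \<in> V"
  have "\<forall>b\<in>S ?k. \<exists>y z. y \<in> carrier L' \<and> z \<in> U \<and> ?D u b = \<phi> y \<oplus>\<^bsub>L\<^esub> z" using Du V by blast
  then obtain v z where vz: "\<And>b. b \<in> S ?k \<Longrightarrow> v b \<in> carrier L'" "\<And>b. b \<in> S ?k \<Longrightarrow> z b \<in> U"
    "\<And>b. b \<in> S ?k \<Longrightarrow> ?D u b = \<phi> (v b) \<oplus>\<^bsub>L\<^esub> z b" by metis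
  note \<phi>c = mod_homD(1)[OF \<phi>]
  have zL: "b \<in> S ?k \<Longrightarrow> z b \<in> carrier L" for b using vz(2) E(1) by blast
  have DuL: "?D u b \<in> carrier L" for b by (rule tens_closed[OF dual dual dP L u])
  have diff: "?D u b \<ominus>\<^bsub>L\<^esub> \<phi> (v b) = z b" if "b \<in> S ?k" for b
    using vz(3)[OF that] zL[OF that] \<phi>c[OF vz(1)[OF that]]
    by (simp add: a_minus_def L.a_ac L.r_neg)
  have "\<phi> (tens L' (s j) (S ?k) (d j) v b) \<in> U" for b
  proof -
    have "?d (?D u) b = tens L (s j) (S ?l) (\<lambda>x. d j (d ?k x)) u b"
      by (rule tens_comp[OF dual dual dual dP dP L u])
    also have "\<dots> = \<zero>\<^bsub>L\<^esub>"
      by (rule tens_zero[OF L dual u]) (use dual_basisD(3)[OF dual] in \<open>auto intro!: dd\<close>)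
    finally have 1: "?d (?D u) b = \<zero>\<^bsub>L\<^esub>" .
    have "?d (\<lambda>c. ?D u c \<ominus>\<^bsub>L\<^esub> \<phi> (v c)) b \<in> U"
      by (rule tens_submodule[OF dual dual dP L U]) (simp add: diff vz(2))
    moreover have "?d (\<lambda>c. ?D u c \<ominus>\<^bsub>L\<^esub> \<phi> (v c)) b = ?d (?D u) b \<ominus>\<^bsub>L\<^esub> ?d (\<lambda>c. \<phi> (v c)) b"
      by (rule tens_minus[OF dual dual dP L]) (auto simp: DuL \<phi>c vz(1))
    ultimately have "\<zero>\<^bsub>L\<^esub> \<ominus>\<^bsub>L\<^esub> ?d (\<lambda>c. \<phi> (v c)) b \<in> U" by (simp add: 1)
    moreover have c: "?d (\<lambda>c. \<phi> (v c)) b \<in> carrier L" by (rule tens_closed[OF dual dual dP L]) (simp add: \<phi>c vz(1))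
    ultimately have "?d (\<lambda>c. \<phi> (v c)) b \<in> U" using E(3) by (fastforce simp: a_minus_def)
    then show ?thesis using tens_natural[where u=v, OF dual dual dP L' L \<phi> vz(1)] by simp
  qed
  then have "tens L' (s j) (S ?k) (d j) v b \<in> U'" for b
    using U' tens_closed[where u=v, OF dual dual dP L' vz(1)] by blast
  from exact_tensorD[where u=v, OF ex(2) vz(1) this] obtain w where w: "\<And>c. c \<in> S ?l \<Longrightarrow> w c \<in> carrier L'"
    "\<And>b. b \<in> S ?k \<Longrightarrow> tens L' (s ?k) (S ?k) (\<lambda>x. x) v b \<ominus>\<^bsub>L'\<^esub> tens L' (s ?k) (S ?l) (d ?k) w b \<in> U'"
    by blast
  define u' where "u' c = u c \<ominus>\<^bsub>L\<^esub> \<phi> (w c)" for c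
  have \<phi>w: "c \<in> S ?l \<Longrightarrow> \<phi> (w c) \<in> carrier L" for c using \<phi>c w(1) by simp
  have \<phi>v: "c \<in> S ?k \<Longrightarrow> \<phi> (v c) \<in> carrier L" for c using \<phi>c vz(1) by simp
  have u': "c \<in> S ?l \<Longrightarrow> u' c \<in> carrier L" for c using u \<phi>w by (simp add: u'_def)
  have "?D u' b \<in> U" if b: "b \<in> S ?k" for b
  proof -
    let ?A = "?e (?D u) b" and ?B = "?e (\<lambda>c. \<phi> (v c)) b" and ?C = "?D (\<lambda>c. \<phi> (w c)) b"
    have closed: "?A \<in> carrier L" "?B \<in> carrier L" "?C \<in> carrier L"
      by (auto intro!: tens_closed[OF dual dual mod_hom_id L] tens_closed[OF dual dual dP L] simp: DuL \<phi>v \<phi>w u)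
    have "\<phi> (tens L' (s ?k) (S ?k) (\<lambda>x. x) v b \<ominus>\<^bsub>L'\<^esub> tens L' (s ?k) (S ?l) (d ?k) w b) \<in> U"
      using U'L w(2)[OF b] by blast
    then have 1: "?B \<ominus>\<^bsub>L\<^esub> ?C \<in> U"
      using mod_hom_minus_apply[OF L' L \<phi> tens_closed[where u=v, OF dual dual mod_hom_id L' vz(1)] tens_closed[where u=w, OF dual dual dP L' w(1)]]
        tens_natural[where u=v, OF dual dual mod_hom_id L' L \<phi> vz(1)] tens_natural[where u=w, OF dual dual dP L' L \<phi> w(1)]
      by simp
    have "?e (\<lambda>c. ?D u c \<ominus>\<^bsub>L\<^esub> \<phi> (v c)) b \<in> U"
      by (rule tens_submodule[OF dual dual mod_hom_id L U]) (simp add: diff vz(2))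
    then have 2: "?A \<ominus>\<^bsub>L\<^esub> ?B \<in> U"
      using tens_minus[where u="?D u" and v="\<lambda>c. \<phi> (v c)", OF dual dual mod_hom_id L] DuL \<phi>v by simp
    have 3: "?A = ?D u b" by (rule tens_comp[OF dual dual dual dP mod_hom_id L u])
    have "?D u' b = ?D u b \<ominus>\<^bsub>L\<^esub> ?C" unfolding u'_def by (rule tens_minus[OF dual dual dP L u \<phi>w])
    also have "\<dots> = (?A \<ominus>\<^bsub>L\<^esub> ?B) \<oplus>\<^bsub>L\<^esub> (?B \<ominus>\<^bsub>L\<^esub> ?C)" unfolding 3[symmetric]
      using closed by (simp add: a_minus_def L.a_assoc L.r_neg1 L.r_neg2)
    finally show ?thesis using 1 2 E(5) by simp
  qed
  from exact_tensorD[where u=u', OF ex(1) u' this] obtain w' where w': "\<And>c. c \<in> S ?m \<Longrightarrow> w' c \<in> carrier L"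
    "\<And>b. b \<in> S ?l \<Longrightarrow> tens L (s ?l) (S ?l) (\<lambda>x. x) u' b \<ominus>\<^bsub>L\<^esub> tens L (s ?l) (S ?m) (d ?l) w' b \<in> U"
    by blast
  show "\<exists>w. (\<forall>c\<in>S ?m. w c \<in> carrier L) \<and>
    (\<forall>b\<in>S ?l. tens L (s ?l) (S ?l) (\<lambda>x. x) u b \<ominus>\<^bsub>L\<^esub> tens L (s ?l) (S ?m) (d ?l) w b \<in> V)"
  proof (intro exI[of _ w'] conjI ballI)
    fix b assume b: "b \<in> S ?l"
    let ?x = "tens L (s ?l) (S ?l) (\<lambda>x. x) u b" and ?y = "tens L (s ?l) (S ?m) (d ?l) w' b"
      and ?p = "tens L' (s ?l) (S ?l) (\<lambda>x. x) w b"
    have cl: "?x \<in> carrier L" "?y \<in> carrier L" "?p \<in> carrier L'"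
      by (auto intro!: tens_closed[OF dual dual mod_hom_id L] tens_closed[OF dual dual mod_hom_id L']
          tens_closed[OF dual dual dP L] simp: u w w')
    have "tens L (s ?l) (S ?l) (\<lambda>x. x) u' b = ?x \<ominus>\<^bsub>L\<^esub> \<phi> ?p"
      unfolding u'_def using tens_minus[where u=u and v="\<lambda>c. \<phi> (w c)", OF dual dual mod_hom_id L u \<phi>w]
        tens_natural[where u=w, OF dual dual mod_hom_id L' L \<phi> w(1)] by simp
    then have "?x \<ominus>\<^bsub>L\<^esub> \<phi> ?p \<ominus>\<^bsub>L\<^esub> ?y \<in> U" using w'(2)[OF b] by simp
    moreover have "?x \<ominus>\<^bsub>L\<^esub> ?y = \<phi> ?p \<oplus>\<^bsub>L\<^esub> (?x \<ominus>\<^bsub>L\<^esub> \<phi> ?p \<ominus>\<^bsub>L\<^esub> ?y)"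
      using cl \<phi>c[OF cl(3)] by (simp add: a_minus_def L.a_ac L.r_neg1 L.r_neg2)
    ultimately show "?x \<ominus>\<^bsub>L\<^esub> ?y \<in> V" unfolding V using cl(3) by blast
  qed (use w'(1) in auto)
qed

text \<open>Over the ring itself the tensored complex is the given one, in coordinates.\<close>

lemma exact_tensor_self: "exact_tensor (self_module R) {\<zero>\<^bsub>R\<^esub>} i"
proof (rule exact_tensorI)
  let ?k = "Suc i" and ?l = "Suc (Suc i)" and ?R = "self_module R"
  interpret R: cring R by (rule R)
  interpret P0: module R "P i" by (rule mP)
  interpret Pk: module R "P ?k" by (rule mP)
  note mR = module_self_module[OF R]
  fix u assume u: "\<And>c. c \<in> S ?k \<Longrightarrow> u c \<in> carrier ?R"
    and Du: "\<And>b. b \<in> S i \<Longrightarrow> tens ?R (s i) (S ?k) (d i) u b \<in> {\<zero>\<^bsub>R\<^esub>}"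
  define y where "y = (\<Oplus>\<^bsub>P ?k\<^esub>c\<in>S ?k. u c \<odot>\<^bsub>P ?k\<^esub> c)"
  have Sk: "c \<in> S ?k \<Longrightarrow> c \<in> carrier (P ?k)" for c using dual_basisD(3)[OF dual] by blast
  have y: "y \<in> carrier (P ?k)" unfolding y_def using u Sk by (intro Pk.finsum_closed) auto
  have hy: "h y = (\<Oplus>\<^bsub>?R\<^esub>c\<in>S ?k. h c \<otimes>\<^bsub>R\<^esub> u c)" if h: "h \<in> mod_hom R (P ?k) ?R" for h
  proof -
    have "h y = (\<Oplus>\<^bsub>?R\<^esub>c\<in>S ?k. h (u c \<odot>\<^bsub>P ?k\<^esub> c))" unfolding y_def
      by (rule mod_hom_finsum[OF mP mR h dual_basisD(2)[OF dual]]) (use u Sk in auto)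
    also have "\<dots> = (\<Oplus>\<^bsub>?R\<^esub>c\<in>S ?k. h c \<otimes>\<^bsub>R\<^esub> u c)" unfolding self_module_finsum
      using mod_homD[OF h] u Sk by (intro R.finsum_cong') (auto simp: R.m_comm)
    finally show ?thesis .
  qed
  have "s i (d i y) = \<zero>\<^bsub>fsupp_module R (S i)\<^esub>"
  proof
    fix b
    show "s i (d i y) b = \<zero>\<^bsub>fsupp_module R (S i)\<^esub> b"
    proof (cases "b \<in> S i")
      case True
      have "s i (d i y) b = (\<Oplus>\<^bsub>?R\<^esub>c\<in>S ?k. s i (d i c) b \<otimes>\<^bsub>R\<^esub> u c)"
        by (rule hy[OF mod_hom_comp[OF dP mod_hom_dual_coord[OF dual]]])
      then show ?thesis using Du[OF True] by (simp add: tens_def)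
    next
      case False
      then show ?thesis using dual_basisD(7)[OF dual mod_homD(1)[OF dP y]] by simp
    qed
  qed
  then have "d i y = lin_ext R (P i) (\<lambda>x. x) \<zero>\<^bsub>fsupp_module R (S i)\<^esub>"
    using dual_basisD(5)[OF dual mod_homD(1)[OF dP y]] by simp
  then have "d i y = \<zero>\<^bsub>P i\<^esub>" by (simp add: lin_ext_def)
  then have "y \<in> cycles_at P d e M ?k" using y by simp
  then have "y \<in> d ?k ` carrier (P ?l)" using exact_uptoD(6)[OF exactP, of ?k ?l] by (simp del: cycles_at_simps)
  then obtain x where x: "x \<in> carrier (P ?l)" "d ?k x = y" by auto
  show "\<exists>w. (\<forall>c\<in>S ?l. w c \<in> carrier ?R) \<and> (\<forall>b\<in>S ?k. tens ?R (s ?k) (S ?k) (\<lambda>x. x) u b \<ominus>\<^bsub>?R\<^esub>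
        tens ?R (s ?k) (S ?l) (d ?k) w b \<in> {\<zero>\<^bsub>R\<^esub>})"
  proof (intro exI[of _ "s ?l x"] conjI ballI)
    fix b assume "b \<in> S ?k"
    have 1: "tens ?R (s ?k) (S ?k) (\<lambda>x. x) u b = s ?k y b"
      using hy[OF mod_hom_dual_coord[OF dual]] by (simp add: tens_def)
    have "tens ?R (s ?k) (S ?l) (d ?k) (\<lambda>c. s ?l x c \<odot>\<^bsub>?R\<^esub> \<one>\<^bsub>R\<^esub>) b = s ?k (d ?k x) b \<odot>\<^bsub>?R\<^esub> \<one>\<^bsub>R\<^esub>"
      by (rule tens_coord_smult[OF dual dual dP mR _ x(1)]) simp
    then have 2: "tens ?R (s ?k) (S ?l) (d ?k) (s ?l x) b = s ?k y b"
      using x dual_basisD(6)[OF dual] y by simp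
    show "tens ?R (s ?k) (S ?k) (\<lambda>x. x) u b \<ominus>\<^bsub>?R\<^esub> tens ?R (s ?k) (S ?l) (d ?k) (s ?l x) b \<in> {\<zero>\<^bsub>R\<^esub>}"
      unfolding 1 2 using dual_basisD(6)[OF dual y] by (simp add: a_minus_def self_module_neg[OF R] R.r_neg)
  qed (use dual_basisD(6)[OF dual x(1)] in simp)
qed

lemma exact_tensor_fsupp: "exact_tensor (fsupp_module R B) {\<zero>\<^bsub>fsupp_module R B\<^esub>} i"
proof (rule exact_tensorI)
  let ?k = "Suc i" and ?l = "Suc (Suc i)" and ?F = "fsupp_module R B" and ?R = "self_module R"
  interpret R: cring R by (rule R)
  note mR = module_self_module[OF R] and mF = module_fsupp_module[OF R, of B]
  fix u assume u: "\<And>c. c \<in> S ?k \<Longrightarrow> u c \<in> carrier ?F"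
    and Du: "\<And>b. b \<in> S i \<Longrightarrow> tens ?F (s i) (S ?k) (d i) u b \<in> {\<zero>\<^bsub>?F\<^esub>}"
  have coord: "tens ?F (s j) (S j') f v b \<beta> = tens ?R (s j) (S j') f (\<lambda>c. v c \<beta>) b"
    if "f \<in> mod_hom R (P j') (P j)" "\<And>c. c \<in> S j' \<Longrightarrow> v c \<in> carrier ?F" for j j' f v b \<beta>
    by (rule tens_natural[OF dual dual that(1) mF mR mod_hom_coord that(2)])
  define C where "C = (\<Union>c\<in>S ?k. {\<beta>. u c \<beta> \<noteq> \<zero>\<^bsub>R\<^esub>})"
  have C: "finite C" "C \<subseteq> B" using u dual_basisD(2)[OF dual[of ?k]] by (auto simp: C_def fsupp_carrier_iff)
  have "\<exists>w. (\<forall>c\<in>S ?l. w c \<in> carrier ?R) \<and> (\<forall>b\<in>S ?k. tens ?R (s ?k) (S ?k) (\<lambda>x. x) (\<lambda>c. u c \<beta>) b \<ominus>\<^bsub>?R\<^esub>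
        tens ?R (s ?k) (S ?l) (d ?k) w b \<in> {\<zero>\<^bsub>R\<^esub>})" for \<beta>
  proof -
    have 1: "u c \<beta> \<in> carrier ?R" if "c \<in> S ?k" for c using u[OF that] by (simp add: fsupp_carrier_iff)
    have 2: "tens ?R (s i) (S ?k) (d i) (\<lambda>c. u c \<beta>) b \<in> {\<zero>\<^bsub>R\<^esub>}" if "b \<in> S i" for b
    proof -
      have "tens ?F (s i) (S ?k) (d i) u b \<beta> = tens ?R (s i) (S ?k) (d i) (\<lambda>c. u c \<beta>) b"
        by (rule coord[OF dP u])
      then show ?thesis using Du[OF that] by simp
    qed
    show ?thesis by (rule exact_tensorD[where u="\<lambda>c. u c \<beta>", OF exact_tensor_self 1 2]) auto
  qed
  then obtain w where w: "\<And>\<beta> c. c \<in> S ?l \<Longrightarrow> w \<beta> c \<in> carrier R"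
    "\<And>\<beta> b. b \<in> S ?k \<Longrightarrow> tens ?R (s ?k) (S ?k) (\<lambda>x. x) (\<lambda>c. u c \<beta>) b \<ominus>\<^bsub>?R\<^esub>
        tens ?R (s ?k) (S ?l) (d ?k) (w \<beta>) b = \<zero>\<^bsub>R\<^esub>" by (simp, metis)
  define w' where "w' c \<beta> = (if \<beta> \<in> C then w \<beta> c else \<zero>\<^bsub>R\<^esub>)" for c \<beta>
  have w': "w' c \<in> carrier ?F" if "c \<in> S ?l" for c
    using w(1)[OF that] C finite_subset[of "{\<beta>. w' c \<beta> \<noteq> \<zero>\<^bsub>R\<^esub>}" C]
    by (auto simp: fsupp_carrier_iff w'_def)
  show "\<exists>w. (\<forall>c\<in>S ?l. w c \<in> carrier ?F) \<and> (\<forall>b\<in>S ?k. tens ?F (s ?k) (S ?k) (\<lambda>x. x) u b \<ominus>\<^bsub>?F\<^esub>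
        tens ?F (s ?k) (S ?l) (d ?k) w b \<in> {\<zero>\<^bsub>?F\<^esub>})"
  proof (intro exI[of _ w'] conjI ballI w'; simp only: singleton_iff)
    fix b assume b: "b \<in> S ?k"
    have "tens ?F (s ?k) (S ?l) (d ?k) w' b \<in> carrier ?F" by (rule tens_closed[OF dual dual dP mF w'])
    then show "tens ?F (s ?k) (S ?k) (\<lambda>x. x) u b \<ominus>\<^bsub>?F\<^esub> tens ?F (s ?k) (S ?l) (d ?k) w' b = \<zero>\<^bsub>?F\<^esub>"
    proof (subst fsupp_minus[OF R], assumption, intro ext)
      fix \<beta>
      have calc: "tens ?R (s ?k) (S ?k) (\<lambda>x. x) (\<lambda>c. u c \<beta>) b \<ominus>\<^bsub>R\<^esub> tens ?R (s ?k) (S ?l) (d ?k) (\<lambda>c. w' c \<beta>) b = \<zero>\<^bsub>R\<^esub>"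
      proof (cases "\<beta> \<in> C")
        case True
        have "tens ?R (s ?k) (S ?l) (d ?k) (w \<beta>) b \<in> carrier ?R"
          by (rule tens_closed[OF dual dual dP mR]) (simp add: w(1))
        then show ?thesis using w(2)[OF b, of \<beta>] True by (simp add: w'_def self_module_minus[OF R])
      next
        case False
        have "tens ?R (s ?k) (S ?l) (d ?k) (\<lambda>c. w' c \<beta>) b = \<zero>\<^bsub>?R\<^esub>"
          unfolding tens_def w'_def using False dual_basisD(3)[OF dual[of ?l]] dual_basisD(6)[OF dual]
            mod_homD(1)[OF dP] by (simp add: self_module_finsum subset_iff cong: R.finsum_cong)
        moreover have "tens ?R (s ?k) (S ?k) (\<lambda>x. x) (\<lambda>c. u c \<beta>) b = \<zero>\<^bsub>?R\<^esub>"
          unfolding tens_def using False dual_basisD(3)[OF dual[of ?k]] dual_basisD(6)[OF dual]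
          by (simp add: self_module_finsum subset_iff C_def cong: R.finsum_cong)
        ultimately show ?thesis by (simp add: a_minus_def)
      qed
      show "tens ?F (s ?k) (S ?k) (\<lambda>x. x) u b \<beta> \<ominus>\<^bsub>R\<^esub> tens ?F (s ?k) (S ?l) (d ?k) w' b \<beta> = \<zero>\<^bsub>?F\<^esub> \<beta>"
      proof -
        have "tens ?F (s ?k) (S ?k) (\<lambda>x. x) u b \<beta> = tens ?R (s ?k) (S ?k) (\<lambda>x. x) (\<lambda>c. u c \<beta>) b"
          by (rule coord[OF mod_hom_id u])
        moreover have "tens ?F (s ?k) (S ?l) (d ?k) w' b \<beta> = tens ?R (s ?k) (S ?l) (d ?k) (\<lambda>c. w' c \<beta>) b"
          by (rule coord[OF dP w'])
        ultimately show ?thesis using calc by simp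
      qed
    qed
  qed
qed

lemma exact_tensor_proj:
  assumes "proj R L"
  shows "exact_tensor L {\<zero>\<^bsub>L\<^esub>} i"
proof (rule exact_tensorI)
  let ?k = "Suc i" and ?l = "Suc (Suc i)" and ?F = "fsupp_module R (carrier L)" and ?\<pi> = "lin_ext R L (\<lambda>x. x)"
  obtain t where mL: "module R L" and t: "t \<in> mod_hom R L ?F" "\<And>x. x \<in> carrier L \<Longrightarrow> ?\<pi> (t x) = x"
    using assms by (auto simp: proj_def)
  note mF = module_fsupp_module[OF R, of "carrier L"]
  have \<pi>: "?\<pi> \<in> mod_hom R ?F L" by (rule lin_ext_hom[OF mL]) simp
  fix u assume u: "\<And>c. c \<in> S ?k \<Longrightarrow> u c \<in> carrier L"
    and Du: "\<And>b. b \<in> S i \<Longrightarrow> tens L (s i) (S ?k) (d i) u b \<in> {\<zero>\<^bsub>L\<^esub>}"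
  have tu: "t (u c) \<in> carrier ?F" if "c \<in> S ?k" for c using mod_homD(1)[OF t(1)] u that by simp
  have 1: "tens ?F (s i) (S ?k) (d i) (\<lambda>c. t (u c)) b \<in> {\<zero>\<^bsub>?F\<^esub>}" if "b \<in> S i" for b
    using tens_natural[where u=u, OF dual dual dP[of i] mL mF t(1) u, symmetric] Du[OF that] mod_hom_zero[OF mL mF t(1)] by simp
  from exact_tensorD[where u="\<lambda>c. t (u c)", OF exact_tensor_fsupp tu this] obtain w where w: "\<And>c. c \<in> S ?l \<Longrightarrow> w c \<in> carrier ?F"
    "\<And>b. b \<in> S ?k \<Longrightarrow> tens ?F (s ?k) (S ?k) (\<lambda>x. x) (\<lambda>c. t (u c)) b \<ominus>\<^bsub>?F\<^esub>
        tens ?F (s ?k) (S ?l) (d ?k) w b \<in> {\<zero>\<^bsub>?F\<^esub>}" by blast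
  show "\<exists>w. (\<forall>c\<in>S ?l. w c \<in> carrier L) \<and> (\<forall>b\<in>S ?k. tens L (s ?k) (S ?k) (\<lambda>x. x) u b \<ominus>\<^bsub>L\<^esub>
        tens L (s ?k) (S ?l) (d ?k) w b \<in> {\<zero>\<^bsub>L\<^esub>})"
  proof (intro exI[of _ "\<lambda>c. ?\<pi> (w c)"] conjI ballI)
    fix b assume b: "b \<in> S ?k"
    let ?A = "tens ?F (s ?k) (S ?k) (\<lambda>x. x) (\<lambda>c. t (u c)) b" and ?B = "tens ?F (s ?k) (S ?l) (d ?k) w b"
    have A: "?A \<in> carrier ?F" by (rule tens_closed[OF dual dual mod_hom_id mF tu])
    have B: "?B \<in> carrier ?F" by (rule tens_closed[OF dual dual dP mF w(1)])
    have "?\<pi> (?A \<ominus>\<^bsub>?F\<^esub> ?B) = \<zero>\<^bsub>L\<^esub>" using w(2)[OF b] mod_hom_zero[OF mF mL \<pi>] by (simp only: singleton_iff)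
    then have "?\<pi> ?A \<ominus>\<^bsub>L\<^esub> ?\<pi> ?B = \<zero>\<^bsub>L\<^esub>" using mod_hom_minus_apply[OF mF mL \<pi> A B] by simp
    moreover have "?\<pi> ?A = tens L (s ?k) (S ?k) (\<lambda>x. x) (\<lambda>c. ?\<pi> (t (u c))) b"
      by (rule tens_natural[OF dual dual mod_hom_id mF mL \<pi> tu])
    moreover have "\<dots> = tens L (s ?k) (S ?k) (\<lambda>x. x) u b"
      by (rule tens_cong[OF dual dual mod_hom_id mL u]) (auto simp: t(2) u)
    moreover have "?\<pi> ?B = tens L (s ?k) (S ?l) (d ?k) (\<lambda>c. ?\<pi> (w c)) b"
      by (rule tens_natural[OF dual dual dP mF mL \<pi> w(1)])
    ultimately show "tens L (s ?k) (S ?k) (\<lambda>x. x) u b \<ominus>\<^bsub>L\<^esub> tens L (s ?k) (S ?l) (d ?k) (\<lambda>c. ?\<pi> (w c)) b \<in> {\<zero>\<^bsub>L\<^esub>}"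
      by simp
  qed (use mod_homD(1)[OF \<pi>] w(1) in auto)
qed

end

section \<open>Spans and ideals\<close>

lemma module_minus_zero:
  assumes "module R M" "x \<in> carrier M"
  shows "x \<ominus>\<^bsub>M\<^esub> \<zero>\<^bsub>M\<^esub> = x"
proof -
  interpret M: module R M by fact
  have "\<ominus>\<^bsub>M\<^esub> \<zero>\<^bsub>M\<^esub> = \<zero>\<^bsub>M\<^esub>" by (rule M.minus_equality) auto
  then show ?thesis using assms(2) by (simp add: a_minus_def)
qed

definition span_of :: "'a ring \<Rightarrow> ('a, 'b) module \<Rightarrow> 'b set \<Rightarrow> 'b set" where
  "span_of R M S = lin_ext R M (\<lambda>x. x) ` carrier (fsupp_module R S)"

lemma span_of_submodule:
  assumes "module R M" "S \<subseteq> carrier M"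
  shows "submodule (span_of R M S) R M"
proof -
  have R: "cring R" using assms(1) by (simp add: module_def)
  show ?thesis unfolding span_of_def
    by (rule image_submodule[OF module_fsupp_module[OF R] assms(1) lin_ext_hom[OF assms(1)]]) (use assms in simp)
qed

lemma span_of_self:
  assumes "module R M" "S \<subseteq> carrier M"
  shows "S \<subseteq> span_of R M S"
proof
  fix b assume b: "b \<in> S"
  show "b \<in> span_of R M S" unfolding span_of_def
    using lin_ext_unit[OF assms(1) _ b, of "\<lambda>x. x"] assms(2) by (metis image_ident imageI)
qed

lemma span_of_least:
  assumes "module R M" "submodule N R M" "S \<subseteq> N"
  shows "span_of R M S \<subseteq> N"
proof
  note E = module.submoduleE[OF assms(1,2)]
  fix y assume "y \<in> span_of R M S"
  then obtain f where f: "f \<in> carrier (fsupp_module R S)" "y = lin_ext R M (\<lambda>x. x) f" by (auto simp: span_of_def)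
  show "y \<in> N" unfolding f(2) lin_ext_def using f(1) assms(3)
    by (intro submodule_smult_closed_finsum[OF assms(1,2)]) (auto simp: fsupp_carrier_iff intro!: E(4))
qed

text \<open>A generator with an invertible coefficient in a relation could be expressed by the others.\<close>

lemma minimal_generators_relation:
  assumes "module R M" "finite S" "S \<subseteq> carrier M"
    "\<And>S'. S' \<subseteq> carrier M \<Longrightarrow> finite S' \<Longrightarrow> span_of R M S' = span_of R M S \<Longrightarrow> card S \<le> card S'"
    "r \<in> carrier (fsupp_module R S)" "lin_ext R M (\<lambda>x. x) r = \<zero>\<^bsub>M\<^esub>" "c0 \<in> S"
  shows "r c0 \<notin> Units R"
proof
  interpret M: module R M by fact
  assume unit: "r c0 \<in> Units R"
  define S' where "S' = S - {c0}"
  have S': "finite S'" "S' \<subseteq> carrier M" "c0 \<notin> S'" "S = insert c0 S'" using assms(2,3,7) by (auto simp: S'_def)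
  have c0: "c0 \<in> carrier M" using assms(3,7) by blast
  have r: "r c \<in> carrier R" for c using assms(5) by (simp add: fsupp_carrier_iff)
  note sub = span_of_submodule[OF assms(1) S'(2)]
  note E = M.submoduleE[OF sub]
  define y where "y = (\<Oplus>\<^bsub>M\<^esub>c\<in>S'. r c \<odot>\<^bsub>M\<^esub> c)"
  have yc: "y \<in> carrier M" unfolding y_def using S' r by (intro M.finsum_closed) auto
  have "lin_ext R M (\<lambda>x. x) r = (\<Oplus>\<^bsub>M\<^esub>c\<in>S. r c \<odot>\<^bsub>M\<^esub> c)"
    by (rule lin_ext_eq[OF assms(1,5)]) (use assms(2,3,5) in \<open>auto simp: fsupp_carrier_iff\<close>)
  also have "\<dots> = r c0 \<odot>\<^bsub>M\<^esub> c0 \<oplus>\<^bsub>M\<^esub> y" unfolding y_def S'(4)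
    using S' r c0 by (intro M.finsum_insert) auto
  finally have "r c0 \<odot>\<^bsub>M\<^esub> c0 = \<ominus>\<^bsub>M\<^esub> y"
    using assms(6) yc c0 r by (metis M.minus_equality M.smult_closed)
  moreover have "y \<in> span_of R M S'" unfolding y_def
    by (rule submodule_smult_closed_finsum[OF assms(1) sub S'(1)])
      (use span_of_self[OF assms(1) S'(2)] r in \<open>auto intro!: E(4)\<close>)
  ultimately have "r c0 \<odot>\<^bsub>M\<^esub> c0 \<in> span_of R M S'" using E(3) by simp
  then have "inv\<^bsub>R\<^esub> (r c0) \<odot>\<^bsub>M\<^esub> (r c0 \<odot>\<^bsub>M\<^esub> c0) \<in> span_of R M S'" using E(4) unit by simp
  moreover have "inv\<^bsub>R\<^esub> (r c0) \<odot>\<^bsub>M\<^esub> (r c0 \<odot>\<^bsub>M\<^esub> c0) = (inv\<^bsub>R\<^esub> (r c0) \<otimes>\<^bsub>R\<^esub> r c0) \<odot>\<^bsub>M\<^esub> c0"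
    by (rule M.smult_assoc1[symmetric]) (use unit c0 r in auto)
  ultimately have c0S: "c0 \<in> span_of R M S'" using M.R.Units_l_inv[OF unit] c0 by simp
  have "span_of R M S' = span_of R M S"
  proof
    show "span_of R M S' \<subseteq> span_of R M S"
      by (rule span_of_least[OF assms(1) span_of_submodule[OF assms(1,3)]])
        (use span_of_self[OF assms(1,3)] in \<open>auto simp: S'_def\<close>)
    show "span_of R M S \<subseteq> span_of R M S'"
      by (rule span_of_least[OF assms(1) sub]) (use c0S span_of_self[OF assms(1) S'(2)] S'(4) in auto)
  qed
  from assms(4)[OF S'(2,1) this] show False using S' by simp
qed

lemma ideal_iff_submodule:
  assumes "cring R"
  shows "ideal I R \<longleftrightarrow> submodule I R (self_module R)"
proof -
  interpret R: cring R by fact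
  interpret S: module R "self_module R" by (rule module_self_module[OF assms])
  show ?thesis
  proof
    assume "ideal I R"
    then interpret I: ideal I R .
    show "submodule I R (self_module R)"
      by (rule S.submoduleI) (auto simp: self_module_neg[OF assms] I.I_l_closed)
  next
    assume I: "submodule I R (self_module R)"
    note E = S.submoduleE[OF I, simplified]
    have "\<ominus>\<^bsub>R\<^esub> a \<in> I" if "a \<in> I" for a
      using E(3)[OF that] self_module_neg[OF assms, of a] E(1) that by auto
    then have "subgroup I (add_monoid R)"
      using E(1,2,5) by (intro R.add.subgroupI) (auto simp: a_inv_def)
    then show "ideal I R"
    proof (rule idealI[OF R.ring_axioms])
      show "x \<otimes>\<^bsub>R\<^esub> a \<in> I" if "a \<in> I" "x \<in> carrier R" for a x using E(4) that by simp
      then show "a \<otimes>\<^bsub>R\<^esub> x \<in> I" if "a \<in> I" "x \<in> carrier R" for a x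
        using R.m_comm[of a x] E(1) that by auto
    qed
  qed
qed

lemma genideal_eq_span:
  assumes "cring R" "S \<subseteq> carrier R"
  shows "Idl\<^bsub>R\<^esub> S = span_of R (self_module R) S"
proof -
  interpret R: cring R by fact
  note m = module_self_module[OF assms(1)]
  have S: "S \<subseteq> carrier (self_module R)" using assms(2) by simp
  show ?thesis
  proof
    show "Idl\<^bsub>R\<^esub> S \<subseteq> span_of R (self_module R) S"
      using span_of_submodule[OF m S] span_of_self[OF m S]
      by (intro R.genideal_minimal) (auto simp: ideal_iff_submodule[OF assms(1)])
    show "span_of R (self_module R) S \<subseteq> Idl\<^bsub>R\<^esub> S"
      using R.genideal_ideal[OF assms(2)] R.genideal_self[OF assms(2)]
      by (intro span_of_least[OF m]) (auto simp: ideal_iff_submodule[OF assms(1)])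
  qed
qed

section \<open>Cyclic quotients of the ring\<close>

text \<open>Module axioms for a structure onto which a module is mapped compatibly with the operations; this
  avoids checking them for cosets.\<close>

lemma module_of_surjection:
  assumes "module R M" "\<pi> ` carrier M = carrier N" "\<pi> \<zero>\<^bsub>M\<^esub> = \<zero>\<^bsub>N\<^esub>"
    "\<And>x y. x \<in> carrier M \<Longrightarrow> y \<in> carrier M \<Longrightarrow> \<pi> x \<oplus>\<^bsub>N\<^esub> \<pi> y = \<pi> (x \<oplus>\<^bsub>M\<^esub> y)"
    "\<And>r x. r \<in> carrier R \<Longrightarrow> x \<in> carrier M \<Longrightarrow> r \<odot>\<^bsub>N\<^esub> \<pi> x = \<pi> (r \<odot>\<^bsub>M\<^esub> x)"
  shows "module R N" "\<pi> \<in> mod_hom R M N"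
proof -
  interpret M: module R M by fact
  have ex: "\<exists>y\<in>carrier M. \<pi> y = x" if "x \<in> carrier N" for x using that assms(2) by (metis imageE)
  have cl: "\<pi> x \<in> carrier N" if "x \<in> carrier M" for x using that assms(2) by blast
  show "\<pi> \<in> mod_hom R M N" using assms(4,5) cl by (intro mod_homI) auto
  show "module R N"
  proof (rule moduleI[OF M.R.cring_axioms abelian_groupI])
    fix x y z assume x: "x \<in> carrier N" and y: "y \<in> carrier N" and z: "z \<in> carrier N"
    obtain x' y' z' where c: "x' \<in> carrier M" "y' \<in> carrier M" "z' \<in> carrier M" "x = \<pi> x'" "y = \<pi> y'" "z = \<pi> z'"
      using ex[OF x] ex[OF y] ex[OF z] by blast
    show "x \<oplus>\<^bsub>N\<^esub> y \<in> carrier N" using c by (simp add: assms(4) cl)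
    show "x \<oplus>\<^bsub>N\<^esub> y \<oplus>\<^bsub>N\<^esub> z = x \<oplus>\<^bsub>N\<^esub> (y \<oplus>\<^bsub>N\<^esub> z)" using c by (simp add: assms(4) M.a_assoc)
    show "x \<oplus>\<^bsub>N\<^esub> y = y \<oplus>\<^bsub>N\<^esub> x" using c by (simp add: assms(4) M.a_comm)
    show "\<zero>\<^bsub>N\<^esub> \<oplus>\<^bsub>N\<^esub> x = x" using c assms(4)[of "\<zero>\<^bsub>M\<^esub>" x'] by (simp add: assms(3))
    show "\<exists>y\<in>carrier N. y \<oplus>\<^bsub>N\<^esub> x = \<zero>\<^bsub>N\<^esub>"
      using c by (intro bexI[of _ "\<pi> (\<ominus>\<^bsub>M\<^esub> x')"]) (auto simp: assms(4) M.l_neg assms(3) cl)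
    fix a assume a: "a \<in> carrier R"
    show "a \<odot>\<^bsub>N\<^esub> x \<in> carrier N" using c a by (simp add: assms(5) cl)
    show "a \<odot>\<^bsub>N\<^esub> (x \<oplus>\<^bsub>N\<^esub> y) = a \<odot>\<^bsub>N\<^esub> x \<oplus>\<^bsub>N\<^esub> a \<odot>\<^bsub>N\<^esub> y"
      using c a by (simp add: assms(4,5) M.smult_r_distr)
    fix b assume b: "b \<in> carrier R"
    show "(a \<oplus>\<^bsub>R\<^esub> b) \<odot>\<^bsub>N\<^esub> x = a \<odot>\<^bsub>N\<^esub> x \<oplus>\<^bsub>N\<^esub> b \<odot>\<^bsub>N\<^esub> x"
      using c a b by (simp add: assms(4,5) M.smult_l_distr)
    show "(a \<otimes>\<^bsub>R\<^esub> b) \<odot>\<^bsub>N\<^esub> x = a \<odot>\<^bsub>N\<^esub> (b \<odot>\<^bsub>N\<^esub> x)"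
      using c a b by (simp add: assms(5) M.smult_assoc1)
  next
    fix x assume "x \<in> carrier N"
    then obtain x' where "x' \<in> carrier M" "x = \<pi> x'" using ex by blast
    then show "\<one>\<^bsub>R\<^esub> \<odot>\<^bsub>N\<^esub> x = x" by (simp add: assms(5))
  qed (use assms(3) cl[OF M.zero_closed] in simp)
qed

lemma quot_module_facts:
  assumes "cring R" "ideal I R"
  shows "module R (quot_module R I)"
    "(\<lambda>r. I +>\<^bsub>R\<^esub> r) \<in> mod_hom R (self_module R) (quot_module R I)"
    "(\<lambda>r. I +>\<^bsub>R\<^esub> r) ` carrier R = carrier (quot_module R I)"
    "r \<in> carrier R \<Longrightarrow> I +>\<^bsub>R\<^esub> r = \<zero>\<^bsub>quot_module R I\<^esub> \<longleftrightarrow> r \<in> I"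
proof -
  interpret R: cring R by fact
  interpret I: ideal I R by fact
  let ?Q = "quot_module R I" and ?\<pi> = "\<lambda>r. I +>\<^bsub>R\<^esub> r"
  show im: "?\<pi> ` carrier R = carrier ?Q"
    by (auto simp: quot_module_def FactRing_def A_RCOSETS_def RCOSETS_def a_r_coset_def)
  show zero: "I +>\<^bsub>R\<^esub> r = \<zero>\<^bsub>?Q\<^esub> \<longleftrightarrow> r \<in> I" if "r \<in> carrier R" for r
    using I.a_rcos_const I.a_rcos_self[OF that] by (auto simp: quot_module_def FactRing_def)
  have sm: "r \<odot>\<^bsub>?Q\<^esub> ?\<pi> x = ?\<pi> (r \<otimes>\<^bsub>R\<^esub> x)" if r: "r \<in> carrier R" and x: "x \<in> carrier R" for r x
  proof -
    have "I +>\<^bsub>R\<^esub> (r \<otimes>\<^bsub>R\<^esub> y) = I +>\<^bsub>R\<^esub> (r \<otimes>\<^bsub>R\<^esub> x)" if y: "y \<in> I +>\<^bsub>R\<^esub> x" for y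
    proof -
      have yc: "y \<in> carrier R" using I.a_elemrcos_carrier[OF x y] .
      have "r \<otimes>\<^bsub>R\<^esub> (y \<ominus>\<^bsub>R\<^esub> x) \<in> I"
        using I.a_rcos_module_minus[OF R.ring_axioms x yc] y r by (intro I.I_l_closed) auto
      then have "r \<otimes>\<^bsub>R\<^esub> y \<in> I +>\<^bsub>R\<^esub> (r \<otimes>\<^bsub>R\<^esub> x)"
        using r x yc by (subst I.a_rcos_module_minus[OF R.ring_axioms])
          (auto simp: a_minus_def R.r_distr R.r_minus)
      then show ?thesis using I.a_repr_independence'[of "r \<otimes>\<^bsub>R\<^esub> y" "r \<otimes>\<^bsub>R\<^esub> x"] r x by simp
    qed
    note const = this
    have "r \<odot>\<^bsub>?Q\<^esub> ?\<pi> x = (\<Union>y\<in>I +>\<^bsub>R\<^esub> x. I +>\<^bsub>R\<^esub> (r \<otimes>\<^bsub>R\<^esub> y))" by (simp add: quot_module_def)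
    also have "\<dots> = (\<Union>y\<in>I +>\<^bsub>R\<^esub> x. I +>\<^bsub>R\<^esub> (r \<otimes>\<^bsub>R\<^esub> x))" by (rule SUP_cong[OF refl const])
    also have "\<dots> = I +>\<^bsub>R\<^esub> (r \<otimes>\<^bsub>R\<^esub> x)" using I.a_rcos_self[OF x] by (intro cSUP_const) auto
    finally show ?thesis .
  qed
  have z0: "?\<pi> \<zero>\<^bsub>self_module R\<^esub> = \<zero>\<^bsub>?Q\<^esub>" using zero[of "\<zero>\<^bsub>R\<^esub>"] I.zero_closed by simp
  have im': "?\<pi> ` carrier (self_module R) = carrier ?Q" using im by simp
  have ad: "?\<pi> x \<oplus>\<^bsub>?Q\<^esub> ?\<pi> y = ?\<pi> (x \<oplus>\<^bsub>self_module R\<^esub> y)"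
    if "x \<in> carrier (self_module R)" "y \<in> carrier (self_module R)" for x y
    using that I.a_rcos_sum by (simp add: quot_module_def FactRing_def)
  have sm': "r \<odot>\<^bsub>?Q\<^esub> ?\<pi> x = ?\<pi> (r \<odot>\<^bsub>self_module R\<^esub> x)"
    if "r \<in> carrier R" "x \<in> carrier (self_module R)" for r x using that sm by simp
  note * = module_of_surjection[OF module_self_module[OF assms(1)] im' z0 ad sm']
  show "module R ?Q" "?\<pi> \<in> mod_hom R (self_module R) ?Q" using * by auto
qed

lemma quot_module_cyclic:
  assumes "cring R" "ideal I R"
  shows "cyclic_module R (quot_module R I)"
proof -
  interpret R: cring R by fact
  note Q = quot_module_facts[OF assms]
  have "r \<odot>\<^bsub>quot_module R I\<^esub> (I +>\<^bsub>R\<^esub> \<one>\<^bsub>R\<^esub>) = I +>\<^bsub>R\<^esub> r" if "r \<in> carrier R" for r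
    using mod_homD(3)[OF Q(2) that, of "\<one>\<^bsub>R\<^esub>"] that by simp
  then have "carrier (quot_module R I) = {r \<odot>\<^bsub>quot_module R I\<^esub> (I +>\<^bsub>R\<^esub> \<one>\<^bsub>R\<^esub>) | r. r \<in> carrier R}"
    unfolding Q(3)[symmetric] by force
  moreover have "I +>\<^bsub>R\<^esub> \<one>\<^bsub>R\<^esub> \<in> carrier (quot_module R I)" using Q(3) by blast
  ultimately show ?thesis unfolding cyclic_module_def using Q(1) by blast
qed

lemma quot_module_presented:
  fixes R :: "'a ring"
  assumes "cring R" "finite S" "S \<subseteq> carrier R"
  shows "n_presented R 1 (quot_module R (Idl\<^bsub>R\<^esub> S))"
proof -
  interpret R: cring R by fact
  let ?I = "Idl\<^bsub>R\<^esub> S" and ?R = "self_module R"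
  note I = R.genideal_ideal[OF assms(3)]
  note Q = quot_module_facts[OF assms(1) I]
  obtain t :: "nat \<Rightarrow> 'a" and k where t: "S = t ` {..<k}"
    using finite_imp_nat_seg_image_inj_on[OF assms(2)] by (auto simp: lessThan_def)
  let ?B = "{0 :: nat}"
  define F :: "nat \<Rightarrow> ('a, nat \<Rightarrow> 'a) module" where
    "F i = (if i = 0 then fsupp_module R ?B else fsupp_module R {..<k})" for i
  define d :: "nat \<Rightarrow> (nat \<Rightarrow> 'a) \<Rightarrow> nat \<Rightarrow> 'a" where
    "d i = (\<lambda>f b. if b \<in> ?B then lin_ext R ?R t f else \<zero>\<^bsub>R\<^esub>)" for i
  define e where "e f = ?I +>\<^bsub>R\<^esub> f 0" for f :: "nat \<Rightarrow> 'a"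
  note mR = module_self_module[OF assms(1)]
  have tR: "t ` {..<k} \<subseteq> carrier ?R" using t assms(3) by simp
  have Ft: "\<forall>i\<le>1. fg_free_module R (F i)" by (simp add: F_def fg_free_fsupp[OF assms(1)])
  have d: "d 0 \<in> mod_hom R (fsupp_module R {..<k}) (fsupp_module R ?B)"
    unfolding d_def by (rule mod_hom_into_fsupp[OF assms(1)]) (auto intro: lin_ext_hom[OF mR tR])
  have e: "e \<in> mod_hom R (fsupp_module R ?B) (quot_module R ?I)"
    unfolding e_def[abs_def] by (rule mod_hom_comp[OF mod_hom_coord Q(2)])
  have unit: "(\<lambda>b. if b \<in> ?B then r else \<zero>\<^bsub>R\<^esub>) \<in> carrier (fsupp_module R ?B)" if "r \<in> carrier R" for r
    using that by (auto simp: fsupp_carrier_finite)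
  have onto: "e ` carrier (fsupp_module R ?B) = carrier (quot_module R ?I)"
  proof
    show "e ` carrier (fsupp_module R ?B) \<subseteq> carrier (quot_module R ?I)" using mod_homD(1)[OF e] by auto
    show "carrier (quot_module R ?I) \<subseteq> e ` carrier (fsupp_module R ?B)"
    proof
      fix q assume "q \<in> carrier (quot_module R ?I)"
      then obtain r where r: "r \<in> carrier R" "q = ?I +>\<^bsub>R\<^esub> r" unfolding Q(3)[symmetric] by blast
      show "q \<in> e ` carrier (fsupp_module R ?B)"
        by (rule image_eqI[OF _ unit[OF r(1)]]) (simp add: e_def r(2))
    qed
  qed
  have span: "?I = lin_ext R ?R t ` carrier (fsupp_module R {..<k})"
  proof
    have "submodule (lin_ext R ?R t ` carrier (fsupp_module R {..<k})) R ?R"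
      by (rule image_submodule[OF module_fsupp_module[OF assms(1)] mR lin_ext_hom[OF mR tR]])
    moreover have "S \<subseteq> lin_ext R ?R t ` carrier (fsupp_module R {..<k})"
    proof
      fix x assume "x \<in> S"
      then obtain b where b: "b \<in> {..<k}" "x = t b" using t by blast
      show "x \<in> lin_ext R ?R t ` carrier (fsupp_module R {..<k})"
        using lin_ext_unit[OF mR tR b(1)] b(2) by (metis imageI)
    qed
    ultimately show "?I \<subseteq> lin_ext R ?R t ` carrier (fsupp_module R {..<k})"
      by (intro R.genideal_minimal) (simp_all add: ideal_iff_submodule[OF assms(1)])
    have sI: "submodule ?I R ?R" using I ideal_iff_submodule[OF assms(1)] by blast
    have tI: "t ` {..<k} \<subseteq> ?I" using R.genideal_self[OF assms(3)] t by simp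
    show "lin_ext R ?R t ` carrier (fsupp_module R {..<k}) \<subseteq> ?I"
    proof (rule image_subsetI)
      fix f assume f: "f \<in> carrier (fsupp_module R {..<k})"
      have "f b \<odot>\<^bsub>?R\<^esub> t b \<in> ?I" if "b \<in> {b. f b \<noteq> \<zero>\<^bsub>R\<^esub>}" for b
      proof -
        have "b \<in> {..<k}" "f b \<in> carrier R" using f that by (auto simp: fsupp_carrier_iff)
        then show ?thesis using tI module.submoduleE(4)[OF mR sI] by blast
      qed
      then show "lin_ext R ?R t f \<in> ?I" unfolding lin_ext_def
        using f by (intro submodule_smult_closed_finsum[OF mR sI]) (auto simp: fsupp_carrier_iff)
    qed
  qed
  have ker: "d 0 ` carrier (fsupp_module R {..<k}) =
      {f \<in> carrier (fsupp_module R ?B). e f = \<zero>\<^bsub>quot_module R ?I\<^esub>}"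
  proof
    show "d 0 ` carrier (fsupp_module R {..<k}) \<subseteq> {f \<in> carrier (fsupp_module R ?B). e f = \<zero>\<^bsub>quot_module R ?I\<^esub>}"
    proof (rule image_subsetI)
      fix f assume f: "f \<in> carrier (fsupp_module R {..<k})"
      have "lin_ext R ?R t f \<in> ?I" using span f by blast
      moreover have "lin_ext R ?R t f \<in> carrier R" using mod_homD(1)[OF lin_ext_hom[OF mR tR] f] by simp
      ultimately show "d 0 f \<in> {f \<in> carrier (fsupp_module R ?B). e f = \<zero>\<^bsub>quot_module R ?I\<^esub>}"
        using mod_homD(1)[OF d f] Q(4) by (simp add: e_def d_def)
    qed
    show "{f \<in> carrier (fsupp_module R ?B). e f = \<zero>\<^bsub>quot_module R ?I\<^esub>} \<subseteq> d 0 ` carrier (fsupp_module R {..<k})"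
    proof
      fix f assume "f \<in> {f \<in> carrier (fsupp_module R ?B). e f = \<zero>\<^bsub>quot_module R ?I\<^esub>}"
      then have f: "f \<in> carrier (fsupp_module R ?B)" "e f = \<zero>\<^bsub>quot_module R ?I\<^esub>" by auto
      have "f 0 \<in> ?I" using f Q(4)[of "f 0"] by (simp add: e_def fsupp_carrier_iff)
      then obtain g where g: "g \<in> carrier (fsupp_module R {..<k})" "f 0 = lin_ext R ?R t g" using span by blast
      have "f = d 0 g" using f(1) g(2) by (auto simp: d_def fsupp_carrier_iff fun_eq_iff)
      then show "f \<in> d 0 ` carrier (fsupp_module R {..<k})" using g(1) by blast
    qed
  qed
  have "exact_upto R 1 F d e (quot_module R ?I)"
    unfolding exact_upto_iff using Q(1) e onto d ker module_fsupp_module[OF assms(1)]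
    by (auto simp: F_def)
  then show ?thesis unfolding n_presented_def using Ft by blast
qed

section \<open>Splitting the first map of a finite resolution\<close>

text \<open>Villamayor's argument for recovering a finite family in \<open>P\<close> from its image under \<open>f\<close>. Having
  recovered one element by \<open>\<theta>\<close>, apply the induction hypothesis to what \<open>\<theta>\<close> gets wrong about the
  others. The invariant \<open>Ind\<close> records what makes it possible to recover single elements.\<close>

lemma recover_finite_family:
  assumes "module R P" "module R P'" "f \<in> mod_hom R P P'"
    "\<And>a C x. finite C \<Longrightarrow> a \<notin> C \<Longrightarrow> Ind (insert a C) x \<Longrightarrow> (\<And>c. c \<in> insert a C \<Longrightarrow> x c \<in> carrier P) \<Longrightarrow>
      \<exists>\<theta>\<in>mod_hom R P' P. \<theta> (f (x a)) = x a \<and> Ind C (\<lambda>c. x c \<ominus>\<^bsub>P\<^esub> \<theta> (f (x c)))"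
    "finite C" "Ind C x" "\<And>c. c \<in> C \<Longrightarrow> x c \<in> carrier P"
  shows "\<exists>\<theta>\<in>mod_hom R P' P. \<forall>c\<in>C. \<theta> (f (x c)) = x c"
  using assms(5-7)
proof (induction C arbitrary: x)
  case empty
  then show ?case using mod_hom_zero_map[OF assms(2,1)] by blast
next
  case (insert a C)
  interpret P: module R P by fact
  define y where "y \<theta> c = x c \<ominus>\<^bsub>P\<^esub> \<theta> (f (x c))" for \<theta> c
  obtain \<theta> where \<theta>: "\<theta> \<in> mod_hom R P' P" "\<theta> (f (x a)) = x a" "Ind C (y \<theta>)"
    using assms(4)[of C a x] insert.hyps insert.prems by (auto simp: y_def[abs_def])
  note fc = mod_homD(1)[OF assms(3)] and \<theta>c = mod_homD(1)[OF \<theta>(1)]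
  have y: "y \<theta> c \<in> carrier P" if "c \<in> C" for c using insert.prems(2)[of c] that \<theta>c[OF fc] by (simp add: y_def)
  from insert.IH[of "y \<theta>", OF \<theta>(3) y] obtain \<theta>' where \<theta>': "\<theta>' \<in> mod_hom R P' P"
    "\<And>c. c \<in> C \<Longrightarrow> \<theta>' (f (y \<theta> c)) = y \<theta> c" by blast
  define \<eta> where "\<eta> z = \<theta> z \<oplus>\<^bsub>P\<^esub> \<theta>' (z \<ominus>\<^bsub>P'\<^esub> f (\<theta> z))" for z
  have "(\<lambda>z. z \<ominus>\<^bsub>P'\<^esub> f (\<theta> z)) \<in> mod_hom R P' P'"
    by (rule mod_hom_minus[OF assms(2,2) mod_hom_id mod_hom_comp[OF \<theta>(1) assms(3)]])
  then have \<eta>: "\<eta> \<in> mod_hom R P' P" unfolding \<eta>_def[abs_def]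
    by (intro mod_hom_add[OF assms(2,1) \<theta>(1)] mod_hom_comp[OF _ \<theta>'(1)])
  have val: "\<eta> (f z) = \<theta> (f z) \<oplus>\<^bsub>P\<^esub> \<theta>' (f (z \<ominus>\<^bsub>P\<^esub> \<theta> (f z)))" if "z \<in> carrier P" for z
    unfolding \<eta>_def using mod_hom_minus_apply[OF assms(1-3) that \<theta>c[OF fc[OF that]]] by simp
  have "\<eta> (f (x c)) = x c" if c: "c \<in> insert a C" for c
  proof (cases "c = a")
    case True
    have "f \<zero>\<^bsub>P\<^esub> = \<zero>\<^bsub>P'\<^esub>" "\<theta>' \<zero>\<^bsub>P'\<^esub> = \<zero>\<^bsub>P\<^esub>" by (rule mod_hom_zero; fact assms \<theta>')+
    then show ?thesis using val[of "x a"] \<theta>(2) insert.prems(2)[of a] True by (simp add: a_minus_def P.r_neg)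
  next
    case False
    then have "\<theta>' (f (y \<theta> c)) = y \<theta> c" "x c \<in> carrier P" using \<theta>'(2) c insert.prems(2)[OF c] by auto
    then show ?thesis using val[of "x c"] \<theta>c[OF fc, of "x c"]
      by (simp add: y_def a_minus_def P.a_ac P.r_neg P.r_neg1 P.r_neg2)
  qed
  then show ?case using \<eta> by blast
qed

lemma hom_id_on_dual_basis:
  assumes "dual_basis R P S s" "h \<in> mod_hom R P P" "\<And>c. c \<in> S \<Longrightarrow> h c = c" "x \<in> carrier P"
  shows "h x = x"
proof -
  note P = dual_basisD[OF assms(1)]
  have "h x = (\<Oplus>\<^bsub>P\<^esub>c\<in>S. s x c \<odot>\<^bsub>P\<^esub> h c)" by (rule dual_basis_sum[OF assms(1) P(1) assms(2,4)])
  also have "\<dots> = (\<Oplus>\<^bsub>P\<^esub>c\<in>S. s x c \<odot>\<^bsub>P\<^esub> c)"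
  proof -
    interpret P: module R P by (rule P(1))
    show ?thesis using assms(3) P(3,6) assms(4) by (intro P.finsum_cong') auto
  qed
  also have "\<dots> = x" using dual_basis_sum[OF assms(1) P(1) mod_hom_id assms(4)] by simp
  finally show ?thesis .
qed

text \<open>If the coordinates of \<open>x\<close> lie in the ideal generated by those of \<open>f x\<close>, then \<open>x\<close> can be
  recovered from \<open>f x\<close>: the values at \<open>f x\<close> of homs to \<open>P\<close> form a submodule, which contains
  \<open>a \<cdot> c\<close> for every coordinate \<open>a\<close> of \<open>f x\<close>.\<close>

lemma recover_element:
  assumes "dual_basis R P S s" "dual_basis R P' S' s'" "f \<in> mod_hom R P P'" "x \<in> carrier P"
    "\<And>c. c \<in> S \<Longrightarrow> s x c \<in> Idl\<^bsub>R\<^esub> (s' (f x) ` S')"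
  shows "\<exists>\<theta>\<in>mod_hom R P' P. \<theta> (f x) = x"
proof -
  note P = dual_basisD[OF assms(1)] and P' = dual_basisD[OF assms(2)]
  interpret P: module R P by (rule P(1))
  interpret P': module R P' by (rule P'(1))
  note R = P.R.cring_axioms
  note fx = mod_homD(1)[OF assms(3,4)]
  define A where "A = {\<alpha> (f x) | \<alpha>. \<alpha> \<in> mod_hom R P' (self_module R)}"
  note mR = module_self_module[OF R]
  interpret S: module R "self_module R" by (rule mR)
  have "submodule A R (self_module R)"
  proof (rule S.submoduleI)
    show "A \<subseteq> carrier (self_module R)" by (auto simp: A_def dest: mod_homD(1)[OF _ fx])
    show "\<zero>\<^bsub>self_module R\<^esub> \<in> A" unfolding A_def using mod_hom_zero_map[OF P'(1) mR] by force
    show "\<ominus>\<^bsub>self_module R\<^esub> a \<in> A" if a: "a \<in> A" for a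
    proof -
      obtain \<alpha> where \<alpha>: "a = \<alpha> (f x)" "\<alpha> \<in> mod_hom R P' (self_module R)" using a by (auto simp: A_def)
      have "(\<lambda>y. \<zero>\<^bsub>self_module R\<^esub> \<ominus>\<^bsub>self_module R\<^esub> \<alpha> y) \<in> mod_hom R P' (self_module R)"
        by (rule mod_hom_minus[OF P'(1) mR mod_hom_zero_map[OF P'(1) mR] \<alpha>(2)])
      moreover have "\<ominus>\<^bsub>self_module R\<^esub> a = \<zero>\<^bsub>self_module R\<^esub> \<ominus>\<^bsub>self_module R\<^esub> \<alpha> (f x)"
        using mod_homD(1)[OF \<alpha>(2) fx] S.a_inv_closed S.l_zero by (simp add: a_minus_def \<alpha>(1) del: self_module_simps)
      ultimately show ?thesis unfolding A_def
        by (intro CollectI exI[of _ "\<lambda>y. \<zero>\<^bsub>self_module R\<^esub> \<ominus>\<^bsub>self_module R\<^esub> \<alpha> y"] conjI)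
    qed
    show "a \<oplus>\<^bsub>self_module R\<^esub> b \<in> A" if ab: "a \<in> A" "b \<in> A" for a b
    proof -
      obtain \<alpha> \<beta> where "a = \<alpha> (f x)" "\<alpha> \<in> mod_hom R P' (self_module R)" "b = \<beta> (f x)" "\<beta> \<in> mod_hom R P' (self_module R)"
        using ab by (auto simp: A_def)
      then show ?thesis unfolding A_def using mod_hom_add[OF P'(1) mR, of \<alpha> \<beta>]
        by (intro CollectI exI[of _ "\<lambda>y. \<alpha> y \<oplus>\<^bsub>self_module R\<^esub> \<beta> y"] conjI) auto
    qed
    show "r \<odot>\<^bsub>self_module R\<^esub> a \<in> A" if ra: "r \<in> carrier R" "a \<in> A" for r a
    proof -
      obtain \<alpha> where "a = \<alpha> (f x)" "\<alpha> \<in> mod_hom R P' (self_module R)" using ra by (auto simp: A_def)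
      then show ?thesis unfolding A_def using mod_hom_smult[OF P'(1) mR _ ra(1), of \<alpha>]
        by (intro CollectI exI[of _ "\<lambda>y. r \<odot>\<^bsub>self_module R\<^esub> \<alpha> y"] conjI) auto
    qed
  qed
  moreover have "s' (f x) ` S' \<subseteq> A" unfolding A_def
  proof (rule image_subsetI)
    fix b
    show "s' (f x) b \<in> {\<alpha> (f x) | \<alpha>. \<alpha> \<in> mod_hom R P' (self_module R)}"
      by (intro CollectI exI[of _ "\<lambda>y. s' y b"] conjI refl mod_hom_dual_coord[OF assms(2)])
  qed
  ultimately have "Idl\<^bsub>R\<^esub> (s' (f x) ` S') \<subseteq> A"
    by (intro P.R.genideal_minimal) (simp_all add: ideal_iff_submodule[OF R])
  then have "\<forall>c\<in>S. \<exists>\<alpha>. s x c = \<alpha> (f x) \<and> \<alpha> \<in> mod_hom R P' (self_module R)" using assms(5) by (auto simp: A_def)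
  then obtain \<alpha> where \<alpha>: "\<And>c. c \<in> S \<Longrightarrow> s x c = \<alpha> c (f x)"
    "\<And>c. c \<in> S \<Longrightarrow> \<alpha> c \<in> mod_hom R P' (self_module R)" by metis
  have "(\<lambda>y b. if b \<in> S then \<alpha> b y else \<zero>\<^bsub>R\<^esub>) \<in> mod_hom R P' (fsupp_module R S)"
    by (rule mod_hom_into_fsupp[OF R P(2) \<alpha>(2)])
  then have \<theta>: "(\<lambda>y. lin_ext R P (\<lambda>x. x) (\<lambda>b. if b \<in> S then \<alpha> b y else \<zero>\<^bsub>R\<^esub>)) \<in> mod_hom R P' P"
    by (rule mod_hom_comp) (rule lin_ext_hom[OF P(1)], use P(3) in simp)
  have "(\<lambda>b. if b \<in> S then \<alpha> b (f x) else \<zero>\<^bsub>R\<^esub>) = s x"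
    using \<alpha>(1) P(7)[OF assms(4)] by (auto simp: fun_eq_iff)
  then show ?thesis using P(5)[OF assms(4)] by (intro bexI[OF _ \<theta>]) simp
qed

context fg_resolution
begin

text \<open>Exactness of \<open>P \<otimes> E\<close> in high degrees, for a module \<open>E\<close> that has a resolution of length \<open>b\<close>: go up
  the cokernels \<open>Q k / im\<close>, beginning with \<open>Q b\<close> itself.\<close>

lemma exact_tensor_resolution:
  fixes Q :: "nat \<Rightarrow> ('a, 'q) module"
  assumes "projective_resolution R Q d' e' E" "vanishes_above Q b" "k \<le> b" "b - k \<le> i"
  shows "exact_tensor (Q k) (d' k ` carrier (Q (Suc k))) i"
  using assms(3,4)
proof (induction "b - k" arbitrary: k i)
  have pQ: "proj R (Q j)" and eQ: "exact_upto R n Q d' e' E" for j n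
    using assms(1) by (auto simp: projective_resolution_iff)
  note mQ = proj_module[OF pQ]
  have dQ: "d' j \<in> mod_hom R (Q (Suc j)) (Q j)" for j using exact_uptoD(5)[OF eQ, of j "Suc j"] by simp
  case 0
  then have "d' k ` carrier (Q (Suc k)) = {\<zero>\<^bsub>Q k\<^esub>}"
    using assms(2) mod_hom_zero[OF mQ mQ dQ, of k] by (simp add: vanishes_above_def)
  then show ?case using exact_tensor_proj[OF pQ] by simp
next
  have pQ: "proj R (Q j)" and eQ: "exact_upto R n Q d' e' E" for j n
    using assms(1) by (auto simp: projective_resolution_iff)
  note mQ = proj_module[OF pQ]
  have dQ: "d' j \<in> mod_hom R (Q (Suc j)) (Q j)" for j using exact_uptoD(5)[OF eQ, of j "Suc j"] by simp
  case (Suc n)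
  then obtain j where j: "i = Suc j" by (cases i) auto
  interpret Q: module R "Q k" by (rule mQ)
  have ker: "d' (Suc k) ` carrier (Q (Suc (Suc k))) = {x \<in> carrier (Q (Suc k)). d' k x = \<zero>\<^bsub>Q k\<^esub>}"
    using exact_uptoD(6)[OF eQ, of "Suc k" "Suc (Suc k)"] by simp
  have IH: "exact_tensor (Q (Suc k)) (d' (Suc k) ` carrier (Q (Suc (Suc k)))) j"
    using Suc.hyps(2) Suc.prems j by (intro Suc.hyps(1)) auto
  show ?case unfolding j
  proof (rule exact_tensor_cokernel[OF mQ mQ dQ submodule_zero[OF mQ] _ _ _ exact_tensor_proj[OF pQ] IH])
    show "d' k ` carrier (Q (Suc k)) = {d' k y \<oplus>\<^bsub>Q k\<^esub> z | y z. y \<in> carrier (Q (Suc k)) \<and> z \<in> {\<zero>\<^bsub>Q k\<^esub>}}"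
    proof (intro equalityI subsetI)
      fix x assume "x \<in> d' k ` carrier (Q (Suc k))"
      then obtain y where y: "y \<in> carrier (Q (Suc k))" "x = d' k y" by (elim imageE)
      then have "x = d' k y \<oplus>\<^bsub>Q k\<^esub> \<zero>\<^bsub>Q k\<^esub>" using mod_homD(1)[OF dQ y(1)] by simp
      with y(1) show "x \<in> {d' k y \<oplus>\<^bsub>Q k\<^esub> z | y z. y \<in> carrier (Q (Suc k)) \<and> z \<in> {\<zero>\<^bsub>Q k\<^esub>}}"
        by (intro CollectI exI[of _ y] exI[of _ "\<zero>\<^bsub>Q k\<^esub>"]) simp
    next
      fix x assume "x \<in> {d' k y \<oplus>\<^bsub>Q k\<^esub> z | y z. y \<in> carrier (Q (Suc k)) \<and> z \<in> {\<zero>\<^bsub>Q k\<^esub>}}"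
      then obtain y where y: "y \<in> carrier (Q (Suc k))" "x = d' k y \<oplus>\<^bsub>Q k\<^esub> \<zero>\<^bsub>Q k\<^esub>" by auto
      then have "x = d' k y" using mod_homD(1)[OF dQ y(1)] by simp
      then show "x \<in> d' k ` carrier (Q (Suc k))" using y(1) by (rule image_eqI)
    qed
    show "y \<in> d' (Suc k) ` carrier (Q (Suc (Suc k)))" if "y \<in> carrier (Q (Suc k))" "d' k y \<in> {\<zero>\<^bsub>Q k\<^esub>}" for y
      unfolding ker using that by simp
    show "d' k y \<in> {\<zero>\<^bsub>Q k\<^esub>}" if "y \<in> d' (Suc k) ` carrier (Q (Suc (Suc k)))" for y
      using that unfolding ker by simp
  qed
qed

text \<open>With \<open>J\<close> the ideal on the right, \<open>x\<close> defines a cycle of \<open>P \<otimes> R/J\<close> in the highest degree, where this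
  complex is exact because \<open>R/J\<close> has a resolution of length \<open>b\<close>.\<close>

lemma coordinates_in_ideal:
  assumes weak: "cyclic_weak_ring R 1 b" and van: "vanishes_above P (Suc k)" and bk: "b \<le> k"
    and x: "x \<in> carrier (P (Suc k))" and c: "c \<in> S (Suc k)"
  shows "s (Suc k) x c \<in> Idl\<^bsub>R\<^esub> (s k (d k x) ` S k)"
proof -
  interpret R: cring R by (rule R)
  let ?G = "s k (d k x) ` S k"
  let ?J = "Idl\<^bsub>R\<^esub> ?G"
  let ?E = "quot_module R ?J"
  note dx = mod_homD(1)[OF dP x]
  have G: "finite ?G" "?G \<subseteq> carrier R" using dual_basisD(2,6)[OF dual] dx by auto
  note J = R.genideal_ideal[OF G(2)]
  note E = quot_module_facts[OF R J]
  have "pd R ?E \<le> enat b"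
    using weak quot_module_cyclic[OF R J] quot_module_presented[OF R G] unfolding cyclic_weak_ring_def by blast
  then obtain Q :: "nat \<Rightarrow> ('a, ('a, 'a set) res) module" and d' e' where
    Q: "projective_resolution R Q d' e' ?E" "vanishes_above Q b" unfolding pd_le_iff by blast
  have eQ: "exact_upto R n Q d' e' ?E" for n using Q(1) by (simp add: projective_resolution_iff)
  have mQ: "module R (Q 0)" by (rule exact_uptoD(2)[OF eQ, of 0 0]) simp
  interpret Q: module R "Q 0" by (rule mQ)
  interpret E: module R ?E by (rule E(1))
  note e = exact_uptoD(3)[OF eQ]
  have ker: "d' 0 ` carrier (Q (Suc 0)) = {x \<in> carrier (Q 0). e' x = \<zero>\<^bsub>?E\<^esub>}"
    using exact_uptoD(6)[OF eQ, of 0 1] by simp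
  have "?J +>\<^bsub>R\<^esub> \<one>\<^bsub>R\<^esub> \<in> carrier ?E" unfolding E(3)[symmetric] by (rule imageI) simp
  then have "?J +>\<^bsub>R\<^esub> \<one>\<^bsub>R\<^esub> \<in> e' ` carrier (Q 0)" unfolding exact_uptoD(4)[OF eQ] .
  then obtain q where q: "q \<in> carrier (Q 0)" "e' q = ?J +>\<^bsub>R\<^esub> \<one>\<^bsub>R\<^esub>" by (elim imageE) simp
  have eq: "e' (r \<odot>\<^bsub>Q 0\<^esub> q) = \<zero>\<^bsub>?E\<^esub> \<longleftrightarrow> r \<in> ?J" if "r \<in> carrier R" for r
    using mod_homD(3)[OF e that q(1)] mod_homD(3)[OF E(2) that, of "\<one>\<^bsub>R\<^esub>"] q(2) that E(4)[OF that] by simp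
  let ?k = "Suc k" and ?l = "Suc (Suc k)"
  let ?u = "\<lambda>c. s ?k x c \<odot>\<^bsub>Q 0\<^esub> q"
  have u: "?u c \<in> carrier (Q 0)" for c using dual_basisD(6)[OF dual x] q(1) by simp
  have "tens (Q 0) (s k) (S ?k) (d k) ?u b \<in> d' 0 ` carrier (Q (Suc 0))" if b: "b \<in> S k" for b
  proof -
    have 1: "s k (d k x) b \<in> carrier R" by (rule dual_basisD(6)[OF dual dx])
    have "s k (d k x) b \<in> ?J" using R.genideal_self[OF G(2)] b by blast
    then show ?thesis unfolding tens_coord_smult[OF dual dual dP mQ q(1) x] ker using eq[OF 1] 1 q(1) by simp
  qed
  note Du = this
  have ex: "exact_tensor (Q 0) (d' 0 ` carrier (Q (Suc 0))) k"
    by (rule exact_tensor_resolution[OF Q]) (use bk in auto)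
  from exact_tensorD[where u = ?u, OF ex u Du] obtain w where
    w: "\<And>c. c \<in> S ?l \<Longrightarrow> w c \<in> carrier (Q 0)"
    "\<And>b. b \<in> S ?k \<Longrightarrow> tens (Q 0) (s ?k) (S ?k) (\<lambda>x. x) ?u b \<ominus>\<^bsub>Q 0\<^esub>
        tens (Q 0) (s ?k) (S ?l) (d ?k) w b \<in> d' 0 ` carrier (Q (Suc 0))" by blast
  have "d ?k c = \<zero>\<^bsub>P ?k\<^esub>" if "c \<in> S ?l" for c
  proof -
    have "c = \<zero>\<^bsub>P ?l\<^esub>" using dual_basisD(3)[OF dual] van that by (auto simp: vanishes_above_def)
    then show ?thesis using mod_hom_zero[OF mP mP dP] by simp
  qed
  then have "tens (Q 0) (s ?k) (S ?l) (d ?k) w c = \<zero>\<^bsub>Q 0\<^esub>" by (intro tens_zero[OF mQ dual]) (use w in auto)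
  moreover have "tens (Q 0) (s ?k) (S ?k) (\<lambda>x. x) ?u c = s ?k x c \<odot>\<^bsub>Q 0\<^esub> q"
    by (rule tens_coord_smult[OF dual dual mod_hom_id mQ q(1) x])
  ultimately have "s ?k x c \<odot>\<^bsub>Q 0\<^esub> q \<in> d' 0 ` carrier (Q (Suc 0))"
    using w(2)[OF c] module_minus_zero[OF mQ u[of c]] by (simp only:)
  then have "e' (s ?k x c \<odot>\<^bsub>Q 0\<^esub> q) = \<zero>\<^bsub>?E\<^esub>" unfolding ker by (elim CollectE conjE)
  then show ?thesis unfolding eq[OF dual_basisD(6)[OF dual x]] .
qed

end

theorem fPD_le_of_cyclic_weak_ring:
  fixes A :: "'a ring"
  assumes "cyclic_weak_ring A 1 b"
  shows "fPD A \<le> enat b"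
proof (rule fPD_le_if_split)
  fix k and P :: "nat \<Rightarrow> ('a, nat \<Rightarrow> 'a) module" and d e and M :: "('a, nat \<Rightarrow> 'a) module"
  assume res: "projective_resolution A P d e M" and fg: "\<forall>i. fg_module A (P i)"
    and van: "vanishes_above P (Suc k)" and bk: "b \<le> k"
  have "\<exists>S s. dual_basis A (P i) S s" for i
    by (rule dual_basis_exists) (use res fg in \<open>auto simp: projective_resolution_iff\<close>)
  then obtain S s where dual: "\<And>i. dual_basis A (P i) (S i) (s i)" by metis
  interpret fg_resolution A P d e M S s using res dual by unfold_locales
  let ?k = "Suc k"
  have "\<exists>\<theta>\<in>mod_hom A (P k) (P ?k). \<theta> (d k x) = x" if x: "x \<in> carrier (P ?k)" for x
    by (rule recover_element[OF dual dual dP x]) (rule coordinates_in_ideal[OF assms van bk x])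
  note single = this
  have "\<exists>\<theta>\<in>mod_hom A (P k) (P ?k). \<forall>c\<in>S ?k. \<theta> (d k c) = c"
  proof (rule recover_finite_family[OF mP mP dP _ dual_basisD(2)[OF dual, of ?k], where Ind = "\<lambda>_ _. True"])
    fix a :: "nat \<Rightarrow> 'a" and C and x :: "(nat \<Rightarrow> 'a) \<Rightarrow> nat \<Rightarrow> 'a"
    assume "\<And>c. c \<in> insert a C \<Longrightarrow> x c \<in> carrier (P ?k)"
    then have "x a \<in> carrier (P ?k)" by simp
    from single[OF this] show "\<exists>\<theta>\<in>mod_hom A (P k) (P ?k). \<theta> (d k (x a)) = x a \<and> True" by simp
  qed (use dual_basisD(3)[OF dual[of ?k]] in auto)
  then obtain \<theta> where \<theta>: "\<theta> \<in> mod_hom A (P k) (P ?k)" "\<And>c. c \<in> S ?k \<Longrightarrow> \<theta> (d k c) = c" by blast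
  have "\<theta> (d k x) = x" if "x \<in> carrier (P ?k)" for x
    by (rule hom_id_on_dual_basis[OF dual mod_hom_comp[OF dP \<theta>(1)] \<theta>(2) that])
  then show "\<exists>r\<in>mod_hom A (P k) (P ?k). \<forall>x\<in>carrier (P ?k). r (d k x) = x"
    by (intro bexI[OF _ \<theta>(1)] ballI)
qed

section \<open>Koszul complexes\<close>

text \<open>The Koszul cochain complex of \<open>x 0, \<dots>, x (j - 1)\<close>, built as an iterated mapping cone: adding the
  element \<open>x j\<close> turns a complex \<open>K\<close> into pairs \<open>(u, v)\<close> of degrees \<open>i\<close> and \<open>i - 1\<close> with differential
  \<open>(u, v) \<mapsto> (d u, x j u - d v)\<close>. A pair is stored as one family, \<open>u\<close> at the even and \<open>v\<close> at the odd
  positions, so that no signs have to be attached to subsets. The positions of degree \<open>i\<close> are the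
  numbers below \<open>2 ^ j\<close> with exactly \<open>i\<close> binary digits \<open>1\<close>.\<close>

primrec koszul :: "'a ring \<Rightarrow> (nat \<Rightarrow> 'a) \<Rightarrow> nat \<Rightarrow> (nat \<Rightarrow> 'a) \<Rightarrow> nat \<Rightarrow> 'a" where
  "koszul T x 0 u = (\<lambda>n. \<zero>\<^bsub>T\<^esub>)"
| "koszul T x (Suc j) u = (\<lambda>n. if even n then koszul T x j (\<lambda>k. u (2 * k)) (n div 2)
     else x j \<otimes>\<^bsub>T\<^esub> u (2 * (n div 2)) \<ominus>\<^bsub>T\<^esub> koszul T x j (\<lambda>k. u (Suc (2 * k))) (n div 2))"

primrec koszul_index :: "nat \<Rightarrow> nat \<Rightarrow> nat set" where
  "koszul_index 0 i = (if i = 0 then {0} else {})"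
| "koszul_index (Suc j) i = {n. if even n then n div 2 \<in> koszul_index j i
     else 0 < i \<and> n div 2 \<in> koszul_index j (i - 1)}"

lemma koszul_index_bound: "n \<in> koszul_index j i \<Longrightarrow> n < 2 ^ j"
proof (induction j arbitrary: n i)
  case (Suc j)
  then have "n div 2 < 2 ^ j" by (auto split: if_splits)
  then show ?case by simp
qed (auto split: if_splits)

lemma finite_koszul_index: "finite (koszul_index j i)"
  by (rule finite_subset[of _ "{..<2 ^ j}"]) (use koszul_index_bound in auto)

lemma koszul_index_degree_0: "koszul_index j 0 = {0}"
proof (induction j)
  case (Suc j)
  have "even n \<and> n div 2 = 0 \<longleftrightarrow> n = 0" for n :: nat by auto
  then show ?case using Suc by auto
qed simp

locale plain_cring = cring R for R :: "'a ring" (structure)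
begin

lemma koszul_closed:
  assumes "\<And>k. k < j \<Longrightarrow> x k \<in> carrier R" "\<And>n. u n \<in> carrier R"
  shows "koszul R x j u n \<in> carrier R"
  using assms by (induction j arbitrary: u n) auto

lemma koszul_zero:
  assumes "\<And>k. k < j \<Longrightarrow> x k \<in> carrier R"
  shows "koszul R x j (\<lambda>n. \<zero>) = (\<lambda>n. \<zero>)"
  using assms
proof (induction j)
  case (Suc j)
  have "\<ominus> \<zero> = \<zero>" by (metis minus_closed a_minus_def add.inv_one a_inv_def)
  then show ?case using Suc by (auto simp: fun_eq_iff a_minus_def)
qed simp

lemma koszul_add:
  assumes "\<And>k. k < j \<Longrightarrow> x k \<in> carrier R" "\<And>n. u n \<in> carrier R" "\<And>n. v n \<in> carrier R"
  shows "koszul R x j (\<lambda>n. u n \<oplus> v n) n = koszul R x j u n \<oplus> koszul R x j v n"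
  using assms
proof (induction j arbitrary: u v n)
  case (Suc j)
  have c: "koszul R x j (\<lambda>k. u (Suc (2 * k))) (n div 2) \<in> carrier R"
    "koszul R x j (\<lambda>k. v (Suc (2 * k))) (n div 2) \<in> carrier R"
    using Suc.prems by (auto intro!: koszul_closed)
  have IH: "koszul R x j (\<lambda>k. u (2 * k) \<oplus> v (2 * k)) (n div 2) =
      koszul R x j (\<lambda>k. u (2 * k)) (n div 2) \<oplus> koszul R x j (\<lambda>k. v (2 * k)) (n div 2)"
    "koszul R x j (\<lambda>k. u (Suc (2 * k)) \<oplus> v (Suc (2 * k))) (n div 2) =
      koszul R x j (\<lambda>k. u (Suc (2 * k))) (n div 2) \<oplus> koszul R x j (\<lambda>k. v (Suc (2 * k))) (n div 2)"
    using Suc.prems by (auto intro!: Suc.IH)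
  show ?case using c Suc.prems by (simp add: IH a_minus_def r_distr minus_add a_ac)
qed simp

lemma koszul_smult:
  assumes "\<And>k. k < j \<Longrightarrow> x k \<in> carrier R" "\<And>n. u n \<in> carrier R" "r \<in> carrier R"
  shows "koszul R x j (\<lambda>n. r \<otimes> u n) n = r \<otimes> koszul R x j u n"
  using assms
proof (induction j arbitrary: u n)
  case (Suc j)
  have c: "koszul R x j (\<lambda>k. u (Suc (2 * k))) (n div 2) \<in> carrier R"
    using Suc.prems by (auto intro!: koszul_closed)
  have IH: "koszul R x j (\<lambda>k. r \<otimes> u (2 * k)) (n div 2) = r \<otimes> koszul R x j (\<lambda>k. u (2 * k)) (n div 2)"
    "koszul R x j (\<lambda>k. r \<otimes> u (Suc (2 * k))) (n div 2) = r \<otimes> koszul R x j (\<lambda>k. u (Suc (2 * k))) (n div 2)"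
    using Suc.prems by (auto intro!: Suc.IH)
  show ?case using c Suc.prems by (simp add: IH a_minus_def r_distr r_minus m_ac)
qed simp

lemma koszul_minus:
  assumes "\<And>k. k < j \<Longrightarrow> x k \<in> carrier R" "\<And>n. u n \<in> carrier R"
  shows "koszul R x j (\<lambda>n. \<ominus> u n) n = \<ominus> koszul R x j u n"
proof -
  have "koszul R x j (\<lambda>n. (\<ominus> \<one>) \<otimes> u n) n = (\<ominus> \<one>) \<otimes> koszul R x j u n"
    by (rule koszul_smult) (use assms in auto)
  then show ?thesis using assms koszul_closed[OF assms] by (simp add: l_minus)
qed

lemma koszul_koszul:
  assumes "\<And>k. k < j \<Longrightarrow> x k \<in> carrier R" "\<And>n. u n \<in> carrier R"
  shows "koszul R x j (koszul R x j u) n = \<zero>"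
  using assms
proof (induction j arbitrary: u n)
  case (Suc j)
  have xk: "\<And>k. k < j \<Longrightarrow> x k \<in> carrier R" and xj: "x j \<in> carrier R" using Suc.prems by auto
  let ?p = "\<lambda>k. u (2 * k)" and ?q = "\<lambda>k. u (Suc (2 * k))"
  obtain m where m: "n = 2 * m \<or> n = Suc (2 * m)" by (metis evenE oddE Suc_eq_plus1)
  have pc: "koszul R x j ?p k \<in> carrier R" and qc: "koszul R x j ?q k \<in> carrier R" for k
    using Suc.prems xk by (auto intro!: koszul_closed)
  have pp: "koszul R x j (koszul R x j ?p) m = \<zero>" and qq: "koszul R x j (koszul R x j ?q) m = \<zero>"
    using Suc.prems by (auto intro!: Suc.IH)
  have "koszul R x j (\<lambda>k. x j \<otimes> ?p k \<oplus> \<ominus> koszul R x j ?q k) m =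
      x j \<otimes> koszul R x j ?p m \<oplus> \<ominus> koszul R x j (koszul R x j ?q) m"
    using koszul_add[OF xk, where u = "\<lambda>k. x j \<otimes> ?p k" and v = "\<lambda>k. \<ominus> koszul R x j ?q k"]
      koszul_smult[OF xk, where u = ?p and r = "x j"] koszul_minus[OF xk, where u = "koszul R x j ?q"]
      Suc.prems(2) xj qc by simp
  also have "\<dots> = x j \<otimes> koszul R x j ?p m" using qq pc xj by (simp add: minus_equality)
  finally show ?case using m pp pc xj by (elim disjE) (simp_all add: a_minus_def r_neg)
qed simp

lemma koszul_support:
  assumes "\<And>k. k < j \<Longrightarrow> x k \<in> carrier R" "\<And>n. n \<notin> koszul_index j i \<Longrightarrow> u n = \<zero>"
    "n \<notin> koszul_index j (Suc i)"
  shows "koszul R x j u n = \<zero>"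
  using assms
proof (induction j arbitrary: u n i)
  case (Suc j)
  have xk: "\<And>k. k < j \<Longrightarrow> x k \<in> carrier R" and xj: "x j \<in> carrier R" using Suc.prems by auto
  have ev: "u (2 * k) = \<zero>" if "k \<notin> koszul_index j i" for k using Suc.prems(2)[of "2 * k"] that by simp
  show ?case
  proof (cases "even n")
    case True
    then have "n div 2 \<notin> koszul_index j (Suc i)" using Suc.prems(3) by simp
    then have "koszul R x j (\<lambda>k. u (2 * k)) (n div 2) = \<zero>" by (intro Suc.IH[OF xk ev])
    then show ?thesis using True by simp
  next
    case False
    then have n: "n div 2 \<notin> koszul_index j i" using Suc.prems(3) by simp
    have "koszul R x j (\<lambda>k. u (Suc (2 * k))) (n div 2) = \<zero>"
    proof (cases i)
      case 0
      then have "(\<lambda>k. u (Suc (2 * k))) = (\<lambda>k. \<zero>)" using Suc.prems(2) by auto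
      then show ?thesis using koszul_zero[OF xk] by simp
    next
      case (Suc i')
      have "u (Suc (2 * k)) = \<zero>" if "k \<notin> koszul_index j i'" for k
        using Suc.prems(2)[of "Suc (2 * k)"] that Suc by simp
      then show ?thesis using n Suc by (intro Suc.IH[OF xk]) auto
    qed
    then show ?thesis using False ev[OF n] xj by (simp add: a_minus_def minus_equality)
  qed
qed simp

lemma koszul_in_ideal:
  assumes "ideal I R" "\<And>k. k < j \<Longrightarrow> x k \<in> I" "\<And>n. u n \<in> carrier R"
  shows "koszul R x j u n \<in> I"
proof -
  interpret I: ideal I R by fact
  show ?thesis using assms(2,3)
  proof (induction j arbitrary: u n)
    case (Suc j)
    obtain m where m: "n = 2 * m \<or> n = Suc (2 * m)" by (metis evenE oddE Suc_eq_plus1)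
    have "x j \<otimes> u (2 * m) \<in> I" using Suc.prems by (intro I.I_r_closed) auto
    moreover have "koszul R x j (\<lambda>k. u (Suc (2 * k))) m \<in> I"
      "koszul R x j (\<lambda>k. u (2 * k)) m \<in> I" using Suc.prems by (auto intro!: Suc.IH)
    ultimately show ?case using m by (elim disjE) (simp_all add: a_minus_def)
  qed simp
qed

lemma mod_hom_koszul:
  assumes "\<And>k. k < j \<Longrightarrow> x k \<in> carrier R"
  shows "koszul R x j \<in> mod_hom R (fsupp_module R (koszul_index j i)) (fsupp_module R (koszul_index j (Suc i)))"
proof (rule mod_homI)
  fix u assume "u \<in> carrier (fsupp_module R (koszul_index j i))"
  then have u: "\<And>n. u n \<in> carrier R" "\<And>n. n \<notin> koszul_index j i \<Longrightarrow> u n = \<zero>"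
    by (auto simp: fsupp_carrier_iff)
  then show "koszul R x j u \<in> carrier (fsupp_module R (koszul_index j (Suc i)))"
    using koszul_closed[of j x u, OF assms] koszul_support[of j x i u, OF assms]
    by (simp add: fsupp_carrier_finite[OF finite_koszul_index])
qed (auto simp: fsupp_carrier_iff koszul_add[OF assms] koszul_smult[OF assms])

text \<open>If \<open>x 0\<close> kills \<open>\<epsilon>\<close>, then the family with the single entry \<open>\<epsilon>\<close> at the product of the directions
  \<open>1, \<dots>, j\<close> is a cocycle. Its class is killed by all the \<open>x k\<close>: by \<open>x 0\<close> since \<open>x 0 \<epsilon> = 0\<close>, and by the
  others because \<open>x k\<close> times it is, up to sign, the coboundary of \<open>\<epsilon>\<close> placed at the remaining directions.\<close>

primrec top_cocycle :: "'a \<Rightarrow> nat \<Rightarrow> nat \<Rightarrow> 'a" where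
  "top_cocycle \<epsilon> 0 = (\<lambda>n. if n = 0 then \<epsilon> else \<zero>)"
| "top_cocycle \<epsilon> (Suc j) = (\<lambda>n. if odd n then top_cocycle \<epsilon> j (n div 2) else \<zero>)"

lemma top_cocycle_closed: "\<epsilon> \<in> carrier R \<Longrightarrow> top_cocycle \<epsilon> j n \<in> carrier R"
  by (induction j arbitrary: n) auto

lemma top_cocycle_carrier:
  assumes "\<epsilon> \<in> carrier R"
  shows "top_cocycle \<epsilon> j \<in> carrier (fsupp_module R (koszul_index (Suc j) j))"
proof -
  have "n \<notin> koszul_index (Suc j) j \<Longrightarrow> top_cocycle \<epsilon> j n = \<zero>" for n
  proof (induction j arbitrary: n)
    case (Suc j)
    show ?case using Suc.prems Suc.IH[of "n div 2"] by (auto simp del: koszul_index.simps(2) simp: koszul_index.simps(2)[of "Suc j"] split: if_splits)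
  qed auto
  then show ?thesis using top_cocycle_closed[OF assms]
    by (simp del: koszul_index.simps add: fsupp_carrier_finite[OF finite_koszul_index])
qed

lemma top_cocycle_value: "\<exists>n. top_cocycle \<epsilon> j n = \<epsilon>"
proof (induction j)
  case (Suc j)
  then obtain n where "top_cocycle \<epsilon> j n = \<epsilon>" by blast
  then have "top_cocycle \<epsilon> (Suc j) (Suc (2 * n)) = \<epsilon>" by simp
  then show ?case by blast
qed auto

lemma top_cocycle_cocycle:
  assumes "\<epsilon> \<in> carrier R" "x 0 \<otimes> \<epsilon> = \<zero>" "\<And>k. k \<le> j \<Longrightarrow> x k \<in> carrier R"
  shows "koszul R x (Suc j) (top_cocycle \<epsilon> j) = (\<lambda>n. \<zero>)"
  using assms(3)
proof (induction j)
  case 0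
  then have "\<ominus> \<zero> = \<zero>" by (metis add.inv_one a_inv_def)
  then show ?case using assms(2) 0 by (auto simp: fun_eq_iff a_minus_def)
next
  case (Suc j)
  have z: "\<ominus> \<zero> = \<zero>" by (metis add.inv_one a_inv_def)
  have IH: "koszul R x (Suc j) (top_cocycle \<epsilon> j) = (\<lambda>n. \<zero>)" using Suc by auto
  have e1: "(\<lambda>k. top_cocycle \<epsilon> (Suc j) (2 * k)) = (\<lambda>k. \<zero>)"
    and e2: "(\<lambda>k. top_cocycle \<epsilon> (Suc j) (Suc (2 * k))) = top_cocycle \<epsilon> j" by (auto simp: fun_eq_iff)
  show ?case unfolding koszul.simps(2)[of R x "Suc j"] e1 e2 IH
    using koszul_zero[of "Suc j" x] Suc.prems by (auto simp: fun_eq_iff a_minus_def z)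
qed

lemma top_cocycle_killed:
  assumes "\<epsilon> \<in> carrier R" "x 0 \<otimes> \<epsilon> = \<zero>" "\<And>k. k \<le> Suc j \<Longrightarrow> x k \<in> carrier R" "k \<le> Suc j"
  shows "\<exists>w\<in>carrier (fsupp_module R (koszul_index (Suc (Suc j)) j)).
    koszul R x (Suc (Suc j)) w = (\<lambda>n. x k \<otimes> top_cocycle \<epsilon> (Suc j) n)"
  using assms(3,4)
proof (induction j arbitrary: k)
  have z: "\<ominus> \<zero> = \<zero>" by (metis add.inv_one a_inv_def)
  have half: "odd n \<Longrightarrow> (n - Suc 0) div 2 = n div 2" for n :: nat by presburger
  have top: "\<exists>w\<in>carrier (fsupp_module R (koszul_index (Suc (Suc j)) j)).
      koszul R x (Suc (Suc j)) w = (\<lambda>n. x (Suc j) \<otimes> top_cocycle \<epsilon> (Suc j) n)"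
    if xk: "\<And>k. k \<le> Suc j \<Longrightarrow> x k \<in> carrier R" for j
  proof (intro bexI)
    let ?w = "\<lambda>n. if even n then top_cocycle \<epsilon> j (n div 2) else \<zero>"
    have tc: "top_cocycle \<epsilon> j n \<in> carrier R" "n \<notin> koszul_index (Suc j) j \<Longrightarrow> top_cocycle \<epsilon> j n = \<zero>" for n
      using top_cocycle_carrier[OF assms(1), of j] by (auto simp del: koszul_index.simps simp: fsupp_carrier_iff)
    show "?w \<in> carrier (fsupp_module R (koszul_index (Suc (Suc j)) j))"
      using tc by (subst fsupp_carrier_finite[OF finite_koszul_index])
        (auto simp del: koszul_index.simps simp: koszul_index.simps(2)[of "Suc j"])
    have e1: "(\<lambda>k. ?w (2 * k)) = top_cocycle \<epsilon> j" and e2: "(\<lambda>k. ?w (Suc (2 * k))) = (\<lambda>k. \<zero>)"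
      by (auto simp: fun_eq_iff)
    have d: "koszul R x (Suc j) (top_cocycle \<epsilon> j) = (\<lambda>n. \<zero>)"
      by (rule top_cocycle_cocycle) (use assms xk in auto)
    show "koszul R x (Suc (Suc j)) ?w = (\<lambda>n. x (Suc j) \<otimes> top_cocycle \<epsilon> (Suc j) n)"
      unfolding koszul.simps(2)[of R x "Suc j"] e1 e2 d
      using koszul_zero[of "Suc j" x] xk tc half by (auto simp: fun_eq_iff a_minus_def z)
  qed
  have zc: "(\<lambda>n. \<zero>) \<in> carrier (fsupp_module R B)" for B :: "nat set" by (simp add: fsupp_carrier_iff)
  {
    case 0
    show ?case
    proof (cases "k = 1")
      case True
      then show ?thesis using top[of 0] 0 by simp
    next
      case False
      then have "k = 0" using 0 by simp
      have "x 0 \<otimes> top_cocycle \<epsilon> (Suc 0) n = \<zero>" for n using assms(2) 0 by simp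
      then show ?thesis using \<open>k = 0\<close> koszul_zero[of "Suc (Suc 0)" x] 0 zc by (intro bexI[OF _ zc]) auto
    qed
  next
    case (Suc j)
    show ?case
    proof (cases "k = Suc (Suc j)")
      case True
      then show ?thesis using top[of "Suc j"] Suc by simp
    next
      case False
      then have k: "k \<le> Suc j" using Suc by simp
      then obtain w where w: "w \<in> carrier (fsupp_module R (koszul_index (Suc (Suc j)) j))"
        "koszul R x (Suc (Suc j)) w = (\<lambda>n. x k \<otimes> top_cocycle \<epsilon> (Suc j) n)"
        using Suc.IH[of k] Suc.prems by auto
      have wc: "w n \<in> carrier R" "n \<notin> koszul_index (Suc (Suc j)) j \<Longrightarrow> w n = \<zero>" for n
        using w(1) by (auto simp del: koszul_index.simps simp: fsupp_carrier_iff)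
      let ?w = "\<lambda>n. if odd n then \<ominus> w (n div 2) else \<zero>"
      have xk: "\<And>i. i < Suc (Suc j) \<Longrightarrow> x i \<in> carrier R" using Suc.prems by auto
      have e1: "(\<lambda>k. ?w (2 * k)) = (\<lambda>k. \<zero>)" and e2: "(\<lambda>k. ?w (Suc (2 * k))) = (\<lambda>k. \<ominus> w k)"
        by (auto simp: fun_eq_iff)
      have e3: "koszul R x (Suc (Suc j)) (\<lambda>k. \<ominus> w k) = (\<lambda>n. \<ominus> (x k \<otimes> top_cocycle \<epsilon> (Suc j) n))"
      proof
        fix n
        have "koszul R x (Suc (Suc j)) (\<lambda>k. \<ominus> w k) n = \<ominus> koszul R x (Suc (Suc j)) w n"
          by (rule koszul_minus[OF xk wc(1)])
        then show "koszul R x (Suc (Suc j)) (\<lambda>k. \<ominus> w k) n = \<ominus> (x k \<otimes> top_cocycle \<epsilon> (Suc j) n)"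
          using fun_cong[OF w(2), of n] by (simp only:)
      qed
      have tc: "top_cocycle \<epsilon> (Suc j) n \<in> carrier R" for n by (rule top_cocycle_closed[OF assms(1)])
      have xkc: "x k \<in> carrier R" and xs: "x (Suc (Suc j)) \<in> carrier R" using Suc.prems k by auto
      show ?thesis
      proof (rule bexI[of _ ?w])
        show "?w \<in> carrier (fsupp_module R (koszul_index (Suc (Suc (Suc j))) (Suc j)))"
          using wc z by (subst fsupp_carrier_finite[OF finite_koszul_index])
            (auto simp del: koszul_index.simps simp: koszul_index.simps(2)[of "Suc (Suc j)"])
        have "top_cocycle \<epsilon> (Suc (Suc j)) n = (if odd n then top_cocycle \<epsilon> (Suc j) (n div 2) else \<zero>)" for n by simp
        then show "koszul R x (Suc (Suc (Suc j))) ?w = (\<lambda>n. x k \<otimes> top_cocycle \<epsilon> (Suc (Suc j)) n)"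
          unfolding koszul.simps(2)[of R x "Suc (Suc j)"] e1 e2 e3
          using koszul_zero[of "Suc (Suc j)" x, OF xk] tc xkc xs xk[of j] xk[of "Suc j"] half by (auto simp: fun_eq_iff a_minus_def simp del: top_cocycle.simps)
      qed
    qed
  }
qed

end

section \<open>Local rings\<close>

definition local_with :: "'a ring \<Rightarrow> 'a set \<Rightarrow> bool" where
  "local_with R m \<longleftrightarrow> cring R \<and> ideal m R \<and> Units R = carrier R - m"

lemma local_withD:
  assumes "local_with R m"
  shows "cring R" "ideal m R" "a \<in> carrier R \<Longrightarrow> a \<notin> m \<Longrightarrow> a \<in> Units R" "a \<in> m \<Longrightarrow> a \<notin> Units R"
    "\<one>\<^bsub>R\<^esub> \<notin> m" "m \<subseteq> carrier R"
proof -
  interpret R: cring R using assms by (simp add: local_with_def)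
  show "cring R" "ideal m R" "a \<in> carrier R \<Longrightarrow> a \<notin> m \<Longrightarrow> a \<in> Units R" "a \<in> m \<Longrightarrow> a \<notin> Units R"
    using assms R.cring_axioms by (auto simp: local_with_def)
  show "\<one>\<^bsub>R\<^esub> \<notin> m" using R.Units_one_closed assms by (auto simp: local_with_def)
  show "m \<subseteq> carrier R" using ideal.axioms(1)[of m R] assms additive_subgroup.a_subset[of m R] by (auto simp: local_with_def)
qed

lemma local_ring_local_with:
  assumes "local_with R m"
  shows "local_ring R"
proof -
  note L = local_withD[OF assms]
  interpret R: cring R by (rule L(1))
  interpret m: ideal m R by (rule L(2))
  have sub: "J \<subseteq> m" if J: "ideal J R" "J \<noteq> carrier R" for J
  proof
    interpret J: ideal J R by fact
    fix a assume a: "a \<in> J"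
    show "a \<in> m"
    proof (rule ccontr)
      assume "a \<notin> m"
      then have u: "a \<in> Units R" using L(3) a J.a_subset by blast
      then have "inv\<^bsub>R\<^esub> a \<otimes>\<^bsub>R\<^esub> a \<in> J" using a by (intro J.I_l_closed) auto
      then have "\<one>\<^bsub>R\<^esub> \<in> J" using R.Units_l_inv[OF u] by simp
      then show False using J.one_imp_carrier J(2) by simp
    qed
  qed
  have max: "maximalideal m R"
  proof (rule maximalidealI)
    show "ideal m R" by (rule L(2))
    show "carrier R \<noteq> m" using L(5) by auto
    fix J assume "ideal J R" "m \<subseteq> J" "J \<subseteq> carrier R"
    then show "J = m \<or> J = carrier R" using sub by blast
  qed
  have "m' = m" if m': "maximalideal m' R" for m'
  proof -
    interpret m': maximalideal m' R by fact
    have "m' \<subseteq> m" using sub[OF m'.is_ideal] m'.I_notcarr by blast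
    then show ?thesis using m'.I_maximal[OF L(2) _ L(6)] L(5) by auto
  qed
  then show ?thesis unfolding local_ring_def using L(1) max by blast
qed

text \<open>The reason is that \<open>1 - \<mu>\<close> is a unit.\<close>

lemma local_with_self_multiple:
  assumes "local_with R m" "\<mu> \<in> m" "\<epsilon> \<in> carrier R" "\<epsilon> = \<mu> \<otimes>\<^bsub>R\<^esub> \<epsilon>"
  shows "\<epsilon> = \<zero>\<^bsub>R\<^esub>"
proof -
  note L = local_withD[OF assms(1)]
  interpret R: cring R by (rule L(1))
  interpret m: ideal m R by (rule L(2))
  have \<mu>: "\<mu> \<in> carrier R" using assms(2) L(6) by blast
  have "\<one>\<^bsub>R\<^esub> \<ominus>\<^bsub>R\<^esub> \<mu> \<notin> m"
  proof
    assume "\<one>\<^bsub>R\<^esub> \<ominus>\<^bsub>R\<^esub> \<mu> \<in> m"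
    then have "(\<one>\<^bsub>R\<^esub> \<ominus>\<^bsub>R\<^esub> \<mu>) \<oplus>\<^bsub>R\<^esub> \<mu> \<in> m" using assms(2) by simp
    moreover have "(\<one>\<^bsub>R\<^esub> \<ominus>\<^bsub>R\<^esub> \<mu>) \<oplus>\<^bsub>R\<^esub> \<mu> = \<one>\<^bsub>R\<^esub>" using \<mu> by (simp add: a_minus_def R.a_assoc R.l_neg)
    ultimately show False using L(5) by simp
  qed
  then have u: "\<one>\<^bsub>R\<^esub> \<ominus>\<^bsub>R\<^esub> \<mu> \<in> Units R" using L(3) \<mu> by simp
  have "(\<one>\<^bsub>R\<^esub> \<ominus>\<^bsub>R\<^esub> \<mu>) \<otimes>\<^bsub>R\<^esub> \<epsilon> = \<epsilon> \<ominus>\<^bsub>R\<^esub> \<mu> \<otimes>\<^bsub>R\<^esub> \<epsilon>"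
    using \<mu> assms(3) by (simp add: a_minus_def R.l_distr R.l_minus)
  also have "\<dots> = \<zero>\<^bsub>R\<^esub>" using assms(3,4) by (simp add: a_minus_def R.r_neg)
  finally have "inv\<^bsub>R\<^esub> (\<one>\<^bsub>R\<^esub> \<ominus>\<^bsub>R\<^esub> \<mu>) \<otimes>\<^bsub>R\<^esub> ((\<one>\<^bsub>R\<^esub> \<ominus>\<^bsub>R\<^esub> \<mu>) \<otimes>\<^bsub>R\<^esub> \<epsilon>) = \<zero>\<^bsub>R\<^esub>" using u by simp
  then show ?thesis using u assms(3) \<mu> by (simp add: R.m_assoc[symmetric] R.Units_l_inv)
qed

text \<open>A map from a finitely generated projective module with a minimal generating set to another one
  splits if it is injective modulo the maximal ideal: at least one coordinate of the image of a
  generator is invertible, and this makes it possible to recover that generator.\<close>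

lemma split_if_injective_mod_maximal:
  assumes loc: "local_with R m" and dual: "dual_basis R P S s" "dual_basis R P' S' s'"
    and f: "f \<in> mod_hom R P P'"
    and min: "\<And>S''. S'' \<subseteq> carrier P \<Longrightarrow> finite S'' \<Longrightarrow> span_of R P S'' = span_of R P S \<Longrightarrow> card S \<le> card S''"
    and inj: "\<And>y. y \<in> carrier P \<Longrightarrow> (\<And>b. b \<in> S' \<Longrightarrow> s' (f y) b \<in> m) \<Longrightarrow> \<forall>b\<in>S. s y b \<in> m"
  shows "\<exists>r\<in>mod_hom R P' P. \<forall>y\<in>carrier P. r (f y) = y"
proof -
  note L = local_withD[OF loc]
  note D = dual_basisD[OF dual(1)] and D' = dual_basisD[OF dual(2)]
  interpret P: module R P by (rule D(1))
  interpret P': module R P' by (rule D'(1))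
  interpret m: ideal m R by (rule L(2))
  note fc = mod_homD(1)[OF f]
  define Ind where "Ind C x \<longleftrightarrow> (\<forall>a. (\<forall>c\<in>C. a c \<in> carrier R) \<and>
      (\<forall>b\<in>S'. s' (f (\<Oplus>\<^bsub>P\<^esub>c\<in>C. a c \<odot>\<^bsub>P\<^esub> x c)) b \<in> m) \<longrightarrow> (\<forall>c\<in>C. a c \<in> m))"
    for C :: "'b set" and x :: "'b \<Rightarrow> 'b"
  have IndD: "a c \<in> m" if "Ind C x" "\<And>c. c \<in> C \<Longrightarrow> a c \<in> carrier R"
    "\<And>b. b \<in> S' \<Longrightarrow> s' (f (\<Oplus>\<^bsub>P\<^esub>c\<in>C. a c \<odot>\<^bsub>P\<^esub> x c)) b \<in> m" "c \<in> C" for C x a c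
    using that unfolding Ind_def by blast
  have "\<exists>\<theta>\<in>mod_hom R P' P. \<forall>c\<in>S. \<theta> (f c) = c"
  proof (rule recover_finite_family[OF D(1) D'(1) f _ D(2), where Ind = Ind and x = "\<lambda>c. c"])
    show "Ind S (\<lambda>c. c)" unfolding Ind_def
    proof (intro allI impI ballI; elim conjE)
      fix a c assume a: "\<forall>c\<in>S. a c \<in> carrier R" and fm: "\<forall>b\<in>S'. s' (f (\<Oplus>\<^bsub>P\<^esub>c\<in>S. a c \<odot>\<^bsub>P\<^esub> c)) b \<in> m"
        and c: "c \<in> S"
      define y where "y = (\<Oplus>\<^bsub>P\<^esub>c\<in>S. a c \<odot>\<^bsub>P\<^esub> c)"
      have y: "y \<in> carrier P" unfolding y_def using a D(3) by (intro P.finsum_closed) auto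
      have sm: "\<forall>b\<in>S. s y b \<in> m" using inj[OF y] fm by (simp add: y_def)
      define a' where "a' b = (if b \<in> S then a b else \<zero>\<^bsub>R\<^esub>)" for b
      have a': "a' \<in> carrier (fsupp_module R S)" using a by (simp add: fsupp_carrier_finite[OF D(2)] a'_def)
      have sy: "s y \<in> carrier (fsupp_module R S)" by (rule mod_homD(1)[OF D(4) y])
      have idS: "(\<lambda>x. x) ` S \<subseteq> carrier P" using D(3) by simp
      have "lin_ext R P (\<lambda>x. x) a' = (\<Oplus>\<^bsub>P\<^esub>c\<in>S. a' c \<odot>\<^bsub>P\<^esub> c)"
        by (rule lin_ext_eq[OF D(1) a' idS D(2) _ subset_refl]) (auto simp: a'_def)
      also have "\<dots> = y" unfolding y_def using a D(3) by (intro P.finsum_cong') (auto simp: a'_def)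
      finally have l: "lin_ext R P (\<lambda>x. x) a' = y" .
      define r where "r = a' \<ominus>\<^bsub>fsupp_module R S\<^esub> s y"
      interpret F: module R "fsupp_module R S" by (rule module_fsupp_module[OF L(1)])
      have r: "r \<in> carrier (fsupp_module R S)" unfolding r_def using a' sy by (rule F.minus_closed)
      have "lin_ext R P (\<lambda>x. x) r = y \<ominus>\<^bsub>P\<^esub> y" unfolding r_def
        using mod_hom_minus_apply[OF F.module_axioms D(1) lin_ext_hom[OF D(1) idS] a' sy] l D(5)[OF y] by simp
      then have "lin_ext R P (\<lambda>x. x) r = \<zero>\<^bsub>P\<^esub>" using y by (simp add: a_minus_def P.r_neg)
      from minimal_generators_relation[OF D(1-3) min r this c] have "r c \<notin> Units R" .
      moreover have rc: "r c = a c \<ominus>\<^bsub>R\<^esub> s y c" using c by (simp add: r_def fsupp_minus[OF L(1) sy] a'_def)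
      moreover have cl: "a c \<in> carrier R" "s y c \<in> carrier R" using a c D(6)[OF y] by auto
      ultimately have "a c \<ominus>\<^bsub>R\<^esub> s y c \<in> m" using L(3)[of "r c"] by auto
      then have "(a c \<ominus>\<^bsub>R\<^esub> s y c) \<oplus>\<^bsub>R\<^esub> s y c \<in> m" using sm c by simp
      moreover have "(a c \<ominus>\<^bsub>R\<^esub> s y c) \<oplus>\<^bsub>R\<^esub> s y c = a c"
        using cl by (simp add: a_minus_def P.R.a_assoc P.R.l_neg)
      ultimately show "a c \<in> m" by simp
    qed
  next
    fix a C x assume C: "finite C" "a \<notin> C" and I: "Ind (insert a C) x"
      and x: "\<And>c. c \<in> insert a C \<Longrightarrow> x c \<in> carrier P"
    have xa: "x a \<in> carrier P" using x by simp
    let ?\<delta> = "\<lambda>c. if c = a then \<one>\<^bsub>R\<^esub> else \<zero>\<^bsub>R\<^esub>"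
    have "(\<Oplus>\<^bsub>P\<^esub>c\<in>insert a C. ?\<delta> c \<odot>\<^bsub>P\<^esub> x c) = ?\<delta> a \<odot>\<^bsub>P\<^esub> x a \<oplus>\<^bsub>P\<^esub> (\<Oplus>\<^bsub>P\<^esub>c\<in>C. ?\<delta> c \<odot>\<^bsub>P\<^esub> x c)"
      using C x by (intro P.finsum_insert) auto
    also have "(\<Oplus>\<^bsub>P\<^esub>c\<in>C. ?\<delta> c \<odot>\<^bsub>P\<^esub> x c) = (\<Oplus>\<^bsub>P\<^esub>c\<in>C. \<zero>\<^bsub>P\<^esub>)" using C x by (intro P.finsum_cong') auto
    finally have "(\<Oplus>\<^bsub>P\<^esub>c\<in>insert a C. ?\<delta> c \<odot>\<^bsub>P\<^esub> x c) = x a" using xa by simp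
    note \<delta>x = this
    have "\<exists>b\<in>S'. s' (f (x a)) b \<notin> m"
    proof (rule ccontr)
      assume "\<not> ?thesis"
      then have "?\<delta> a \<in> m" by (intro IndD[OF I, of ?\<delta>]) (simp_all only: \<delta>x, auto)
      then show False using L(5) by simp
    qed
    then obtain b where b: "b \<in> S'" "s' (f (x a)) b \<notin> m" by blast
    define v where "v = s' (f (x a)) b"
    have v: "v \<in> Units R" using L(3) D'(6)[OF fc[OF xa]] b(2) by (simp add: v_def)
    define \<alpha> where "\<alpha> y = inv\<^bsub>R\<^esub> v \<otimes>\<^bsub>R\<^esub> s' y b" for y
    have \<alpha>: "\<alpha> \<in> mod_hom R P' (self_module R)"
      using mod_hom_smult[OF D'(1) module_self_module[OF L(1)] mod_hom_dual_coord[OF dual(2)] P.R.Units_inv_closed[OF v]]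
      by (simp add: \<alpha>_def[abs_def])
    have \<alpha>a: "\<alpha> (f (x a)) = \<one>\<^bsub>R\<^esub>" using P.R.Units_l_inv[OF v] by (simp add: \<alpha>_def v_def)
    define \<theta> where "\<theta> y = \<alpha> y \<odot>\<^bsub>P\<^esub> x a" for y
    have "(\<lambda>r. r \<odot>\<^bsub>P\<^esub> x a) \<in> mod_hom R (self_module R) P"
      using xa by (intro mod_homI) (auto simp: P.smult_l_distr P.smult_assoc1)
    from mod_hom_comp[OF \<alpha> this] have \<theta>: "\<theta> \<in> mod_hom R P' P" by (simp add: \<theta>_def[abs_def])
    have \<alpha>c: "\<alpha> (f (x c)) \<in> carrier R" if "c \<in> C" for c using mod_homD(1)[OF \<alpha> fc[OF x]] that by simp
    have "Ind C (\<lambda>c. x c \<ominus>\<^bsub>P\<^esub> \<theta> (f (x c)))" unfolding Ind_def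
    proof (intro allI impI ballI; elim conjE)
      fix a' c assume a': "\<forall>c\<in>C. a' c \<in> carrier R" and c: "c \<in> C"
        and fm: "\<forall>b\<in>S'. s' (f (\<Oplus>\<^bsub>P\<^esub>c\<in>C. a' c \<odot>\<^bsub>P\<^esub> (x c \<ominus>\<^bsub>P\<^esub> \<theta> (f (x c))))) b \<in> m"
      define t where "t = (\<Oplus>\<^bsub>R\<^esub>c\<in>C. a' c \<otimes>\<^bsub>R\<^esub> \<alpha> (f (x c)))"
      have t: "t \<in> carrier R" unfolding t_def using a' \<alpha>c by (intro P.R.finsum_closed) auto
      define a'' where "a'' = a'(a := \<ominus>\<^bsub>R\<^esub> t)"
      have xc: "\<And>c. c \<in> C \<Longrightarrow> x c \<in> carrier P" using x by simp
      have "(\<Oplus>\<^bsub>P\<^esub>c\<in>C. a' c \<odot>\<^bsub>P\<^esub> (x c \<ominus>\<^bsub>P\<^esub> \<theta> (f (x c)))) =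
          (\<Oplus>\<^bsub>P\<^esub>c\<in>C. a' c \<odot>\<^bsub>P\<^esub> x c \<ominus>\<^bsub>P\<^esub> (a' c \<otimes>\<^bsub>R\<^esub> \<alpha> (f (x c))) \<odot>\<^bsub>P\<^esub> x a)"
        using a' xc \<alpha>c xa by (intro P.finsum_cong')
          (auto simp: \<theta>_def a_minus_def P.smult_r_distr P.smult_r_minus P.smult_assoc1)
      also have "\<dots> = (\<Oplus>\<^bsub>P\<^esub>c\<in>C. a' c \<odot>\<^bsub>P\<^esub> x c) \<ominus>\<^bsub>P\<^esub> (\<Oplus>\<^bsub>P\<^esub>c\<in>C. (a' c \<otimes>\<^bsub>R\<^esub> \<alpha> (f (x c))) \<odot>\<^bsub>P\<^esub> x a)"
        using a' xc \<alpha>c xa C by (intro P.finsum_minusf) auto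
      also have "(\<Oplus>\<^bsub>P\<^esub>c\<in>C. (a' c \<otimes>\<^bsub>R\<^esub> \<alpha> (f (x c))) \<odot>\<^bsub>P\<^esub> x a) = t \<odot>\<^bsub>P\<^esub> x a"
        using mod_hom_finsum[OF module_self_module[OF L(1)] D(1) \<open>(\<lambda>r. r \<odot>\<^bsub>P\<^esub> x a) \<in> _\<close> C(1),
            of "\<lambda>c. a' c \<otimes>\<^bsub>R\<^esub> \<alpha> (f (x c))"] a' \<alpha>c by (simp add: self_module_finsum t_def)
      also have "(\<Oplus>\<^bsub>P\<^esub>c\<in>C. a' c \<odot>\<^bsub>P\<^esub> x c) = (\<Oplus>\<^bsub>P\<^esub>c\<in>C. a'' c \<odot>\<^bsub>P\<^esub> x c)"
        using a' xc C by (intro P.finsum_cong') (auto simp: a''_def)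
      also have "\<dots> \<ominus>\<^bsub>P\<^esub> t \<odot>\<^bsub>P\<^esub> x a = a'' a \<odot>\<^bsub>P\<^esub> x a \<oplus>\<^bsub>P\<^esub> \<dots>"
        using t xa a' xc C
        by (subst P.a_comm) (auto simp: a''_def a_minus_def P.smult_l_minus intro!: P.finsum_closed)
      also have "\<dots> = (\<Oplus>\<^bsub>P\<^esub>c\<in>insert a C. a'' c \<odot>\<^bsub>P\<^esub> x c)"
        using C a' xc t xa by (intro P.finsum_insert[symmetric]) (auto simp: a''_def)
      finally have "(\<Oplus>\<^bsub>P\<^esub>c\<in>C. a' c \<odot>\<^bsub>P\<^esub> (x c \<ominus>\<^bsub>P\<^esub> \<theta> (f (x c)))) = (\<Oplus>\<^bsub>P\<^esub>c\<in>insert a C. a'' c \<odot>\<^bsub>P\<^esub> x c)" .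
      then have "a'' c \<in> m" using fm c a' t by (intro IndD[OF I, of a'']) (auto simp: a''_def)
      then show "a' c \<in> m" using c C by (auto simp: a''_def split: if_splits)
    qed
    then show "\<exists>\<theta>\<in>mod_hom R P' P. \<theta> (f (x a)) = x a \<and> Ind C (\<lambda>c. x c \<ominus>\<^bsub>P\<^esub> \<theta> (f (x c)))"
      by (intro bexI[OF _ \<theta>] conjI) (use \<alpha>a xa in \<open>simp_all add: \<theta>_def\<close>)
  qed (use D(3) in auto)
  then obtain \<theta> where \<theta>: "\<theta> \<in> mod_hom R P' P" "\<And>c. c \<in> S \<Longrightarrow> \<theta> (f c) = c" by blast
  have "\<theta> (f y) = y" if "y \<in> carrier P" for y
    by (rule hom_id_on_dual_basis[OF dual(1) mod_hom_comp[OF f \<theta>(1)] \<theta>(2) that])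
  then show ?thesis by (intro bexI[OF _ \<theta>(1)] ballI)
qed

declare koszul.simps [simp del] koszul_index.simps [simp del]

section \<open>Local rings of small finitistic dimension \<open>h\<close>\<close>

text \<open>Multiplication by the elements of \<open>F\<close> does not leave the complement of the ideal \<open>T \<epsilon>\<close> that is
  described by the additive projection \<open>\<kappa>\<close>.\<close>

definition retraction :: "'a ring \<Rightarrow> 'a set \<Rightarrow> 'a \<Rightarrow> ('a \<Rightarrow> 'a) \<Rightarrow> bool" where
  "retraction T F \<epsilon> \<kappa> \<longleftrightarrow> \<epsilon> \<in> carrier T \<and>
    (\<forall>a\<in>carrier T. \<exists>y\<in>carrier T. \<kappa> a = y \<otimes>\<^bsub>T\<^esub> \<epsilon>) \<and>
    (\<forall>a\<in>carrier T. \<forall>b\<in>carrier T. \<kappa> (a \<oplus>\<^bsub>T\<^esub> b) = \<kappa> a \<oplus>\<^bsub>T\<^esub> \<kappa> b) \<and>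
    (\<forall>y\<in>carrier T. \<kappa> (y \<otimes>\<^bsub>T\<^esub> \<epsilon>) = y \<otimes>\<^bsub>T\<^esub> \<epsilon>) \<and>
    (\<forall>a\<in>F. \<forall>w\<in>carrier T. \<kappa> (a \<otimes>\<^bsub>T\<^esub> w) = a \<otimes>\<^bsub>T\<^esub> \<kappa> w)"

lemma retractionD:
  assumes "retraction T F \<epsilon> \<kappa>"
  shows "\<epsilon> \<in> carrier T" "a \<in> carrier T \<Longrightarrow> \<exists>y\<in>carrier T. \<kappa> a = y \<otimes>\<^bsub>T\<^esub> \<epsilon>"
    "a \<in> carrier T \<Longrightarrow> b \<in> carrier T \<Longrightarrow> \<kappa> (a \<oplus>\<^bsub>T\<^esub> b) = \<kappa> a \<oplus>\<^bsub>T\<^esub> \<kappa> b"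
    "y \<in> carrier T \<Longrightarrow> \<kappa> (y \<otimes>\<^bsub>T\<^esub> \<epsilon>) = y \<otimes>\<^bsub>T\<^esub> \<epsilon>"
    "a \<in> F \<Longrightarrow> w \<in> carrier T \<Longrightarrow> \<kappa> (a \<otimes>\<^bsub>T\<^esub> w) = a \<otimes>\<^bsub>T\<^esub> \<kappa> w"
  using assms by (auto simp: retraction_def)

lemma (in plain_cring) retraction_finsum:
  assumes "retraction R F \<epsilon> \<kappa>" "finite A" "\<And>a. a \<in> A \<Longrightarrow> v a \<in> carrier R"
  shows "\<kappa> (\<Oplus>a\<in>A. v a) = (\<Oplus>a\<in>A. \<kappa> (v a))"
  using assms(2,3)
proof (induction A)
  case empty
  show ?case using retractionD(4)[OF assms(1), of \<zero>] retractionD(1)[OF assms(1)] by simp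
next
  case (insert a A)
  have "\<kappa> (v c) \<in> carrier R" if "c \<in> insert a A" for c
    using retractionD(2)[OF assms(1), of "v c"] retractionD(1)[OF assms(1)] insert.prems that by auto
  then show ?case using insert retractionD(3)[OF assms(1), of "v a" "\<Oplus>a\<in>A. v a"]
    by (auto intro!: finsum_closed)
qed

text \<open>Applying \<open>\<kappa>\<close> to the representation of \<open>\<epsilon>\<close> shows that \<open>\<epsilon>\<close> is a multiple of itself by an element of \<open>m\<close>.\<close>

lemma retraction_sum_zero:
  assumes "local_with T m" "retraction T F \<epsilon> \<kappa>" "finite A"
    "\<And>a. a \<in> A \<Longrightarrow> c a \<in> carrier T" "\<And>a. a \<in> A \<Longrightarrow> g a \<in> F" "\<And>a. a \<in> A \<Longrightarrow> g a \<in> m"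
    "\<epsilon> = (\<Oplus>\<^bsub>T\<^esub>a\<in>A. g a \<otimes>\<^bsub>T\<^esub> c a)"
  shows "\<epsilon> = \<zero>\<^bsub>T\<^esub>"
proof -
  note L = local_withD[OF assms(1)]
  interpret T: plain_cring T using L(1) by (rule plain_cring.intro)
  interpret m: ideal m T by (rule L(2))
  note r = retractionD[OF assms(2)]
  have g: "g a \<in> carrier T" if "a \<in> A" for a using assms(6)[OF that] L(6) by blast
  have "\<forall>a\<in>A. \<exists>y\<in>carrier T. \<kappa> (c a) = y \<otimes>\<^bsub>T\<^esub> \<epsilon>" using r(2) assms(4) by blast
  then obtain y where y: "\<And>a. a \<in> A \<Longrightarrow> y a \<in> carrier T" "\<And>a. a \<in> A \<Longrightarrow> \<kappa> (c a) = y a \<otimes>\<^bsub>T\<^esub> \<epsilon>" by metis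
  have "\<epsilon> = \<kappa> \<epsilon>" using r(4)[of "\<one>\<^bsub>T\<^esub>"] r(1) by simp
  also have "\<dots> = \<kappa> (\<Oplus>\<^bsub>T\<^esub>a\<in>A. g a \<otimes>\<^bsub>T\<^esub> c a)" using assms(7) by simp
  also have "\<dots> = (\<Oplus>\<^bsub>T\<^esub>a\<in>A. \<kappa> (g a \<otimes>\<^bsub>T\<^esub> c a))"
    by (rule T.retraction_finsum[OF assms(2,3)]) (use g assms(4) in auto)
  also have "\<dots> = (\<Oplus>\<^bsub>T\<^esub>a\<in>A. (g a \<otimes>\<^bsub>T\<^esub> y a) \<otimes>\<^bsub>T\<^esub> \<epsilon>)"
    using r(1,5) y g assms(4,5) by (intro T.finsum_cong') (auto simp: T.m_assoc)
  also have "\<dots> = (\<Oplus>\<^bsub>T\<^esub>a\<in>A. g a \<otimes>\<^bsub>T\<^esub> y a) \<otimes>\<^bsub>T\<^esub> \<epsilon>"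
    using r(1) y g by (intro T.finsum_ldistr[symmetric] assms(3)) auto
  finally have eq: "\<epsilon> = (\<Oplus>\<^bsub>T\<^esub>a\<in>A. g a \<otimes>\<^bsub>T\<^esub> y a) \<otimes>\<^bsub>T\<^esub> \<epsilon>" .
  have "submodule m T (self_module T)" using ideal_iff_submodule[OF L(1)] L(2) by blast
  from submodule_smult_closed_finsum[OF module_self_module[OF L(1)] this assms(3), of "\<lambda>a. g a \<otimes>\<^bsub>T\<^esub> y a"]
  have "(\<Oplus>\<^bsub>T\<^esub>a\<in>A. g a \<otimes>\<^bsub>T\<^esub> y a) \<in> m"
    using m.I_r_closed[OF assms(6) y(1)] by (simp add: self_module_finsum)
  from local_with_self_multiple[OF assms(1) this r(1) eq] show ?thesis .
qed

lemma retraction_notin_ideal: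
  assumes "local_with T m" "retraction T F \<epsilon> \<kappa>" "finite F" "F \<subseteq> m" "\<epsilon> \<noteq> \<zero>\<^bsub>T\<^esub>"
  shows "\<epsilon> \<notin> Idl\<^bsub>T\<^esub> F"
proof
  note L = local_withD[OF assms(1)]
  interpret T: plain_cring T using L(1) by (rule plain_cring.intro)
  have FT: "F \<subseteq> carrier T" using assms(4) L(6) by blast
  assume "\<epsilon> \<in> Idl\<^bsub>T\<^esub> F"
  then obtain c where c: "c \<in> carrier (fsupp_module T F)" "\<epsilon> = lin_ext T (self_module T) (\<lambda>x. x) c"
    unfolding genideal_eq_span[OF L(1) FT] span_of_def by blast
  have cT: "c a \<in> carrier T" for a using c(1) by (simp add: fsupp_carrier_iff)
  have "lin_ext T (self_module T) (\<lambda>x. x) c = (\<Oplus>\<^bsub>self_module T\<^esub>a\<in>F. c a \<odot>\<^bsub>self_module T\<^esub> a)"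
    by (rule lin_ext_eq[OF module_self_module[OF L(1)] c(1)])
      (use FT c(1) in \<open>auto simp: fsupp_carrier_iff assms(3)\<close>)
  also have "\<dots> = (\<Oplus>\<^bsub>T\<^esub>a\<in>F. a \<otimes>\<^bsub>T\<^esub> c a)" unfolding self_module_finsum
    using FT cT by (intro T.finsum_cong') (auto simp: T.m_comm subset_iff)
  finally have "\<epsilon> = (\<Oplus>\<^bsub>T\<^esub>a\<in>F. a \<otimes>\<^bsub>T\<^esub> c a)" using c(2) by simp
  from retraction_sum_zero[OF assms(1,2,3) cT _ _ this] assms(4,5) show False by blast
qed

lemma minimal_dual_basis_exists:
  assumes "proj R P" "fg_module R P"
  shows "\<exists>S s. dual_basis R P S s \<and> (\<forall>S'. S' \<subseteq> carrier P \<and> finite S' \<and> span_of R P S' = span_of R P S \<longrightarrow> card S \<le> card S')"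
proof -
  define G where "G S \<longleftrightarrow> finite S \<and> S \<subseteq> carrier P \<and> span_of R P S = carrier P" for S
  have "\<exists>S. G S" using assms(2) by (auto simp: fg_module_iff G_def span_of_def)
  then obtain S where S: "G S" "\<And>S'. G S' \<Longrightarrow> card S \<le> card S'" using ex_has_least_nat[of G _ card] by blast
  from fg_proj_dual_basis[OF assms(1), of S] S(1) obtain s where "dual_basis R P S s"
    using proj_module[OF assms(1)] by (auto simp: dual_basis_def G_def span_of_def)
  moreover have "card S \<le> card S'" if "S' \<subseteq> carrier P" "finite S'" "span_of R P S' = span_of R P S" for S'
    using S that by (auto simp: G_def)
  ultimately show ?thesis by blast
qed

text \<open>The ring-theoretic facts from which the statements about the example are derived. In the example
  \<open>b i\<close> is the preimage of the ideal \<open>(x 0, \<dots>, x (i - 1))\<close> of the regular ring \<open>R\<close>; by \<open>b_base\<close> there are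
  copies \<open>T \<epsilon>\<close> of \<open>T/b 1\<close> that look like direct summands to a given finite set \<open>F\<close> of ring elements, and by
  \<open>annihilated\<close> every element of the maximal ideal kills such an \<open>\<epsilon>\<close>.\<close>

locale grade_ring =
  fixes T :: "'a ring" (structure) and m :: "'a set" and x :: "nat \<Rightarrow> 'a" and h :: nat and b :: "nat \<Rightarrow> 'a set"
  assumes loc: "local_with T m"
    and h: "1 \<le> h"
    and x_m: "i \<le> h \<Longrightarrow> x i \<in> m"
    and annihilated: "t \<in> m \<Longrightarrow> finite F \<Longrightarrow> F \<subseteq> carrier T \<Longrightarrow>
      \<exists>\<epsilon> \<kappa>. retraction T F \<epsilon> \<kappa> \<and> \<epsilon> \<noteq> \<zero> \<and> t \<otimes> \<epsilon> = \<zero>"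
    and b_base: "finite F \<Longrightarrow> F \<subseteq> carrier T \<Longrightarrow>
      \<exists>\<epsilon> \<kappa>. retraction T F \<epsilon> \<kappa> \<and> (\<forall>t\<in>carrier T. t \<otimes> \<epsilon> = \<zero> \<longleftrightarrow> t \<in> b 1)"
    and b_ideal: "1 \<le> i \<Longrightarrow> i \<le> Suc h \<Longrightarrow> ideal (b i) T"
    and b_step: "1 \<le> i \<Longrightarrow> i \<le> h \<Longrightarrow> b (Suc i) = {x i \<otimes> y \<oplus> z | y z. y \<in> carrier T \<and> z \<in> b i}"
    and b_regular: "1 \<le> i \<Longrightarrow> i \<le> h \<Longrightarrow> y \<in> carrier T \<Longrightarrow> x i \<otimes> y \<in> b i \<Longrightarrow> y \<in> b i"
    and b_top: "b (Suc h) = m"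
    and exact_0: "u \<in> carrier (fsupp_module T (koszul_index (Suc h) 0)) \<Longrightarrow>
      koszul T x (Suc h) u = (\<lambda>n. \<zero>) \<Longrightarrow> u = (\<lambda>n. \<zero>)"
    and exact_Suc: "Suc i < h \<Longrightarrow> u \<in> carrier (fsupp_module T (koszul_index (Suc h) (Suc i))) \<Longrightarrow>
      koszul T x (Suc h) u = (\<lambda>n. \<zero>) \<Longrightarrow>
      \<exists>w\<in>carrier (fsupp_module T (koszul_index (Suc h) i)). koszul T x (Suc h) w = u"

sublocale grade_ring \<subseteq> plain_cring T
  using local_withD(1)[OF loc] by (rule plain_cring.intro)

context grade_ring
begin

lemmas L = local_withD[OF loc]

lemma T: "cring T" by (rule L(1))

lemma x_T: "i \<le> h \<Longrightarrow> x i \<in> carrier T" using x_m L(6) by blast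

subsection \<open>The upper bound\<close>

text \<open>The exactness of the tensored resolution passes from \<open>T\<close> to \<open>T/b 1\<close> without loss, and then along
  \<open>T/b 1, \<dots>, T/b (h + 1) = T/m\<close> with the loss of one degree in each of the \<open>h\<close> steps.\<close>

lemma fPD_upper: "fPD T \<le> enat h"
proof (rule fPD_le_if_split)
  fix k and P :: "nat \<Rightarrow> ('a, nat \<Rightarrow> 'a) module" and d e and M :: "('a, nat \<Rightarrow> 'a) module"
  assume res: "projective_resolution T P d e M" and fg: "\<forall>i. fg_module T (P i)"
    and van: "vanishes_above P (Suc k)" and hk: "h \<le> k"
  have "\<exists>S s. dual_basis T (P i) S s \<and>
      (\<forall>S'. S' \<subseteq> carrier (P i) \<and> finite S' \<and> span_of T (P i) S' = span_of T (P i) S \<longrightarrow> card S \<le> card S')" for i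
    by (rule minimal_dual_basis_exists) (use res fg in \<open>auto simp: projective_resolution_iff\<close>)
  then obtain S s where dual: "\<And>i. dual_basis T (P i) (S i) (s i)"
    and min: "\<And>i S'. S' \<subseteq> carrier (P i) \<Longrightarrow> finite S' \<Longrightarrow> span_of T (P i) S' = span_of T (P i) (S i) \<Longrightarrow>
      card (S i) \<le> card S'" by metis
  interpret fg_resolution T P d e M S s using res dual by unfold_locales
  let ?T = "self_module T"
  note mT = module_self_module[OF T]
  \<comment> \<open>Exactness over \<open>T\<close> passes to the summand \<open>T \<epsilon>\<close>, because the projection commutes with the finitely
    many matrix entries.\<close>
  have base: "exact_tensor ?T (b 1) i" for i
  proof (rule exact_tensorI)
    let ?k = "Suc i" and ?l = "Suc (Suc i)"
    fix u assume u: "\<And>c. c \<in> S ?k \<Longrightarrow> u c \<in> carrier ?T"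
      and Du: "\<And>c. c \<in> S i \<Longrightarrow> tens ?T (s i) (S ?k) (d i) u c \<in> b 1"
    define F where "F = (\<lambda>(c, c'). s ?k (d ?k c) c') ` (S ?l \<times> S ?k)"
    have dc: "d ?k c \<in> carrier (P ?k)" if "c \<in> S ?l" for c
      using mod_homD(1)[OF dP] dual_basisD(3)[OF dual] that by blast
    have F: "finite F" "F \<subseteq> carrier T"
      using dual_basisD(2)[OF dual] dual_basisD(6)[OF dual dc] by (auto simp: F_def)
    obtain \<epsilon> \<kappa> where ret: "retraction T F \<epsilon> \<kappa>" and ann: "\<And>t. t \<in> carrier T \<Longrightarrow> t \<otimes> \<epsilon> = \<zero> \<longleftrightarrow> t \<in> b 1"
      using b_base[OF F] by blast
    note r = retractionD[OF ret] and rs = retraction_finsum[OF ret]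
    have me: "(\<lambda>t. t \<otimes> \<epsilon>) \<in> mod_hom T ?T ?T"
      using r(1) by (intro mod_homI) (auto simp: l_distr m_assoc)
    have u\<epsilon>: "u c \<otimes> \<epsilon> \<in> carrier ?T" if "c \<in> S ?k" for c using u[OF that] r(1) by simp
    have "tens ?T (s i) (S ?k) (d i) (\<lambda>c. u c \<otimes> \<epsilon>) c \<in> {\<zero>}" if c: "c \<in> S i" for c
    proof -
      have eq: "tens ?T (s i) (S ?k) (d i) u c \<otimes> \<epsilon> = tens ?T (s i) (S ?k) (d i) (\<lambda>c. u c \<otimes> \<epsilon>) c"
        by (rule tens_natural[OF dual dual dP mT mT me u])
      moreover have "tens ?T (s i) (S ?k) (d i) u c \<in> carrier T"
        using tens_closed[OF dual dual dP mT u] by simp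
      ultimately have "tens ?T (s i) (S ?k) (d i) u c \<otimes> \<epsilon> = \<zero>" using ann Du[OF c] by blast
      with eq show ?thesis by simp
    qed
    from exact_tensorD[where u = "\<lambda>c. u c \<otimes> \<epsilon>", OF exact_tensor_self u\<epsilon> this] obtain w where
      w: "\<And>c. c \<in> S ?l \<Longrightarrow> w c \<in> carrier ?T"
      "\<And>c. c \<in> S ?k \<Longrightarrow> tens ?T (s ?k) (S ?k) (\<lambda>x. x) (\<lambda>c. u c \<otimes> \<epsilon>) c \<ominus>\<^bsub>?T\<^esub>
        tens ?T (s ?k) (S ?l) (d ?k) w c \<in> {\<zero>}" by blast
    have "\<forall>c\<in>S ?l. \<exists>y\<in>carrier T. \<kappa> (w c) = y \<otimes> \<epsilon>" using r(2) w(1) by simp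
    then obtain w' where w': "\<And>c. c \<in> S ?l \<Longrightarrow> w' c \<in> carrier T" "\<And>c. c \<in> S ?l \<Longrightarrow> \<kappa> (w c) = w' c \<otimes> \<epsilon>" by metis
    have w'T: "\<And>c. c \<in> S ?l \<Longrightarrow> w' c \<in> carrier ?T" using w'(1) by simp
    show "\<exists>w. (\<forall>c\<in>S ?l. w c \<in> carrier ?T) \<and> (\<forall>c\<in>S ?k. tens ?T (s ?k) (S ?k) (\<lambda>x. x) u c \<ominus>\<^bsub>?T\<^esub>
        tens ?T (s ?k) (S ?l) (d ?k) w c \<in> b 1)"
    proof (intro exI[of _ w'] conjI ballI w'T)
      fix c assume c: "c \<in> S ?k"
      let ?A = "tens ?T (s ?k) (S ?k) (\<lambda>x. x) u c" and ?B = "tens ?T (s ?k) (S ?l) (d ?k) w' c"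
        and ?W = "tens ?T (s ?k) (S ?l) (d ?k) w c"
      have A: "?A \<in> carrier ?T" by (rule tens_closed[OF dual dual mod_hom_id mT u])
      have B: "?B \<in> carrier ?T" by (rule tens_closed[OF dual dual dP mT w'T])
      have W: "?W \<in> carrier ?T" by (rule tens_closed[OF dual dual dP mT w(1)])
      have A\<epsilon>: "?A \<otimes> \<epsilon> = tens ?T (s ?k) (S ?k) (\<lambda>x. x) (\<lambda>c. u c \<otimes> \<epsilon>) c"
        by (rule tens_natural[OF dual dual mod_hom_id mT mT me u])
      have A\<epsilon>T: "?A \<otimes> \<epsilon> \<in> carrier ?T" using A r(1) by simp
      have "?A \<otimes> \<epsilon> = ?W"
        using w(2)[OF c] module_minus_eq_zero[OF mT _ A\<epsilon>T W] A\<epsilon> by simp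
      moreover have "\<kappa> ?W = ?B \<otimes> \<epsilon>"
      proof -
        have e: "s ?k (d ?k c') c \<in> carrier T" "s ?k (d ?k c') c \<in> F" if "c' \<in> S ?l" for c'
          using dual_basisD(6)[OF dual dc[OF that]] that c by (auto simp: F_def)
        have "\<kappa> ?W = (\<Oplus>c'\<in>S ?l. \<kappa> (s ?k (d ?k c') c \<otimes> w c'))"
          unfolding tens_def self_module_finsum self_module_simps
          by (rule rs[OF dual_basisD(2)[OF dual]]) (use e w(1) in simp)
        also have "\<dots> = (\<Oplus>c'\<in>S ?l. s ?k (d ?k c') c \<otimes> (w' c' \<otimes> \<epsilon>))"
          using e w(1) w' r(1,5) by (intro finsum_cong') auto
        also have "\<dots> = tens ?T (s ?k) (S ?l) (d ?k) (\<lambda>c. w' c \<otimes> \<epsilon>) c"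
          by (simp add: tens_def self_module_finsum)
        also have "\<dots> = ?B \<otimes> \<epsilon>" by (rule tens_natural[OF dual dual dP mT mT me w'T, symmetric])
        finally show ?thesis .
      qed
      moreover have "\<kappa> (?A \<otimes> \<epsilon>) = ?A \<otimes> \<epsilon>" using r(4) A by simp
      ultimately have "?A \<otimes> \<epsilon> = ?B \<otimes> \<epsilon>" by simp
      then have "(?A \<ominus> ?B) \<otimes> \<epsilon> = \<zero>" using A B r(1) by (simp add: a_minus_def l_distr l_minus r_neg)
      then have "?A \<ominus> ?B \<in> b 1" using ann[of "?A \<ominus> ?B"] A B by simp
      then show "?A \<ominus>\<^bsub>?T\<^esub> ?B \<in> b 1" using B by (simp add: self_module_minus[OF T])
    qed
  qed
  have "exact_tensor ?T (b (Suc j)) i" if "j \<le> h" "j \<le> i" for j i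
    using that
  proof (induction j arbitrary: i)
    case 0
    show ?case using base by simp
  next
    case (Suc j)
    obtain i' where i': "i = Suc i'" using Suc.prems by (cases i) auto
    have xT: "x (Suc j) \<in> carrier T" using x_T Suc.prems by simp
    have \<phi>: "(\<lambda>t. x (Suc j) \<otimes> t) \<in> mod_hom T ?T ?T"
      using xT by (intro mod_homI) (auto simp: r_distr m_lcomm)
    have id: "ideal (b (Suc j)) T" using b_ideal Suc.prems by simp
    interpret bj: ideal "b (Suc j)" T by (rule id)
    show ?case unfolding i'
    proof (rule exact_tensor_cokernel[OF mT mT \<phi>])
      show "submodule (b (Suc j)) T ?T" using id ideal_iff_submodule[OF T] by blast
      show "y \<in> b (Suc j)" if "y \<in> carrier ?T" "x (Suc j) \<otimes> y \<in> b (Suc j)" for y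
        using b_regular[of "Suc j" y] that Suc.prems by simp
      show "x (Suc j) \<otimes> y \<in> b (Suc j)" if "y \<in> b (Suc j)" for y
        using bj.I_l_closed[OF that xT] .
      show "b (Suc (Suc j)) = {x (Suc j) \<otimes> y \<oplus>\<^bsub>?T\<^esub> z | y z. y \<in> carrier ?T \<and> z \<in> b (Suc j)}"
        using b_step[of "Suc j"] Suc.prems by simp
      show "exact_tensor ?T (b (Suc j)) (Suc i')" "exact_tensor ?T (b (Suc j)) i'"
        using Suc.prems i' by (auto intro!: Suc.IH)
    qed
  qed
  from this[of h k] have ex: "exact_tensor ?T m k" using hk b_top by simp
  let ?k = "Suc k" and ?l = "Suc (Suc k)"
  show "\<exists>r\<in>mod_hom T (P k) (P ?k). \<forall>y\<in>carrier (P ?k). r (d k y) = y"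
  proof (rule split_if_injective_mod_maximal[OF loc dual dual dP min])
    fix y assume y: "y \<in> carrier (P ?k)" and sm: "\<And>c. c \<in> S k \<Longrightarrow> s k (d k y) c \<in> m"
    let ?u = "\<lambda>c. s ?k y c \<odot>\<^bsub>?T\<^esub> \<one>"
    have 1: "\<one> \<in> carrier ?T" by simp
    note dy = mod_homD(1)[OF dP y]
    have u: "?u c \<in> carrier ?T" for c using dual_basisD(6)[OF dual y] by simp
    have "tens ?T (s k) (S ?k) (d k) ?u c \<in> m" if "c \<in> S k" for c
      using tens_coord_smult[OF dual dual dP mT 1 y] sm[OF that] dual_basisD(6)[OF dual dy] by simp
    from exact_tensorD[where u = ?u, OF ex u this] obtain w where w: "\<And>c. c \<in> S ?l \<Longrightarrow> w c \<in> carrier ?T"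
      "\<And>c. c \<in> S ?k \<Longrightarrow> tens ?T (s ?k) (S ?k) (\<lambda>x. x) ?u c \<ominus>\<^bsub>?T\<^esub> tens ?T (s ?k) (S ?l) (d ?k) w c \<in> m"
      by blast
    show "\<forall>c\<in>S ?k. s ?k y c \<in> m"
    proof
      fix c assume c: "c \<in> S ?k"
      have "d ?k c' = \<zero>\<^bsub>P ?k\<^esub>" if "c' \<in> S ?l" for c'
      proof -
        have "c' = \<zero>\<^bsub>P ?l\<^esub>" using dual_basisD(3)[OF dual] van that by (auto simp: vanishes_above_def)
        then show ?thesis using mod_hom_zero[OF mP mP dP] by simp
      qed
      then have "tens ?T (s ?k) (S ?l) (d ?k) w c = \<zero>\<^bsub>?T\<^esub>" by (intro tens_zero[OF mT dual]) (use w in auto)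
      moreover have "tens ?T (s ?k) (S ?k) (\<lambda>x. x) ?u c = s ?k y c \<odot>\<^bsub>?T\<^esub> \<one>"
        by (rule tens_coord_smult[OF dual dual mod_hom_id mT 1 y])
      ultimately show "s ?k y c \<in> m"
        using w(2)[OF c] module_minus_zero[OF mT u[of c]] dual_basisD(6)[OF dual y] by simp
    qed
  qed
qed

subsection \<open>The Koszul complex as a resolution\<close>

abbreviation C :: "nat \<Rightarrow> ('a, nat \<Rightarrow> 'a) module" where "C i \<equiv> fsupp_module T (koszul_index (Suc h) i)"
abbreviation D :: "(nat \<Rightarrow> 'a) \<Rightarrow> nat \<Rightarrow> 'a" where "D \<equiv> koszul T x (Suc h)"

lemma xS: "k < Suc h \<Longrightarrow> x k \<in> carrier T" using x_T by simp

lemma mC: "module T (C i)" by (rule module_fsupp_module[OF T])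

lemma pC: "proj T (C i)" by (rule proj_fsupp[OF T])

lemma DC: "D \<in> mod_hom T (C i) (C (Suc i))" by (rule mod_hom_koszul[OF xS])

lemma C_closed: "u \<in> carrier (C i) \<Longrightarrow> u n \<in> carrier T" by (simp add: fsupp_carrier_iff)

lemma DD: "u \<in> carrier (C i) \<Longrightarrow> D (D u) = (\<lambda>n. \<zero>)"
  by (rule ext, rule koszul_koszul[OF xS C_closed])

lemma D_inj: "u \<in> carrier (C 0) \<Longrightarrow> v \<in> carrier (C 0) \<Longrightarrow> D u = D v \<Longrightarrow> u = v"
proof -
  assume u: "u \<in> carrier (C 0)" and v: "v \<in> carrier (C 0)" and eq: "D u = D v"
  interpret C0: module T "C 0" by (rule mC)
  interpret C1: module T "C 1" by (rule mC)
  have "D (u \<ominus>\<^bsub>C 0\<^esub> v) = D u \<ominus>\<^bsub>C 1\<^esub> D v"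
    using mod_hom_minus_apply[OF mC mC DC u v] by simp
  also have "\<dots> = (\<lambda>n. \<zero>)" unfolding eq using mod_homD(1)[OF DC v] C1.r_neg[of "D v"]
    by (simp add: a_minus_def)
  finally have "u \<ominus>\<^bsub>C 0\<^esub> v = \<zero>\<^bsub>C 0\<^esub>" using exact_0 u v by simp
  then show "u = v" by (rule module_minus_eq_zero[OF mC _ u v])
qed

definition unit_vec :: "nat \<Rightarrow> 'a" where "unit_vec = (\<lambda>n. if n = 0 then \<one> else \<zero>)"

lemma unit_vec: "unit_vec \<in> carrier (C 0)"
  by (auto simp: fsupp_carrier_iff koszul_index_degree_0 unit_vec_def)

lemma C_0: "u \<in> carrier (C 0) \<Longrightarrow> u = (\<lambda>n. u 0 \<otimes> unit_vec n)"
  by (auto simp: fsupp_carrier_iff koszul_index_degree_0 unit_vec_def fun_eq_iff)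

definition I :: "'a set" where "I = Idl (x ` {..h})"

lemma xI: "x ` {..h} \<subseteq> carrier T" using x_T by auto

lemma I_ideal: "ideal I T" unfolding I_def by (rule genideal_ideal[OF xI])

lemma I_m: "I \<subseteq> m" unfolding I_def by (rule genideal_minimal[OF L(2)]) (use x_m in auto)

lemma I_T: "I \<subseteq> carrier T" using I_m L(6) by blast

lemma x_I: "k < Suc h \<Longrightarrow> x k \<in> I"
  using genideal_self[OF xI] unfolding I_def by auto

lemma D_in_I: "u \<in> carrier (C i) \<Longrightarrow> D u n \<in> I"
  by (rule koszul_in_ideal[OF I_ideal x_I C_closed])

text \<open>A functional on a free module is a combination of the coordinates.\<close>

lemma functional_in_ideal:
  assumes "ideal J T" "finite B" "\<alpha> \<in> mod_hom T (fsupp_module T B) (self_module T)"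
    "v \<in> carrier (fsupp_module T B)" "\<And>n. v n \<in> J"
  shows "\<alpha> v \<in> J"
proof -
  interpret J: ideal J T by fact
  note mT = module_self_module[OF T]
  have sJ: "submodule J T (self_module T)" using assms(1) ideal_iff_submodule[OF T] by blast
  let ?u = "\<lambda>b c. if c = b then \<one> else \<zero>"
  have "\<alpha> v = lin_ext T (self_module T) (\<lambda>b. \<alpha> (?u b)) v" by (rule lin_ext_unique[OF mT assms(3,4)])
  moreover have "lin_ext T (self_module T) (\<lambda>b. \<alpha> (?u b)) v \<in> J" unfolding lin_ext_def
  proof (rule submodule_smult_closed_finsum[OF mT sJ])
    show "finite {b. v b \<noteq> \<zero>}" using assms(4) by (simp add: fsupp_carrier_iff)
    fix b assume "b \<in> {b. v b \<noteq> \<zero>}"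
    then have "b \<in> B" using assms(4) by (auto simp: fsupp_carrier_iff)
    then have "?u b \<in> carrier (fsupp_module T B)" by (auto simp: fsupp_carrier_finite[OF assms(2)])
    then have "\<alpha> (?u b) \<in> carrier T" using mod_homD(1)[OF assms(3)] by simp
    then show "v b \<odot>\<^bsub>self_module T\<^esub> \<alpha> (?u b) \<in> J" using J.I_r_closed[OF assms(5)] by simp
  qed
  ultimately show ?thesis by simp
qed

text \<open>The beginning of the Koszul complex, read backwards, is a free resolution of a module whose
  projective dimension is \<open>h\<close>: the last map \<open>C 0 \<rightarrow> C 1\<close> has its entries in \<open>m\<close> and cannot split.\<close>

lemma fPD_lower: "enat h \<le> fPD T"
proof -
  obtain h' where h': "h = Suc h'" using h by (cases h) auto
  let ?K = "D ` carrier (C h')"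
  have sub: "submodule ?K T (C h)" unfolding h' using image_submodule[OF mC mC DC] h' by simp
  from quotient_module_exists[OF mC sub] obtain Q :: "('a, nat \<Rightarrow> 'a) module" and \<pi> where
    Q: "module T Q" "\<pi> \<in> mod_hom T (C h) Q" "\<pi> ` carrier (C h) = carrier Q"
    "\<And>u. u \<in> carrier (C h) \<Longrightarrow> \<pi> u = \<zero>\<^bsub>Q\<^esub> \<longleftrightarrow> u \<in> ?K" by blast
  define B where "B i = (if i \<le> h then koszul_index (Suc h) (h - i) else {})" for i
  define P where "P i = fsupp_module T (B i)" for i
  define d where "d i = (if i < h then D else (\<lambda>u. \<zero>\<^bsub>P i\<^esub>))" for i
  have PC: "P i = C (h - i)" if "i \<le> h" for i using that by (simp add: P_def B_def)
  have Pz: "carrier (P i) = {\<zero>\<^bsub>P i\<^esub>}" if "h < i" for i using that by (auto simp: P_def B_def fsupp_carrier_iff)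
  have fin: "finite (B i)" for i by (simp add: B_def finite_koszul_index)
  have mP: "module T (P i)" for i unfolding P_def by (rule module_fsupp_module[OF T])
  have dP: "d i \<in> mod_hom T (P (Suc i)) (P i)" for i
  proof (cases "i < h")
    case True
    then have "h - i = Suc (h - Suc i)" by simp
    then show ?thesis using True DC[of "h - Suc i"] PC[of i] PC[of "Suc i"] by (simp add: d_def)
  next
    case False
    then show ?thesis using mod_hom_zero_map[OF mP mP] by (simp add: d_def)
  qed
  have ex: "d i ` carrier (P (Suc i)) = cycles_at P d \<pi> Q i" for i
  proof -
    consider "i = 0" | j where "i = Suc j" "i < h" | "i = h" | "h < i" by (cases i) force+
    then show ?thesis
    proof cases
      case 1
      have "d 0 ` carrier (P 1) = ?K" using PC[of 1] h h' by (simp add: d_def)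
      moreover have "?K \<subseteq> carrier (C h)" using module.submoduleE(1)[OF mC sub] .
      ultimately show ?thesis using 1 PC[of 0] Q(4) by auto
    next
      case 2
      obtain i' where i': "h - i = Suc i'" using 2(2) by (cases "h - i") auto
      have e: "h - Suc i = i'" "h - j = Suc (h - i)" "Suc i' < h" using i' 2 by auto
      have P: "P (Suc i) = C i'" "P i = C (Suc i')" using PC[of "Suc i"] PC[of i] 2 e i' by auto
      have z: "\<zero>\<^bsub>P j\<^esub> = (\<lambda>n. \<zero>)" by (simp add: P_def)
      show ?thesis
      proof
        show "d i ` carrier (P (Suc i)) \<subseteq> cycles_at P d \<pi> Q i"
          using 2 DD mod_homD(1)[OF DC[of i']] P z by (auto simp: d_def)
        show "cycles_at P d \<pi> Q i \<subseteq> d i ` carrier (P (Suc i))"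
        proof
          fix u assume "u \<in> cycles_at P d \<pi> Q i"
          then have "u \<in> carrier (C (Suc i'))" "D u = (\<lambda>n. \<zero>)" using 2 P z by (auto simp: d_def)
          from exact_Suc[OF e(3) this] show "u \<in> d i ` carrier (P (Suc i))"
            using 2(2) P by (auto simp: d_def)
        qed
      qed
    next
      case 3
      have z: "\<zero>\<^bsub>P i\<^esub> = (\<lambda>n. \<zero>)" for i by (simp add: P_def)
      have "cycles_at P d \<pi> Q h = {u \<in> carrier (C 0). D u = (\<lambda>n. \<zero>)}"
        using h' PC[of h] z by (simp add: d_def)
      also have "\<dots> = {\<lambda>n. \<zero>}"
        using exact_0 mod_hom_zero[OF mC mC DC, of 0] module.axioms(2)[OF mC[of 0]]
        by (auto simp: fsupp_carrier_iff)
      finally show ?thesis using 3 Pz[of "Suc h"] z by (simp add: d_def)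
    next
      case 4
      then obtain j where "i = Suc j" "h \<le> j" by (cases i) auto
      then show ?thesis using Pz[of i] Pz[of "Suc i"] 4 by (auto simp: d_def)
    qed
  qed
  have pP: "proj T (P i)" for i unfolding P_def by (rule proj_fsupp[OF T])
  have res: "projective_resolution T P d \<pi> Q"
    unfolding projective_resolution_iff exact_upto_iff
    using pP Q(1-3) mP dP ex PC[of 0] by simp
  have van: "vanishes_above P h" using Pz by (simp add: vanishes_above_def)
  have fg: "fg_module T (P i)" for i unfolding P_def by (rule fg_fsupp[OF T fin])
  have "Q \<in> FPR T" unfolding FPR_def using res van fg by blast
  then have le: "pd T Q \<le> fPD T" unfolding fPD_def by (rule SUP_upper)
  have "\<not> pd T Q \<le> enat h'"
  proof
    assume "pd T Q \<le> enat h'"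
    then obtain P' :: "nat \<Rightarrow> ('a, ('a, nat \<Rightarrow> 'a) res) module" and d' e' where
      P': "projective_resolution T P' d' e' Q" "vanishes_above P' h'" unfolding pd_le_iff by blast
    from boundaries_split[OF P' res] obtain \<rho> where \<rho>: "\<rho> \<in> mod_hom T (P h') (P h')"
      "\<rho> ` carrier (P h') \<subseteq> d h' ` carrier (P (Suc h'))" "\<And>u. u \<in> carrier (P (Suc h')) \<Longrightarrow> \<rho> (d h' u) = d h' u"
      by blast
    have P1: "P h' = C 1" "P (Suc h') = C 0" "d h' = D" using PC[of h'] PC[of "Suc h'"] h' by (auto simp: d_def)
    have "\<exists>k\<in>mod_hom T (C 1) (C 0). \<forall>u\<in>carrier (C 1). D (k u) = \<rho> u"
      by (rule proj_lift[OF pC mC mC]) (use \<rho> P1 DC[of 0] in \<open>auto\<close>)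
    then obtain k where k: "k \<in> mod_hom T (C 1) (C 0)" "\<And>u. u \<in> carrier (C 1) \<Longrightarrow> D (k u) = \<rho> u" by blast
    have v: "D unit_vec \<in> carrier (C 1)" using mod_homD(1)[OF DC unit_vec] by simp
    have "D (k (D unit_vec)) = D unit_vec" using k(2)[OF v] \<rho>(3) unit_vec P1 by simp
    then have "k (D unit_vec) = unit_vec" by (rule D_inj[OF mod_homD(1)[OF k(1) v] unit_vec])
    moreover have "(\<lambda>u. k u 0) (D unit_vec) \<in> m"
      by (rule functional_in_ideal[OF L(2) finite_koszul_index mod_hom_comp[OF k(1) mod_hom_coord] v])
        (use D_in_I[OF unit_vec] I_m in blast)
    ultimately show False using L(5) by (simp add: unit_vec_def)
  qed
  then have "enat (Suc h') \<le> pd T Q" by (simp add: not_le Suc_ile_eq)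
  then show ?thesis using le h' by (metis order_trans)
qed

lemma fPD_eq: "fPD T = enat h"
  by (rule antisym[OF fPD_upper fPD_lower])

end

section \<open>Cyclic modules with finitely presented relations\<close>

lemma fg_sum_of_images:
  assumes "fg_module R A" "fg_module R B" "module R M" "f \<in> mod_hom R A M" "g \<in> mod_hom R B M"
    "submodule K R M" "K = {f a \<oplus>\<^bsub>M\<^esub> g b | a b. a \<in> carrier A \<and> b \<in> carrier B}"
  shows "\<exists>S. finite S \<and> S \<subseteq> K \<and> span_of R M S = K"
proof -
  obtain SA where A: "module R A" "finite SA" "SA \<subseteq> carrier A"
    "\<And>N. submodule N R A \<Longrightarrow> SA \<subseteq> N \<Longrightarrow> N = carrier A" using assms(1) by (auto simp: fg_module_def)
  obtain SB where B: "module R B" "finite SB" "SB \<subseteq> carrier B"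
    "\<And>N. submodule N R B \<Longrightarrow> SB \<subseteq> N \<Longrightarrow> N = carrier B" using assms(2) by (auto simp: fg_module_def)
  interpret A: module R A by (rule A(1))
  interpret B: module R B by (rule B(1))
  interpret M: module R M by (rule assms(3))
  let ?S = "f ` SA \<union> g ` SB"
  note fc = mod_homD(1)[OF assms(4)] and gc = mod_homD(1)[OF assms(5)]
  have SM: "?S \<subseteq> carrier M" using A(3) B(3) fc gc by blast
  note sp = span_of_submodule[OF assms(3) SM]
  note E = M.submoduleE[OF sp]
  note self = span_of_self[OF assms(3) SM]
  have pre: "submodule {a \<in> carrier L. h a \<in> span_of R M ?S} R L"
    if L: "module R L" and h: "h \<in> mod_hom R L M" for L :: "('a, 'z) module" and h
  proof -
    interpret L: module R L by fact
    show ?thesis using E mod_homD[OF h] mod_hom_zero[OF L assms(3) h] mod_hom_neg[OF L assms(3) h]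
        submodule_zero_mem[OF assms(3) sp] by (intro L.submoduleI) auto
  qed
  have "{a \<in> carrier A. f a \<in> span_of R M ?S} = carrier A"
    by (rule A(4)[OF pre[OF A(1) assms(4)]]) (use A(3) self in auto)
  moreover have "{a \<in> carrier B. g a \<in> span_of R M ?S} = carrier B"
    by (rule B(4)[OF pre[OF B(1) assms(5)]]) (use B(3) self in auto)
  ultimately have im: "a \<in> carrier A \<Longrightarrow> f a \<in> span_of R M ?S" "b \<in> carrier B \<Longrightarrow> g b \<in> span_of R M ?S" for a b
    by blast+
  have "f a \<in> K" if a: "a \<in> carrier A" for a
  proof -
    have "f a = f a \<oplus>\<^bsub>M\<^esub> g \<zero>\<^bsub>B\<^esub>" using mod_hom_zero[OF B(1) assms(3,5)] fc[OF a] by simp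
    then show ?thesis unfolding assms(7) using a B.zero_closed by blast
  qed
  moreover have "g b \<in> K" if b: "b \<in> carrier B" for b
  proof -
    have "g b = f \<zero>\<^bsub>A\<^esub> \<oplus>\<^bsub>M\<^esub> g b" using mod_hom_zero[OF A(1) assms(3,4)] gc[OF b] by simp
    then show ?thesis unfolding assms(7) using b A.zero_closed by blast
  qed
  ultimately have SK: "?S \<subseteq> K" using A(3) B(3) by auto
  have "K \<subseteq> span_of R M ?S" by (subst assms(7)) (auto intro: E(5) im)
  with span_of_least[OF assms(3,6) SK] have "span_of R M ?S = K" by (rule subset_antisym)
  with SK show ?thesis using A(2) B(2) by (intro exI[of _ ?S] conjI) simp_all
qed

text \<open>Whether the \<open>n\<close>-th syzygy is finitely generated does not depend on the resolution: comparing two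
  resolutions there and back exhibits the syzygy as the sum of the image of the other one and the
  image of a module of the resolution.\<close>

lemma syzygy_fg:
  assumes F: "exact_upto R (Suc n) F dF eF E" "\<And>i. i \<le> Suc n \<Longrightarrow> proj R (F i)" "fg_module R (F (Suc n))"
    and G: "exact_upto R n G d e E" "\<And>i. i \<le> n \<Longrightarrow> proj R (G i)" "fg_module R (G n)"
  shows "\<exists>S. finite S \<and> S \<subseteq> cycles_at G d e E n \<and> span_of R (G n) S = cycles_at G d e E n"
proof -
  have F': "exact_upto R n F dF eF E" by (rule exact_upto_mono[OF F(1)]) simp
  have mG: "module R (G i)" if "i \<le> n" for i using proj_module[OF G(2)[OF that]] .
  have mF: "module R (F i)" if "i \<le> Suc n" for i using proj_module[OF F(2)[OF that]] .
  have mE: "module R E" by (rule exact_uptoD(1)[OF G(1)])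
  obtain \<phi> where \<phi>: "\<And>i. i \<le> n \<Longrightarrow> \<phi> i \<in> mod_hom R (G i) (F i)"
    "\<And>x. x \<in> carrier (G 0) \<Longrightarrow> eF (\<phi> 0 x) = e x"
    "\<And>i x. i < n \<Longrightarrow> x \<in> carrier (G (Suc i)) \<Longrightarrow> dF i (\<phi> (Suc i) x) = \<phi> i (d i x)"
    using chain_map_exists[OF G(1) F' G(2)] by blast
  have "\<exists>\<psi>. (\<forall>i\<le>n. \<psi> i \<in> mod_hom R (F i) (G i)) \<and> (\<forall>x\<in>carrier (F 0). e (\<psi> 0 x) = eF x) \<and>
    (\<forall>i<n. \<forall>x\<in>carrier (F (Suc i)). d i (\<psi> (Suc i) x) = \<psi> i (dF i x))"
    by (rule chain_map_exists[OF F' G(1)]) (simp add: F(2))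
  then obtain \<psi> where \<psi>: "\<And>i. i \<le> n \<Longrightarrow> \<psi> i \<in> mod_hom R (F i) (G i)"
    "\<And>x. x \<in> carrier (F 0) \<Longrightarrow> e (\<psi> 0 x) = eF x"
    "\<And>i x. i < n \<Longrightarrow> x \<in> carrier (F (Suc i)) \<Longrightarrow> d i (\<psi> (Suc i) x) = \<psi> i (dF i x)" by blast
  have dG: "d i \<in> mod_hom R (G (Suc i)) (G i)" if "i < n" for i using exact_uptoD(5)[OF G(1) that] .
  have dFh: "dF i \<in> mod_hom R (F (Suc i)) (F i)" if "i \<le> n" for i using exact_uptoD(5)[OF F(1), of i] that by simp
  define \<chi> where "\<chi> i x = x \<ominus>\<^bsub>G i\<^esub> \<psi> i (\<phi> i x)" for i x
  have pp: "(\<lambda>x. \<psi> i (\<phi> i x)) \<in> mod_hom R (G i) (G i)" if "i \<le> n" for i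
    by (rule mod_hom_comp[OF \<phi>(1)[OF that] \<psi>(1)[OF that]])
  have \<chi>: "\<chi> i \<in> mod_hom R (G i) (G i)" if "i \<le> n" for i
    using mod_hom_minus[OF mG[OF that] mG[OF that] mod_hom_id pp[OF that]] by (simp add: \<chi>_def[abs_def])
  have comm: "d i (\<chi> (Suc i) x) = \<chi> i (d i x)" if i: "i < n" and x: "x \<in> carrier (G (Suc i))" for i x
  proof -
    have "\<phi> (Suc i) x \<in> carrier (F (Suc i))" using mod_homD(1)[OF \<phi>(1)] i x by simp
    then show ?thesis unfolding \<chi>_def using i x
      by (subst mod_hom_minus_apply[OF mG mG dG x]) (auto intro: mod_homD(1)[OF pp] simp: \<phi>(3) \<psi>(3))
  qed
  interpret E: module R E by (rule mE)
  have aug: "e (\<chi> 0 x) = \<zero>\<^bsub>E\<^esub>" if x: "x \<in> carrier (G 0)" for x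
  proof -
    have "\<phi> 0 x \<in> carrier (F 0)" using mod_homD(1)[OF \<phi>(1)] x by simp
    moreover have "e x \<in> carrier E" using mod_homD(1)[OF exact_uptoD(3)[OF G(1)]] x .
    moreover have "e (x \<ominus>\<^bsub>G 0\<^esub> \<psi> 0 (\<phi> 0 x)) = e x \<ominus>\<^bsub>E\<^esub> e (\<psi> 0 (\<phi> 0 x))"
      by (rule mod_hom_minus_apply[OF mG mE exact_uptoD(3)[OF G(1)] x mod_homD(1)[OF pp x]]) auto
    ultimately show ?thesis unfolding \<chi>_def using x by (simp add: \<phi>(2) \<psi>(2) a_minus_def E.r_neg)
  qed
  let ?Z = "cycles_at G d e E n"
  have "\<exists>\<eta>\<in>mod_hom R (G n) (G n). (\<forall>x\<in>carrier (G n). \<eta> x \<in> ?Z) \<and> (\<forall>x\<in>?Z. \<eta> x = \<chi> n x)"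
  proof (cases n)
    case 0
    then show ?thesis using \<chi>[of 0] aug mod_homD(1)[OF \<chi>[of 0]] by (intro bexI[of _ "\<chi> 0"]) auto
  next
    case (Suc k)
    have "\<exists>\<sigma>. (\<forall>i\<le>k. \<sigma> i \<in> mod_hom R (G i) (G (Suc i))) \<and> (\<forall>x\<in>carrier (G 0). d 0 (\<sigma> 0 x) = \<chi> 0 x) \<and>
      (\<forall>i<k. \<forall>x\<in>carrier (G (Suc i)). d (Suc i) (\<sigma> (Suc i) x) = \<chi> (Suc i) x \<ominus>\<^bsub>G (Suc i)\<^esub> \<sigma> i (d i x))"
    proof (rule homotopy_exists[OF exact_upto_mono[OF G(1)]])
      show "exact_upto R (Suc k) G d e E" using G(1) Suc by simp
    qed (use Suc G(2) \<chi> comm aug in auto)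
    then obtain \<sigma> where \<sigma>: "\<And>i. i \<le> k \<Longrightarrow> \<sigma> i \<in> mod_hom R (G i) (G (Suc i))"
      "\<And>x. x \<in> carrier (G 0) \<Longrightarrow> d 0 (\<sigma> 0 x) = \<chi> 0 x"
      "\<And>i x. i < k \<Longrightarrow> x \<in> carrier (G (Suc i)) \<Longrightarrow>
        d (Suc i) (\<sigma> (Suc i) x) = \<chi> (Suc i) x \<ominus>\<^bsub>G (Suc i)\<^esub> \<sigma> i (d i x)" by blast
    have mGk: "module R (G k)" "module R (G n)" using mG Suc by auto
    interpret Gk: module R "G k" by (rule mGk(1))
    interpret Gn: module R "G n" by (rule mGk(2))
    have dk: "d k \<in> mod_hom R (G n) (G k)" using dG[of k] Suc by simp
    have \<sigma>k: "\<sigma> k \<in> mod_hom R (G k) (G n)" using \<sigma>(1)[of k] Suc by simp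
    define \<eta> where "\<eta> x = \<chi> n x \<ominus>\<^bsub>G n\<^esub> \<sigma> k (d k x)" for x
    have sd: "(\<lambda>x. \<sigma> k (d k x)) \<in> mod_hom R (G n) (G n)" by (rule mod_hom_comp[OF dk \<sigma>k])
    have \<eta>: "\<eta> \<in> mod_hom R (G n) (G n)" unfolding \<eta>_def[abs_def]
      by (rule mod_hom_minus[OF mGk(2,2) \<chi> sd]) simp
    have "d k (\<eta> x) = \<zero>\<^bsub>G k\<^esub>" if x: "x \<in> carrier (G n)" for x
    proof -
      have dx: "d k x \<in> carrier (G k)" using mod_homD(1)[OF dk x] .
      have \<chi>dx: "\<chi> k (d k x) \<in> carrier (G k)" using mod_homD(1)[OF \<chi> dx] Suc by simp
      have "d k (\<sigma> k (d k x)) = \<chi> k (d k x)"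
      proof (cases k)
        case 0
        then show ?thesis using \<sigma>(2) dx by simp
      next
        case (Suc j)
        have "d j (d k x) = \<zero>\<^bsub>G j\<^esub>" using exact_upto_diff_diff[OF G(1), of j x] x \<open>n = Suc k\<close> Suc by simp
        moreover have "\<sigma> j \<zero>\<^bsub>G j\<^esub> = \<zero>\<^bsub>G k\<^esub>"
          using mod_hom_zero[OF mG mG \<sigma>(1), of j] \<open>n = Suc k\<close> Suc by simp
        ultimately show ?thesis using \<sigma>(3)[of j "d k x"] dx Suc module_minus_zero[OF mGk(1) \<chi>dx] by simp
      qed
      moreover have "d k (\<chi> n x) = \<chi> k (d k x)" using comm[of k x] x Suc by simp
      ultimately show ?thesis unfolding \<eta>_def
        using mod_hom_minus_apply[OF mGk(2,1) dk mod_homD(1)[OF \<chi> x] mod_homD(1)[OF sd x]] \<chi>dx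
        by (simp add: a_minus_def Gk.r_neg)
    qed
    moreover have "\<eta> x = \<chi> n x" if "x \<in> carrier (G n)" "d k x = \<zero>\<^bsub>G k\<^esub>" for x
      using that mod_hom_zero[OF mGk \<sigma>k] module_minus_zero[OF mGk(2) mod_homD(1)[OF \<chi> that(1)]]
      by (simp add: \<eta>_def)
    ultimately show ?thesis using mod_homD(1)[OF \<eta>] Suc by (intro bexI[OF _ \<eta>]) auto
  qed
  then obtain \<eta> where \<eta>: "\<eta> \<in> mod_hom R (G n) (G n)" "\<And>x. x \<in> carrier (G n) \<Longrightarrow> \<eta> x \<in> ?Z"
    "\<And>x. x \<in> ?Z \<Longrightarrow> \<eta> x = \<chi> n x" by blast
  have mGn: "module R (G n)" using mG by simp
  interpret Gn: module R "G n" by (rule mGn)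
  have ZG: "?Z \<subseteq> carrier (G n)" by (cases n) auto
  have Z: "submodule ?Z R (G n)"
  proof (cases n)
    case 0
    then show ?thesis using kernel_submodule[OF mGn mE] exact_uptoD(3)[OF G(1)] by (simp add: a_kernel_eq)
  next
    case (Suc k)
    have "module R (G k)" "d k \<in> mod_hom R (G n) (G k)" using mG[of k] dG[of k] Suc by auto
    from kernel_submodule[OF mGn this] show ?thesis using Suc by (simp add: a_kernel_eq)
  qed
  note EZ = Gn.submoduleE[OF Z]
  have f: "(\<lambda>y. \<psi> n (dF n y)) \<in> mod_hom R (F (Suc n)) (G n)"
    by (rule mod_hom_comp[OF dFh \<psi>(1)]) auto
  have cyc: "dF n ` carrier (F (Suc n)) = cycles_at F dF eF E n" using exact_uptoD(6)[OF F(1), of n] by simp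
  have \<psi>Z: "\<psi> n y \<in> ?Z" if y: "y \<in> cycles_at F dF eF E n" for y
  proof (cases n)
    case 0
    then show ?thesis using y \<psi>(2)[of y] mod_homD(1)[OF \<psi>(1)[of 0]] by simp
  next
    case (Suc k)
    have "\<psi> k \<zero>\<^bsub>F k\<^esub> = \<zero>\<^bsub>G k\<^esub>" using mod_hom_zero[OF mF mG \<psi>(1), of k] Suc by simp
    then show ?thesis using y \<psi>(3)[of k y] mod_homD(1)[OF \<psi>(1)[of n]] Suc by simp
  qed
  have \<phi>Z: "\<phi> n x \<in> cycles_at F dF eF E n" if x: "x \<in> ?Z" for x
  proof (cases n)
    case 0
    then show ?thesis using x \<phi>(2)[of x] mod_homD(1)[OF \<phi>(1)[of 0]] by simp
  next
    case (Suc k)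
    have "\<phi> k \<zero>\<^bsub>G k\<^esub> = \<zero>\<^bsub>F k\<^esub>" using mod_hom_zero[OF mG mF \<phi>(1), of k] Suc by simp
    then show ?thesis using x \<phi>(3)[of k x] mod_homD(1)[OF \<phi>(1)[of n]] Suc by simp
  qed
  show ?thesis
  proof (rule fg_sum_of_images[OF F(3) G(3) mGn f \<eta>(1) Z], intro equalityI subsetI)
    fix z assume "z \<in> {\<psi> n (dF n a) \<oplus>\<^bsub>G n\<^esub> \<eta> b | a b. a \<in> carrier (F (Suc n)) \<and> b \<in> carrier (G n)}"
    then obtain a c where "z = \<psi> n (dF n a) \<oplus>\<^bsub>G n\<^esub> \<eta> c" "a \<in> carrier (F (Suc n))" "c \<in> carrier (G n)" by blast
    moreover have "dF n a \<in> cycles_at F dF eF E n" using \<open>a \<in> carrier (F (Suc n))\<close> unfolding cyc[symmetric] by (rule imageI)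
    ultimately show "z \<in> ?Z" using EZ(5)[OF \<psi>Z \<eta>(2)] by simp
  next
    fix z assume z: "z \<in> ?Z"
    then have zG: "z \<in> carrier (G n)" using ZG by blast
    have "\<phi> n z \<in> dF n ` carrier (F (Suc n))" unfolding cyc by (rule \<phi>Z[OF z])
    then obtain a where a: "a \<in> carrier (F (Suc n))" "\<phi> n z = dF n a" by (elim imageE)
    have pz: "\<psi> n (\<phi> n z) \<in> carrier (G n)" using mod_homD(1)[OF pp zG] by simp
    have "z = \<psi> n (\<phi> n z) \<oplus>\<^bsub>G n\<^esub> (z \<ominus>\<^bsub>G n\<^esub> \<psi> n (\<phi> n z))"
      using pz zG by (simp add: a_minus_def Gn.a_lcomm Gn.r_neg)
    then have "z = \<psi> n (dF n a) \<oplus>\<^bsub>G n\<^esub> \<eta> z" using a \<eta>(3)[OF z] by (simp add: \<chi>_def)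
    then show "z \<in> {\<psi> n (dF n a) \<oplus>\<^bsub>G n\<^esub> \<eta> b | a b. a \<in> carrier (F (Suc n)) \<and> b \<in> carrier (G n)}"
      using a(1) zG by blast
  qed
qed

context grade_ring
begin

text \<open>The relations between minimal generators of a nonzero ideal \<open>J \<subseteq> m\<close> are not finitely generated:
  their coefficients lie in \<open>m\<close>, but one generator is killed by some \<open>\<epsilon>\<close> outside the reach of any
  finite set of coefficients.\<close>

lemma relations_not_fg:
  assumes "finite S" "S \<subseteq> m" "t \<in> S"
    "\<And>S'. S' \<subseteq> carrier T \<Longrightarrow> finite S' \<Longrightarrow> span_of T (self_module T) S' = span_of T (self_module T) S \<Longrightarrow>
      card S \<le> card S'"
    "finite W" "W \<subseteq> {c \<in> carrier (fsupp_module T S). lin_ext T (self_module T) (\<lambda>x. x) c = \<zero>}"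
    "span_of T (fsupp_module T S) W = {c \<in> carrier (fsupp_module T S). lin_ext T (self_module T) (\<lambda>x. x) c = \<zero>}"
  shows False
proof -
  let ?T = "self_module T" and ?G = "fsupp_module T S"
  note mT = module_self_module[OF T] and mG = module_fsupp_module[OF T, of S]
  have ST: "S \<subseteq> carrier ?T" using assms(2) L(6) by auto
  have W: "w \<in> carrier ?G" "lin_ext T ?T (\<lambda>x. x) w = \<zero>\<^bsub>?T\<^esub>" if "w \<in> W" for w using assms(6) that by auto
  have wT: "w a \<in> carrier T" if "w \<in> W" for w a using W(1)[OF that] by (simp add: fsupp_carrier_iff)
  have wm: "w t \<in> m" if "w \<in> W" for w
  proof -
    have "w t \<notin> Units T"
      by (rule minimal_generators_relation[OF mT assms(1) ST _ W[OF that] assms(3)]) (use assms(4) in auto)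
    then show ?thesis using L(3)[OF wT[OF that]] by blast
  qed
  define F where "F = (\<lambda>w. w t) ` W"
  have tm: "t \<in> m" using assms(2,3) by blast
  have F: "finite F" "F \<subseteq> carrier T" using assms(5) wT by (auto simp: F_def)
  from annihilated[OF tm F] obtain \<epsilon> \<kappa> where \<epsilon>: "retraction T F \<epsilon> \<kappa>" "\<epsilon> \<noteq> \<zero>" "t \<otimes> \<epsilon> = \<zero>" by blast
  have \<epsilon>T: "\<epsilon> \<in> carrier T" by (rule retractionD(1)[OF \<epsilon>(1)])
  define v where "v = (\<lambda>a. if a = t then \<epsilon> else \<zero>)"
  have v: "v \<in> carrier ?G" using assms(3) \<epsilon>T by (auto simp: v_def fsupp_carrier_finite[OF assms(1)])
  have "lin_ext T ?T (\<lambda>x. x) v = (\<Oplus>\<^bsub>?T\<^esub>a\<in>{t}. v a \<odot>\<^bsub>?T\<^esub> a)"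
    by (rule lin_ext_eq[OF mT v]) (use ST assms(3) in \<open>auto simp: v_def\<close>)
  also have "\<dots> = \<zero>" using \<epsilon>T \<epsilon>(3) tm L(6) by (simp add: self_module_finsum v_def m_comm subset_iff)
  finally have "v \<in> span_of T ?G W" unfolding assms(7) using v by simp
  then obtain c where c: "c \<in> carrier (fsupp_module T W)" "v = lin_ext T ?G (\<lambda>x. x) c" by (auto simp: span_of_def)
  have cT: "c w \<in> carrier T" for w using c(1) by (simp add: fsupp_carrier_iff)
  have "lin_ext T ?G (\<lambda>x. x) c = (\<Oplus>\<^bsub>?G\<^esub>w\<in>W. c w \<odot>\<^bsub>?G\<^esub> w)"
    by (rule lin_ext_eq[OF mG c(1) _ assms(5)]) (use W(1) c(1) in \<open>auto simp: fsupp_carrier_iff\<close>)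
  note sum = this
  have "\<epsilon> = v t" by (simp add: v_def)
  also have "\<dots> = (\<Oplus>\<^bsub>?G\<^esub>w\<in>W. c w \<odot>\<^bsub>?G\<^esub> w) t" unfolding sum[symmetric] by (rule fun_cong[OF c(2)])
  also have "\<dots> = (\<Oplus>w\<in>W. (c w \<odot>\<^bsub>?G\<^esub> w) t)"
    by (rule fsupp_finsum_apply[OF T assms(5)]) (use cT W(1) module.smult_closed[OF mG] in blast)
  also have "\<dots> = (\<Oplus>w\<in>W. w t \<otimes> c w)" using cT wT by (intro finsum_cong') (auto simp: m_comm)
  finally have "\<epsilon> = (\<Oplus>w\<in>W. w t \<otimes> c w)" .
  then have "\<epsilon> = \<zero>"
    by (rule retraction_sum_zero[where g = "\<lambda>w. w t" and c = c, OF loc \<epsilon>(1) assms(5), rotated 3])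
      (use cT wm in \<open>auto simp: F_def\<close>)
  with \<epsilon>(2) show False by simp
qed

text \<open>Such a module is \<open>T/J\<close> with a finitely generated ideal \<open>J\<close> whose relations are finitely generated.
  As this is impossible for \<open>0 \<noteq> J \<subseteq> m\<close>, either \<open>J = 0\<close> or \<open>J = T\<close>.\<close>

theorem presented_cyclic_projective:
  fixes E :: "('a, 'e) module"
  assumes "cyclic_module T E" "n_presented T n E" "2 \<le> n"
  shows "projective_module T E"
proof -
  obtain g where mE: "module T E" and g: "g \<in> carrier E" "carrier E = {r \<odot>\<^bsub>E\<^esub> g | r. r \<in> carrier T}"
    using assms(1) by (auto simp: cyclic_module_def)
  interpret E: module T E by (rule mE)
  let ?T = "self_module T"
  note mT = module_self_module[OF T]
  define \<theta> where "\<theta> r = r \<odot>\<^bsub>E\<^esub> g" for r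
  have \<theta>: "\<theta> \<in> mod_hom T ?T E" unfolding \<theta>_def[abs_def]
    using g(1) by (intro mod_homI) (auto simp: E.smult_l_distr E.smult_assoc1)
  have onto: "\<theta> ` carrier T = carrier E" using g(2) by (auto simp: \<theta>_def)
  define J where "J = {r \<in> carrier T. \<theta> r = \<zero>\<^bsub>E\<^esub>}"
  have J_iff: "r \<in> J \<longleftrightarrow> r \<in> carrier T \<and> \<theta> r = \<zero>\<^bsub>E\<^esub>" for r unfolding J_def by (rule mem_Collect_eq)
  have sJ: "submodule J T ?T" using kernel_submodule[OF mT mE \<theta>] by (simp add: a_kernel_eq J_def)
  then have iJ: "ideal J T" using ideal_iff_submodule[OF T] by blast
  interpret J: ideal J T by (rule iJ)
  have "proj T E"
  proof (cases "\<one> \<in> J")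
    case True
    then have "\<theta> \<one> = \<zero>\<^bsub>E\<^esub>" unfolding J_def by (elim CollectE conjE)
    then have g0: "g = \<zero>\<^bsub>E\<^esub>" unfolding \<theta>_def E.smult_one[OF g(1)] .
    have "y = \<zero>\<^bsub>E\<^esub>" if y: "y \<in> carrier E" for y
    proof -
      obtain r where "r \<in> carrier T" "y = r \<odot>\<^bsub>E\<^esub> g" using y[unfolded g(2)] by blast
      then show ?thesis by (simp add: g0)
    qed
    then show ?thesis
      by (intro proj_retract[OF proj_self_module[OF T] mE mod_hom_zero_map[OF mE mT] mod_hom_zero_map[OF mT mE]]) auto
  next
    case False
    have Jm: "J \<subseteq> m"
    proof
      fix a assume a: "a \<in> J"
      show "a \<in> m"
      proof (rule ccontr)
        assume "a \<notin> m"
        then have u: "a \<in> Units T" using L(3) a J.a_subset by blast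
        then have "inv a \<otimes> a \<in> J" using a by (intro J.I_l_closed) auto
        then show False using Units_l_inv[OF u] False by simp
      qed
    qed
    show ?thesis
    proof (cases "J = {\<zero>}")
      case True
      have inj: "r = r'" if "r \<in> carrier T" "r' \<in> carrier T" "\<theta> r = \<theta> r'" for r r'
      proof -
        have "\<theta> (r \<ominus>\<^bsub>?T\<^esub> r') = \<theta> r \<ominus>\<^bsub>E\<^esub> \<theta> r'" by (rule mod_hom_minus_apply[OF mT mE \<theta>]) (use that in auto)
        also have "\<dots> = \<zero>\<^bsub>E\<^esub>" unfolding that(3) a_minus_def
          by (rule E.r_neg) (use mod_homD(1)[OF \<theta>, of r'] that(2) in simp)
        finally have "\<theta> (r \<ominus>\<^bsub>?T\<^esub> r') = \<zero>\<^bsub>E\<^esub>" .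
        moreover have "r \<ominus>\<^bsub>?T\<^esub> r' \<in> carrier T"
          using that(1,2) unfolding self_module_minus[OF T that(2)] by (rule minus_closed)
        ultimately have "r \<ominus>\<^bsub>?T\<^esub> r' \<in> J" unfolding J_def by (intro CollectI conjI)
        then have "r \<ominus>\<^bsub>?T\<^esub> r' = \<zero>\<^bsub>?T\<^esub>" unfolding True by simp
        from module_minus_eq_zero[OF mT this] that(1,2) show ?thesis by simp
      qed
      define i where "i y = (THE r. r \<in> carrier T \<and> \<theta> r = y)" for y
      have i: "i y \<in> carrier T \<and> \<theta> (i y) = y" if "y \<in> carrier E" for y
      proof -
        have "y \<in> \<theta> ` carrier T" using that unfolding onto .
        then have "\<exists>!r. r \<in> carrier T \<and> \<theta> r = y" using inj by blast
        then show ?thesis unfolding i_def by (rule theI')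
      qed
      have "i \<in> mod_hom T E ?T"
      proof (rule mod_homI)
        show "i y \<in> carrier ?T" if "y \<in> carrier E" for y using i[OF that] by simp
        show "i (y \<oplus>\<^bsub>E\<^esub> z) = i y \<oplus>\<^bsub>?T\<^esub> i z" if "y \<in> carrier E" "z \<in> carrier E" for y z
          using i[of y] i[of z] i[of "y \<oplus>\<^bsub>E\<^esub> z"] that mod_homD(2)[OF \<theta>, of "i y" "i z"]
          by (intro inj) auto
        show "i (r \<odot>\<^bsub>E\<^esub> y) = r \<odot>\<^bsub>?T\<^esub> i y" if "r \<in> carrier T" "y \<in> carrier E" for r y
          using i[of y] i[of "r \<odot>\<^bsub>E\<^esub> y"] that mod_homD(3)[OF \<theta>, of r "i y"] by (intro inj) auto
      qed
      then show ?thesis using i by (intro proj_retract[OF proj_self_module[OF T] mE _ \<theta>]) auto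
    next
      case nz: False
      obtain F :: "nat \<Rightarrow> ('a, nat \<Rightarrow> 'a) module" and dF eF where
        F: "\<forall>i\<le>n. fg_free_module T (F i)" "exact_upto T n F dF eF E" using assms(2) by (auto simp: n_presented_def)
      have pF: "proj T (F i)" "fg_module T (F i)" if "i \<le> 2" for i
        using F(1) assms(3) that by (auto intro!: fg_free_proj_fg)
      let ?B = "{\<one>}" and ?e = "\<lambda>f. \<theta> (f \<one>)"
      have B: "finite ?B" by simp
      have e: "?e \<in> mod_hom T (fsupp_module T ?B) E" by (rule mod_hom_comp[OF mod_hom_coord \<theta>])
      have unit: "(\<lambda>a. if a \<in> ?B then r else \<zero>) \<in> carrier (fsupp_module T ?B)" if "r \<in> carrier T" for r
        using that by (auto simp: fsupp_carrier_finite)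
      have e_onto: "?e ` carrier (fsupp_module T ?B) = carrier E"
      proof
        show "?e ` carrier (fsupp_module T ?B) \<subseteq> carrier E" using mod_homD(1)[OF e] by auto
        show "carrier E \<subseteq> ?e ` carrier (fsupp_module T ?B)"
        proof
          fix y assume "y \<in> carrier E"
          then have "y \<in> \<theta> ` carrier T" unfolding onto .
          then obtain r where r: "r \<in> carrier T" "y = \<theta> r" by (elim imageE)
          show "y \<in> ?e ` carrier (fsupp_module T ?B)" by (rule image_eqI[OF _ unit[OF r(1)]]) (simp add: r(2))
        qed
      qed
      \<comment> \<open>Comparison with the given free resolution: the surjection \<open>T \<rightarrow> E\<close> is the beginning of another
        resolution, so its kernel \<open>J\<close> is finitely generated too.\<close>
      define G0 where "G0 = (\<lambda>_ :: nat. fsupp_module T ?B)"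
      have "exact_upto T 0 G0 d ?e E" for d :: "nat \<Rightarrow> ('a \<Rightarrow> 'a) \<Rightarrow> 'a \<Rightarrow> 'a"
        using mE module_fsupp_module[OF T] e e_onto by (simp add: exact_upto_iff G0_def)
      from syzygy_fg[OF exact_upto_mono[OF F(2)] _ _ this] obtain S0 where
        S0: "finite S0" "S0 \<subseteq> {f \<in> carrier (fsupp_module T ?B). ?e f = \<zero>\<^bsub>E\<^esub>}"
          "span_of T (fsupp_module T ?B) S0 = {f \<in> carrier (fsupp_module T ?B). ?e f = \<zero>\<^bsub>E\<^esub>}"
        using pF proj_fsupp[OF T] fg_fsupp[OF T B] assms(3) by (auto simp: G0_def)
      have co: "(\<lambda>f. f \<one>) \<in> mod_hom T (fsupp_module T ?B) ?T" by (rule mod_hom_coord)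
      let ?S1 = "(\<lambda>f. f \<one>) ` S0"
      have S1T: "?S1 \<subseteq> carrier ?T" using S0(2) mod_homD(1)[OF co] by auto
      have "span_of T ?T ?S1 = J"
      proof
        have "?S1 \<subseteq> J"
        proof (rule image_subsetI)
          fix f assume "f \<in> S0"
          from subsetD[OF S0(2) this] show "f \<one> \<in> J" by (simp add: J_iff fsupp_carrier_iff)
        qed
        then show "span_of T ?T ?S1 \<subseteq> J" by (rule span_of_least[OF mT sJ])
        show "J \<subseteq> span_of T ?T ?S1"
        proof
          fix r assume r: "r \<in> J"
          have S0G: "(\<lambda>x. x) ` S0 \<subseteq> carrier (fsupp_module T ?B)" using S0(2) by auto
          have "(\<lambda>a. if a \<in> ?B then r else \<zero>) \<in> span_of T (fsupp_module T ?B) S0"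
            unfolding S0(3) using r unit by (auto simp: J_iff)
          then obtain c where c: "c \<in> carrier (fsupp_module T S0)"
            "(\<lambda>a. if a \<in> ?B then r else \<zero>) = lin_ext T (fsupp_module T ?B) (\<lambda>x. x) c" by (auto simp: span_of_def)
          have "r = (\<lambda>f. f \<one>) (lin_ext T (fsupp_module T ?B) (\<lambda>x. x) c)" using fun_cong[OF c(2), of \<one>] by simp
          also have "\<dots> = lin_ext T ?T (\<lambda>f. f \<one>) c"
            by (rule lin_ext_natural[OF module_fsupp_module[OF T] mT co S0G c(1)])
          also have "\<dots> \<in> span_of T ?T ?S1" unfolding lin_ext_def
          proof (rule submodule_smult_closed_finsum[OF mT span_of_submodule[OF mT S1T]])
            show "finite {b. c b \<noteq> \<zero>}" using c(1) by (simp add: fsupp_carrier_iff)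
            fix f assume "f \<in> {b. c b \<noteq> \<zero>}"
            then have "f \<in> S0" using c(1) by (auto simp: fsupp_carrier_iff)
            then have "f \<one> \<in> span_of T ?T ?S1" using span_of_self[OF mT S1T] by blast
            then show "c f \<odot>\<^bsub>?T\<^esub> f \<one> \<in> span_of T ?T ?S1"
              using module.submoduleE(4)[OF mT span_of_submodule[OF mT S1T]] c(1) by (simp add: fsupp_carrier_iff)
          qed
          finally show "r \<in> span_of T ?T ?S1" .
        qed
      qed
      define G' where "G' S \<longleftrightarrow> finite S \<and> S \<subseteq> carrier T \<and> span_of T ?T S = J" for S
      have "G' ?S1" unfolding G'_def using \<open>span_of T ?T ?S1 = J\<close> S0(1) S1T by simp
      then obtain S where "G' S" and least: "\<And>S'. G' S' \<Longrightarrow> card S \<le> card S'"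
        using ex_has_least_nat[of G' ?S1 card] by blast
      have S: "finite S" "S \<subseteq> carrier T" "span_of T ?T S = J" using \<open>G' S\<close> by (simp_all add: G'_def)
      have S4: "card S \<le> card S'" if "S' \<subseteq> carrier T" "finite S'" "span_of T ?T S' = span_of T ?T S" for S'
        by (rule least) (use that S(3) in \<open>simp add: G'_def\<close>)
      have ST: "S \<subseteq> carrier ?T" "(\<lambda>x. x) ` S \<subseteq> carrier ?T" using S(2) by auto
      have SJ: "S \<subseteq> J" using span_of_self[OF mT ST(1)] S(3) by simp
      have "S \<noteq> {}"
      proof
        assume "S = {}"
        then have "J \<subseteq> {\<zero>}" using span_of_least[OF mT submodule_zero[OF mT], of S] S(3) by simp
        then show False using nz J.zero_closed by blast
      qed
      then obtain t where t: "t \<in> S" by blast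
      \<comment> \<open>The same comparison one step further, for the free module on minimal generators of \<open>J\<close>.\<close>
      define G where "G = (\<lambda>i :: nat. if i = 0 then fsupp_module T ?B else fsupp_module T S)"
      let ?l = "lin_ext T ?T (\<lambda>x. x)"
      have l: "?l \<in> mod_hom T (fsupp_module T S) ?T" by (rule lin_ext_hom[OF mT ST(2)])
      define d where "d = (\<lambda>(i :: nat) c a. if a \<in> ?B then ?l c else \<zero>)"
      have d: "d 0 \<in> mod_hom T (fsupp_module T S) (fsupp_module T ?B)" unfolding d_def
        by (rule mod_hom_into_fsupp[OF T B]) (rule l)
      have d0: "d 0 c = (\<lambda>a. if a \<in> ?B then ?l c else \<zero>)" for c by (simp add: d_def)
      have "d 0 ` carrier (fsupp_module T S) = {f \<in> carrier (fsupp_module T ?B). ?e f = \<zero>\<^bsub>E\<^esub>}"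
      proof
        show "d 0 ` carrier (fsupp_module T S) \<subseteq> {f \<in> carrier (fsupp_module T ?B). ?e f = \<zero>\<^bsub>E\<^esub>}"
        proof (rule image_subsetI)
          fix c assume c: "c \<in> carrier (fsupp_module T S)"
          have "?l c \<in> J" unfolding S(3)[symmetric] span_of_def using c by (rule imageI)
          then show "d 0 c \<in> {f \<in> carrier (fsupp_module T ?B). ?e f = \<zero>\<^bsub>E\<^esub>}"
            using mod_homD(1)[OF d c] by (simp add: d0 J_iff)
        qed
        show "{f \<in> carrier (fsupp_module T ?B). ?e f = \<zero>\<^bsub>E\<^esub>} \<subseteq> d 0 ` carrier (fsupp_module T S)"
        proof
          fix f assume f: "f \<in> {f \<in> carrier (fsupp_module T ?B). ?e f = \<zero>\<^bsub>E\<^esub>}"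
          then have "f \<one> \<in> J" by (simp add: J_iff fsupp_carrier_iff)
          then have "f \<one> \<in> ?l ` carrier (fsupp_module T S)" unfolding S(3)[symmetric] span_of_def .
          then obtain c where c: "c \<in> carrier (fsupp_module T S)" "f \<one> = ?l c" by (elim imageE)
          have "f = d 0 c" using f c(2) by (auto simp: d0 fsupp_carrier_iff fun_eq_iff)
          then show "f \<in> d 0 ` carrier (fsupp_module T S)" using c(1) by (rule image_eqI)
        qed
      qed
      moreover have mG: "module T (G i)" for i by (simp add: G_def module_fsupp_module[OF T])
      ultimately have exG: "exact_upto T 1 G d ?e E"
        unfolding exact_upto_iff using mE mG e e_onto d
        by (simp add: G_def)
      have ex2: "exact_upto T (Suc 1) F dF eF E" by (rule exact_upto_mono[OF F(2)]) (use assms(3) in simp)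
      have "\<exists>W. finite W \<and> W \<subseteq> cycles_at G d ?e E 1 \<and> span_of T (G 1) W = cycles_at G d ?e E 1"
        by (rule syzygy_fg[OF ex2 _ _ exG])
          (use pF proj_fsupp[OF T] fg_fsupp[OF T S(1)] in \<open>auto simp: G_def\<close>)
      moreover have "cycles_at G d ?e E 1 = {c \<in> carrier (fsupp_module T S). ?l c = \<zero>}"
        by (auto simp: G_def d0 fun_eq_iff split: if_splits)
      ultimately obtain W where W: "finite W" "W \<subseteq> {c \<in> carrier (fsupp_module T S). ?l c = \<zero>}"
        "span_of T (fsupp_module T S) W = {c \<in> carrier (fsupp_module T S). ?l c = \<zero>}" by (auto simp: G_def)
      have "S \<subseteq> m" using SJ Jm by blast
      from relations_not_fg[OF S(1) this t S4 W] have False by blast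
      then show ?thesis ..
    qed
  qed
  then show ?thesis by (simp add: projective_module_iff_proj)
qed

end

section \<open>The modules \<open>Ext\<close>\<close>

lemma Hom_module_simps [simp]:
  "carrier (Hom_module R M N) = mod_hom R M N \<inter> extensional (carrier M)"
  "\<zero>\<^bsub>Hom_module R M N\<^esub> = (\<lambda>x\<in>carrier M. \<zero>\<^bsub>N\<^esub>)"
  "f \<oplus>\<^bsub>Hom_module R M N\<^esub> g = (\<lambda>x\<in>carrier M. f x \<oplus>\<^bsub>N\<^esub> g x)"
  "r \<odot>\<^bsub>Hom_module R M N\<^esub> f = (\<lambda>x\<in>carrier M. r \<odot>\<^bsub>N\<^esub> f x)"
  by (simp_all add: Hom_module_def)

lemma mod_hom_restrict:
  assumes "module R M" "f \<in> mod_hom R M N"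
  shows "(\<lambda>x\<in>carrier M. f x) \<in> mod_hom R M N"
proof -
  interpret M: module R M by fact
  show ?thesis using mod_homD[OF assms(2)] by (intro mod_homI) auto
qed

lemma module_Hom_module:
  assumes "module R M" "module R N"
  shows "module R (Hom_module R M N)"
proof -
  interpret M: module R M by fact
  interpret N: module R N by fact
  note D = mod_homD
  show ?thesis
  proof (rule moduleI[OF M.R.cring_axioms abelian_groupI])
    fix f assume "f \<in> carrier (Hom_module R M N)"
    then have f: "f \<in> mod_hom R M N" "f \<in> extensional (carrier M)" by auto
    have "(\<lambda>x. \<ominus>\<^bsub>N\<^esub> f x) \<in> mod_hom R M N" 
      using D[OF f(1)] by (intro mod_homI) (auto simp: N.minus_add N.a_ac N.smult_r_minus)
    from mod_hom_restrict[OF assms(1) this] D(1)[OF f(1)]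
    show "\<exists>g\<in>carrier (Hom_module R M N). g \<oplus>\<^bsub>Hom_module R M N\<^esub> f = \<zero>\<^bsub>Hom_module R M N\<^esub>"
      by (intro bexI[of _ "\<lambda>x\<in>carrier M. \<ominus>\<^bsub>N\<^esub> f x"]) (auto simp: fun_eq_iff N.l_neg)
  next
    fix f g assume "f \<in> carrier (Hom_module R M N)" "g \<in> carrier (Hom_module R M N)"
    then show "f \<oplus>\<^bsub>Hom_module R M N\<^esub> g \<in> carrier (Hom_module R M N)"
      using mod_hom_restrict[OF assms(1) mod_hom_add[OF assms]] by simp
  next
    show "\<zero>\<^bsub>Hom_module R M N\<^esub> \<in> carrier (Hom_module R M N)"
      using mod_hom_restrict[OF assms(1) mod_hom_zero_map[OF assms]] by simp
  next
    fix r f assume "r \<in> carrier R" "f \<in> carrier (Hom_module R M N)"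
    then show "r \<odot>\<^bsub>Hom_module R M N\<^esub> f \<in> carrier (Hom_module R M N)"
      using mod_hom_restrict[OF assms(1) mod_hom_smult[OF assms]] by simp
  next
    fix f assume "f \<in> carrier (Hom_module R M N)"
    then show "\<zero>\<^bsub>Hom_module R M N\<^esub> \<oplus>\<^bsub>Hom_module R M N\<^esub> f = f"
      using D(1)[of f R M N] by (auto simp: fun_eq_iff extensional_def)
  next
    fix f assume "f \<in> carrier (Hom_module R M N)"
    then show "\<one>\<^bsub>R\<^esub> \<odot>\<^bsub>Hom_module R M N\<^esub> f = f"
      using D(1)[of f R M N] by (auto simp: fun_eq_iff extensional_def)
  qed (auto simp: fun_eq_iff D(1) N.a_ac N.smult_l_distr N.smult_r_distr N.smult_assoc1)
qed

text \<open>All cosets of \<open>B\<close> in \<open>Z\<close> coincide with \<open>B\<close> exactly if \<open>Z \<subseteq> B\<close>.\<close>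

lemma trivial_subquotient_iff:
  assumes "module R M" "submodule Z R M" "submodule B R M" "B \<subseteq> Z"
  shows "trivial_group (M\<lparr>carrier := Z\<rparr> A_Mod B) \<longleftrightarrow> Z \<subseteq> B"
proof -
  let ?Z = "M\<lparr>carrier := Z\<rparr>"
  have mZ: "module R ?Z" by (rule submodule.submodule_is_module[OF assms(2,1)])
  interpret Z: module R ?Z by (rule mZ)
  interpret M: module R M by fact
  have "subgroup B (add_monoid ?Z)"
    using submodule.axioms(1)[OF assms(2)] submodule.axioms(1)[OF assms(3)] assms(4)
    using group.subgroup_incl[OF M.a_group, of B Z] by simp
  then interpret B: abelian_subgroup B ?Z
    by (intro abelian_subgroupI3 additive_subgroup.intro Z.abelian_group_axioms)
  have "carrier (?Z A_Mod B) = a_rcosets\<^bsub>?Z\<^esub> B"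
    unfolding A_FactGroup_def FactGroup_def A_RCOSETS_def partial_object.simps ..
  then have c: "carrier (?Z A_Mod B) = (\<Union>z\<in>Z. {B +>\<^bsub>?Z\<^esub> z})" by (simp add: A_RCOSETS_def')
  have o: "\<one>\<^bsub>?Z A_Mod B\<^esub> = B" by (simp add: A_FactGroup_def FactGroup_def)
  show ?thesis
  proof
    assume "trivial_group (?Z A_Mod B)"
    then have t: "(\<Union>z\<in>Z. {B +>\<^bsub>?Z\<^esub> z}) = {B}" unfolding trivial_group_def c o by (rule conjunct2)
    show "Z \<subseteq> B"
    proof
      fix z assume z: "z \<in> Z"
      then have "B +>\<^bsub>?Z\<^esub> z = B" using t by blast
      moreover have "z \<in> B +>\<^bsub>?Z\<^esub> z" by (rule B.a_rcos_self) (use z in simp)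
      ultimately show "z \<in> B" by simp
    qed
  next
    assume ZB: "Z \<subseteq> B"
    have "B +>\<^bsub>?Z\<^esub> z = B" if "z \<in> Z" for z by (rule B.a_rcos_const) (use ZB that in blast)
    moreover have "\<zero>\<^bsub>M\<^esub> \<in> Z" by (rule submodule_zero_mem[OF assms(1,2)])
    ultimately have "(\<Union>z\<in>Z. {B +>\<^bsub>?Z\<^esub> z}) = {B}" by blast
    moreover have "group (?Z A_Mod B)" by (rule B.a_factorgroup_is_group)
    ultimately show "trivial_group (?Z A_Mod B)" unfolding trivial_group_def c o by (intro conjI)
  qed
qed

definition is_coboundary ::
  "'a ring \<Rightarrow> (nat \<Rightarrow> ('a, 'p) module) \<Rightarrow> (nat \<Rightarrow> 'p \<Rightarrow> 'p) \<Rightarrow> ('a, 'c) module \<Rightarrow> nat \<Rightarrow> ('p \<Rightarrow> 'c) \<Rightarrow> bool" where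
  "is_coboundary R P d N i f \<longleftrightarrow> (case i of 0 \<Rightarrow> \<forall>y\<in>carrier (P 0). f y = \<zero>\<^bsub>N\<^esub>
     | Suc j \<Rightarrow> \<exists>g\<in>mod_hom R (P j) N. \<forall>y\<in>carrier (P (Suc j)). f y = g (d j y))"

lemma is_coboundary_simps [simp]:
  "is_coboundary R P d N 0 f \<longleftrightarrow> (\<forall>y\<in>carrier (P 0). f y = \<zero>\<^bsub>N\<^esub>)"
  "is_coboundary R P d N (Suc j) f \<longleftrightarrow> (\<exists>g\<in>mod_hom R (P j) N. \<forall>y\<in>carrier (P (Suc j)). f y = g (d j y))"
  by (simp_all add: is_coboundary_def)

text \<open>The extensionality of the elements of \<open>Hom_module\<close> is removed here, so that homomorphisms can be
  composed without restricting them.\<close>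

lemma trivial_cohomology_iff:
  assumes N: "module R N" and P: "\<And>i. module R (P i)" and d: "\<And>i. d i \<in> mod_hom R (P (Suc i)) (P i)"
    and dd: "\<And>i y. y \<in> carrier (P (Suc (Suc i))) \<Longrightarrow> d i (d (Suc i) y) = \<zero>\<^bsub>P i\<^esub>"
  shows "trivial_group (cohomology R P d N i) \<longleftrightarrow>
    (\<forall>f\<in>mod_hom R (P i) N. (\<forall>y\<in>carrier (P (Suc i)). f (d i y) = \<zero>\<^bsub>N\<^esub>) \<longrightarrow> is_coboundary R P d N i f)"
    (is "_ \<longleftrightarrow> ?rhs")
proof -
  let ?H = "Hom_module R (P i) N" and ?Z = "cocycles R P d N i" and ?B = "coboundaries R P d N i"
  interpret N: module R N by fact
  note mH = module_Hom_module[OF P N]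
  interpret H: module R ?H by (rule mH)
  note dc = mod_homD(1)[OF d]
  have cH: "(\<lambda>y\<in>carrier (P (Suc j)). g (d j y)) \<in> carrier (Hom_module R (P (Suc j)) N)"
    if "g \<in> mod_hom R (P j) N" for g j
    using mod_hom_restrict[OF P mod_hom_comp[OF d that]] by simp
  have Z_iff: "f \<in> ?Z \<longleftrightarrow> f \<in> carrier ?H \<and> (\<forall>y\<in>carrier (P (Suc i)). f (d i y) = \<zero>\<^bsub>N\<^esub>)" for f
    by (auto simp: cocycles_def)
  have pull: "(\<lambda>g. \<lambda>y\<in>carrier (P (Suc j)). g (d j y)) \<in> mod_hom R (Hom_module R (P j) N) (Hom_module R (P (Suc j)) N)" for j
    using cH dc by (intro mod_homI) (auto simp: fun_eq_iff simp del: Hom_module_simps(1), simp_all)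
  have Z_kernel: "?Z = a_kernel ?H (Hom_module R (P (Suc i)) N) (\<lambda>g. \<lambda>y\<in>carrier (P (Suc i)). g (d i y))"
    using dc by (auto simp: Z_iff a_kernel_eq fun_eq_iff)
  have sZ: "submodule ?Z R ?H" unfolding Z_kernel
    by (rule kernel_submodule[OF mH module_Hom_module[OF P N] pull])
  have sB: "submodule ?B R ?H"
  proof (cases i)
    case 0
    then show ?thesis using submodule_zero[OF mH] by (simp add: coboundaries_def)
  next
    case (Suc j)
    then show ?thesis using image_submodule[OF module_Hom_module[OF P N] module_Hom_module[OF P N] pull[of j]]
      by (simp add: coboundaries_def del: Hom_module_simps)
  qed
  have B_iff: "f \<in> ?B \<longleftrightarrow> is_coboundary R P d N i f" if f: "f \<in> carrier ?H" for f
  proof (cases i)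
    case 0
    then show ?thesis using f by (auto simp: coboundaries_def fun_eq_iff extensional_def)
  next
    case (Suc j)
    show ?thesis
    proof
      assume "f \<in> ?B"
      then obtain g where "g \<in> carrier (Hom_module R (P j) N)" "f = (\<lambda>y\<in>carrier (P i). g (d j y))"
        unfolding coboundaries_def Suc nat.case by (elim imageE)
      then show "is_coboundary R P d N i f" unfolding Suc is_coboundary_simps
        by (intro bexI[of _ g]) auto
    next
      assume "is_coboundary R P d N i f"
      then obtain g where g: "g \<in> mod_hom R (P j) N" "\<And>y. y \<in> carrier (P (Suc j)) \<Longrightarrow> f y = g (d j y)"
        unfolding Suc is_coboundary_simps by blast
      have "f = (\<lambda>y\<in>carrier (P (Suc j)). (\<lambda>y\<in>carrier (P j). g y) (d j y))"
        using f g(2) dc Suc by (auto simp: fun_eq_iff extensional_def)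
      moreover have "(\<lambda>y\<in>carrier (P j). g y) \<in> carrier (Hom_module R (P j) N)"
        using mod_hom_restrict[OF P g(1)] by simp
      ultimately show "f \<in> ?B" unfolding coboundaries_def Suc nat.case by (rule image_eqI)
    qed
  qed
  have BH: "?B \<subseteq> carrier ?H" by (rule module.submoduleE(1)[OF mH sB])
  have BZ: "?B \<subseteq> ?Z"
  proof
    fix f assume f: "f \<in> ?B"
    then have fH: "f \<in> carrier ?H" using BH by blast
    have "f (d i y) = \<zero>\<^bsub>N\<^esub>" if y: "y \<in> carrier (P (Suc i))" for y
    proof (cases i)
      case 0
      then show ?thesis using f B_iff[OF fH] dc[OF y] by simp
    next
      case (Suc j)
      then obtain g where g: "g \<in> mod_hom R (P j) N" "\<And>y. y \<in> carrier (P (Suc j)) \<Longrightarrow> f y = g (d j y)"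
        using f B_iff[OF fH] by auto
      then show ?thesis using dd[of y j] y dc[OF y] mod_hom_zero[OF P N g(1)] Suc by simp
    qed
    then show "f \<in> ?Z" using fH Z_iff by blast
  qed
  have "?Z \<subseteq> ?B \<longleftrightarrow> ?rhs"
  proof
    assume ZB: "?Z \<subseteq> ?B"
    show ?rhs
    proof (intro ballI impI)
      fix f assume f: "f \<in> mod_hom R (P i) N" "\<forall>y\<in>carrier (P (Suc i)). f (d i y) = \<zero>\<^bsub>N\<^esub>"
      have r: "(\<lambda>y\<in>carrier (P i). f y) \<in> carrier ?H" using mod_hom_restrict[OF P f(1)] by simp
      then have "(\<lambda>y\<in>carrier (P i). f y) \<in> ?Z" using f(2) dc by (simp add: Z_iff)
      then have "is_coboundary R P d N i (\<lambda>y\<in>carrier (P i). f y)" using ZB B_iff[OF r] by blast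
      then show "is_coboundary R P d N i f" by (cases i) auto
    qed
  next
    assume rhs: ?rhs
    show "?Z \<subseteq> ?B"
    proof
      fix f assume "f \<in> ?Z"
      then have f: "f \<in> carrier ?H" "\<forall>y\<in>carrier (P (Suc i)). f (d i y) = \<zero>\<^bsub>N\<^esub>" by (auto simp: Z_iff)
      then have "is_coboundary R P d N i f" using rhs by simp
      then show "f \<in> ?B" using B_iff[OF f(1)] by simp
    qed
  qed
  then show ?thesis unfolding cohomology_def using trivial_subquotient_iff[OF mH sZ sB BZ] by simp
qed

lemma Ext_eq_cohomology:
  fixes M :: "('a, 'b) module" and N :: "('a, 'c) module"
  assumes "module R M"
  shows "\<exists>(P :: nat \<Rightarrow> ('a, ('a, 'b) res) module) d e. projective_resolution R P d e M \<and>
    (\<forall>i. Ext R i M N = cohomology R P d N i)"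
proof -
  let ?Q = "\<lambda>(P :: nat \<Rightarrow> ('a, ('a, 'b) res) module, d). \<exists>e. projective_resolution R P d e M"
  have "\<exists>Pd. ?Q Pd" using projective_resolution_exists[OF assms] by auto
  then have Q: "?Q (SOME Pd. ?Q Pd)" by (rule someI_ex)
  obtain P d where Pd: "(SOME Pd. ?Q Pd) = (P, d)" by (cases "SOME Pd. ?Q Pd")
  obtain e where "projective_resolution R P d e M" using Q unfolding Pd by auto
  moreover have "Ext R i M N = cohomology R P d N i" for i unfolding Ext_def Pd by simp
  ultimately show ?thesis by blast
qed

text \<open>The resolution is arbitrary; the one chosen in the definition of \<open>Ext\<close> is a special case.\<close>

locale ext_resolution = grade_ring +
  fixes P :: "nat \<Rightarrow> ('a, 'p) module" and d :: "nat \<Rightarrow> 'p \<Rightarrow> 'p" and e :: "'p \<Rightarrow> 'a set"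
  assumes res: "projective_resolution T P d e (quot_module T I)"
begin

lemma pP: "proj T (P i)" and eP: "exact_upto T n P d e (quot_module T I)"
  using res by (auto simp: projective_resolution_iff)

lemma mP: "module T (P i)" by (rule proj_module[OF pP])

lemma dP: "d i \<in> mod_hom T (P (Suc i)) (P i)" using exact_uptoD(5)[OF eP, of i "Suc i"] by simp

lemma dd: "y \<in> carrier (P (Suc (Suc i))) \<Longrightarrow> d i (d (Suc i) y) = \<zero>\<^bsub>P i\<^esub>"
  using exact_upto_diff_diff[OF eP, of i "Suc (Suc i)"] by simp

lemma mT: "module T (self_module T)" by (rule module_self_module[OF T])

abbreviation cocycle :: "('a, 'c) module \<Rightarrow> nat \<Rightarrow> ('p \<Rightarrow> 'c) \<Rightarrow> bool" where
  "cocycle N i f \<equiv> f \<in> mod_hom T (P i) N \<and> (\<forall>y\<in>carrier (P (Suc i)). f (d i y) = \<zero>\<^bsub>N\<^esub>)"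

lemma vector_multiples:
  assumes "u \<in> carrier (C i)"
  shows "(\<lambda>t n. t \<otimes> u n) \<in> mod_hom T (self_module T) (C i)"
proof (rule mod_homI)
  show "(\<lambda>n. t \<otimes> u n) \<in> carrier (C i)" if "t \<in> carrier (self_module T)" for t
    using module.smult_closed[OF mC[of i] _ assms, of t] that by simp
qed (use C_closed[OF assms] in \<open>auto simp: fun_eq_iff l_distr m_assoc\<close>)

text \<open>Multiplication by an element of \<open>I\<close> is zero on \<open>T/I\<close>, hence null-homotopic on the resolution.\<close>

lemma cobounded_multiple:
  assumes N: "module T N" and f: "cocycle N i f" and t: "t \<in> I"
  shows "is_coboundary T P d N i (\<lambda>y. t \<odot>\<^bsub>N\<^esub> f y)"
proof -
  interpret N: module T N by fact
  have tT: "t \<in> carrier T" using t I_T by blast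
  note Q = quot_module_facts[OF T I_ideal]
  note eM = exact_uptoD(3)[OF eP]
  interpret I: ideal I T by (rule I_ideal)
  have \<phi>: "(\<lambda>y. t \<odot>\<^bsub>P i\<^esub> y) \<in> mod_hom T (P i) (P i)" for i
    by (rule mod_hom_smult[OF mP mP mod_hom_id tT])
  have aug: "e (t \<odot>\<^bsub>P 0\<^esub> y) = \<zero>\<^bsub>quot_module T I\<^esub>" if y: "y \<in> carrier (P 0)" for y
  proof -
    have "e y \<in> carrier (quot_module T I)" by (rule mod_homD(1)[OF eM y])
    then obtain r where r: "r \<in> carrier T" "e y = I +> r" unfolding Q(3)[symmetric] by (elim imageE)
    have "e (t \<odot>\<^bsub>P 0\<^esub> y) = I +> (t \<otimes> r)"
      using mod_homD(3)[OF eM tT y] mod_homD(3)[OF Q(2) tT, of r] r by simp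
    also have "\<dots> = \<zero>\<^bsub>quot_module T I\<^esub>" using Q(4)[of "t \<otimes> r"] I.I_r_closed[OF t r(1)] tT r(1) by simp
    finally show ?thesis .
  qed
  have comm: "d k (t \<odot>\<^bsub>P (Suc k)\<^esub> y) = t \<odot>\<^bsub>P k\<^esub> d k y" if "y \<in> carrier (P (Suc k))" for k y
    by (rule mod_homD(3)[OF dP tT that])
  from homotopy_exists[where \<phi> = "\<lambda>i y. t \<odot>\<^bsub>P i\<^esub> y", OF eP[of i] eP[of "Suc i"] pP \<phi> comm aug]
  obtain \<sigma> where \<sigma>: "\<And>k. k \<le> i \<Longrightarrow> \<sigma> k \<in> mod_hom T (P k) (P (Suc k))"
    "\<And>y. y \<in> carrier (P 0) \<Longrightarrow> d 0 (\<sigma> 0 y) = t \<odot>\<^bsub>P 0\<^esub> y"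
    "\<And>k y. k < i \<Longrightarrow> y \<in> carrier (P (Suc k)) \<Longrightarrow>
      d (Suc k) (\<sigma> (Suc k) y) = t \<odot>\<^bsub>P (Suc k)\<^esub> y \<ominus>\<^bsub>P (Suc k)\<^esub> \<sigma> k (d k y)" by blast
  have fh: "f \<in> mod_hom T (P i) N" and f0: "\<And>y. y \<in> carrier (P (Suc i)) \<Longrightarrow> f (d i y) = \<zero>\<^bsub>N\<^esub>"
    using f by auto
  show ?thesis
  proof (cases i)
    case 0
    have "t \<odot>\<^bsub>N\<^esub> f y = \<zero>\<^bsub>N\<^esub>" if y: "y \<in> carrier (P 0)" for y
    proof -
      have "t \<odot>\<^bsub>N\<^esub> f y = f (d 0 (\<sigma> 0 y))" using mod_homD(3)[OF fh tT] y \<sigma>(2)[OF y] 0 by simp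
      also have "\<dots> = \<zero>\<^bsub>N\<^esub>" using f0[of "\<sigma> 0 y"] mod_homD(1)[OF \<sigma>(1)[of 0] y] 0 by simp
      finally show ?thesis .
    qed
    then show ?thesis using 0 by simp
  next
    case (Suc k)
    have "t \<odot>\<^bsub>N\<^esub> f y = f (\<sigma> k (d k y))" if y: "y \<in> carrier (P (Suc k))" for y
    proof -
      have fk: "f \<in> mod_hom T (P (Suc k)) N" using fh Suc by simp
      have s: "\<sigma> k (d k y) \<in> carrier (P (Suc k))" using mod_homD(1)[OF \<sigma>(1)[of k]] mod_homD(1)[OF dP y] Suc by simp
      have ty: "t \<odot>\<^bsub>P (Suc k)\<^esub> y \<in> carrier (P (Suc k))" by (rule mod_homD(1)[OF \<phi> y])
      have "\<zero>\<^bsub>N\<^esub> = f (d (Suc k) (\<sigma> (Suc k) y))" using f0[of "\<sigma> (Suc k) y"] mod_homD(1)[OF \<sigma>(1)[of "Suc k"] y] Suc by simp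
      also have "\<dots> = f (t \<odot>\<^bsub>P (Suc k)\<^esub> y \<ominus>\<^bsub>P (Suc k)\<^esub> \<sigma> k (d k y))" using \<sigma>(3)[of k y] y Suc by simp
      also have "\<dots> = f (t \<odot>\<^bsub>P (Suc k)\<^esub> y) \<ominus>\<^bsub>N\<^esub> f (\<sigma> k (d k y))"
        by (rule mod_hom_minus_apply[OF mP N fk ty s])
      also have "f (t \<odot>\<^bsub>P (Suc k)\<^esub> y) = t \<odot>\<^bsub>N\<^esub> f y" by (rule mod_homD(3)[OF fk tT y])
      finally have "t \<odot>\<^bsub>N\<^esub> f y \<ominus>\<^bsub>N\<^esub> f (\<sigma> k (d k y)) = \<zero>\<^bsub>N\<^esub>" by simp
      from module_minus_eq_zero[OF N this] show ?thesis
        using mod_homD(1)[OF fk s] mod_homD(1)[OF fk y] tT by simp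
    qed
    moreover have "(\<lambda>y. f (\<sigma> k y)) \<in> mod_hom T (P k) N"
      by (rule mod_hom_comp[where N = "P (Suc k)"]) (use \<sigma>(1)[of k] fh Suc in auto)
    ultimately show ?thesis unfolding Suc is_coboundary_simps by (intro bexI) auto
  qed
qed

lemma coordinatewise_coboundary:
  assumes f: "cocycle (C j) i f" and "\<And>f. cocycle (self_module T) i f \<Longrightarrow> is_coboundary T P d (self_module T) i f"
  shows "is_coboundary T P d (C j) i f"
proof -
  have c: "is_coboundary T P d (self_module T) i (\<lambda>y. f y n)" for n
    using f mod_hom_comp[OF _ mod_hom_coord, of f T "P i" "koszul_index (Suc h) j" n]
    by (intro assms(2)) (auto simp: fun_eq_iff)
  show ?thesis
  proof (cases i)
    case 0
    then show ?thesis using c by (auto simp: fun_eq_iff)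
  next
    case (Suc k)
    have "\<forall>n. \<exists>g\<in>mod_hom T (P k) (self_module T). \<forall>y\<in>carrier (P (Suc k)). f y n = g (d k y)"
      using c unfolding Suc is_coboundary_simps by blast
    then obtain g where g: "\<And>n. g n \<in> mod_hom T (P k) (self_module T)"
      "\<And>n y. y \<in> carrier (P (Suc k)) \<Longrightarrow> f y n = g n (d k y)" by metis
    have "f y = (\<lambda>n. if n \<in> koszul_index (Suc h) j then g n (d k y) else \<zero>)" if y: "y \<in> carrier (P (Suc k))" for y
    proof -
      have "f y \<in> carrier (C j)" using f mod_homD(1)[of f T "P i"] y Suc by simp
      then show ?thesis using g(2)[OF y] by (auto simp: fsupp_carrier_iff fun_eq_iff)
    qed
    then show ?thesis unfolding Suc is_coboundary_simps
      by (intro bexI[OF _ mod_hom_into_fsupp[OF T finite_koszul_index g(1)]]) auto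
  qed
qed

text \<open>Exactness of the Koszul complex for families indexed by a projective module.\<close>

lemma D_lift:
  assumes "Suc j < h" "f \<in> mod_hom T (P i) (C (Suc j))" "\<And>y. y \<in> carrier (P i) \<Longrightarrow> D (f y) = (\<lambda>n. \<zero>)"
  shows "\<exists>w\<in>mod_hom T (P i) (C j). \<forall>y\<in>carrier (P i). D (w y) = f y"
proof (rule proj_lift[OF pP mC mC DC assms(2)])
  show "f ` carrier (P i) \<subseteq> D ` carrier (C j)"
  proof (rule image_subsetI)
    fix y assume y: "y \<in> carrier (P i)"
    from exact_Suc[OF assms(1) mod_homD(1)[OF assms(2) y] assms(3)[OF y]]
    obtain w where "w \<in> carrier (C j)" "D w = f y" by blast
    then show "f y \<in> D ` carrier (C j)" by (intro image_eqI[of _ _ w]) auto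
  qed
qed

lemma D_minus:
  assumes "u \<in> carrier (C i)" "v \<in> carrier (C i)"
  shows "D (u \<ominus>\<^bsub>C i\<^esub> v) = D u \<ominus>\<^bsub>C (Suc i)\<^esub> D v"
  by (rule mod_hom_minus_apply[OF mC mC DC assms])

lemma C_minus_self: "u \<in> carrier (C i) \<Longrightarrow> u \<ominus>\<^bsub>C i\<^esub> u = (\<lambda>n. \<zero>)"
proof -
  assume u: "u \<in> carrier (C i)"
  interpret Ci: module T "C i" by (rule mC)
  show ?thesis using Ci.r_neg[OF u] by (simp add: a_minus_def)
qed

text \<open>Two statements about the double complex \<open>Hom(P, C)\<close>, which need each other. A cocycle \<open>f\<close> of
  \<open>Hom(P (i + 1), T)\<close> is regarded as a map to \<open>C 0\<close>. The Koszul differential multiplies it by elements of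
  \<open>I\<close>, which makes it a coboundary \<open>G d\<close>; by the second statement for \<open>(i, 0)\<close> the map \<open>G\<close> can be chosen of
  the form \<open>D w\<close>, and then \<open>f = w d\<close>. Conversely, for \<open>f\<close> as in the second statement for \<open>(i + 1, j)\<close>, the
  first one shows that \<open>D f = g d\<close>, the second one for \<open>(i, j + 1)\<close> allows \<open>g = D w'\<close>, and \<open>f - w' d\<close> is a
  Koszul cocycle, hence of the form \<open>D w\<close>.\<close>

lemma ext_vanishing_induction:
  shows "(i < h \<longrightarrow> (\<forall>f. cocycle (self_module T) i f \<longrightarrow> is_coboundary T P d (self_module T) i f)) \<and>
    (\<forall>j f. i + Suc j < h \<longrightarrow> f \<in> mod_hom T (P i) (C (Suc j)) \<longrightarrow>
      (\<forall>y\<in>carrier (P (Suc i)). D (f (d i y)) = (\<lambda>n. \<zero>)) \<longrightarrow>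
      (\<exists>w\<in>mod_hom T (P i) (C j). \<forall>y\<in>carrier (P (Suc i)). f (d i y) = D (w (d i y))))"
proof (induction i)
  \<comment> \<open>The cocycle \<open>f\<close> as a map into \<open>C 0\<close>, and its Koszul differential.\<close>
  have F: "(\<lambda>y n. f y \<otimes> unit_vec n) \<in> mod_hom T (P i) (C 0)" if "f \<in> mod_hom T (P i) (self_module T)" for f i
    by (rule mod_hom_comp[OF that vector_multiples[OF unit_vec]])
  have DF: "D (\<lambda>n. t \<otimes> unit_vec n) = (\<lambda>n. t \<otimes> D unit_vec n)" if "t \<in> carrier T" for t
    using mod_homD(3)[OF DC that unit_vec] by simp
  have DFc: "is_coboundary T P d (C 1) i (\<lambda>y. D (\<lambda>n. f y \<otimes> unit_vec n))" if f: "cocycle (self_module T) i f" for f i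
  proof -
    have fT: "f y \<in> carrier T" if "y \<in> carrier (P i)" for y using mod_homD(1)[of f T "P i" "self_module T"] f that by simp
    have c: "is_coboundary T P d (self_module T) i (\<lambda>y. D unit_vec n \<odot>\<^bsub>self_module T\<^esub> f y)" for n
      by (rule cobounded_multiple[OF mT f D_in_I[OF unit_vec]])
    have u: "D unit_vec n \<in> carrier T" for n using D_in_I[OF unit_vec] I_T by blast
    have eq: "D (\<lambda>n. f y \<otimes> unit_vec n) = (\<lambda>n. D unit_vec n \<otimes> f y)" if "y \<in> carrier (P i)" for y
      using DF[OF fT[OF that]] fT[OF that] u by (auto simp: m_comm)
    show ?thesis
    proof (cases i)
      case 0
      then show ?thesis using c eq by (simp add: fun_eq_iff)
    next
      case (Suc k)
      have "\<forall>n. \<exists>g\<in>mod_hom T (P k) (self_module T). \<forall>y\<in>carrier (P (Suc k)). D unit_vec n \<otimes> f y = g (d k y)"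
        using c unfolding Suc is_coboundary_simps self_module_simps by blast
      then obtain g where g: "\<And>n. g n \<in> mod_hom T (P k) (self_module T)"
        "\<And>n y. y \<in> carrier (P (Suc k)) \<Longrightarrow> D unit_vec n \<otimes> f y = g n (d k y)" by metis
      have "D (\<lambda>n. f y \<otimes> unit_vec n) = (\<lambda>n. if n \<in> koszul_index (Suc h) 1 then g n (d k y) else \<zero>)"
        if y: "y \<in> carrier (P (Suc k))" for y
      proof -
        have "(\<lambda>n. f y \<otimes> unit_vec n) \<in> carrier (C 0)" using mod_homD(1)[OF F[of f "Suc k"] y] f Suc by simp
        then have "D (\<lambda>n. f y \<otimes> unit_vec n) \<in> carrier (C 1)" using mod_homD(1)[OF DC[of 0]] by simp
        then show ?thesis using eq[of y] g(2)[OF y] y Suc by (auto simp: fsupp_carrier_iff fun_eq_iff)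
      qed
      then show ?thesis unfolding Suc is_coboundary_simps
        by (intro bexI[OF _ mod_hom_into_fsupp[OF T finite_koszul_index g(1)]]) auto
    qed
  qed
  {
    case 0
    have V0: "is_coboundary T P d (self_module T) 0 f" if f: "cocycle (self_module T) 0 f" for f
    proof -
      have "f y = \<zero>" if y: "y \<in> carrier (P 0)" for y
      proof -
        have fT: "f y \<in> carrier T" using mod_homD(1)[of f T "P 0" "self_module T"] f y by simp
        have "(\<lambda>n. f y \<otimes> unit_vec n) \<in> carrier (C 0)" using mod_homD(1)[OF F[of f 0] y] f by simp
        moreover have "D (\<lambda>n. f y \<otimes> unit_vec n) = (\<lambda>n. \<zero>)" using DFc[OF f] y by simp
        ultimately have "(\<lambda>n. f y \<otimes> unit_vec n) = (\<lambda>n. \<zero>)" by (rule exact_0)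
        from fun_cong[OF this, of 0] show ?thesis using fT by (simp add: unit_vec_def)
      qed
      then show ?thesis by simp
    qed
    have "\<exists>w\<in>mod_hom T (P 0) (C j). \<forall>y\<in>carrier (P (Suc 0)). f (d 0 y) = D (w (d 0 y))"
      if j: "Suc j < h" and f: "f \<in> mod_hom T (P 0) (C (Suc j))"
        "\<forall>y\<in>carrier (P (Suc 0)). D (f (d 0 y)) = (\<lambda>n. \<zero>)" for j f
    proof -
      have "cocycle (C (Suc (Suc j))) 0 (\<lambda>y. D (f y))" using mod_hom_comp[OF f(1) DC] f(2) by simp
      from coordinatewise_coboundary[OF this V0] have "\<And>y. y \<in> carrier (P 0) \<Longrightarrow> D (f y) = (\<lambda>n. \<zero>)" by simp
      from D_lift[OF j f(1) this] obtain w where "w \<in> mod_hom T (P 0) (C j)" "\<And>y. y \<in> carrier (P 0) \<Longrightarrow> D (w y) = f y"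
        by blast
      then show ?thesis using mod_homD(1)[OF dP[of 0]] by (intro bexI[of _ w]) auto
    qed
    then show ?case using V0 by auto
  next
    case (Suc k)
    have S: "\<exists>w\<in>mod_hom T (P k) (C j). \<forall>y\<in>carrier (P (Suc k)). f (d k y) = D (w (d k y))"
      if "k + Suc j < h" "f \<in> mod_hom T (P k) (C (Suc j))" "\<And>y. y \<in> carrier (P (Suc k)) \<Longrightarrow> D (f (d k y)) = (\<lambda>n. \<zero>)" for f j
      using Suc that by blast
    have V: "is_coboundary T P d (self_module T) (Suc k) f" if h: "Suc k < h" and f: "cocycle (self_module T) (Suc k) f" for f
    proof -
      from DFc[OF f] obtain G where G: "G \<in> mod_hom T (P k) (C 1)"
        "\<And>y. y \<in> carrier (P (Suc k)) \<Longrightarrow> D (\<lambda>n. f y \<otimes> unit_vec n) = G (d k y)" unfolding is_coboundary_simps by blast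
      have Fc: "(\<lambda>n. f y \<otimes> unit_vec n) \<in> carrier (C 0)" if "y \<in> carrier (P (Suc k))" for y
        using mod_homD(1)[OF F[of f "Suc k"] that] f by simp
      have "\<exists>w\<in>mod_hom T (P k) (C 0). \<forall>y\<in>carrier (P (Suc k)). G (d k y) = D (w (d k y))"
      proof (rule S)
        show "D (G (d k y)) = (\<lambda>n. \<zero>)" if "y \<in> carrier (P (Suc k))" for y
          using DD[OF Fc[OF that]] G(2)[OF that] by simp
      qed (use h G(1) in auto)
      then obtain w where w: "w \<in> mod_hom T (P k) (C 0)"
        "\<And>y. y \<in> carrier (P (Suc k)) \<Longrightarrow> G (d k y) = D (w (d k y))" by blast
      have "f y = w (d k y) 0" if y: "y \<in> carrier (P (Suc k))" for y
      proof -
        have fT: "f y \<in> carrier T" using mod_homD(1)[of f T "P (Suc k)" "self_module T"] f y by simp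
        have "w (d k y) \<in> carrier (C 0)" by (rule mod_homD(1)[OF w(1) mod_homD(1)[OF dP y]])
        then have "(\<lambda>n. f y \<otimes> unit_vec n) = w (d k y)" by (rule D_inj[OF Fc[OF y]]) (simp add: G(2) w(2) y)
        from fun_cong[OF this, of 0] show ?thesis using fT by (simp add: unit_vec_def)
      qed
      then show ?thesis unfolding is_coboundary_simps
        by (intro bexI[of _ "\<lambda>y. w y 0"] mod_hom_comp[OF w(1) mod_hom_coord]) auto
    qed
    have "\<exists>w\<in>mod_hom T (P (Suc k)) (C j). \<forall>y\<in>carrier (P (Suc (Suc k))). f (d (Suc k) y) = D (w (d (Suc k) y))"
      if j: "Suc k + Suc j < h" and f: "f \<in> mod_hom T (P (Suc k)) (C (Suc j))"
        "\<forall>y\<in>carrier (P (Suc (Suc k))). D (f (d (Suc k) y)) = (\<lambda>n. \<zero>)" for j f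
    proof -
      have fc: "f y \<in> carrier (C (Suc j))" if "y \<in> carrier (P (Suc k))" for y by (rule mod_homD(1)[OF f(1) that])
      have "cocycle (C (Suc (Suc j))) (Suc k) (\<lambda>y. D (f y))" using mod_hom_comp[OF f(1) DC] f(2) by simp
      moreover have "Suc k < h" using j by simp
      ultimately have "is_coboundary T P d (C (Suc (Suc j))) (Suc k) (\<lambda>y. D (f y))"
        by (intro coordinatewise_coboundary V)
      then obtain g where g: "g \<in> mod_hom T (P k) (C (Suc (Suc j)))"
        "\<And>y. y \<in> carrier (P (Suc k)) \<Longrightarrow> D (f y) = g (d k y)" unfolding is_coboundary_simps by blast
      have "\<exists>w\<in>mod_hom T (P k) (C (Suc j)). \<forall>y\<in>carrier (P (Suc k)). g (d k y) = D (w (d k y))"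
      proof (rule S)
        show "D (g (d k y)) = (\<lambda>n. \<zero>)" if "y \<in> carrier (P (Suc k))" for y
          using DD[OF fc[OF that]] g(2)[OF that] by simp
      qed (use j g(1) in auto)
      then obtain w' where w': "w' \<in> mod_hom T (P k) (C (Suc j))"
        "\<And>y. y \<in> carrier (P (Suc k)) \<Longrightarrow> g (d k y) = D (w' (d k y))" by blast
      have w'd: "(\<lambda>y. w' (d k y)) \<in> mod_hom T (P (Suc k)) (C (Suc j))" by (rule mod_hom_comp[OF dP w'(1)])
      let ?q = "\<lambda>y. f y \<ominus>\<^bsub>C (Suc j)\<^esub> w' (d k y)"
      have q: "?q \<in> mod_hom T (P (Suc k)) (C (Suc j))" by (rule mod_hom_minus[OF mP mC f(1) w'd])
      have Dq: "D (?q y) = (\<lambda>n. \<zero>)" if y: "y \<in> carrier (P (Suc k))" for y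
        using D_minus[OF fc[OF y] mod_homD(1)[OF w'd y]] C_minus_self[OF mod_homD(1)[OF DC fc[OF y]]]
          g(2)[OF y] w'(2)[OF y] by simp
      have "Suc j < h" using j by simp
      from D_lift[OF this q Dq] obtain w where w: "w \<in> mod_hom T (P (Suc k)) (C j)"
        "\<And>y. y \<in> carrier (P (Suc k)) \<Longrightarrow> D (w y) = ?q y" by blast
      show ?thesis
      proof (intro bexI[OF _ w(1)] ballI)
        fix y assume y: "y \<in> carrier (P (Suc (Suc k)))"
        note dy = mod_homD(1)[OF dP y]
        have "w' (d k (d (Suc k) y)) = \<zero>\<^bsub>C (Suc j)\<^esub>" unfolding dd[OF y] by (rule mod_hom_zero[OF mP mC w'(1)])
        then show "f (d (Suc k) y) = D (w (d (Suc k) y))"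
          using w(2)[OF dy] module_minus_zero[OF mC fc[OF dy]] by simp
      qed
    qed
    then show ?case using V by auto
  }
qed

lemma ext_vanishing:
  "i < h \<Longrightarrow> cocycle (self_module T) i f \<Longrightarrow> is_coboundary T P d (self_module T) i f"
  using ext_vanishing_induction[of i] by blast

text \<open>The class of \<open>top_cocycle\<close> is nonzero and killed by \<open>I\<close>, so it defines a map from \<open>T/I\<close> to the \<open>h\<close>th
  Koszul cohomology.\<close>

lemma koszul_class:
  "\<exists>z\<in>carrier (C h). z \<notin> D ` carrier (C (h - 1)) \<and> (\<forall>t\<in>I. (\<lambda>n. t \<otimes> z n) \<in> D ` carrier (C (h - 1)))"
proof -
  obtain h' where h': "h = Suc h'" using h by (cases h) auto
  obtain \<epsilon> \<kappa> where r: "retraction T (x ` {..h}) \<epsilon> \<kappa>" "\<epsilon> \<noteq> \<zero>" "x 0 \<otimes> \<epsilon> = \<zero>"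
    using annihilated[OF x_m[of 0], of "x ` {..h}"] xI by auto
  have \<epsilon>: "\<epsilon> \<in> carrier T" by (rule retractionD(1)[OF r(1)])
  have \<epsilon>I: "\<epsilon> \<notin> I" unfolding I_def by (rule retraction_notin_ideal[OF loc r(1) _ _ r(2)]) (use x_m in auto)
  let ?z = "top_cocycle \<epsilon> h" and ?K = "D ` carrier (C (h - 1))"
  have zC: "?z \<in> carrier (C h)" by (rule top_cocycle_carrier[OF \<epsilon>])
  have "?z \<notin> ?K"
  proof
    assume "?z \<in> ?K"
    then obtain w where w: "w \<in> carrier (C (h - 1))" "?z = D w" by (elim imageE)
    obtain n where "?z n = \<epsilon>" using top_cocycle_value by blast
    then show False using D_in_I[OF w(1), of n] \<epsilon>I w(2) by simp
  qed
  moreover have "(\<lambda>n. t \<otimes> ?z n) \<in> ?K" if t: "t \<in> I" for t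
  proof -
    define \<theta> where "\<theta> = (\<lambda>t n. t \<otimes> ?z n)"
    have \<theta>: "\<theta> \<in> mod_hom T (self_module T) (C h)" unfolding \<theta>_def by (rule vector_multiples[OF zC])
    have sK: "submodule ?K T (C h)" unfolding h' using image_submodule[OF mC mC DC, of h'] h' by simp
    from quotient_module_exists[OF mC sK] obtain Q :: "('a, nat \<Rightarrow> 'a) module" and \<pi> where
      Q: "module T Q" "\<pi> \<in> mod_hom T (C h) Q" "\<And>u. u \<in> carrier (C h) \<Longrightarrow> \<pi> u = \<zero>\<^bsub>Q\<^esub> \<longleftrightarrow> u \<in> ?K" by blast
    define A where "A = a_kernel (self_module T) Q (\<lambda>t. \<pi> (\<theta> t))"
    have "submodule A T (self_module T)" unfolding A_def
      by (rule kernel_submodule[OF mT Q(1) mod_hom_comp[OF \<theta> Q(2)]])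
    then have iA: "ideal A T" using ideal_iff_submodule[OF T] by blast
    have A_iff: "t \<in> A \<longleftrightarrow> \<theta> t \<in> ?K" if "t \<in> carrier T" for t
      using that Q(3)[OF mod_homD(1)[OF \<theta>, of t]] by (simp add: A_def a_kernel_eq)
    have "x k \<in> A" if k: "k \<le> h" for k
    proof -
      have "\<exists>w\<in>carrier (fsupp_module T (koszul_index (Suc (Suc h')) h')).
          koszul T x (Suc (Suc h')) w = (\<lambda>n. x k \<otimes> top_cocycle \<epsilon> (Suc h') n)"
        by (rule top_cocycle_killed[where x = x and j = h' and k = k, OF \<epsilon> r(3)]) (use x_T k h' in auto)
      then obtain w where "w \<in> carrier (C (h - 1))" "D w = \<theta> (x k)" unfolding \<theta>_def h' by auto
      then have "\<theta> (x k) \<in> ?K" by (intro image_eqI[of _ _ w]) auto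
      then show ?thesis using A_iff[OF x_T[OF k]] by simp
    qed
    then have "I \<subseteq> A" unfolding I_def by (intro genideal_minimal[OF iA]) auto
    then show ?thesis using t A_iff[of t] I_T by (auto simp: \<theta>_def)
  qed
  ultimately show ?thesis by (intro bexI[OF _ zC] conjI ballI)
qed

text \<open>Iterated connecting homomorphisms, beginning with \<open>F 0 p = l p \<cdot> z\<close>, where \<open>z\<close> is the class from
  \<open>koszul_class\<close> and \<open>l\<close> lifts \<open>e\<close>: the maps \<open>F k\<close> from \<open>P k\<close> to \<open>C (h - k)\<close> satisfy
  \<open>D (F (k + 1)) = F k d\<close>. If \<open>F (k + 1)\<close> were a coboundary up to Koszul boundaries, then so would be
  \<open>F k\<close>, because there are no other cocycles below degree \<open>h\<close>; finally \<open>z\<close> would be a Koszul boundary.\<close>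

lemma ext_connecting_sequence:
  assumes "k < h"
  shows "\<exists>f\<in>mod_hom T (P (Suc k)) (C (h - Suc k)). (\<forall>y\<in>carrier (P (Suc (Suc k))). D (f (d (Suc k) y)) = (\<lambda>n. \<zero>)) \<and>
    \<not> (\<exists>g\<in>mod_hom T (P k) (C (h - Suc k)). \<forall>y\<in>carrier (P (Suc k)). D (f y) = D (g (d k y)))"
  using assms
proof (induction k)
  case 0
  obtain h' where h': "h = Suc h'" using h by (cases h) auto
  obtain z where z: "z \<in> carrier (C h)" "z \<notin> D ` carrier (C (h - 1))"
    "\<And>t. t \<in> I \<Longrightarrow> (\<lambda>n. t \<otimes> z n) \<in> D ` carrier (C (h - 1))" using koszul_class by blast
  note Q = quot_module_facts[OF T I_ideal]
  note eM = exact_uptoD(3,4)[OF eP]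
  have "\<exists>\<l>\<in>mod_hom T (P 0) (self_module T). \<forall>y\<in>carrier (P 0). I +> \<l> y = e y"
    by (rule proj_lift[OF pP mT Q(1,2) eM(1)]) (use eM(2) Q(3) in simp)
  then obtain l where l: "l \<in> mod_hom T (P 0) (self_module T)" "\<And>y. y \<in> carrier (P 0) \<Longrightarrow> I +> l y = e y" by blast
  have lT: "l y \<in> carrier T" if "y \<in> carrier (P 0)" for y using mod_homD(1)[OF l(1) that] by simp
  let ?F = "\<lambda>y n. l y \<otimes> z n"
  have F: "?F \<in> mod_hom T (P 0) (C (Suc h'))" using mod_hom_comp[OF l(1) vector_multiples[OF z(1)]] h' by simp
  have Fd: "(\<lambda>y. ?F (d 0 y)) \<in> mod_hom T (P (Suc 0)) (C (Suc h'))" by (rule mod_hom_comp[OF dP F])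
  have "\<exists>f\<in>mod_hom T (P (Suc 0)) (C h'). \<forall>y\<in>carrier (P (Suc 0)). D (f y) = ?F (d 0 y)"
  proof (rule proj_lift[OF pP mC mC DC Fd])
    show "(\<lambda>y. ?F (d 0 y)) ` carrier (P (Suc 0)) \<subseteq> D ` carrier (C h')"
    proof (rule image_subsetI)
      fix y assume y: "y \<in> carrier (P (Suc 0))"
      note dy = mod_homD(1)[OF dP y]
      have "I +> l (d 0 y) = \<zero>\<^bsub>quot_module T I\<^esub>"
        using l(2)[OF dy] exact_upto_aug_diff[OF eP[of 1] _ y] by simp
      then have "l (d 0 y) \<in> I" using Q(4)[OF lT[OF dy]] by simp
      then show "?F (d 0 y) \<in> D ` carrier (C h')" using z(3)[of "l (d 0 y)"] h' by simp
    qed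
  qed
  then obtain f where f: "f \<in> mod_hom T (P (Suc 0)) (C h')" "\<And>y. y \<in> carrier (P (Suc 0)) \<Longrightarrow> D (f y) = ?F (d 0 y)" by blast
  have "D (f (d (Suc 0) y)) = (\<lambda>n. \<zero>)" if y: "y \<in> carrier (P (Suc (Suc 0)))" for y
    using f(2)[OF mod_homD(1)[OF dP y]] dd[OF y] mod_hom_zero[OF mP mC F] by simp
  moreover have False if g: "g \<in> mod_hom T (P 0) (C h')" "\<And>y. y \<in> carrier (P (Suc 0)) \<Longrightarrow> D (f y) = D (g (d 0 y))" for g
  proof -
    note Dg = mod_hom_comp[OF g(1) DC]
    let ?q = "\<lambda>y. ?F y \<ominus>\<^bsub>C (Suc h')\<^esub> D (g y)"
    have q: "?q \<in> mod_hom T (P 0) (C (Suc h'))" by (rule mod_hom_minus[OF mP mC F Dg])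
    have "?q (d 0 y) = (\<lambda>n. \<zero>)" if y: "y \<in> carrier (P (Suc 0))" for y
      using f(2)[OF y] g(2)[OF y] C_minus_self[OF mod_homD(1)[OF Dg mod_homD(1)[OF dP y]]] by simp
    then have "cocycle (C (Suc h')) 0 ?q" using q by simp
    from coordinatewise_coboundary[OF this] ext_vanishing[of 0] h
    have q0: "?q y = \<zero>\<^bsub>C (Suc h')\<^esub>" if "y \<in> carrier (P 0)" for y using that by simp
    have FD: "?F y = D (g y)" if y: "y \<in> carrier (P 0)" for y
      by (rule module_minus_eq_zero[OF mC q0[OF y] mod_homD(1)[OF F y] mod_homD(1)[OF Dg y]])
    have "I +> \<one> \<in> carrier (quot_module T I)" unfolding Q(3)[symmetric] by (rule imageI) simp
    then have "I +> \<one> \<in> e ` carrier (P 0)" unfolding eM(2) .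
    then obtain y where y: "y \<in> carrier (P 0)" "I +> \<one> = e y" by (elim imageE)
    interpret Q: module T "quot_module T I" by (rule Q(1))
    have "I +> (\<one> \<ominus> l y) = (I +> \<one>) \<ominus>\<^bsub>quot_module T I\<^esub> (I +> l y)"
      using mod_hom_minus_apply[OF mT Q(1,2), of \<one> "l y"] lT[OF y(1)] self_module_minus[OF T, of "l y" \<one>] by simp
    also have "\<dots> = \<zero>\<^bsub>quot_module T I\<^esub>" unfolding l(2)[OF y(1)] y(2) a_minus_def
      by (rule Q.r_neg[OF mod_homD(1)[OF eM(1) y(1)]])
    finally have "\<one> \<ominus> l y \<in> I" using Q(4)[of "\<one> \<ominus> l y"] lT[OF y(1)] by simp
    from z(3)[OF this] obtain w where w: "w \<in> carrier (C h')" "(\<lambda>n. (\<one> \<ominus> l y) \<otimes> z n) = D w" using h' by auto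
    note gy = mod_homD(1)[OF g(1) y(1)]
    have "z = (\<lambda>n. (\<one> \<ominus> l y) \<otimes> z n \<oplus> l y \<otimes> z n)"
      using lT[OF y(1)] C_closed[OF z(1)] by (auto simp: fun_eq_iff l_distr[symmetric] a_minus_def a_assoc l_neg)
    also have "\<dots> = D w \<oplus>\<^bsub>C (Suc h')\<^esub> D (g y)" using fun_cong[OF w(2)] fun_cong[OF FD[OF y(1)]] by simp
    also have "\<dots> = D (w \<oplus>\<^bsub>C h'\<^esub> g y)" by (rule mod_homD(2)[OF DC w(1) gy, symmetric])
    finally have "z \<in> D ` carrier (C h')"
      using abelian_monoid.a_closed[of "C h'" w "g y"] mC[of h'] w(1) gy
      by (intro image_eqI[of _ _ "w \<oplus>\<^bsub>C h'\<^esub> g y"]) (auto simp: module_def abelian_group_def)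
    then show False using z(2) h' by simp
  qed
  ultimately show ?case using f(1) h' by (intro bexI[of _ f]) auto
next
  case (Suc k)
  then obtain f where f: "f \<in> mod_hom T (P (Suc k)) (C (h - Suc k))"
    "\<And>y. y \<in> carrier (P (Suc (Suc k))) \<Longrightarrow> D (f (d (Suc k) y)) = (\<lambda>n. \<zero>)"
    and nf: "\<not> (\<exists>g\<in>mod_hom T (P k) (C (h - Suc k)). \<forall>y\<in>carrier (P (Suc k)). D (f y) = D (g (d k y)))"
    by auto
  obtain j where j: "h - Suc k = Suc j" "h - Suc (Suc k) = j" "Suc j < h"
    using Suc.prems by (cases "h - Suc k") auto
  note f1 = f(1)[unfolded j(1)]
  from D_lift[OF j(3) mod_hom_comp[OF dP f1] f(2)] obtain f' where
    f': "f' \<in> mod_hom T (P (Suc (Suc k))) (C j)" "\<And>y. y \<in> carrier (P (Suc (Suc k))) \<Longrightarrow> D (f' y) = f (d (Suc k) y)"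
    by blast
  have "D (f' (d (Suc (Suc k)) y)) = (\<lambda>n. \<zero>)" if y: "y \<in> carrier (P (Suc (Suc (Suc k))))" for y
    using f'(2)[OF mod_homD(1)[OF dP y]] dd[OF y] mod_hom_zero[OF mP mC f1] by simp
  moreover have False if g: "g \<in> mod_hom T (P (Suc k)) (C j)"
    "\<And>y. y \<in> carrier (P (Suc (Suc k))) \<Longrightarrow> D (f' y) = D (g (d (Suc k) y))" for g
  proof -
    note Dg = mod_hom_comp[OF g(1) DC]
    let ?q = "\<lambda>y. f y \<ominus>\<^bsub>C (Suc j)\<^esub> D (g y)"
    have q: "?q \<in> mod_hom T (P (Suc k)) (C (Suc j))" by (rule mod_hom_minus[OF mP mC f1 Dg])
    have "?q (d (Suc k) y) = (\<lambda>n. \<zero>)" if y: "y \<in> carrier (P (Suc (Suc k)))" for y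
      using f'(2)[OF y] g(2)[OF y] C_minus_self[OF mod_homD(1)[OF Dg mod_homD(1)[OF dP y]]] by simp
    then have "cocycle (C (Suc j)) (Suc k) ?q" using q by simp
    from coordinatewise_coboundary[OF this] ext_vanishing[of "Suc k"] Suc.prems
    have "is_coboundary T P d (C (Suc j)) (Suc k) ?q" by blast
    then obtain g' where g': "g' \<in> mod_hom T (P k) (C (Suc j))"
      "\<And>y. y \<in> carrier (P (Suc k)) \<Longrightarrow> ?q y = g' (d k y)" unfolding is_coboundary_simps by blast
    have "D (f y) = D (g' (d k y))" if y: "y \<in> carrier (P (Suc k))" for y
    proof -
      note fy = mod_homD(1)[OF f1 y] and gy = mod_homD(1)[OF g(1) y] and Dgy = mod_homD(1)[OF Dg y]
      have "D (?q y) = D (f y) \<ominus>\<^bsub>C (Suc (Suc j))\<^esub> \<zero>\<^bsub>C (Suc (Suc j))\<^esub>"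
        using D_minus[OF fy Dgy] DD[OF gy] by simp
      also have "\<dots> = D (f y)" by (rule module_minus_zero[OF mC mod_homD(1)[OF DC fy]])
      finally show ?thesis using g'(2)[OF y] by simp
    qed
    then show False using nf g'(1) j(1) by auto
  qed
  ultimately show ?case using f'(1) j(2) by (intro bexI[of _ f']) auto
qed

text \<open>The last map of the sequence has values in \<open>C 0 = T\<close>, where \<open>D\<close> is injective.\<close>

lemma ext_nonvanishing:
  "\<exists>f. cocycle (self_module T) h f \<and> \<not> is_coboundary T P d (self_module T) h f"
proof -
  obtain h' where h': "h = Suc h'" using h by (cases h) auto
  from ext_connecting_sequence[of h'] obtain f where f: "f \<in> mod_hom T (P h) (C 0)"
    "\<And>y. y \<in> carrier (P (Suc h)) \<Longrightarrow> D (f (d h y)) = (\<lambda>n. \<zero>)"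
    and nf: "\<not> (\<exists>g\<in>mod_hom T (P h') (C 0). \<forall>y\<in>carrier (P h). D (f y) = D (g (d h' y)))"
    unfolding h' by auto
  have c: "(\<lambda>y. f y 0) \<in> mod_hom T (P h) (self_module T)" by (rule mod_hom_comp[OF f(1) mod_hom_coord])
  have "f (d h y) = (\<lambda>n. \<zero>)" if y: "y \<in> carrier (P (Suc h))" for y
    by (rule exact_0[OF mod_homD(1)[OF f(1) mod_homD(1)[OF dP y]] f(2)[OF y]])
  then have "cocycle (self_module T) h (\<lambda>y. f y 0)" using c by simp
  moreover have "\<not> is_coboundary T P d (self_module T) h (\<lambda>y. f y 0)"
  proof
    assume "is_coboundary T P d (self_module T) h (\<lambda>y. f y 0)"
    then obtain g where g: "g \<in> mod_hom T (P h') (self_module T)" "\<And>y. y \<in> carrier (P h) \<Longrightarrow> f y 0 = g (d h' y)"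
      unfolding h' is_coboundary_simps by blast
    have G: "(\<lambda>y n. g y \<otimes> unit_vec n) \<in> mod_hom T (P h') (C 0)"
      by (rule mod_hom_comp[OF g(1) vector_multiples[OF unit_vec]])
    have "f y = (\<lambda>n. g (d h' y) \<otimes> unit_vec n)" if y: "y \<in> carrier (P h)" for y
      using C_0[OF mod_homD(1)[OF f(1) y]] g(2)[OF y] by simp
    then show False using nf G by auto
  qed
  ultimately show ?thesis by blast
qed

end

lemma (in grade_ring) Ext_vanishes_exactly_below:
  "(\<forall>i<h. trivial_group (Ext T i (quot_module T I) (self_module T))) \<and>
    \<not> trivial_group (Ext T h (quot_module T I) (self_module T))"
proof -
  note Q = quot_module_facts(1)[OF T I_ideal]
  from Ext_eq_cohomology[OF Q] obtain P :: "nat \<Rightarrow> ('a, ('a, 'a set) res) module" and d e where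
    P: "projective_resolution T P d e (quot_module T I)"
    and Ext: "\<And>i. Ext T i (quot_module T I) (self_module T) = cohomology T P d (self_module T) i" by blast
  interpret ext_resolution T m x h b P d e by unfold_locales (rule P)
  have triv: "trivial_group (cohomology T P d (self_module T) i) \<longleftrightarrow>
      (\<forall>f. cocycle (self_module T) i f \<longrightarrow> is_coboundary T P d (self_module T) i f)" for i
    using trivial_cohomology_iff[where P = P and d = d and i = i, OF mT mP dP] dd by blast
  have "trivial_group (cohomology T P d (self_module T) i)" if "i < h" for i
    unfolding triv using ext_vanishing[OF that] by blast
  moreover have "\<not> trivial_group (cohomology T P d (self_module T) h)"
  proof
    assume "trivial_group (cohomology T P d (self_module T) h)"
    then show False using ext_nonvanishing unfolding triv by blast
  qed
  ultimately show ?thesis unfolding Ext by blast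
qed

section \<open>Regular local rings and their trivial extensions\<close>

text \<open>Here \<open>J i = (x 0, \<dots>, x (i - 1))\<close>, and \<open>J_reg\<close> says that \<open>x 0, \<dots>, x h\<close> is a regular sequence.\<close>

locale regular_local = plain_cring R for R :: "'k ring" (structure) +
  fixes x :: "nat \<Rightarrow> 'k" and h :: nat and J :: "nat \<Rightarrow> 'k set"
  assumes h: "1 \<le> h"
    and integral: "a \<in> carrier R \<Longrightarrow> b \<in> carrier R \<Longrightarrow> a \<otimes> b = \<zero> \<Longrightarrow> a = \<zero> \<or> b = \<zero>"
    and loc: "local_with R (J (Suc h))"
    and x_R: "i \<le> h \<Longrightarrow> x i \<in> carrier R"
    and J_0: "J 0 = {\<zero>}"
    and J_ideal: "i \<le> Suc h \<Longrightarrow> ideal (J i) R"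
    and J_step: "i \<le> h \<Longrightarrow> J (Suc i) = {x i \<otimes> y \<oplus> z | y z. y \<in> carrier R \<and> z \<in> J i}"
    and J_reg: "i \<le> h \<Longrightarrow> y \<in> carrier R \<Longrightarrow> x i \<otimes> y \<in> J i \<Longrightarrow> y \<in> J i"
begin

lemmas L = local_withD[OF loc]

lemma J_zero: "i \<le> Suc h \<Longrightarrow> \<zero> \<in> J i"
  using additive_subgroup.zero_closed[OF ideal.axioms(1)[OF J_ideal]] .

lemma J_mono: "i \<le> j \<Longrightarrow> j \<le> Suc h \<Longrightarrow> J i \<subseteq> J j"
proof (induction j)
  case (Suc j)
  have "J j \<subseteq> J (Suc j)"
  proof
    fix z assume z: "z \<in> J j"
    have "z \<in> carrier R" using additive_subgroup.a_subset[OF ideal.axioms(1)[OF J_ideal[of j]]] z Suc.prems by auto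
    then have "z = x j \<otimes> \<zero> \<oplus> z" using x_R[of j] Suc.prems by simp
    then show "z \<in> J (Suc j)" using z J_step[of j] Suc.prems by blast
  qed
  then show ?case using Suc by (cases "i = Suc j") auto
qed simp

lemma J_x: "i \<le> h \<Longrightarrow> x i \<in> J (Suc i)"
proof -
  assume i: "i \<le> h"
  have "x i = x i \<otimes> \<one> \<oplus> \<zero>" using x_R[OF i] by simp
  then show ?thesis unfolding J_step[OF i] using J_zero[of i] i by (intro CollectI exI[of _ \<one>] exI[of _ \<zero>]) auto
qed

lemma x_J: "i < j \<Longrightarrow> j \<le> Suc h \<Longrightarrow> x i \<in> J j"
  using J_x[of i] J_mono[of "Suc i" j] by auto

lemma x_0_nonzero: "x 0 \<noteq> \<zero>"
proof
  assume "x 0 = \<zero>"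
  then have "\<one> \<in> J 0" using J_reg[of 0 \<one>] J_0 by simp
  then have "\<one> \<in> J (Suc h)" using J_mono[of 0 "Suc h"] by auto
  then show False using L(5) by simp
qed

subsection \<open>Exactness of the Koszul complex\<close>

text \<open>The positions of degree \<open>i - 1\<close>; for \<open>i = 0\<close> there are none, so that exactness in degree \<open>0\<close>
  becomes a special case.\<close>

definition pred_index :: "nat \<Rightarrow> nat \<Rightarrow> nat set" where
  "pred_index j i = (case i of 0 \<Rightarrow> {} | Suc i' \<Rightarrow> koszul_index j i')"

lemma pred_index_simps [simp]: "pred_index j 0 = {}" "pred_index j (Suc i) = koszul_index j i"
  by (simp_all add: pred_index_def)

lemma finite_pred_index: "finite (pred_index j i)"
  by (cases i) (simp_all add: finite_koszul_index)

text \<open>The two halves of a family on the mapping cone.\<close>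

definition join :: "(nat \<Rightarrow> 'k) \<Rightarrow> (nat \<Rightarrow> 'k) \<Rightarrow> nat \<Rightarrow> 'k" where
  "join p q n = (if even n then p (n div 2) else q (n div 2))"

lemma join_split: "join (\<lambda>k. u (2 * k)) (\<lambda>k. u (Suc (2 * k))) = u"
  by (auto simp: join_def fun_eq_iff elim!: oddE)

lemma koszul_join:
  "koszul R x (Suc j) (join p q) = join (koszul R x j p) (\<lambda>n. x j \<otimes> p n \<ominus> koszul R x j q n)"
proof -
  have "(\<lambda>k. join p q (2 * k)) = p" "(\<lambda>k. join p q (Suc (2 * k))) = q" by (auto simp: join_def)
  moreover have "join p q (2 * (n div 2)) = p (n div 2)" for n by (simp add: join_def)
  ultimately show ?thesis unfolding koszul.simps by (simp only: fun_eq_iff join_def[of "koszul R x j p"]) simp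
qed

definition family :: "nat set \<Rightarrow> (nat \<Rightarrow> 'k) \<Rightarrow> bool" where
  "family A u \<longleftrightarrow> (\<forall>n. u n \<in> carrier R) \<and> (\<forall>n. n \<notin> A \<longrightarrow> u n = \<zero>)"

lemma familyD: "family A u \<Longrightarrow> u n \<in> carrier R" "family A u \<Longrightarrow> n \<notin> A \<Longrightarrow> u n = \<zero>"
  by (auto simp: family_def)

lemma family_join_iff:
  "family (koszul_index (Suc j) i) (join p q) \<longleftrightarrow> family (koszul_index j i) p \<and> family (pred_index j i) q"
proof -
  have pi: "n \<in> pred_index j i \<longleftrightarrow> 0 < i \<and> n \<in> koszul_index j (i - 1)" for n by (cases i) auto
  have e: "join p q (2 * n) = p n" "join p q (Suc (2 * n)) = q n" for n by (auto simp: join_def)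
  have i: "2 * n \<in> koszul_index (Suc j) i \<longleftrightarrow> n \<in> koszul_index j i"
    "Suc (2 * n) \<in> koszul_index (Suc j) i \<longleftrightarrow> n \<in> pred_index j i" for n by (auto simp: koszul_index.simps pi)
  have n: "\<exists>k. n = 2 * k \<or> n = Suc (2 * k)" for n :: nat by presburger
  show ?thesis
  proof
    assume l: "family (koszul_index (Suc j) i) (join p q)"
    have "p n \<in> carrier R \<and> (n \<notin> koszul_index j i \<longrightarrow> p n = \<zero>)" for n
      using familyD[OF l, of "2 * n"] unfolding e i by simp
    moreover have "q n \<in> carrier R \<and> (n \<notin> pred_index j i \<longrightarrow> q n = \<zero>)" for n
      using familyD[OF l, of "Suc (2 * n)"] unfolding e i by simp
    ultimately show "family (koszul_index j i) p \<and> family (pred_index j i) q" unfolding family_def by simp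
  next
    assume r: "family (koszul_index j i) p \<and> family (pred_index j i) q"
    have "join p q n \<in> carrier R \<and> (n \<notin> koszul_index (Suc j) i \<longrightarrow> join p q n = \<zero>)" for n
    proof -
      obtain k where "n = 2 * k \<or> n = Suc (2 * k)" using n by blast
      then show ?thesis using r by (elim disjE) (simp_all add: e i family_def)
    qed
    then show "family (koszul_index (Suc j) i) (join p q)" unfolding family_def by blast
  qed
qed

lemma family_pred_join:
  assumes "family (pred_index j i) p" "family (pred_index j (i - 1)) q" "i = 0 \<Longrightarrow> q = (\<lambda>n. \<zero>)"
  shows "family (pred_index (Suc j) i) (join p q)"
proof (cases i)
  case 0
  then show ?thesis using assms by (auto simp: family_def join_def)
next
  case (Suc i')
  then show ?thesis using assms(1,2) family_join_iff[of j i' p q] by simp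
qed

lemma family_minus: "family A u \<Longrightarrow> family A v \<Longrightarrow> family A (\<lambda>n. u n \<ominus> v n)"
  by (auto simp: family_def a_minus_def r_neg)

lemma family_smult: "r \<in> carrier R \<Longrightarrow> family A u \<Longrightarrow> family A (\<lambda>n. r \<otimes> u n)"
  by (auto simp: family_def)

lemma family_zero: "family A (\<lambda>n. \<zero>)" by (simp add: family_def)

lemma xj: "j \<le> Suc h \<Longrightarrow> k < j \<Longrightarrow> x k \<in> carrier R" by (rule x_R) simp

lemma koszul_family:
  assumes "j \<le> Suc h" "family (koszul_index j i) u"
  shows "family (koszul_index j (Suc i)) (koszul R x j u)"
proof -
  have "koszul R x j u n \<in> carrier R" for n by (rule koszul_closed[OF xj[OF assms(1)] familyD(1)[OF assms(2)]])
  moreover have "koszul R x j u n = \<zero>" if "n \<notin> koszul_index j (Suc i)" for n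
    by (rule koszul_support[OF xj[OF assms(1)] familyD(2)[OF assms(2)] that])
  ultimately show ?thesis unfolding family_def by blast
qed

lemma koszul_minus_families:
  assumes "j \<le> Suc h" "\<And>n. u n \<in> carrier R" "\<And>n. v n \<in> carrier R"
  shows "koszul R x j (\<lambda>n. u n \<ominus> v n) n = koszul R x j u n \<ominus> koszul R x j v n"
proof -
  have "koszul R x j (\<lambda>n. u n \<oplus> \<ominus> v n) n = koszul R x j u n \<oplus> koszul R x j (\<lambda>n. \<ominus> v n) n"
    by (rule koszul_add[OF xj[OF assms(1)]]) (use assms in auto)
  also have "koszul R x j (\<lambda>n. \<ominus> v n) n = \<ominus> koszul R x j v n"
    by (rule koszul_minus[OF xj[OF assms(1)] assms(3)])
  finally show ?thesis by (simp add: a_minus_def)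
qed

lemma koszul_index_empty: "j < i \<Longrightarrow> koszul_index j i = {}"
proof (induction j arbitrary: i)
  case (Suc j)
  then show ?case using Suc.IH[of i] Suc.IH[of "i - 1"] by (auto simp: koszul_index.simps)
qed (simp add: koszul_index.simps)

text \<open>The cohomology in the top degree \<open>j\<close> is \<open>R/J j\<close>.\<close>

lemma koszul_top:
  assumes "j \<le> Suc h" "family (koszul_index j j) p" "\<And>n. p n \<in> J j"
  shows "\<exists>w. family (pred_index j j) w \<and> koszul R x j w = p"
  using assms
proof (induction j arbitrary: p)
  case 0
  then have "p = (\<lambda>n. \<zero>)" using J_0 by auto
  then show ?case by (intro exI[of _ "\<lambda>n. \<zero>"]) (simp add: koszul.simps family_zero)
next
  case (Suc j)
  note jh = Suc.prems(1)
  let ?p = "\<lambda>k. p (2 * k)" and ?q = "\<lambda>k. p (Suc (2 * k))"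
  interpret Jj: ideal "J j" R by (rule J_ideal) (use jh in simp)
  have fam: "family (koszul_index j (Suc j)) ?p" "family (koszul_index j j) ?q"
    using Suc.prems(2) family_join_iff[of j "Suc j" ?p ?q] by (simp_all add: join_split)
  have p0: "?p = (\<lambda>n. \<zero>)" using fam(1) by (auto simp: family_def koszul_index_empty)
  have "\<forall>n. \<exists>a b. a \<in> carrier R \<and> b \<in> J j \<and> ?q n = x j \<otimes> a \<oplus> b \<and> (n \<notin> koszul_index j j \<longrightarrow> a = \<zero> \<and> b = \<zero>)"
  proof
    fix n
    show "\<exists>a b. a \<in> carrier R \<and> b \<in> J j \<and> ?q n = x j \<otimes> a \<oplus> b \<and> (n \<notin> koszul_index j j \<longrightarrow> a = \<zero> \<and> b = \<zero>)"
    proof (cases "n \<in> koszul_index j j")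
      case True
      have "?q n \<in> J (Suc j)" by (rule Suc.prems(3))
      then show ?thesis using J_step[of j] jh True by auto
    next
      case False
      then show ?thesis using familyD(2)[OF fam(2) False] x_R[of j] jh Jj.zero_closed
        by (intro exI[of _ \<zero>]) simp
    qed
  qed
  then obtain a b where ab: "\<And>n. a n \<in> carrier R" "\<And>n. b n \<in> J j" "\<And>n. ?q n = x j \<otimes> a n \<oplus> b n"
    "\<And>n. n \<notin> koszul_index j j \<Longrightarrow> a n = \<zero> \<and> b n = \<zero>" by metis
  have bR: "b n \<in> carrier R" for n using ab(2) Jj.a_subset by blast
  have m0: "\<ominus> \<zero> = \<zero>" using minus_equality[of \<zero> \<zero>] by simp
  have "family (koszul_index j j) (\<lambda>n. \<ominus> b n)" using bR ab(4) m0 by (simp add: family_def)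
  then obtain w where w: "family (pred_index j j) w" "koszul R x j w = (\<lambda>n. \<ominus> b n)"
    using Suc.IH[of "\<lambda>n. \<ominus> b n"] Jj.a_inv_closed[OF ab(2)] jh by auto
  have fa: "family (koszul_index j j) a" using ab(1,4) by (simp add: family_def)
  have "koszul R x j a = (\<lambda>n. \<zero>)"
    using koszul_family[OF _ fa] jh by (auto simp: family_def koszul_index_empty)
  then have "koszul R x (Suc j) (join a w) = join ?p (\<lambda>n. x j \<otimes> a n \<ominus> \<ominus> b n)"
    unfolding koszul_join w(2) p0 by simp
  also have "(\<lambda>n. x j \<otimes> a n \<ominus> \<ominus> b n) = ?q" using ab(3) bR by (simp add: a_minus_def)
  finally have "koszul R x (Suc j) (join a w) = p" by (simp add: join_split)
  moreover have "family (pred_index (Suc j) (Suc j)) (join a w)"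
    by (rule family_pred_join) (use fa w(1) in auto)
  ultimately show ?case by blast
qed

text \<open>Let \<open>u = (p, q)\<close> be a cocycle on the cone. Then \<open>D p = 0\<close> and \<open>D q = x j p\<close>. In degree \<open>j\<close> the second
  equation and regularity show that the entries of \<open>p\<close> lie in \<open>J j\<close>, so in every degree \<open>p = D p'\<close>. Since
  \<open>x j p' - q\<close> is a cocycle, it equals \<open>D q'\<close>, and \<open>u = D (p', q')\<close>.\<close>

theorem koszul_exact:
  assumes "j \<le> Suc h" "i < j" "family (koszul_index j i) u" "koszul R x j u = (\<lambda>n. \<zero>)"
  shows "\<exists>w. family (pred_index j i) w \<and> koszul R x j w = u"
  using assms
proof (induction j arbitrary: i u)
  case (Suc j)
  note jh = Suc.prems(1)
  have jh': "j \<le> Suc h" using jh by simp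
  let ?p = "\<lambda>k. u (2 * k)" and ?q = "\<lambda>k. u (Suc (2 * k))"
  have xjR: "x j \<in> carrier R" using x_R jh by simp
  have fp: "family (koszul_index j i) ?p" and fq: "family (pred_index j i) ?q"
    using Suc.prems(3) family_join_iff[of j i ?p ?q] by (simp_all add: join_split)
  have "koszul R x (Suc j) (join ?p ?q) = (\<lambda>n. \<zero>)" using Suc.prems(4) by (simp add: join_split)
  then have 0: "join (koszul R x j ?p) (\<lambda>n. x j \<otimes> ?p n \<ominus> koszul R x j ?q n) = (\<lambda>n. \<zero>)" unfolding koszul_join .
  have Dp: "koszul R x j ?p n = \<zero>" for n using fun_cong[OF 0, of "2 * n"] by (simp add: join_def)
  have qR: "koszul R x j ?q n \<in> carrier R" for n by (rule koszul_closed[OF xj[OF jh'] familyD(1)[OF fq]])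
  have Dq: "koszul R x j ?q n = x j \<otimes> ?p n" for n
  proof -
    have "x j \<otimes> ?p n \<ominus> koszul R x j ?q n = \<zero>" using fun_cong[OF 0, of "Suc (2 * n)"] by (simp add: join_def)
    then show ?thesis using qR xjR familyD(1)[OF fp] by (metis m_closed r_right_minus_eq)
  qed
  have "\<exists>p'. family (pred_index j i) p' \<and> koszul R x j p' = ?p"
  proof (cases "i < j")
    case True
    then show ?thesis using Suc.IH[OF jh' True fp] Dp by blast
  next
    case False
    then have i: "i = j" using Suc.prems(2) by simp
    have "?p n \<in> J j" for n
    proof (rule J_reg)
      show "x j \<otimes> ?p n \<in> J j" unfolding Dq[symmetric]
        by (rule koszul_in_ideal[OF J_ideal x_J familyD(1)[OF fq]]) (use jh in auto)
    qed (use jh familyD(1)[OF fp] in auto)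
    from koszul_top[OF jh' fp[unfolded i] this] show ?thesis using i by simp
  qed
  then obtain p' where p': "family (pred_index j i) p'" "koszul R x j p' = ?p" by blast
  let ?r = "\<lambda>n. x j \<otimes> p' n \<ominus> ?q n"
  have fr: "family (pred_index j i) ?r" by (rule family_minus[OF family_smult[OF xjR p'(1)] fq])
  have Dr: "koszul R x j ?r = (\<lambda>n. \<zero>)"
  proof
    fix n
    have "koszul R x j ?r n = koszul R x j (\<lambda>n. x j \<otimes> p' n) n \<ominus> koszul R x j ?q n"
      by (rule koszul_minus_families[OF jh']) (use xjR familyD(1)[OF p'(1)] familyD(1)[OF fq] in auto)
    also have "koszul R x j (\<lambda>n. x j \<otimes> p' n) n = x j \<otimes> ?p n"
      using koszul_smult[where j = j and x = x and u = p' and n = n, OF xj[OF jh'] familyD(1)[OF p'(1)] xjR] p'(2) by simp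
    also have "\<dots> \<ominus> koszul R x j ?q n = \<zero>" unfolding Dq
      using xjR familyD(1)[OF fp] by (simp add: a_minus_def r_neg)
    finally show "koszul R x j ?r n = \<zero>" .
  qed
  have "\<exists>q'. family (pred_index j (i - 1)) q' \<and> koszul R x j q' = ?r \<and> (i = 0 \<longrightarrow> q' = (\<lambda>n. \<zero>))"
  proof (cases i)
    case 0
    then have "?r = (\<lambda>n. \<zero>)" using fr by (simp add: family_def)
    then show ?thesis using koszul_zero[OF xj[OF jh']] by (intro exI[of _ "\<lambda>n. \<zero>"]) (simp add: family_zero)
  next
    case (Suc i')
    then have "i' < j" "family (koszul_index j i') ?r" using Suc.prems(2) fr by auto
    from Suc.IH[OF jh' this Dr] show ?thesis using Suc by simp
  qed
  then obtain q' where q': "family (pred_index j (i - 1)) q'" "koszul R x j q' = ?r" "i = 0 \<Longrightarrow> q' = (\<lambda>n. \<zero>)" by blast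
  have "koszul R x (Suc j) (join p' q') = join ?p (\<lambda>n. x j \<otimes> p' n \<ominus> ?r n)" unfolding koszul_join p'(2) q'(2) ..
  also have "(\<lambda>n. x j \<otimes> p' n \<ominus> ?r n) = ?q"
  proof
    fix n
    have c: "x j \<otimes> p' n \<in> carrier R" "?q n \<in> carrier R" using xjR familyD(1)[OF p'(1)] familyD(1)[OF fq] by auto
    then show "x j \<otimes> p' n \<ominus> ?r n = ?q n" by (simp add: a_minus_def minus_add r_neg2)
  qed
  finally have "koszul R x (Suc j) (join p' q') = u" by (simp add: join_split)
  moreover have "family (pred_index (Suc j) i) (join p' q')" by (rule family_pred_join[OF p'(1) q'(1,3)])
  ultimately show ?case by blast
qed simp

text \<open>Dividing by a nonzero \<open>f\<close> costs one degree: if \<open>D v = f a\<close>, then \<open>D a = 0\<close>, so \<open>a = D w\<close> and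
  \<open>v - f w\<close> is a cocycle.\<close>

lemma koszul_exact_modulo:
  assumes "f \<in> carrier R" "f \<noteq> \<zero>" "i < h" "family (koszul_index (Suc h) i) v"
    "\<And>n. koszul R x (Suc h) v n \<in> PIdl f"
  shows "\<exists>w w'. family (pred_index (Suc h) i) w \<and> (\<forall>n. w' n \<in> carrier R) \<and>
    (\<forall>n. v n = koszul R x (Suc h) w n \<oplus> w' n \<otimes> f)"
proof -
  let ?D = "koszul R x (Suc h)"
  have cancel: "a = \<zero>" if "a \<in> carrier R" "a \<otimes> f = \<zero>" for a using integral[OF that(1) assms(1) that(2)] assms(2) by simp
  have "\<forall>n. \<exists>a\<in>carrier R. ?D v n = a \<otimes> f" using assms(5) by (auto simp: cgenideal_def)
  then obtain a where a: "\<And>n. a n \<in> carrier R" "\<And>n. ?D v n = a n \<otimes> f" by metis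
  have fDv: "family (koszul_index (Suc h) (Suc i)) (?D v)" by (rule koszul_family[OF _ assms(4)]) simp
  have fa: "family (koszul_index (Suc h) (Suc i)) a"
    unfolding family_def using a(1) cancel[OF a(1)] familyD(2)[OF fDv] a(2) by simp
  have "?D a = (\<lambda>n. \<zero>)"
  proof
    fix n
    have Da: "?D a n \<in> carrier R" by (rule koszul_closed[OF xj a(1)]) auto
    have "\<zero> = ?D (?D v) n" by (rule koszul_koszul[OF xj familyD(1)[OF assms(4)], symmetric]) auto
    also have "?D v = (\<lambda>n. f \<otimes> a n)" using a assms(1) by (auto simp: m_comm)
    also have "?D \<dots> n = f \<otimes> ?D a n" by (rule koszul_smult[OF xj a(1) assms(1)]) auto
    finally show "?D a n = \<zero>" using cancel[OF Da] Da assms(1) by (simp add: m_comm)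
  qed
  from koszul_exact[OF _ _ fa this] assms(3) obtain w' where
    w': "family (koszul_index (Suc h) i) w'" "?D w' = a" by auto
  have w'R: "w' n \<in> carrier R" for n by (rule familyD(1)[OF w'(1)])
  have vR: "v n \<in> carrier R" for n by (rule familyD(1)[OF assms(4)])
  let ?r = "\<lambda>n. v n \<ominus> f \<otimes> w' n"
  have "?D ?r = (\<lambda>n. \<zero>)"
  proof
    fix n
    have "?D ?r n = ?D v n \<ominus> ?D (\<lambda>n. f \<otimes> w' n) n"
      by (rule koszul_minus_families) (use vR w'R assms(1) in auto)
    also have "?D (\<lambda>n. f \<otimes> w' n) n = f \<otimes> a n"
      using koszul_smult[where j = "Suc h" and x = x and u = w' and n = n, OF xj[OF order_refl] w'R assms(1)] w'(2) by simp
    also have "?D v n \<ominus> f \<otimes> a n = \<zero>" using a assms(1) by (simp add: m_comm a_minus_def r_neg)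
    finally show "?D ?r n = \<zero>" .
  qed
  from koszul_exact[OF _ _ family_minus[OF assms(4) family_smult[OF assms(1) w'(1)]] this] assms(3)
  obtain w where w: "family (pred_index (Suc h) i) w" "?D w = ?r" by auto
  have "v n = ?D w n \<oplus> w' n \<otimes> f" for n unfolding w(2) using vR w'R assms(1)
    by (simp add: a_minus_def a_assoc l_neg m_comm)
  then show ?thesis using w(1) w'R by blast
qed

end

text \<open>The trivial extension: \<open>E\<close> becomes an ideal of square zero.\<close>

definition idealization :: "'a ring \<Rightarrow> ('a, 'b) module \<Rightarrow> ('a \<times> 'b) ring" where
  "idealization R E =
    \<lparr>carrier = carrier R \<times> carrier E,
     monoid.mult = (\<lambda>p q. (fst p \<otimes>\<^bsub>R\<^esub> fst q, fst p \<odot>\<^bsub>E\<^esub> snd q \<oplus>\<^bsub>E\<^esub> fst q \<odot>\<^bsub>E\<^esub> snd p)),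
     one = (\<one>\<^bsub>R\<^esub>, \<zero>\<^bsub>E\<^esub>), ring.zero = (\<zero>\<^bsub>R\<^esub>, \<zero>\<^bsub>E\<^esub>),
     ring.add = (\<lambda>p q. (fst p \<oplus>\<^bsub>R\<^esub> fst q, snd p \<oplus>\<^bsub>E\<^esub> snd q))\<rparr>"

lemma cring_idealization:
  assumes "module R E"
  shows "cring (idealization R E)"
proof -
  interpret E: module R E by fact
  show ?thesis
  proof (rule cringI[OF abelian_groupI comm_monoidI])
    fix p assume "p \<in> carrier (idealization R E)"
    then show "\<exists>q\<in>carrier (idealization R E). q \<oplus>\<^bsub>idealization R E\<^esub> p = \<zero>\<^bsub>idealization R E\<^esub>"
      by (intro bexI[of _ "(\<ominus>\<^bsub>R\<^esub> fst p, \<ominus>\<^bsub>E\<^esub> snd p)"]) (auto simp: idealization_def E.R.l_neg E.l_neg)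
  qed (auto simp: idealization_def E.R.a_ac E.R.m_ac E.R.l_distr E.R.r_distr E.a_ac E.smult_l_distr E.smult_r_distr
      E.smult_assoc1[symmetric])
qed

definition direct_sum :: "('i \<Rightarrow> ('a, 'b) module) \<Rightarrow> ('a, 'i \<Rightarrow> 'b) module" where
  "direct_sum M =
    \<lparr>carrier = {u. (\<forall>i. u i \<in> carrier (M i)) \<and> finite {i. u i \<noteq> \<zero>\<^bsub>M i\<^esub>}},
     monoid.mult = undefined, one = undefined,
     ring.zero = (\<lambda>i. \<zero>\<^bsub>M i\<^esub>), ring.add = (\<lambda>u v i. u i \<oplus>\<^bsub>M i\<^esub> v i),
     smult = (\<lambda>r u i. r \<odot>\<^bsub>M i\<^esub> u i)\<rparr>"

lemma module_direct_sum:
  assumes "cring R" "\<And>i. module R (M i)"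
  shows "module R (direct_sum M)"
proof -
  interpret M: module R "M i" for i by (rule assms(2))
  have fin: "finite {i. u i \<oplus>\<^bsub>M i\<^esub> v i \<noteq> \<zero>\<^bsub>M i\<^esub>}"
    if "finite {i. u i \<noteq> \<zero>\<^bsub>M i\<^esub>}" "finite {i. v i \<noteq> \<zero>\<^bsub>M i\<^esub>}" for u v
    by (rule finite_subset[OF _ finite_UnI[OF that]]) auto
  have fin2: "finite {i. H i (u i) \<noteq> \<zero>\<^bsub>M i\<^esub>}"
    if "finite {i. u i \<noteq> \<zero>\<^bsub>M i\<^esub>}" "\<And>i. H i \<zero>\<^bsub>M i\<^esub> = \<zero>\<^bsub>M i\<^esub>" for u H
    by (rule finite_subset[OF _ that(1)]) (use that(2) in auto)
  show ?thesis
  proof (rule moduleI[OF assms(1) abelian_groupI])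
    fix u assume "u \<in> carrier (direct_sum M)"
    then show "\<exists>v\<in>carrier (direct_sum M). v \<oplus>\<^bsub>direct_sum M\<^esub> u = \<zero>\<^bsub>direct_sum M\<^esub>"
      using fin2[of u "\<lambda>i y. \<ominus>\<^bsub>M i\<^esub> y"]
      by (intro bexI[of _ "\<lambda>i. \<ominus>\<^bsub>M i\<^esub> u i"]) (auto simp: direct_sum_def M.l_neg)
  next
    fix r u assume "r \<in> carrier R" "u \<in> carrier (direct_sum M)"
    then show "r \<odot>\<^bsub>direct_sum M\<^esub> u \<in> carrier (direct_sum M)"
      using fin2[of u "\<lambda>i y. r \<odot>\<^bsub>M i\<^esub> y"] by (auto simp: direct_sum_def)
  qed (auto simp: direct_sum_def fin M.a_ac M.smult_l_distr M.smult_r_distr M.smult_assoc1 intro!: ext)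
qed

lemma direct_sum_simps [simp]:
  "\<zero>\<^bsub>direct_sum M\<^esub> = (\<lambda>i. \<zero>\<^bsub>M i\<^esub>)"
  "u \<oplus>\<^bsub>direct_sum M\<^esub> v = (\<lambda>i. u i \<oplus>\<^bsub>M i\<^esub> v i)"
  "r \<odot>\<^bsub>direct_sum M\<^esub> u = (\<lambda>i. r \<odot>\<^bsub>M i\<^esub> u i)"
  by (simp_all add: direct_sum_def)

lemma direct_sum_carrier:
  "u \<in> carrier (direct_sum M) \<longleftrightarrow> (\<forall>i. u i \<in> carrier (M i)) \<and> finite {i. u i \<noteq> \<zero>\<^bsub>M i\<^esub>}"
  by (simp add: direct_sum_def)

context regular_local
begin

text \<open>Every \<open>R/f\<close> with \<open>f \<noteq> 0\<close> in the maximal ideal occurs infinitely often among the summands; all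
  other indices contribute \<open>R/1 = 0\<close>.\<close>

definition modulus :: "'k \<times> nat \<Rightarrow> 'k" where
  "modulus i = (if fst i \<in> J (Suc h) \<and> fst i \<noteq> \<zero> then fst i else \<one>)"

definition summand :: "'k \<times> nat \<Rightarrow> ('k, 'k set) module" where
  "summand i = quot_module R (PIdl (modulus i))"

definition proj_summand :: "'k \<times> nat \<Rightarrow> 'k \<Rightarrow> 'k set" where
  "proj_summand i r = PIdl (modulus i) +> r"

abbreviation torsion :: "('k, 'k \<times> nat \<Rightarrow> 'k set) module" where "torsion \<equiv> direct_sum summand"

lemma modulus: "modulus i \<in> carrier R" "modulus i \<noteq> \<zero>"
proof -
  have "\<one> \<noteq> \<zero>" using L(5) J_zero[of "Suc h"] by auto
  then show "modulus i \<in> carrier R" "modulus i \<noteq> \<zero>" using L(6) by (auto simp: modulus_def)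
qed

lemma R: "cring R" by (rule L(1))

lemma modulus_ideal: "ideal (PIdl (modulus i)) R" by (rule cgenideal_ideal[OF modulus(1)])

lemma module_summand: "module R (summand i)"
  and proj_summand_hom: "proj_summand i \<in> mod_hom R (self_module R) (summand i)"
  and proj_summand_onto: "proj_summand i ` carrier R = carrier (summand i)"
  and proj_summand_zero_iff: "r \<in> carrier R \<Longrightarrow> proj_summand i r = \<zero>\<^bsub>summand i\<^esub> \<longleftrightarrow> r \<in> PIdl (modulus i)"
  unfolding summand_def proj_summand_def[abs_def]
  by (rule quot_module_facts[OF R modulus_ideal])+

lemma module_torsion: "module R torsion" by (rule module_direct_sum[OF R module_summand])

end

text \<open>\<open>T\<close> is any isomorphic copy of the idealization, so that its carrier type can be chosen freely.\<close>

locale trivial_extension = regular_local R x h J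
  for R :: "'k ring" (structure) and x h J +
  fixes T :: "'a ring" and \<phi> :: "'k \<times> ('k \<times> nat \<Rightarrow> 'k set) \<Rightarrow> 'a"
  assumes cring_T: "cring T" and iso: "\<phi> \<in> ring_iso (idealization R torsion) T"

sublocale trivial_extension \<subseteq> T: plain_cring T
  using cring_T by (rule plain_cring.intro)

context trivial_extension
begin

abbreviation S where "S \<equiv> idealization R torsion"

sublocale S: cring S by (rule cring_idealization[OF module_torsion])

sublocale M: module R "summand i" for i by (rule module_summand)

definition mk :: "'k \<Rightarrow> ('k \<times> nat \<Rightarrow> 'k set) \<Rightarrow> 'a" where "mk r u = \<phi> (r, u)"

text \<open>The two coordinates of an element of \<open>T\<close>. All further arguments use only these.\<close>

definition base :: "'a \<Rightarrow> 'k" where "base t = fst (inv_into (carrier S) \<phi> t)"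

definition comp :: "'a \<Rightarrow> 'k \<times> nat \<Rightarrow> 'k set" where "comp t = snd (inv_into (carrier S) \<phi> t)"

lemma S_simps: "carrier S = carrier R \<times> carrier torsion"
  "(r, u) \<otimes>\<^bsub>S\<^esub> (s, v) = (r \<otimes> s, \<lambda>i. r \<odot>\<^bsub>summand i\<^esub> v i \<oplus>\<^bsub>summand i\<^esub> s \<odot>\<^bsub>summand i\<^esub> u i)"
  "(r, u) \<oplus>\<^bsub>S\<^esub> (s, v) = (r \<oplus> s, \<lambda>i. u i \<oplus>\<^bsub>summand i\<^esub> v i)"
  "\<one>\<^bsub>S\<^esub> = (\<one>, \<lambda>i. \<zero>\<^bsub>summand i\<^esub>)" "\<zero>\<^bsub>S\<^esub> = (\<zero>, \<lambda>i. \<zero>\<^bsub>summand i\<^esub>)"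
  by (simp_all add: idealization_def)

lemma bij: "bij_betw \<phi> (carrier S) (carrier T)" using iso by (simp add: ring_iso_def)

lemma hom: "\<phi> \<in> ring_hom S T" using iso by (simp add: ring_iso_def)

lemma mk_closed: "r \<in> carrier R \<Longrightarrow> u \<in> carrier torsion \<Longrightarrow> mk r u \<in> carrier T"
  using bij_betw_imp_surj_on[OF bij] unfolding mk_def S_simps(1) by blast

lemma base_mk: "r \<in> carrier R \<Longrightarrow> u \<in> carrier torsion \<Longrightarrow> base (mk r u) = r"
  and comp_mk: "r \<in> carrier R \<Longrightarrow> u \<in> carrier torsion \<Longrightarrow> comp (mk r u) = u"
proof -
  assume "r \<in> carrier R" "u \<in> carrier torsion"
  then have "(r, u) \<in> carrier S" unfolding S_simps(1) by blast
  from inv_into_f_f[OF bij_betw_imp_inj_on[OF bij] this]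
  show "base (mk r u) = r" "comp (mk r u) = u" by (simp_all add: base_def comp_def mk_def)
qed

lemma element_cases:
  assumes "t \<in> carrier T"
  obtains r u where "r \<in> carrier R" "u \<in> carrier torsion" "t = mk r u"
proof -
  have "t \<in> \<phi> ` carrier S" using assms bij_betw_imp_surj_on[OF bij] by simp
  then obtain p where p: "p \<in> carrier S" "t = \<phi> p" by (elim imageE)
  obtain r u where "p = (r, u)" by (cases p)
  then show thesis using that p unfolding S_simps(1) mk_def by blast
qed

lemma base_closed: "t \<in> carrier T \<Longrightarrow> base t \<in> carrier R"
  by (elim element_cases) (simp del: direct_sum_simps add: base_mk)

lemma comp_torsion: "t \<in> carrier T \<Longrightarrow> comp t \<in> carrier torsion"
  by (elim element_cases) (simp del: direct_sum_simps add: comp_mk)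

lemma comp_closed: "t \<in> carrier T \<Longrightarrow> comp t i \<in> carrier (summand i)"
  using comp_torsion[of t] unfolding direct_sum_carrier by blast

lemma mk_base_comp: "t \<in> carrier T \<Longrightarrow> mk (base t) (comp t) = t"
  by (elim element_cases) (simp del: direct_sum_simps add: base_mk comp_mk)

lemma T_eqI:
  assumes "s \<in> carrier T" "t \<in> carrier T" "base s = base t" "\<And>i. comp s i = comp t i"
  shows "s = t"
proof -
  have c: "comp s = comp t" by (rule ext) (rule assms(4))
  have "s = mk (base s) (comp s)" by (rule mk_base_comp[OF assms(1), symmetric])
  also have "\<dots> = t" unfolding assms(3) c by (rule mk_base_comp[OF assms(2)])
  finally show ?thesis .
qed

lemma mk_mult:
  assumes "r \<in> carrier R" "u \<in> carrier torsion" "s \<in> carrier R" "v \<in> carrier torsion"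
  shows "mk r u \<otimes>\<^bsub>T\<^esub> mk s v = mk (r \<otimes> s) (\<lambda>i. r \<odot>\<^bsub>summand i\<^esub> v i \<oplus>\<^bsub>summand i\<^esub> s \<odot>\<^bsub>summand i\<^esub> u i)"
proof -
  have "(r, u) \<in> carrier S" "(s, v) \<in> carrier S" using assms unfolding S_simps(1) by blast+
  from ring_hom_mult[OF hom this] show ?thesis unfolding mk_def S_simps(2) ..
qed

lemma mk_add:
  assumes "r \<in> carrier R" "u \<in> carrier torsion" "s \<in> carrier R" "v \<in> carrier torsion"
  shows "mk r u \<oplus>\<^bsub>T\<^esub> mk s v = mk (r \<oplus> s) (\<lambda>i. u i \<oplus>\<^bsub>summand i\<^esub> v i)"
proof -
  have "(r, u) \<in> carrier S" "(s, v) \<in> carrier S" using assms unfolding S_simps(1) by blast+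
  from ring_hom_add[OF hom this] show ?thesis unfolding mk_def S_simps(3) ..
qed

lemma torsion_closed:
  "u \<in> carrier torsion \<Longrightarrow> v \<in> carrier torsion \<Longrightarrow> (\<lambda>i. u i \<oplus>\<^bsub>summand i\<^esub> v i) \<in> carrier torsion"
  "r \<in> carrier R \<Longrightarrow> v \<in> carrier torsion \<Longrightarrow> (\<lambda>i. r \<odot>\<^bsub>summand i\<^esub> v i) \<in> carrier torsion"
  "(\<lambda>i. \<zero>\<^bsub>summand i\<^esub>) \<in> carrier torsion"
proof -
  interpret E: module R torsion by (rule module_torsion)
  show "u \<in> carrier torsion \<Longrightarrow> v \<in> carrier torsion \<Longrightarrow> (\<lambda>i. u i \<oplus>\<^bsub>summand i\<^esub> v i) \<in> carrier torsion"
    using E.a_closed[of u v] unfolding direct_sum_simps(1-3) .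
  show "r \<in> carrier R \<Longrightarrow> v \<in> carrier torsion \<Longrightarrow> (\<lambda>i. r \<odot>\<^bsub>summand i\<^esub> v i) \<in> carrier torsion"
    using E.smult_closed[of r v] unfolding direct_sum_simps(1-3) .
  show "(\<lambda>i. \<zero>\<^bsub>summand i\<^esub>) \<in> carrier torsion"
    using E.zero_closed unfolding direct_sum_simps(1-3) .
qed

lemma base_mult: "s \<in> carrier T \<Longrightarrow> t \<in> carrier T \<Longrightarrow> base (s \<otimes>\<^bsub>T\<^esub> t) = base s \<otimes> base t"
  and comp_mult: "s \<in> carrier T \<Longrightarrow> t \<in> carrier T \<Longrightarrow>
    comp (s \<otimes>\<^bsub>T\<^esub> t) i = base s \<odot>\<^bsub>summand i\<^esub> comp t i \<oplus>\<^bsub>summand i\<^esub> base t \<odot>\<^bsub>summand i\<^esub> comp s i"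
  and base_add: "s \<in> carrier T \<Longrightarrow> t \<in> carrier T \<Longrightarrow> base (s \<oplus>\<^bsub>T\<^esub> t) = base s \<oplus> base t"
  and comp_add: "s \<in> carrier T \<Longrightarrow> t \<in> carrier T \<Longrightarrow> comp (s \<oplus>\<^bsub>T\<^esub> t) i = comp s i \<oplus>\<^bsub>summand i\<^esub> comp t i"
  by (elim element_cases; simp del: direct_sum_simps add: mk_mult mk_add base_mk comp_mk torsion_closed)+

lemma mk_zero: "mk \<zero> (\<lambda>i. \<zero>\<^bsub>summand i\<^esub>) = \<zero>\<^bsub>T\<^esub>"
  using ring_hom_zero[OF hom S.ring_axioms T.ring_axioms] unfolding mk_def S_simps(5) .

lemma mk_one: "mk \<one> (\<lambda>i. \<zero>\<^bsub>summand i\<^esub>) = \<one>\<^bsub>T\<^esub>"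
  using ring_hom_one[OF hom] unfolding mk_def S_simps(4) .

lemma base_zero: "base \<zero>\<^bsub>T\<^esub> = \<zero>" and comp_zero: "comp \<zero>\<^bsub>T\<^esub> i = \<zero>\<^bsub>summand i\<^esub>"
  and base_one: "base \<one>\<^bsub>T\<^esub> = \<one>" and comp_one: "comp \<one>\<^bsub>T\<^esub> i = \<zero>\<^bsub>summand i\<^esub>"
  unfolding mk_zero[symmetric] mk_one[symmetric]
  by (simp_all del: direct_sum_simps add: base_mk comp_mk torsion_closed)

lemma base_minus: "s \<in> carrier T \<Longrightarrow> t \<in> carrier T \<Longrightarrow> base (s \<ominus>\<^bsub>T\<^esub> t) = base s \<ominus> base t"
  and comp_minus: "s \<in> carrier T \<Longrightarrow> t \<in> carrier T \<Longrightarrow> comp (s \<ominus>\<^bsub>T\<^esub> t) i = comp s i \<ominus>\<^bsub>summand i\<^esub> comp t i"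
proof -
  assume s: "s \<in> carrier T" and t: "t \<in> carrier T"
  have d: "s \<ominus>\<^bsub>T\<^esub> t \<in> carrier T" using s t by simp
  have e: "(s \<ominus>\<^bsub>T\<^esub> t) \<oplus>\<^bsub>T\<^esub> t = s" using s t by (simp add: a_minus_def T.a_assoc T.l_neg)
  have cancel: "a \<oplus> b \<ominus> b = a" if "a \<in> carrier R" "b \<in> carrier R" for a b
    using that by (simp add: a_minus_def a_assoc r_neg)
  have cancel': "a \<oplus>\<^bsub>summand i\<^esub> b \<ominus>\<^bsub>summand i\<^esub> b = a"
    if "a \<in> carrier (summand i)" "b \<in> carrier (summand i)" for a b
    using that by (simp add: a_minus_def M.a_assoc M.r_neg)
  have "base s \<ominus> base t = base (s \<ominus>\<^bsub>T\<^esub> t) \<oplus> base t \<ominus> base t" using base_add[OF d t] e by simp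
  also have "\<dots> = base (s \<ominus>\<^bsub>T\<^esub> t)" 
    by (rule cancel[OF base_closed[OF d] base_closed[OF t]])
  finally show "base (s \<ominus>\<^bsub>T\<^esub> t) = base s \<ominus> base t" ..
  have "comp s i \<ominus>\<^bsub>summand i\<^esub> comp t i = comp (s \<ominus>\<^bsub>T\<^esub> t) i \<oplus>\<^bsub>summand i\<^esub> comp t i \<ominus>\<^bsub>summand i\<^esub> comp t i"
    using comp_add[OF d t] e by simp
  also have "\<dots> = comp (s \<ominus>\<^bsub>T\<^esub> t) i" 
    by (rule cancel'[OF comp_closed[OF d] comp_closed[OF t]])
  finally show "comp (s \<ominus>\<^bsub>T\<^esub> t) i = comp s i \<ominus>\<^bsub>summand i\<^esub> comp t i" ..
qed

subsection \<open>The Koszul complex of the trivial extension\<close>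

definition emb :: "'k \<Rightarrow> 'a" where "emb r = mk r (\<lambda>i. \<zero>\<^bsub>summand i\<^esub>)"

lemma emb: "r \<in> carrier R \<Longrightarrow> emb r \<in> carrier T" "r \<in> carrier R \<Longrightarrow> base (emb r) = r"
    "r \<in> carrier R \<Longrightarrow> comp (emb r) i = \<zero>\<^bsub>summand i\<^esub>"
  unfolding emb_def by (simp_all del: direct_sum_simps add: mk_closed base_mk comp_mk torsion_closed)

lemma emb_mult:
  assumes "r \<in> carrier R" "t \<in> carrier T"
  shows "base (emb r \<otimes>\<^bsub>T\<^esub> t) = r \<otimes> base t" "comp (emb r \<otimes>\<^bsub>T\<^esub> t) i = r \<odot>\<^bsub>summand i\<^esub> comp t i"
  using assms base_closed[OF assms(2)] comp_closed[OF assms(2)]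
  by (simp_all add: base_mult comp_mult emb M.smult_r_null)

abbreviation xT :: "nat \<Rightarrow> 'a" where "xT k \<equiv> emb (x k)"

lemma xT: "j \<le> Suc h \<Longrightarrow> k < j \<Longrightarrow> xT k \<in> carrier T" by (rule emb(1)[OF x_R]) simp

lemma base_koszul:
  assumes "j \<le> Suc h" "\<And>n. u n \<in> carrier T"
  shows "base (koszul T xT j u n) = koszul R x j (\<lambda>n. base (u n)) n"
  using assms
proof (induction j arbitrary: u n)
  case (Suc j)
  have xj: "x j \<in> carrier R" using x_R Suc.prems by simp
  have c: "koszul T xT j v k \<in> carrier T" if "\<And>n. v n \<in> carrier T" for v k
    by (rule T.koszul_closed[OF xT that]) (use Suc.prems in auto)
  have IH: "base (koszul T xT j v k) = koszul R x j (\<lambda>n. base (v n)) k" if "\<And>n. v n \<in> carrier T" for v k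
    using Suc.IH[of v k] that Suc.prems by simp
  show ?case using Suc.prems(2) by (simp add: koszul.simps IH base_minus c emb_mult(1)[OF xj] emb(1)[OF xj])
qed (simp add: koszul.simps base_zero)

text \<open>In the summand \<open>R/f\<close> the Koszul complex of \<open>T\<close> is computed by lifting the entries to \<open>R\<close>.\<close>

lemma comp_koszul:
  assumes "j \<le> Suc h" "\<And>n. u n \<in> carrier T" "\<And>n. v n \<in> carrier R" "\<And>n. comp (u n) i = proj_summand i (v n)"
  shows "comp (koszul T xT j u n) i = proj_summand i (koszul R x j v n)"
  using assms
proof (induction j arbitrary: u v n)
  case 0
  show ?case using mod_hom_zero[OF module_self_module[OF R] module_summand proj_summand_hom]
    by (simp add: koszul.simps comp_zero)
next
  case (Suc j)
  have xj: "x j \<in> carrier R" using x_R Suc.prems by simp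
  have c: "koszul T xT j v k \<in> carrier T" if "\<And>n. v n \<in> carrier T" for v k
    by (rule T.koszul_closed[OF xT that]) (use Suc.prems in auto)
  have cR: "koszul R x j v k \<in> carrier R" if "\<And>n. v n \<in> carrier R" for v k
    by (rule koszul_closed[OF x_R that]) (use Suc.prems in auto)
  have IH: "comp (koszul T xT j u' k) i = proj_summand i (koszul R x j v' k)"
    if "\<And>n. u' n \<in> carrier T" "\<And>n. v' n \<in> carrier R" "\<And>n. comp (u' n) i = proj_summand i (v' n)" for u' v' k
    using Suc.IH[of u' v' k] that Suc.prems by simp
  have smult: "proj_summand i (x j \<otimes> v n) = x j \<odot>\<^bsub>summand i\<^esub> proj_summand i (v n)" for n
    using mod_homD(3)[OF proj_summand_hom xj, of "v n"] Suc.prems(3) by simp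
  have minus: "proj_summand i (a \<ominus> b) = proj_summand i a \<ominus>\<^bsub>summand i\<^esub> proj_summand i b"
    if "a \<in> carrier R" "b \<in> carrier R" for a b
    using mod_hom_minus_apply[OF module_self_module[OF R] module_summand proj_summand_hom, of a b] that
      self_module_minus[OF R, of b a] by simp
  show ?case
  proof (cases "even n")
    case True
    then show ?thesis using IH[of "\<lambda>k. u (2 * k)" "\<lambda>k. v (2 * k)"] Suc.prems by (simp add: koszul.simps)
  next
    case False
    have "comp (koszul T xT j (\<lambda>k. u (Suc (2 * k))) (n div 2)) i = proj_summand i (koszul R x j (\<lambda>k. v (Suc (2 * k))) (n div 2))"
      by (rule IH) (use Suc.prems in auto)
    then show ?thesis using False Suc.prems xj c[of "\<lambda>k. u (Suc (2 * k))"] cR[of "\<lambda>k. v (Suc (2 * k))"]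
      by (simp add: koszul.simps comp_minus emb(1) emb_mult(2) minus smult)
  qed
qed

text \<open>Preimages are chosen separately for the component in \<open>R\<close> and for every summand. The chosen preimage
  is zero wherever the given cocycle has no component, which keeps the support finite.\<close>

lemma koszul_exact_extension:
  assumes "i < h" "u \<in> carrier (fsupp_module T (koszul_index (Suc h) i))" "koszul T xT (Suc h) u = (\<lambda>n. \<zero>\<^bsub>T\<^esub>)"
  shows "\<exists>w\<in>carrier (fsupp_module T (pred_index (Suc h) i)). koszul T xT (Suc h) w = u"
proof -
  have uT: "u n \<in> carrier T" and u0: "n \<notin> koszul_index (Suc h) i \<Longrightarrow> u n = \<zero>\<^bsub>T\<^esub>" for n
    using assms(2) by (auto simp: fsupp_carrier_iff)
  let ?D = "koszul R x (Suc h)"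
  have f0: "family (koszul_index (Suc h) i) (\<lambda>n. base (u n))"
    using base_closed[OF uT] u0 base_zero by (simp add: family_def)
  have "?D (\<lambda>n. base (u n)) = (\<lambda>n. \<zero>)"
    using base_koszul[where u = u, OF order_refl uT] assms(3) base_zero by (simp add: fun_eq_iff)
  from koszul_exact[OF order_refl _ f0 this] assms(1)
  obtain w0 where w0: "family (pred_index (Suc h) i) w0" "?D w0 = (\<lambda>n. base (u n))" by auto
  have "\<exists>w. family (pred_index (Suc h) i) w \<and> (\<forall>n. proj_summand a (?D w n) = comp (u n) a) \<and>
    ((\<forall>n. comp (u n) a = \<zero>\<^bsub>summand a\<^esub>) \<longrightarrow> w = (\<lambda>n. \<zero>))" for a
  proof (cases "\<forall>n. comp (u n) a = \<zero>\<^bsub>summand a\<^esub>")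
    case True
    have "?D (\<lambda>n. \<zero>) = (\<lambda>n. \<zero>)" by (rule koszul_zero) (rule x_R, simp)
    then show ?thesis using True family_zero
        mod_hom_zero[OF module_self_module[OF R] module_summand proj_summand_hom, of a]
      by (intro exI[of _ "\<lambda>n. \<zero>"]) simp
  next
    case False
    have "\<forall>n. \<exists>r\<in>carrier R. proj_summand a r = comp (u n) a"
    proof
      fix n
      have "comp (u n) a \<in> proj_summand a ` carrier R" unfolding proj_summand_onto by (rule comp_closed[OF uT])
      then obtain r where "r \<in> carrier R" "comp (u n) a = proj_summand a r" by (elim imageE)
      then show "\<exists>r\<in>carrier R. proj_summand a r = comp (u n) a" by (intro bexI[of _ r]) simp_all
    qed
    then obtain v' where v': "\<And>n. v' n \<in> carrier R" "\<And>n. proj_summand a (v' n) = comp (u n) a" by metis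
    define v where "v n = (if n \<in> koszul_index (Suc h) i then v' n else \<zero>)" for n
    have v: "family (koszul_index (Suc h) i) v" using v'(1) by (simp add: family_def v_def)
    have pv: "comp (u n) a = proj_summand a (v n)" for n
      using v'(2)[of n] u0[of n] comp_zero mod_hom_zero[OF module_self_module[OF R] module_summand proj_summand_hom, of a]
      by (simp add: v_def)
    have Dv: "?D v n \<in> PIdl (modulus a)" for n
    proof -
      have "proj_summand a (?D v n) = \<zero>\<^bsub>summand a\<^esub>"
        using comp_koszul[where u = u and v = v and n = n and i = a, OF order_refl uT familyD(1)[OF v] pv] assms(3) comp_zero by simp
      moreover have "?D v n \<in> carrier R" by (rule koszul_closed[OF x_R familyD(1)[OF v]]) simp
      ultimately show ?thesis using proj_summand_zero_iff by blast
    qed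
    from koszul_exact_modulo[OF modulus assms(1) v Dv] obtain w w' where
      w: "family (pred_index (Suc h) i) w" "\<And>n. w' n \<in> carrier R" "\<And>n. v n = ?D w n \<oplus> w' n \<otimes> modulus a" by blast
    have "proj_summand a (?D w n) = comp (u n) a" for n
    proof -
      have DR: "?D w n \<in> carrier R" by (rule koszul_closed[OF x_R familyD(1)[OF w(1)]]) simp
      have wm: "w' n \<otimes> modulus a \<in> carrier R" using w(2) modulus(1) by simp
      have "proj_summand a (w' n \<otimes> modulus a) = \<zero>\<^bsub>summand a\<^esub>"
        using proj_summand_zero_iff[OF wm] w(2) by (auto simp: cgenideal_def)
      then have "proj_summand a (v n) = proj_summand a (?D w n) \<oplus>\<^bsub>summand a\<^esub> \<zero>\<^bsub>summand a\<^esub>"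
        using mod_homD(2)[OF proj_summand_hom, of "?D w n" "w' n \<otimes> modulus a"] DR wm w(3)[of n] by simp
      then show ?thesis using pv[of n] mod_homD(1)[OF proj_summand_hom, of "?D w n" a] DR by simp
    qed
    then show ?thesis using w(1) False by blast
  qed
  then obtain W where W: "\<And>a. family (pred_index (Suc h) i) (W a)"
    "\<And>a n. proj_summand a (?D (W a) n) = comp (u n) a"
    "\<And>a. (\<And>n. comp (u n) a = \<zero>\<^bsub>summand a\<^esub>) \<Longrightarrow> W a = (\<lambda>n. \<zero>)" by metis
  have p0: "proj_summand a \<zero> = \<zero>\<^bsub>summand a\<^esub>" for a
    using mod_hom_zero[OF module_self_module[OF R] module_summand proj_summand_hom, of a] by simp
  have torsion: "(\<lambda>a. proj_summand a (W a n)) \<in> carrier torsion" for n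
  proof -
    have "{a. proj_summand a (W a n) \<noteq> \<zero>\<^bsub>summand a\<^esub>} \<subseteq> (\<Union>k\<in>koszul_index (Suc h) i. {a. comp (u k) a \<noteq> \<zero>\<^bsub>summand a\<^esub>})"
    proof
      fix a assume "a \<in> {a. proj_summand a (W a n) \<noteq> \<zero>\<^bsub>summand a\<^esub>}"
      then have "W a \<noteq> (\<lambda>n. \<zero>)" using p0[of a] by (intro notI) simp
      then obtain k where k: "comp (u k) a \<noteq> \<zero>\<^bsub>summand a\<^esub>" using W(3)[of a] by blast
      then have "k \<in> koszul_index (Suc h) i" using u0[of k] comp_zero by fastforce
      then show "a \<in> (\<Union>k\<in>koszul_index (Suc h) i. {a. comp (u k) a \<noteq> \<zero>\<^bsub>summand a\<^esub>})" using k by blast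
    qed
    moreover have "finite (\<Union>k\<in>koszul_index (Suc h) i. {a. comp (u k) a \<noteq> \<zero>\<^bsub>summand a\<^esub>})"
      using comp_torsion[OF uT] unfolding direct_sum_carrier by (intro finite_UN_I finite_koszul_index) blast
    ultimately have "finite {a. proj_summand a (W a n) \<noteq> \<zero>\<^bsub>summand a\<^esub>}" by (rule finite_subset)
    moreover have "proj_summand a (W a n) \<in> carrier (summand a)" for a
      using mod_homD(1)[OF proj_summand_hom, of "W a n" a] familyD(1)[OF W(1)] by simp
    ultimately show ?thesis unfolding direct_sum_carrier by blast
  qed
  define w where "w n = mk (w0 n) (\<lambda>a. proj_summand a (W a n))" for n
  have w: "w n \<in> carrier T" "base (w n) = w0 n" "comp (w n) a = proj_summand a (W a n)" for n a
    using mk_closed[OF familyD(1)[OF w0(1)] torsion] base_mk[OF familyD(1)[OF w0(1)] torsion]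
      comp_mk[OF familyD(1)[OF w0(1)] torsion] by (simp_all add: w_def)
  have "w n = \<zero>\<^bsub>T\<^esub>" if "n \<notin> pred_index (Suc h) i" for n
    unfolding w_def familyD(2)[OF w0(1) that] familyD(2)[OF W(1) that] p0 by (rule mk_zero)
  then have wc: "w \<in> carrier (fsupp_module T (pred_index (Suc h) i))"
    using w(1) by (simp add: fsupp_carrier_finite[OF finite_pred_index])
  have "koszul T xT (Suc h) w n = u n" for n
  proof (rule T_eqI)
    show "koszul T xT (Suc h) w n \<in> carrier T" by (rule T.koszul_closed[OF xT w(1)]) auto
    show "u n \<in> carrier T" by (rule uT)
    show "base (koszul T xT (Suc h) w n) = base (u n)" using base_koszul[where u = w, OF order_refl w(1)] w(2) w0(2) by simp
    show "comp (koszul T xT (Suc h) w n) a = comp (u n) a" for a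
      using comp_koszul[where u = w and v = "W a" and n = n and i = a, OF order_refl w(1) familyD(1)[OF W(1)] w(3)] W(2) by simp
  qed
  then show ?thesis using wc by blast
qed

subsection \<open>The annihilators of the summands\<close>

definition bT :: "nat \<Rightarrow> 'a set" where "bT i = {t \<in> carrier T. base t \<in> J i}"

definition gen :: "'k \<times> nat \<Rightarrow> 'a" where
  "gen i = mk \<zero> (\<lambda>k. if k = i then proj_summand i \<one> else \<zero>\<^bsub>summand k\<^esub>)"

lemma single_torsion:
  "c \<in> carrier (summand i) \<Longrightarrow> (\<lambda>k. if k = i then c else \<zero>\<^bsub>summand k\<^esub>) \<in> carrier torsion"
  unfolding direct_sum_carrier using M.zero_closed by (auto intro: finite_subset[of _ "{i}"])

lemma proj_summand_closed: "r \<in> carrier R \<Longrightarrow> proj_summand i r \<in> carrier (summand i)"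
  using mod_homD(1)[OF proj_summand_hom] by simp

lemma gen: "gen i \<in> carrier T" "base (gen i) = \<zero>"
    "comp (gen i) k = (if k = i then proj_summand i \<one> else \<zero>\<^bsub>summand k\<^esub>)"
  using single_torsion[OF proj_summand_closed[of \<one> i]] unfolding gen_def
  by (simp_all del: direct_sum_simps add: mk_closed base_mk comp_mk)

lemma mult_gen:
  assumes "t \<in> carrier T"
  shows "t \<otimes>\<^bsub>T\<^esub> gen i = mk \<zero> (\<lambda>k. if k = i then proj_summand i (base t) else \<zero>\<^bsub>summand k\<^esub>)"
proof (rule T_eqI)
  have tor: "(\<lambda>k. if k = i then proj_summand i (base t) else \<zero>\<^bsub>summand k\<^esub>) \<in> carrier torsion"
    by (rule single_torsion[OF proj_summand_closed[OF base_closed[OF assms]]])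
  show "t \<otimes>\<^bsub>T\<^esub> gen i \<in> carrier T" using assms gen(1) by simp
  show "mk \<zero> (\<lambda>k. if k = i then proj_summand i (base t) else \<zero>\<^bsub>summand k\<^esub>) \<in> carrier T"
    by (rule mk_closed[OF _ tor]) simp
  show "base (t \<otimes>\<^bsub>T\<^esub> gen i) = base (mk \<zero> (\<lambda>k. if k = i then proj_summand i (base t) else \<zero>\<^bsub>summand k\<^esub>))"
    using base_closed[OF assms] by (simp add: base_mk[OF _ tor] base_mult[OF assms gen(1)] gen(2))
  have "base t \<odot>\<^bsub>summand i\<^esub> proj_summand i \<one> = proj_summand i (base t)"
    using mod_homD(3)[OF proj_summand_hom base_closed[OF assms], of \<one> i] base_closed[OF assms] by simp
  then show "comp (t \<otimes>\<^bsub>T\<^esub> gen i) k =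
      comp (mk \<zero> (\<lambda>k. if k = i then proj_summand i (base t) else \<zero>\<^bsub>summand k\<^esub>)) k" for k
    using base_closed[OF assms] comp_closed[OF assms] proj_summand_closed[of "base t" i]
    by (simp add: comp_mk[OF _ tor] comp_mult[OF assms gen(1)] gen(2,3) M.smult_l_null M.smult_r_null)
qed

lemma mult_gen_zero_iff:
  assumes "t \<in> carrier T"
  shows "t \<otimes>\<^bsub>T\<^esub> gen i = \<zero>\<^bsub>T\<^esub> \<longleftrightarrow> base t \<in> PIdl (modulus i)"
proof -
  have tor: "(\<lambda>k. if k = i then proj_summand i (base t) else \<zero>\<^bsub>summand k\<^esub>) \<in> carrier torsion"
    by (rule single_torsion[OF proj_summand_closed[OF base_closed[OF assms]]])
  have "t \<otimes>\<^bsub>T\<^esub> gen i = \<zero>\<^bsub>T\<^esub> \<longleftrightarrow> proj_summand i (base t) = \<zero>\<^bsub>summand i\<^esub>"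
  proof
    assume "t \<otimes>\<^bsub>T\<^esub> gen i = \<zero>\<^bsub>T\<^esub>"
    then have "comp (mk \<zero> (\<lambda>k. if k = i then proj_summand i (base t) else \<zero>\<^bsub>summand k\<^esub>)) i = comp \<zero>\<^bsub>T\<^esub> i"
      unfolding mult_gen[OF assms] by simp
    then show "proj_summand i (base t) = \<zero>\<^bsub>summand i\<^esub>" by (simp add: comp_mk[OF _ tor] comp_zero)
  next
    assume "proj_summand i (base t) = \<zero>\<^bsub>summand i\<^esub>"
    then have "(\<lambda>k. if k = i then proj_summand i (base t) else \<zero>\<^bsub>summand k\<^esub>) = (\<lambda>k. \<zero>\<^bsub>summand k\<^esub>)"
    proof (intro ext)
      fix k
      show "(if k = i then proj_summand i (base t) else \<zero>\<^bsub>summand k\<^esub>) = \<zero>\<^bsub>summand k\<^esub>"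
        using \<open>proj_summand i (base t) = \<zero>\<^bsub>summand i\<^esub>\<close> by (cases "k = i") simp_all
    qed
    then show "t \<otimes>\<^bsub>T\<^esub> gen i = \<zero>\<^bsub>T\<^esub>" unfolding mult_gen[OF assms] using mk_zero by simp
  qed
  then show ?thesis using proj_summand_zero_iff[OF base_closed[OF assms]] by simp
qed

text \<open>A copy of \<open>R/f\<close> in which no element of \<open>F\<close> has a component.\<close>

lemma fresh_summand:
  assumes "f \<in> J (Suc h)" "f \<noteq> \<zero>" "finite F" "F \<subseteq> carrier T"
  shows "\<exists>i \<kappa>. modulus i = f \<and> retraction T F (gen i) \<kappa> \<and> gen i \<noteq> \<zero>\<^bsub>T\<^esub>"
proof -
  have "finite (\<Union>t\<in>F. {i. comp t i \<noteq> \<zero>\<^bsub>summand i\<^esub>})" 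
    using assms(3,4) comp_torsion unfolding direct_sum_carrier by (intro finite_UN_I) blast+
  moreover have "infinite (range (\<lambda>n :: nat. (f, n)))" by (rule range_inj_infinite) (simp add: inj_on_def)
  ultimately have "\<exists>i\<in>range (\<lambda>n :: nat. (f, n)). i \<notin> (\<Union>t\<in>F. {i. comp t i \<noteq> \<zero>\<^bsub>summand i\<^esub>})"
    by (meson finite_subset subsetI)
  then obtain n where "\<And>t. t \<in> F \<Longrightarrow> comp t (f, n) = \<zero>\<^bsub>summand (f, n)\<^esub>" by blast
  then obtain i where i: "modulus i = f" and F: "\<And>t. t \<in> F \<Longrightarrow> comp t i = \<zero>\<^bsub>summand i\<^esub>"
    using assms(1,2) by (metis fst_conv modulus_def)
  define \<kappa> where "\<kappa> t = mk \<zero> (\<lambda>k. if k = i then comp t i else \<zero>\<^bsub>summand k\<^esub>)" for t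
  have tor: "(\<lambda>k. if k = i then comp t i else \<zero>\<^bsub>summand k\<^esub>) \<in> carrier torsion" if "t \<in> carrier T" for t
    by (rule single_torsion[OF comp_closed[OF that]])
  have \<kappa>: "\<kappa> t \<in> carrier T" "base (\<kappa> t) = \<zero>" "comp (\<kappa> t) k = (if k = i then comp t i else \<zero>\<^bsub>summand k\<^esub>)"
    if "t \<in> carrier T" for t k
    using mk_closed[OF zero_closed tor[OF that]] base_mk[OF zero_closed tor[OF that]]
      comp_mk[OF zero_closed tor[OF that]] unfolding \<kappa>_def by simp_all
  have "retraction T F (gen i) \<kappa>" unfolding retraction_def
  proof (intro conjI ballI)
    show "gen i \<in> carrier T" by (rule gen(1))
    fix a assume a: "a \<in> carrier T"
    have "comp a i \<in> proj_summand i ` carrier R" unfolding proj_summand_onto by (rule comp_closed[OF a])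
    then obtain r where r: "r \<in> carrier R" "comp a i = proj_summand i r" by (elim imageE)
    show "\<exists>y\<in>carrier T. \<kappa> a = y \<otimes>\<^bsub>T\<^esub> gen i"
      using mult_gen[OF emb(1)[OF r(1)], of i] emb(1,2)[OF r(1)] r(2)
      by (intro bexI[of _ "emb r"]) (simp_all add: \<kappa>_def cong: if_cong)
    fix b assume b: "b \<in> carrier T"
    show "\<kappa> (a \<oplus>\<^bsub>T\<^esub> b) = \<kappa> a \<oplus>\<^bsub>T\<^esub> \<kappa> b"
      by (rule T_eqI) (use a b comp_closed in \<open>simp_all add: \<kappa> base_add comp_add\<close>)
  next
    fix y assume y: "y \<in> carrier T"
    have c: "comp (y \<otimes>\<^bsub>T\<^esub> gen i) k = (if k = i then proj_summand i (base y) else \<zero>\<^bsub>summand k\<^esub>)" for k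
      unfolding mult_gen[OF y] comp_mk[OF zero_closed single_torsion[OF proj_summand_closed[OF base_closed[OF y]]]] ..
    have b: "base (y \<otimes>\<^bsub>T\<^esub> gen i) = \<zero>" using base_closed[OF y] by (simp add: base_mult[OF y gen(1)] gen(2))
    have yg: "y \<otimes>\<^bsub>T\<^esub> gen i \<in> carrier T" using y gen(1) by simp
    show "\<kappa> (y \<otimes>\<^bsub>T\<^esub> gen i) = y \<otimes>\<^bsub>T\<^esub> gen i"
      by (rule T_eqI) (use yg in \<open>simp_all add: \<kappa> b c\<close>)
  next
    fix a w assume a: "a \<in> F" and w: "w \<in> carrier T"
    have aT: "a \<in> carrier T" using a assms(4) by blast
    have ca: "comp a i = \<zero>\<^bsub>summand i\<^esub>" by (rule F[OF a])
    show "\<kappa> (a \<otimes>\<^bsub>T\<^esub> w) = a \<otimes>\<^bsub>T\<^esub> \<kappa> w"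
      by (rule T_eqI) (use aT w ca \<kappa>(1)[OF w] base_closed[OF aT] base_closed[OF w] comp_closed[OF aT] comp_closed[OF w] in
        \<open>simp_all add: \<kappa> base_mult comp_mult M.smult_l_null M.smult_r_null\<close>)
  qed
  moreover have "gen i \<noteq> \<zero>\<^bsub>T\<^esub>"
  proof
    assume "gen i = \<zero>\<^bsub>T\<^esub>"
    then have "comp (gen i) i = \<zero>\<^bsub>summand i\<^esub>" using comp_zero by simp
    then have "\<one> \<in> PIdl f" using proj_summand_zero_iff[of \<one> i] i by (simp add: gen(3))
    then obtain r where r: "r \<in> carrier R" "\<one> = r \<otimes> f" by (auto simp: cgenideal_def)
    have "r \<otimes> f \<in> J (Suc h)" using ideal.I_l_closed[OF J_ideal[OF order_refl] assms(1) r(1)] .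
    then show False using L(5) r(2) by simp
  qed
  ultimately show ?thesis using i by blast
qed

lemma bT_ideal:
  assumes "i \<le> Suc h"
  shows "ideal (bT i) T"
proof -
  interpret Ji: ideal "J i" R by (rule J_ideal[OF assms])
  note mT = module_self_module[OF cring_T]
  have "submodule (bT i) T (self_module T)"
  proof (rule module.submoduleI[OF mT])
    fix a assume "a \<in> bT i"
    then have a: "a \<in> carrier T" "base a \<in> J i" by (auto simp: bT_def)
    have "\<zero>\<^bsub>T\<^esub> \<ominus>\<^bsub>T\<^esub> a = \<ominus>\<^bsub>T\<^esub> a" using a(1) by (simp add: a_minus_def)
    then have "base (\<ominus>\<^bsub>T\<^esub> a) = \<zero> \<ominus> base a" using base_minus[of "\<zero>\<^bsub>T\<^esub>" a] a(1) base_zero by simp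
    then have "base (\<ominus>\<^bsub>T\<^esub> a) \<in> J i" using a(2) by (simp add: a_minus_def)
    then show "\<ominus>\<^bsub>self_module T\<^esub> a \<in> bT i" using a(1) self_module_neg[OF cring_T] by (simp add: bT_def)
  qed (use Ji.I_l_closed in \<open>auto simp: bT_def base_zero base_add base_mult base_closed\<close>)
  then show ?thesis using ideal_iff_submodule[OF cring_T] by blast
qed

lemma local_with_T: "local_with T (bT (Suc h))"
  unfolding local_with_def
proof (intro conjI cring_T bT_ideal order_refl equalityI subsetI)
  interpret m: ideal "J (Suc h)" R by (rule J_ideal[OF order_refl])
  fix t assume t: "t \<in> Units T"
  then obtain s where s: "s \<in> carrier T" "s \<otimes>\<^bsub>T\<^esub> t = \<one>\<^bsub>T\<^esub>" and tT: "t \<in> carrier T"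
    unfolding Units_def by blast
  have "base s \<otimes> base t = \<one>" using base_mult[OF s(1) tT] s(2) base_one by simp
  then have "base t \<notin> J (Suc h)" using m.I_l_closed[OF _ base_closed[OF s(1)], of "base t"] L(5) by auto
  then show "t \<in> carrier T - bT (Suc h)" using tT by (simp add: bT_def)
next
  fix t assume "t \<in> carrier T - bT (Suc h)"
  then have t: "t \<in> carrier T" "base t \<notin> J (Suc h)" by (auto simp: bT_def)
  have u: "base t \<in> Units R" using L(3)[OF base_closed[OF t(1)] t(2)] .
  \<comment> \<open>Up to the inverse of \<open>base t\<close>, the element is \<open>y = 1 + e\<close> with \<open>e\<^sup>2 = 0\<close>, which has the inverse \<open>2 - y\<close>.\<close>
  define y where "y = emb (inv base t) \<otimes>\<^bsub>T\<^esub> t"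
  have y: "y \<in> carrier T" using emb(1)[OF Units_inv_closed[OF u]] t(1) by (simp add: y_def)
  have by1: "base y = \<one>" using emb_mult(1)[OF Units_inv_closed[OF u] t(1)] Units_l_inv[OF u] by (simp add: y_def)
  define z where "z = \<one>\<^bsub>T\<^esub> \<oplus>\<^bsub>T\<^esub> (\<one>\<^bsub>T\<^esub> \<ominus>\<^bsub>T\<^esub> y)"
  have zT: "z \<in> carrier T" using y by (simp add: z_def)
  have "base z = \<one> \<oplus> (\<one> \<ominus> \<one>)" using y by (simp add: z_def base_add base_minus base_one by1)
  then have bz: "base z = \<one>" by (simp add: a_minus_def r_neg)
  have "comp z i = \<zero>\<^bsub>summand i\<^esub> \<oplus>\<^bsub>summand i\<^esub> (\<zero>\<^bsub>summand i\<^esub> \<ominus>\<^bsub>summand i\<^esub> comp y i)" for i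
    using y by (simp add: z_def comp_add comp_minus comp_one)
  then have cz: "comp z i = \<ominus>\<^bsub>summand i\<^esub> comp y i" for i
    using comp_closed[OF y, of i] by (simp add: a_minus_def)
  have "z \<otimes>\<^bsub>T\<^esub> y = \<one>\<^bsub>T\<^esub>"
    by (rule T_eqI) (use y zT comp_closed[OF y] in \<open>simp_all add: base_mult comp_mult bz by1 cz base_one comp_one M.r_neg\<close>)
  then have "(z \<otimes>\<^bsub>T\<^esub> emb (inv base t)) \<otimes>\<^bsub>T\<^esub> t = \<one>\<^bsub>T\<^esub>"
    using zT emb(1)[OF Units_inv_closed[OF u]] t(1) by (simp add: y_def T.m_assoc)
  moreover have c: "z \<otimes>\<^bsub>T\<^esub> emb (inv base t) \<in> carrier T" using zT emb(1)[OF Units_inv_closed[OF u]] by simp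
  ultimately have "t \<otimes>\<^bsub>T\<^esub> (z \<otimes>\<^bsub>T\<^esub> emb (inv base t)) = \<one>\<^bsub>T\<^esub>" using T.m_comm[OF c t(1)] by simp
  then show "t \<in> Units T" unfolding Units_def using t(1) c \<open>_ \<otimes>\<^bsub>T\<^esub> t = \<one>\<^bsub>T\<^esub>\<close> by blast
qed

text \<open>The generator \<open>\<epsilon>\<close> of the summand \<open>R/f\<close> is killed exactly by the elements with \<open>base t \<in> R f\<close>. Hence
  \<open>f = x 0\<close> provides \<open>b_base\<close>, and \<open>f = base t\<close> provides \<open>annihilated\<close>; if \<open>base t = 0\<close>, any summand will do.\<close>

theorem grade_ring_T: "grade_ring T (bT (Suc h)) xT h bT"
proof (rule grade_ring.intro)
  have J1: "PIdl (x 0) = J 1"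
  proof -
    have x0: "x 0 \<in> carrier R" by (rule x_R) simp
    have "J 1 = {x 0 \<otimes> y \<oplus> z | y z. y \<in> carrier R \<and> z \<in> {\<zero>}}" using J_step[of 0] J_0 by simp
    also have "\<dots> = PIdl (x 0)" unfolding cgenideal_def
    proof (intro equalityI subsetI)
      fix r assume "r \<in> {x 0 \<otimes> y \<oplus> z | y z. y \<in> carrier R \<and> z \<in> {\<zero>}}"
      then obtain y where "y \<in> carrier R" "r = x 0 \<otimes> y \<oplus> \<zero>" by auto
      then show "r \<in> {y \<otimes> x 0 | y. y \<in> carrier R}" using x0 by (auto simp: m_comm)
    next
      fix r assume "r \<in> {y \<otimes> x 0 | y. y \<in> carrier R}"
      then obtain y where "y \<in> carrier R" "r = y \<otimes> x 0" by auto
      then show "r \<in> {x 0 \<otimes> y \<oplus> z | y z. y \<in> carrier R \<and> z \<in> {\<zero>}}" using x0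
        by (intro CollectI exI[of _ y] exI[of _ \<zero>]) (simp add: m_comm)
    qed
    finally show ?thesis ..
  qed
  have x0J: "x 0 \<in> J (Suc h)" by (rule x_J) auto
  show "local_with T (bT (Suc h))" by (rule local_with_T)
  show "1 \<le> h" by (rule h)
  show "xT i \<in> bT (Suc h)" if "i \<le> h" for i
    using emb(1,2)[OF x_R[OF that]] x_J[of i "Suc h"] that by (simp add: bT_def)
  show "\<exists>\<epsilon> \<kappa>. retraction T F \<epsilon> \<kappa> \<and> \<epsilon> \<noteq> \<zero>\<^bsub>T\<^esub> \<and> t \<otimes>\<^bsub>T\<^esub> \<epsilon> = \<zero>\<^bsub>T\<^esub>"
    if t: "t \<in> bT (Suc h)" and F: "finite F" "F \<subseteq> carrier T" for t F
  proof -
    have tT: "t \<in> carrier T" and bt: "base t \<in> J (Suc h)" using t by (auto simp: bT_def)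
    define f where "f = (if base t = \<zero> then x 0 else base t)"
    have f: "f \<in> J (Suc h)" "f \<noteq> \<zero>" using bt x0J x_0_nonzero by (auto simp: f_def)
    then have fR: "f \<in> carrier R" using L(6) by blast
    from fresh_summand[OF f F] obtain i \<kappa> where i: "modulus i = f" "retraction T F (gen i) \<kappa>" "gen i \<noteq> \<zero>\<^bsub>T\<^esub>" by blast
    have "base t \<in> PIdl f"
      using cgenideal_self[OF fR] additive_subgroup.zero_closed[OF ideal.axioms(1)[OF cgenideal_ideal[OF fR]]]
      by (cases "base t = \<zero>") (simp_all add: f_def)
    then have "t \<otimes>\<^bsub>T\<^esub> gen i = \<zero>\<^bsub>T\<^esub>" using mult_gen_zero_iff[OF tT] i(1) by simp
    then show ?thesis using i by blast
  qed
  show "\<exists>\<epsilon> \<kappa>. retraction T F \<epsilon> \<kappa> \<and> (\<forall>t\<in>carrier T. t \<otimes>\<^bsub>T\<^esub> \<epsilon> = \<zero>\<^bsub>T\<^esub> \<longleftrightarrow> t \<in> bT 1)"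
    if F: "finite F" "F \<subseteq> carrier T" for F
  proof -
    from fresh_summand[OF x0J x_0_nonzero F] obtain i \<kappa> where
      i: "modulus i = x 0" "retraction T F (gen i) \<kappa>" by blast
    have "t \<otimes>\<^bsub>T\<^esub> gen i = \<zero>\<^bsub>T\<^esub> \<longleftrightarrow> t \<in> bT 1" if "t \<in> carrier T" for t
      using mult_gen_zero_iff[OF that, of i] i(1) J1 that by (simp add: bT_def)
    then show ?thesis using i(2) by blast
  qed
  show "ideal (bT i) T" if "1 \<le> i" "i \<le> Suc h" for i by (rule bT_ideal[OF that(2)])
  show "bT (Suc i) = {xT i \<otimes>\<^bsub>T\<^esub> y \<oplus>\<^bsub>T\<^esub> z | y z. y \<in> carrier T \<and> z \<in> bT i}" if i1: "1 \<le> i" and ih: "i \<le> h" for i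
  proof (intro equalityI subsetI)
    note xi = x_R[OF ih]
    fix t assume "t \<in> bT (Suc i)"
    then have t: "t \<in> carrier T" "base t \<in> J (Suc i)" by (auto simp: bT_def)
    then obtain a c where ac: "a \<in> carrier R" "c \<in> J i" "base t = x i \<otimes> a \<oplus> c" unfolding J_step[OF ih] by blast
    have cR: "c \<in> carrier R" using ac(2) additive_subgroup.a_subset[OF ideal.axioms(1)[OF J_ideal[of i]]] ih by auto
    note mc = mk_closed[OF cR comp_torsion[OF t(1)]] base_mk[OF cR comp_torsion[OF t(1)]] comp_mk[OF cR comp_torsion[OF t(1)]]
    have "t = xT i \<otimes>\<^bsub>T\<^esub> emb a \<oplus>\<^bsub>T\<^esub> mk c (comp t)"
      by (rule T_eqI) (use t(1) emb[OF xi] emb[OF ac(1)] emb_mult[OF xi emb(1)[OF ac(1)]] mc ac(3) xi comp_closed[OF t(1)] in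
        \<open>simp_all add: base_add comp_add M.smult_r_null\<close>)
    then show "t \<in> {xT i \<otimes>\<^bsub>T\<^esub> y \<oplus>\<^bsub>T\<^esub> z | y z. y \<in> carrier T \<and> z \<in> bT i}"
      using emb(1)[OF ac(1)] mc ac(2) by (intro CollectI exI[of _ "emb a"] exI[of _ "mk c (comp t)"]) (simp add: bT_def)
  next
    note xi = x_R[OF ih]
    fix t assume "t \<in> {xT i \<otimes>\<^bsub>T\<^esub> y \<oplus>\<^bsub>T\<^esub> z | y z. y \<in> carrier T \<and> z \<in> bT i}"
    then obtain y z where yz: "t = xT i \<otimes>\<^bsub>T\<^esub> y \<oplus>\<^bsub>T\<^esub> z" "y \<in> carrier T" "z \<in> carrier T" "base z \<in> J i"
      by (auto simp: bT_def)
    have "base t = x i \<otimes> base y \<oplus> base z" using yz(2,3) emb(1)[OF xi] by (simp add: yz(1) base_add emb_mult(1)[OF xi])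
    then have "base t \<in> J (Suc i)" unfolding J_step[OF ih] using base_closed[OF yz(2)] yz(4) by blast
    moreover have "t \<in> carrier T" unfolding yz(1) using yz(2,3) emb(1)[OF xi] by simp
    ultimately show "t \<in> bT (Suc i)" by (simp add: bT_def)
  qed
  show "y \<in> bT i" if "1 \<le> i" "i \<le> h" "y \<in> carrier T" "xT i \<otimes>\<^bsub>T\<^esub> y \<in> bT i" for i y
    using that(3,4) J_reg[OF that(2) base_closed[OF that(3)]] emb_mult(1)[OF x_R[OF that(2)] that(3)] by (simp add: bT_def)
  show "bT (Suc h) = bT (Suc h)" ..
  show "u = (\<lambda>n. \<zero>\<^bsub>T\<^esub>)" if "u \<in> carrier (fsupp_module T (koszul_index (Suc h) 0))"
    "koszul T xT (Suc h) u = (\<lambda>n. \<zero>\<^bsub>T\<^esub>)" for u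
  proof -
    from koszul_exact_extension[OF _ that] h obtain w where
      w: "w \<in> carrier (fsupp_module T {})" "koszul T xT (Suc h) w = u" by auto
    have "w = (\<lambda>n. \<zero>\<^bsub>T\<^esub>)" using w(1) by (auto simp: fsupp_carrier_iff)
    then show ?thesis using w(2) T.koszul_zero[where x = xT and j = "Suc h", OF xT[OF order_refl]] by simp
  qed
  show "\<exists>w\<in>carrier (fsupp_module T (koszul_index (Suc h) i)). koszul T xT (Suc h) w = u"
    if "Suc i < h" "u \<in> carrier (fsupp_module T (koszul_index (Suc h) (Suc i)))"
      "koszul T xT (Suc h) u = (\<lambda>n. \<zero>\<^bsub>T\<^esub>)" for i u
    using koszul_exact_extension[OF that] by simp
qed

end

section \<open>A countable regular local ring of any dimension\<close>

type_synonym mpoly = "(nat \<Rightarrow>\<^sub>0 nat) \<Rightarrow>\<^sub>0 int"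

definition avoids :: "nat \<Rightarrow> (nat \<Rightarrow>\<^sub>0 nat) \<Rightarrow> bool" where
  "avoids n k \<longleftrightarrow> (\<forall>i<n. Poly_Mapping.lookup k i = 0)"

lemma avoids_add: "avoids n (k + l) \<longleftrightarrow> avoids n k \<and> avoids n l"
  by (auto simp: avoids_def lookup_add)

text \<open>Setting the variables below \<open>n\<close> to zero. Its kernel is the ideal generated by these variables, which
  is prime since this is a ring homomorphism to an integral domain.\<close>

lift_definition kill_vars :: "nat \<Rightarrow> mpoly \<Rightarrow> mpoly" is "\<lambda>n p k. if avoids n k then p k else 0"
  by (rule finite_subset) auto

lemma lookup_kill_vars: "Poly_Mapping.lookup (kill_vars n p) k = (if avoids n k then Poly_Mapping.lookup p k else 0)"
  by transfer simp

lemma kill_vars_add: "kill_vars n (p + q) = kill_vars n p + kill_vars n q"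
  by (rule poly_mapping_eqI) (simp add: lookup_kill_vars lookup_add)

lemma kill_vars_zero [simp]: "kill_vars n 0 = 0"
  by (rule poly_mapping_eqI) (simp add: lookup_kill_vars)

lemma kill_vars_uminus: "kill_vars n (- p) = - kill_vars n p"
  using kill_vars_add[of n p "- p"] by (simp add: eq_neg_iff_add_eq_0 add.commute)

lemma kill_vars_single: "kill_vars n (Poly_Mapping.single k v) = (if avoids n k then Poly_Mapping.single k v else 0)"
  by (rule poly_mapping_eqI) (auto simp: lookup_kill_vars lookup_single when_def)

lemma kill_vars_one [simp]: "kill_vars n 1 = 1"
proof -
  have "avoids n 0" by (simp add: avoids_def)
  then show ?thesis unfolding single_one[symmetric] kill_vars_single by simp
qed

lemma mpoly_induct:
  fixes p :: mpoly
  assumes single: "\<And>k v. Q (Poly_Mapping.single k v)" and add: "\<And>p q. Q p \<Longrightarrow> Q q \<Longrightarrow> Q (p + q)"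
  shows "Q p"
proof (induction p rule: update_induct)
  case const
  show ?case using single[of undefined 0] by simp
next
  case (update p k v)
  have "Poly_Mapping.update k v p = p + Poly_Mapping.single k v"
    using update(1) by (intro poly_mapping_eqI) (auto simp: lookup_update lookup_add lookup_single when_def in_keys_iff)
  then show ?case using add[OF update(3) single] by simp
qed

lemma kill_vars_mult: "kill_vars n (p * q) = kill_vars n p * kill_vars n q"
proof (induction p rule: mpoly_induct)
  case (1 k v)
  show ?case
  proof (induction q rule: mpoly_induct)
    case (1 l w)
    show ?case by (simp add: mult_single kill_vars_single avoids_add)
  next
    case (2 p q)
    then show ?case by (simp add: distrib_left kill_vars_add)
  qed
next
  case (2 p q)
  then show ?case by (simp add: distrib_right kill_vars_add)
qed

lemma kill_vars_kill_vars:
  assumes "n \<le> m"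
  shows "kill_vars m (kill_vars n p) = kill_vars m p"
proof (rule poly_mapping_eqI)
  fix k
  have "avoids m k \<Longrightarrow> avoids n k" using assms by (auto simp: avoids_def)
  then show "Poly_Mapping.lookup (kill_vars m (kill_vars n p)) k = Poly_Mapping.lookup (kill_vars m p) k"
    by (simp add: lookup_kill_vars)
qed

lemma kill_vars_mono: "kill_vars n p = 0 \<Longrightarrow> n \<le> m \<Longrightarrow> kill_vars m p = 0"
  using kill_vars_kill_vars[of n m p] by simp

lemma kill_no_vars: "kill_vars 0 p = p"
  by (rule poly_mapping_eqI) (simp add: lookup_kill_vars avoids_def)

definition var :: "nat \<Rightarrow> mpoly" where "var n = Poly_Mapping.single (Poly_Mapping.single n 1) 1"

lemma kill_vars_var: "kill_vars m (var n) = (if n < m then 0 else var n)"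
  by (auto simp: var_def kill_vars_single avoids_def lookup_single when_def)

lemma var_nonzero: "var n \<noteq> 0"
proof
  assume "var n = 0"
  then have "Poly_Mapping.lookup (var n) (Poly_Mapping.single n 1) = 0" by simp
  then show False by (simp add: var_def)
qed

text \<open>Every monomial of \<open>p\<close> contains a variable below \<open>n\<close>, or else the variable \<open>n\<close>, or survives.\<close>

lemma kill_vars_division: "\<exists>y z. kill_vars n z = 0 \<and> p = var n * y + z + kill_vars (Suc n) p"
proof (induction p rule: mpoly_induct)
  case (1 k v)
  show ?case
  proof (cases "avoids n k")
    case False
    then have "\<not> avoids (Suc n) k" by (auto simp: avoids_def intro: less_SucI)
    then show ?thesis using False
      by (intro exI[of _ 0] exI[of _ "Poly_Mapping.single k v"]) (simp add: kill_vars_single)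
  next
    case True
    show ?thesis
    proof (cases "Poly_Mapping.lookup k n = 0")
      case True
      then have "avoids (Suc n) k" using \<open>avoids n k\<close> by (auto simp: avoids_def less_Suc_eq)
      then show ?thesis by (intro exI[of _ 0]) (simp add: kill_vars_single)
    next
      case False
      then have "\<not> avoids (Suc n) k" by (auto simp: avoids_def)
      moreover have "Poly_Mapping.single n 1 + (k - Poly_Mapping.single n 1) = k"
        using False by (intro poly_mapping_eqI) (auto simp: lookup_add lookup_minus lookup_single when_def)
      ultimately show ?thesis
        by (intro exI[of _ "Poly_Mapping.single (k - Poly_Mapping.single n 1) v"] exI[of _ 0])
          (simp add: kill_vars_single var_def mult_single)
    qed
  qed
next
  case (2 p q)
  then obtain y z y' z' where *: "kill_vars n z = 0" "p = var n * y + z + kill_vars (Suc n) p"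
    "kill_vars n z' = 0" "q = var n * y' + z' + kill_vars (Suc n) q" by blast
  have "p + q = (var n * y + z + kill_vars (Suc n) p) + (var n * y' + z' + kill_vars (Suc n) q)"
    using *(2,4) by (rule arg_cong2)
  also have "\<dots> = var n * (y + y') + (z + z') + kill_vars (Suc n) (p + q)" by (simp add: kill_vars_add algebra_simps)
  finally have "p + q = var n * (y + y') + (z + z') + kill_vars (Suc n) (p + q)" .
  moreover have "kill_vars n (z + z') = 0" using *(1,3) by (simp add: kill_vars_add)
  ultimately show ?case by blast
qed

lemma countable_poly_mapping:
  assumes "countable (UNIV :: 'a set)" "countable (UNIV :: 'b set)"
  shows "countable (UNIV :: ('a \<Rightarrow>\<^sub>0 'b :: zero) set)"
proof -
  let ?G = "\<lambda>p :: 'a \<Rightarrow>\<^sub>0 'b. (\<lambda>k. (k, Poly_Mapping.lookup p k)) ` Poly_Mapping.keys p"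
  have "inj ?G"
  proof (rule injI)
    fix p q assume eq: "?G p = ?G q"
    have G: "(k, v) \<in> ?G p \<longleftrightarrow> v \<noteq> 0 \<and> v = Poly_Mapping.lookup p k" for p k v
      by (auto simp: in_keys_iff)
    have "Poly_Mapping.lookup p k = Poly_Mapping.lookup q k" for k
      using G[of k _ p] G[of k _ q] unfolding eq by metis
    then show "p = q" by (rule poly_mapping_eqI)
  qed
  moreover have "countable {A. finite A \<and> A \<subseteq> (UNIV :: ('a \<times> 'b) set)}"
    using countable_SIGMA[OF assms(1), of "\<lambda>_. UNIV"] assms(2) by (intro countable_Collect_finite_subset) simp
  then have "countable (range ?G)" by (rule countable_subset[rotated]) auto
  ultimately show ?thesis by (metis countable_image_inj_on)
qed

lemma countable_fract:
  assumes "countable (UNIV :: 'a :: idom set)"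
  shows "countable (UNIV :: 'a fract set)"
proof -
  have "UNIV = (\<lambda>(a, b). Fract a b) ` (UNIV :: ('a \<times> 'a) set)"
  proof (intro equalityI subsetI)
    fix q :: "'a fract"
    obtain a b where "q = Fract a b" by (cases q) auto
    then show "q \<in> (\<lambda>(a, b). Fract a b) ` UNIV" by (intro image_eqI[of _ _ "(a, b)"]) auto
  qed simp
  moreover have "countable (UNIV :: ('a \<times> 'a) set)"
    using countable_SIGMA[OF assms, of "\<lambda>_. UNIV"] assms by simp
  ultimately show ?thesis by (metis countable_image)
qed

subsection \<open>The localisation at the variables\<close>

text \<open>The localisation consists of the fractions whose denominator does not lie in the prime ideal generated
  by the variables \<open>0, \<dots>, h\<close>, and \<open>local_ideal h n\<close> is the ideal of the variables below \<open>n\<close>.\<close>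

definition local_ideal :: "nat \<Rightarrow> nat \<Rightarrow> mpoly fract set" where
  "local_ideal h n = {Fract a b | a b. kill_vars n a = 0 \<and> kill_vars (Suc h) b \<noteq> 0}"

definition poly_local :: "nat \<Rightarrow> mpoly fract ring" where
  "poly_local h = \<lparr>carrier = {Fract a b | a b. kill_vars (Suc h) b \<noteq> 0},
     monoid.mult = (*), one = 1, ring.zero = 0, ring.add = (+)\<rparr>"

lemma poly_local_simps [simp]:
  "y \<otimes>\<^bsub>poly_local h\<^esub> z = y * z" "\<one>\<^bsub>poly_local h\<^esub> = 1" "\<zero>\<^bsub>poly_local h\<^esub> = 0" "y \<oplus>\<^bsub>poly_local h\<^esub> z = y + z"
  by (simp_all add: poly_local_def)

lemma poly_local_carrier: "y \<in> carrier (poly_local h) \<longleftrightarrow> (\<exists>a b. y = Fract a b \<and> kill_vars (Suc h) b \<noteq> 0)"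
  by (auto simp: poly_local_def)

lemma Fract_poly_local: "kill_vars (Suc h) b \<noteq> 0 \<Longrightarrow> Fract a b \<in> carrier (poly_local h)"
  unfolding poly_local_carrier by blast

lemma Fract_local_ideal_iff:
  assumes "n \<le> Suc h" "kill_vars (Suc h) b \<noteq> 0"
  shows "Fract a b \<in> local_ideal h n \<longleftrightarrow> kill_vars n a = 0"
proof
  assume "Fract a b \<in> local_ideal h n"
  then obtain c d where cd: "Fract a b = Fract c d" "kill_vars n c = 0" "kill_vars (Suc h) d \<noteq> 0"
    unfolding local_ideal_def by blast
  have "b \<noteq> 0" "d \<noteq> 0" using assms(2) cd(3) by auto
  then have "a * d = c * b" using cd(1) eq_fract(1) by blast
  then have "kill_vars n a * kill_vars n d = kill_vars n c * kill_vars n b" by (simp flip: kill_vars_mult)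
  moreover have "kill_vars n d \<noteq> 0" using kill_vars_mono[OF _ assms(1)] cd(3) by blast
  ultimately show "kill_vars n a = 0" using cd(2) by simp
next
  assume "kill_vars n a = 0"
  then show "Fract a b \<in> local_ideal h n" unfolding local_ideal_def using assms(2) by blast
qed

lemma cring_poly_local: "cring (poly_local h)"
proof (rule cringI[OF abelian_groupI comm_monoidI])
  have sum: "y + z \<in> carrier (poly_local h)" and prod: "y * z \<in> carrier (poly_local h)"
    if y: "y \<in> carrier (poly_local h)" and z: "z \<in> carrier (poly_local h)" for y z
  proof -
    obtain a b c d where yz: "y = Fract a b" "z = Fract c d" "kill_vars (Suc h) b \<noteq> 0" "kill_vars (Suc h) d \<noteq> 0"
      using y z unfolding poly_local_carrier by blast
    have bd: "kill_vars (Suc h) (b * d) \<noteq> 0" using yz(3,4) by (simp add: kill_vars_mult)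
    have "b \<noteq> 0" "d \<noteq> 0" using yz(3,4) by auto
    then show "y + z \<in> carrier (poly_local h)" using Fract_poly_local[OF bd] yz(1,2) by simp
    show "y * z \<in> carrier (poly_local h)" using Fract_poly_local[OF bd] yz(1,2) by simp
  qed
  show "y \<oplus>\<^bsub>poly_local h\<^esub> z \<in> carrier (poly_local h)" "y \<otimes>\<^bsub>poly_local h\<^esub> z \<in> carrier (poly_local h)"
    if "y \<in> carrier (poly_local h)" "z \<in> carrier (poly_local h)" for y z
    using sum[OF that] prod[OF that] by simp_all
  show "\<zero>\<^bsub>poly_local h\<^esub> \<in> carrier (poly_local h)" "\<one>\<^bsub>poly_local h\<^esub> \<in> carrier (poly_local h)"
    using Fract_poly_local[of h 1 0] Fract_poly_local[of h 1 1] by (simp_all add: Zero_fract_def One_fract_def)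
  fix y assume "y \<in> carrier (poly_local h)"
  then obtain a b where "y = Fract a b" "kill_vars (Suc h) b \<noteq> 0" unfolding poly_local_carrier by blast
  then have "- y \<in> carrier (poly_local h)" using Fract_poly_local[of h b "- a"] by simp
  then show "\<exists>z\<in>carrier (poly_local h). z \<oplus>\<^bsub>poly_local h\<^esub> y = \<zero>\<^bsub>poly_local h\<^esub>"
    by (intro bexI[of _ "- y"]) simp_all
qed (simp_all add: algebra_simps)

lemma poly_local_uminus: "y \<in> carrier (poly_local h) \<Longrightarrow> \<ominus>\<^bsub>poly_local h\<^esub> y = - y"
proof -
  assume y: "y \<in> carrier (poly_local h)"
  interpret cring "poly_local h" by (rule cring_poly_local)
  have "\<ominus>\<^bsub>poly_local h\<^esub> y + y = 0" using l_neg[OF y] by simp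
  then show ?thesis by (simp add: eq_neg_iff_add_eq_0)
qed

lemma ideal_local_ideal:
  assumes n: "n \<le> Suc h"
  shows "ideal (local_ideal h n) (poly_local h)"
proof -
  let ?R = "poly_local h"
  note R = cring_poly_local[of h]
  note mem = Fract_local_ideal_iff[OF n]
  have E: "\<exists>a b. y = Fract a b \<and> kill_vars n a = 0 \<and> kill_vars (Suc h) b \<noteq> 0 \<and> b \<noteq> 0" if y: "y \<in> local_ideal h n" for y
  proof -
    obtain a b where "y = Fract a b" "kill_vars n a = 0" "kill_vars (Suc h) b \<noteq> 0"
      using y unfolding local_ideal_def by blast
    moreover have "b \<noteq> 0" using calculation(3) by auto
    ultimately show ?thesis by blast
  qed
  have sub: "y \<in> carrier ?R" if "y \<in> local_ideal h n" for y
    using E[OF that] unfolding poly_local_carrier by blast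
  have "submodule (local_ideal h n) ?R (self_module ?R)"
  proof (rule module.submoduleI[OF module_self_module[OF R]])
    show "local_ideal h n \<subseteq> carrier (self_module ?R)" using sub by auto
    show "\<zero>\<^bsub>self_module ?R\<^esub> \<in> local_ideal h n" using mem[of 1 0] by (simp add: Zero_fract_def)
  next
    fix y assume y: "y \<in> local_ideal h n"
    obtain a b where ab: "y = Fract a b" "kill_vars n a = 0" "kill_vars (Suc h) b \<noteq> 0" using E[OF y] by blast
    show "\<ominus>\<^bsub>self_module ?R\<^esub> y \<in> local_ideal h n"
      unfolding self_module_neg[OF R sub[OF y]] poly_local_uminus[OF sub[OF y]]
      using mem[OF ab(3), of "- a"] ab by (simp add: kill_vars_uminus)
    fix z assume z: "z \<in> local_ideal h n"
    obtain c d where cd: "z = Fract c d" "kill_vars n c = 0" "kill_vars (Suc h) d \<noteq> 0" using E[OF z] by blast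
    have bd: "kill_vars (Suc h) (b * d) \<noteq> 0" using ab(3) cd(3) by (simp add: kill_vars_mult)
    have "b \<noteq> 0" "d \<noteq> 0" using ab(3) cd(3) by auto
    then show "y \<oplus>\<^bsub>self_module ?R\<^esub> z \<in> local_ideal h n"
      using mem[OF bd] ab cd by (simp add: kill_vars_add kill_vars_mult)
  next
    fix r y assume r: "r \<in> carrier ?R" and y: "y \<in> local_ideal h n"
    obtain a b where ab: "y = Fract a b" "kill_vars n a = 0" "kill_vars (Suc h) b \<noteq> 0" using E[OF y] by blast
    obtain c d where cd: "r = Fract c d" "kill_vars (Suc h) d \<noteq> 0" using r unfolding poly_local_carrier by blast
    have bd: "kill_vars (Suc h) (d * b) \<noteq> 0" using ab(3) cd(2) by (simp add: kill_vars_mult)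
    show "r \<odot>\<^bsub>self_module ?R\<^esub> y \<in> local_ideal h n"
      using mem[OF bd] ab cd by (simp add: kill_vars_mult)
  qed
  then show ?thesis using ideal_iff_submodule[OF R] by blast
qed

theorem regular_local_poly_local:
  assumes "1 \<le> h"
  shows "regular_local (poly_local h) (\<lambda>i. Fract (var i) 1) h (local_ideal h)"
proof (rule regular_local.intro[OF plain_cring.intro[OF cring_poly_local] regular_local_axioms.intro])
  let ?R = "poly_local h"
  have 1: "kill_vars (Suc h) 1 \<noteq> 0" by simp
  show "1 \<le> h" by fact
  show "a = \<zero>\<^bsub>?R\<^esub> \<or> b = \<zero>\<^bsub>?R\<^esub>" if "a \<otimes>\<^bsub>?R\<^esub> b = \<zero>\<^bsub>?R\<^esub>" for a b using that by simp
  show "Fract (var i) 1 \<in> carrier ?R" for i by (rule Fract_poly_local[OF 1])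
  show "local_ideal h 0 = {\<zero>\<^bsub>?R\<^esub>}"
  proof (intro equalityI subsetI)
    fix y assume "y \<in> local_ideal h 0"
    then show "y \<in> {\<zero>\<^bsub>?R\<^esub>}" unfolding local_ideal_def by (auto simp: kill_no_vars fract_collapse)
  next
    fix y assume "y \<in> {\<zero>\<^bsub>?R\<^esub>}"
    then show "y \<in> local_ideal h 0" using Fract_local_ideal_iff[OF _ 1, of 0 0] by (simp add: Zero_fract_def)
  qed
  show "ideal (local_ideal h i) ?R" if "i \<le> Suc h" for i by (rule ideal_local_ideal[OF that])
  show "local_with ?R (local_ideal h (Suc h))" unfolding local_with_def
  proof (intro conjI cring_poly_local ideal_local_ideal order_refl equalityI subsetI)
    fix y assume "y \<in> Units ?R"
    then obtain z where y: "y \<in> carrier ?R" and z: "z \<in> carrier ?R" "z * y = 1" unfolding Units_def by auto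
    obtain a b c d where yz: "y = Fract a b" "z = Fract c d" "kill_vars (Suc h) b \<noteq> 0" "kill_vars (Suc h) d \<noteq> 0"
      using y z(1) unfolding poly_local_carrier by blast
    have "b \<noteq> 0" "d \<noteq> 0" using yz(3,4) by auto
    then have "c * a = d * b" using z(2) yz(1,2) by (simp add: One_fract_def eq_fract)
    then have "kill_vars (Suc h) c * kill_vars (Suc h) a = kill_vars (Suc h) d * kill_vars (Suc h) b"
      by (simp flip: kill_vars_mult)
    then have "kill_vars (Suc h) a \<noteq> 0" using yz(3,4) by auto
    then show "y \<in> carrier ?R - local_ideal h (Suc h)" using y Fract_local_ideal_iff[OF order_refl yz(3)] yz(1) by simp
  next
    fix y assume y: "y \<in> carrier ?R - local_ideal h (Suc h)"
    obtain a b where ab: "y = Fract a b" "kill_vars (Suc h) b \<noteq> 0"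
      using DiffD1[OF y] unfolding poly_local_carrier by blast
    have a: "kill_vars (Suc h) a \<noteq> 0" using y Fract_local_ideal_iff[OF order_refl ab(2)] ab(1) by auto
    have "a \<noteq> 0" "b \<noteq> 0" using a ab(2) by auto
    then have "Fract b a * y = 1" "y * Fract b a = 1" using ab(1) by (simp_all add: One_fract_def eq_fract mult.commute)
    then show "y \<in> Units ?R" unfolding Units_def using y Fract_poly_local[OF a, of b] by auto
  qed
  show "local_ideal h (Suc i) = {Fract (var i) 1 \<otimes>\<^bsub>?R\<^esub> y \<oplus>\<^bsub>?R\<^esub> z | y z. y \<in> carrier ?R \<and> z \<in> local_ideal h i}"
    if i: "i \<le> h" for i
  proof (intro equalityI subsetI)
    fix t assume "t \<in> local_ideal h (Suc i)"
    then obtain a b where ab: "t = Fract a b" "kill_vars (Suc i) a = 0" "kill_vars (Suc h) b \<noteq> 0"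
      unfolding local_ideal_def by blast
    obtain y z where yz: "kill_vars i z = 0" "a = var i * y + z" using kill_vars_division[of i a] ab(2) by auto
    have "b \<noteq> 0" using ab(3) by auto
    then have "Fract (var i) 1 * Fract y b + Fract z b = t"
      using ab(1) yz(2) by (simp add: eq_fract algebra_simps)
    moreover have "Fract y b \<in> carrier ?R" by (rule Fract_poly_local[OF ab(3)])
    moreover have "Fract z b \<in> local_ideal h i" using Fract_local_ideal_iff[OF _ ab(3), of i z] yz(1) i by simp
    ultimately show "t \<in> {Fract (var i) 1 \<otimes>\<^bsub>?R\<^esub> y \<oplus>\<^bsub>?R\<^esub> z | y z. y \<in> carrier ?R \<and> z \<in> local_ideal h i}"
      by (intro CollectI exI[of _ "Fract y b"] exI[of _ "Fract z b"]) simp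
  next
    fix t assume "t \<in> {Fract (var i) 1 \<otimes>\<^bsub>?R\<^esub> y \<oplus>\<^bsub>?R\<^esub> z | y z. y \<in> carrier ?R \<and> z \<in> local_ideal h i}"
    then obtain y z where yz: "t = Fract (var i) 1 * y + z" "y \<in> carrier ?R" "z \<in> local_ideal h i" by auto
    obtain a b where ab: "y = Fract a b" "kill_vars (Suc h) b \<noteq> 0" using yz(2) unfolding poly_local_carrier by blast
    obtain c d where cd: "z = Fract c d" "kill_vars i c = 0" "kill_vars (Suc h) d \<noteq> 0"
      using yz(3) unfolding local_ideal_def by blast
    have bd: "kill_vars (Suc h) (b * d) \<noteq> 0" using ab(2) cd(3) by (simp add: kill_vars_mult)
    have "b \<noteq> 0" "d \<noteq> 0" using ab(2) cd(3) by auto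
    then have "t = Fract (var i * a * d + c * b) (b * d)" using yz(1) ab(1) cd(1) by simp
    moreover have "kill_vars (Suc i) (var i * a * d + c * b) = 0"
      using kill_vars_mono[OF cd(2), of "Suc i"] by (simp add: kill_vars_add kill_vars_mult kill_vars_var)
    ultimately show "t \<in> local_ideal h (Suc i)" using Fract_local_ideal_iff[OF _ bd, of "Suc i"] i by simp
  qed
  show "y \<in> local_ideal h i" if i: "i \<le> h" and y: "y \<in> carrier ?R" "Fract (var i) 1 \<otimes>\<^bsub>?R\<^esub> y \<in> local_ideal h i" for i y
  proof -
    obtain a b where ab: "y = Fract a b" "kill_vars (Suc h) b \<noteq> 0" using y(1) unfolding poly_local_carrier by blast
    have "Fract (var i * a) b \<in> local_ideal h i" using y(2) ab(1) by simp
    then have "kill_vars i (var i) * kill_vars i a = 0"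
      using Fract_local_ideal_iff[OF _ ab(2), of i] i by (simp add: kill_vars_mult)
    then have "kill_vars i a = 0" using var_nonzero by (simp add: kill_vars_var)
    then show ?thesis using Fract_local_ideal_iff[OF _ ab(2), of i] i ab(1) by simp
  qed
qed

text \<open>The element \<open>(r, u)\<close> is encoded by the set that contains \<open>r\<close> and, for every index \<open>i\<close>, the elements
  of the coset \<open>u i\<close>, each tagged with \<open>i\<close>.\<close>

lemma example_on_nat_sets:
  assumes "1 \<le> h"
  shows "\<exists>(T :: nat set ring) \<phi>. trivial_extension (poly_local h) (\<lambda>i. Fract (var i) 1) h (local_ideal h) T \<phi>"
proof -
  interpret regular_local "poly_local h" "\<lambda>i. Fract (var i) 1" h "local_ideal h"
    by (rule regular_local_poly_local[OF assms])
  let ?S = "idealization (poly_local h) torsion"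
  interpret S: cring ?S by (rule cring_idealization[OF module_torsion])
  have "countable (UNIV :: mpoly fract set)"
    by (intro countable_fract countable_poly_mapping) auto
  then obtain code :: "mpoly fract \<Rightarrow> nat" where code: "inj code" by (auto simp: countable_def)
  \<comment> \<open>The tags \<open>0\<close> and \<open>n + 1\<close> keep the two kinds of entries apart.\<close>
  define atom :: "mpoly fract + (mpoly fract \<times> nat) \<times> mpoly fract \<Rightarrow> nat" where
    "atom = (\<lambda>s. case s of Inl r \<Rightarrow> to_nat (code r, 0 :: nat, 0 :: nat)
      | Inr ((f, n), c) \<Rightarrow> to_nat (code f, Suc n, code c))"
  have atom: "inj atom" using code by (auto simp: inj_def atom_def split: sum.splits)
  define \<phi> :: "mpoly fract \<times> (mpoly fract \<times> nat \<Rightarrow> mpoly fract set) \<Rightarrow> nat set" where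
    "\<phi> p = atom ` (insert (Inl (fst p)) {Inr (i, c) | i c. c \<in> snd p i})" for p
  have "inj \<phi>"
  proof (rule injI)
    fix p q assume "\<phi> p = \<phi> q"
    then have eq: "insert (Inl (fst p)) {Inr (i, c) | i c. c \<in> snd p i} = insert (Inl (fst q)) {Inr (i, c) | i c. c \<in> snd q i}"
      unfolding \<phi>_def by (rule inj_image_eq_iff[OF atom, THEN iffD1])
    have "fst p = fst q" using eq by blast
    moreover have "snd p i = snd q i" for i using eq by blast
    ultimately show "p = q" by (simp add: prod_eq_iff fun_eq_iff)
  qed
  then have iso: "\<phi> \<in> ring_iso ?S (image_ring \<phi> ?S)"
    by (intro inj_imp_image_ring_iso) (rule inj_on_subset, auto)
  have "cring (image_ring \<phi> ?S\<lparr>zero := \<phi> \<zero>\<^bsub>?S\<^esub>\<rparr>)" by (rule S.ring_iso_imp_img_cring[OF iso])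
  then have "cring (image_ring \<phi> ?S)" by (simp add: image_ring_def image_group_def monoid.defs)
  with iso have "trivial_extension (poly_local h) (\<lambda>i. Fract (var i) 1) h (local_ideal h) (image_ring \<phi> ?S) \<phi>"
    by (intro trivial_extension.intro regular_local_axioms trivial_extension_axioms.intro)
  then show ?thesis by blast
qed

section \<open>The example\<close>

lemma (in grade_ring) grade_ring_properties:
  assumes "2 \<le> n"
  shows "local_ring T \<and>
    (\<forall>E :: ('a, 'a set) module. cyclic_module T E \<and> n_presented T n E \<longrightarrow> projective_module T E) \<and>
    fPD T = enat h \<and>
    (\<exists>I. fg_ideal I T \<and> I \<noteq> carrier T \<and>
      (\<forall>i<h. trivial_group (Ext T i (quot_module T I) (self_module T))) \<and>
      \<not> trivial_group (Ext T h (quot_module T I) (self_module T)))"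
proof (intro conjI allI impI exI[of _ I])
  show "local_ring T" by (rule local_ring_local_with[OF loc])
  show "projective_module T E" if "cyclic_module T E \<and> n_presented T n E" for E :: "('a, 'a set) module"
    using that by (intro presented_cyclic_projective[OF _ _ assms]) blast+
  show "fPD T = enat h" by (rule fPD_eq)
  show "fg_ideal I T" unfolding fg_ideal_def I_def using xI by (intro exI[of _ "x ` {..h}"]) simp
  show "I \<noteq> carrier T" using I_m L(5) by auto
qed (use Ext_vanishes_exactly_below in auto)

theorem theorem1p2:
  shows "(\<forall>n h :: nat. n \<ge> 2 \<and> h \<ge> 1 \<longrightarrow>
      (\<exists>T :: nat set ring. local_ring T \<and>
        (\<forall>E :: (nat set, nat set set) module.
          cyclic_module T E \<and> n_presented T n E \<longrightarrow> projective_module T E) \<and>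
        fPD T = enat h \<and>
        (\<exists>I. fg_ideal I T \<and> I \<noteq> carrier T \<and>
          (\<forall>i<h. trivial_group (Ext T i (quot_module T I) (self_module T))) \<and>
          \<not> trivial_group (Ext T h (quot_module T I) (self_module T))))) \<and>
    (\<forall>(A :: 'a ring) d. cyclic_weak_ring A 1 d \<longrightarrow> fPD A \<le> enat d)"
proof (intro conjI allI impI)
  fix n h :: nat
  assume nh: "n \<ge> 2 \<and> h \<ge> 1"
  from example_on_nat_sets[OF conjunct2[OF nh]] obtain T :: "nat set ring" and \<phi> where
    T: "trivial_extension (poly_local h) (\<lambda>i. Fract (var i) 1) h (local_ideal h) T \<phi>" by blast
  from grade_ring.grade_ring_properties[OF trivial_extension.grade_ring_T[OF T] conjunct1[OF nh]]
  show "\<exists>T :: nat set ring. local_ring T \<and>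
      (\<forall>E :: (nat set, nat set set) module.
        cyclic_module T E \<and> n_presented T n E \<longrightarrow> projective_module T E) \<and>
      fPD T = enat h \<and>
      (\<exists>I. fg_ideal I T \<and> I \<noteq> carrier T \<and>
        (\<forall>i<h. trivial_group (Ext T i (quot_module T I) (self_module T))) \<and>
        \<not> trivial_group (Ext T h (quot_module T I) (self_module T)))" by (rule exI[of _ T])
next
  fix A :: "'a ring" and d
  assume "cyclic_weak_ring A 1 d"
  then show "fPD A \<le> enat d" by (rule fPD_le_of_cyclic_weak_ring)
qed

end
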